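(* Let $\mathfrak{D}_{\mathfrak{s}}$ be a cluster scattering diagram for a seed $\mathfrak{s}$ of a fixed data $\Gamma$, taken in a positive realization (every wall element has the form $\Psi[tn]^{s\,\delta(tn)}$ with $n\in N^+_{\mathrm{pr}}$ the normal vector and $t,s\in\mathbb{Z}_{>0}$). Let $\gamma$ be any admissible loop for $\mathfrak{D}_{\mathfrak{s}}$. Parametrize the crossings of $\gamma$ with the walls of $\mathfrak{D}_{\mathfrak{s}}$ by a countable totally ordered set $J$, so that the crossing $a\in J$ occurs at the point $z_a$ with a wall $\mathbf{w}_a=(\mathfrak{d}_a,\Psi[t_an_a]^{s_a\delta(t_an_a)})_{n_a}$ and with intersection sign $\epsilon_a$, where $\gamma$ crosses $z_a$ earlier than $z_{a'}$ only if $a<a'$ (several walls with a common normal vector crossed at the same time are listed separately). Thus the consistency relation along $\gamma$ is $$\mathfrak{p}_{\gamma,\mathfrak{D}_{\mathfrak{s}}}=\prod_{a\in J}^{\leftarrow}\Psi[t_an_a]^{\epsilon_as_a\delta(t_an_a)}=\mathrm{id},$$ the product being taken in increasing order in $J$ from right to left. Then the following identity holds as a formal Puiseux series in $\mathbf{y}=(y_1,\dots,y_r)$ with $\log$ factor: $$\sum_{a\in J}\epsilon_a\,s_a\,\delta(t_an_a)\,\tilde L\bigl(y_{z_a}[t_an_a]\bigr)=0 .$$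
   Context: **Fixed data and seed.** A fixed data $\Gamma$ consists of: a lattice $N$ of rank $r$; a skew-symmetric bilinear form $\{\cdot,\cdot\}:N\times N\to\mathbb{Q}$; a finite-index sublattice $N^\circ\subset N$ with $\{N^\circ,N\}\subset\mathbb{Z}$; positive integers $\delta_1,\dots,\delta_r$ such that there is a basis $(e_1,\dots,e_r)$ of $N$ for which $(\delta_1e_1,\dots,\delta_re_r)$ is a basis of $N^\circ$; and $M=\mathrm{Hom}(N,\mathbb{Z})$, $M^\circ=\mathrm{Hom}(N^\circ,\mathbb{Z})$. A seed $\mathfrak{s}=(e_1,\dots,e_r)$ is such a basis. Put $M_{\mathbb{R}}=M\otimes\mathbb{R}$ (which contains $M^\circ$), with canonical pairing $\langle n,z\rangle$ for $n\in N$, $z\in M_{\mathbb R}$, and $n^\perp=\{z\in M_{\mathbb{R}}\mid\langle n,z\rangle=0\}$. Let $N^+=\{\sum a_ie_i\mid a_i\in\mathbb{Z}_{\ge0},\ \sum a_i>0\}$, $N^+_{\mathrm{pr}}$ its subset of primitive elements, and $\deg(\sum a_ie_i)=\sum a_i$. For $n\in N^+$, $\delta(n)$ is the smallest positive rational number with $\delta(n)n\in N^\circ$. **Structure group.** $\mathfrak{g}=\bigoplus_{n\in N^+}\mathbb{Q}X_n$ with $[X_n,X_{n'}]=\{n,n'\}X_{n+n'}$; $\widehat{\mathfrak{g}}$ is its completion with respect to $\deg$; $G=\exp(\widehat{\mathfrak g})$ with product given by the Baker–Campbell–Hausdorff formula. $G^{>\ell}$ is the normal subgroup generated by elements of degree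 $>\ell$, and $\pi_\ell:G\to G^{\le\ell}=G/G^{>\ell}$ is the projection. For $n\in N^+_{\mathrm{pr}}$, $G_n^{\parallel}$ is the abelian subgroup of elements $\exp(\sum_{j\ge1}c_jX_{jn})$, $c_j\in\mathbb{Q}$. For $g=\exp X$ and $c\in\mathbb{Q}$, $g^c=\exp(cX)$. The dilogarithm element for $n\in N^+$ is $\Psi[n]=\exp\bigl(\sum_{j\ge1}\frac{(-1)^{j+1}}{j^2}X_{jn}\bigr)$. **$y$-representation.** $Q=N^+\sqcup\{0\}$; $\mathbb{Q}[[Q]]$ is the completed monoid algebra, i.e. formal power series in $y_i=y^{e_i}$. $X_n$ acts as the derivation $X_n(y^{n'})=\{n,n'\}y^{n'+n}$, and $\exp X\in G$ acts by the algebra automorphism $\sum_{j}X^j/j!$. In particular $\Psi[n]^c(y^{n'})=y^{n'}(1+y^n)^{c\{n,n'\}}$. **Scattering diagrams.** A wall $\mathbf{w}=(\mathfrak{d},g)_n$ consists of a normal vector $n\in N^+_{\mathrm{pr}}$, a support $\mathfrak{d}\subset n^\perp$ which is a (convex rational polyhedral) cone of codimension 1 in $M_{\mathbb R}$, and a wall element $g\in G_n^\parallel$. With $p^*(n)=\{\cdot,n\}$, the wall is incoming if $p^*(n)\in\mathfrak{d}$. A scattering diagram $\mathfrak{D}$ is a collection of walls $(\mathfrak{d}_\lambda,g_\lambda)_{n_\lambda}$ such that for each $\ell$ only finitely many satisfy $\pi_\ell(g_\lambda)\ne\mathrm{id}$. $\mathrm{Supp}(\mathfrak{D})=\bigcup\mathfrak{d}_\lambda$;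 $\mathrm{Sing}(\mathfrak{D})$ is the union of all boundaries $\partial\mathfrak{d}_\lambda$ and all intersections $\mathfrak{d}_\lambda\cap\mathfrak{d}_{\lambda'}$ of dimension $r-2$. A curve $\gamma:[0,1]\to M_{\mathbb{R}}$ is admissible if (i) its end points are outside $\mathrm{Supp}(\mathfrak{D})$, (ii) it is smooth and intersects $\mathrm{Supp}(\mathfrak{D})$ transversally, (iii) it does not meet $\mathrm{Sing}(\mathfrak{D})$; weakly admissible if (ii) and (iii) hold. A loop is a closed curve. The path-ordered product $\mathfrak{p}_{\gamma,\mathfrak{D}}\in G$ is the product, in order of crossing from right to left, of $g_\lambda^{\epsilon_\lambda}$ over the walls crossed by $\gamma$ (defined as the limit of the finite products modulo $G^{>\ell}$), with intersection sign $\epsilon_\lambda=1$ if $\langle n_\lambda,\gamma'\rangle<0$ and $-1$ if $\langle n_\lambda,\gamma'\rangle>0$ at the crossing; for weakly admissible $\gamma$ walls at the end points are ignored. $\mathfrak{D}$ is consistent if $\mathfrak{p}_{\gamma,\mathfrak{D}}=\mathrm{id}$ for every admissible loop. A cluster scattering diagram $\mathfrak{D}_{\mathfrak{s}}$ is a consistent scattering diagram whose set of incoming walls is $\{(e_i^\perp,\Psi[e_i]^{\delta_i})_{e_i}\mid i=1,\dots,r\}$. It is known that one exists, uniquely up to equivalence (equality of path-ordered products), and that it can be chosen as a positive realization. **$y$-variables.** Let $\mathcal{C}^+=\{z\in M_{\mathbb{R}}\mid\langle e_i,z\rangle\ge0\ \forall i\}$. For a wall $(\mathfrak{d},\Psi[tn]^{s\delta(tn)})_n$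 of $\mathfrak{D}_{\mathfrak{s}}$ and $z\in\mathfrak{d}\setminus\mathrm{Sing}(\mathfrak{D}_{\mathfrak{s}})$, set $y_z[tn]=\mathfrak{p}_{\gamma_z,\mathfrak{D}_{\mathfrak{s}}}(y^{tn})\in\mathbb{Q}[[Q]]$, where $\gamma_z$ is any weakly admissible curve from $z$ to a point of $\mathrm{Int}(\mathcal{C}^+)$ (the result does not depend on $\gamma_z$). **Modified Rogers dilogarithm and formal series.** For real $x\ge0$, $\tilde L(x)=\frac12\int_0^x\bigl\{\frac{\log(1+y)}{y}-\frac{\log y}{1+y}\bigr\}dy$, with expansion at $x=0$ $$\tilde L(x)=\sum_{j\ge1}\frac{(-1)^{j+1}}{j^2}x^j-\frac12\log x\sum_{j\ge1}\frac{(-1)^{j+1}}{j}x^j.$$ A formal Puiseux series in $\mathbf{y}$ with $\log$ factor is a formal sum $f(\mathbf{y})+\sum_{i=1}^r(\log y_i)g_i(\mathbf{y})$, $f,g_i\in\mathbb{Q}[[Q]]$. Each $y_z[tn]$ has the form $y^{tn}(1+h)$ with $h\in\mathbb{Q}[[Q]]$ without constant term, and $\tilde L(y_z[tn])$ is the formal series obtained by substituting into the expansion, with $\log y_z[tn]=\sum_i t n_i\log y_i+\log(1+h)$ for $n=\sum n_ie_i$. The infinite sum over $J$ is understood degree by degree in $\mathbf{y}$: up to any given total degree only finitely many terms contribute. *)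

theory Defs
  imports "HOL-Analysis.Analysis"
begin

section \<open>Fixed data\<close>

text \<open>
  The lattice N of rank r is \<open>int^'r\<close>, with r the cardinality of \<open>'r\<close>.
  Accordingly \<open>M\<^sub>\<real> = Hom(N,\<int>) \<otimes> \<real>\<close> is \<open>real^'r\<close>, in the coordinates dual to
  the standard ones of \<open>int^'r\<close>. A seed is an arbitrary basis, not the standard one.
\<close>

definition pairing :: "int^'r \<Rightarrow> real^'r \<Rightarrow> real" where
  "pairing n z = (\<Sum>i\<in>UNIV. of_int (n $ i) * z $ i)"

definition perp :: "int^'r \<Rightarrow> (real^'r) set" where
  "perp n = {z. pairing n z = 0}"

definition lin_comb :: "('r \<Rightarrow> int^'r) \<Rightarrow> int^'r \<Rightarrow> int^'r" where
  "lin_comb b a = (\<Sum>i\<in>UNIV. a $ i *s b i)"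

definition lattice_basis :: "('r \<Rightarrow> int^'r) \<Rightarrow> (int^'r) set \<Rightarrow> bool" where
  "lattice_basis b L \<longleftrightarrow> bij_betw (lin_comb b) UNIV L"

definition primitive :: "int^'r \<Rightarrow> bool" where
  "primitive n \<longleftrightarrow> n \<noteq> 0 \<and> (\<forall>k m. n = k *s m \<longrightarrow> \<bar>k\<bar> = 1)"

locale fixed_data =
  fixes form :: "int^'r \<Rightarrow> int^'r \<Rightarrow> rat"
    and Nc :: "(int^'r) set"
    and \<delta> :: "'r \<Rightarrow> nat"
  assumes form_add: "form (n + n') m = form n m + form n' m"
    and form_skew: "form n m = - form m n"
    and Nc_zero: "0 \<in> Nc"
    and Nc_diff: "n \<in> Nc \<Longrightarrow> m \<in> Nc \<Longrightarrow> n - m \<in> Nc"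
    and Nc_finite_index: "finite (range (\<lambda>n. (+) n ` Nc))"
    and form_integral: "n \<in> Nc \<Longrightarrow> form n m \<in> \<int>"
    and \<delta>_pos: "\<delta> i > 0"
    and adapted_basis_exists:
      "\<exists>b. lattice_basis b UNIV \<and> lattice_basis (\<lambda>i. int (\<delta> i) *s b i) Nc"

section \<open>Walls and curves\<close>

text \<open>
  Walls carry their element of the structure group through its logarithm (see the structure group below).
\<close>

record 'r wall =
  normal :: "int^'r"
  support :: "(real^'r) set"
  elt :: "int^'r \<Rightarrow> rat"

definition rational_polyhedral_cone :: "(real^'r) set \<Rightarrow> bool" where
  "rational_polyhedral_cone C \<longleftrightarrow>
    (\<exists>S. finite S \<and> (\<forall>v\<in>S. \<forall>i. v $ i \<in> \<rat>) \<and> C = convex_cone hull S)"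

definition Supp :: "('l \<Rightarrow> 'r wall) \<Rightarrow> (real^'r) set" where
  "Supp D = (\<Union>\<iota>. support (D \<iota>))"

definition Sing :: "('l \<Rightarrow> 'r wall) \<Rightarrow> (real^'r) set" where
  "Sing D = (\<Union>\<iota>. rel_frontier (support (D \<iota>))) \<union>
    \<Union> {support (D \<iota>) \<inter> support (D \<iota>') | \<iota> \<iota>'.
        aff_dim (support (D \<iota>) \<inter> support (D \<iota>')) = int CARD('r) - 2}"

text \<open>Curves are parametrised by the interval \<open>[0,1]\<close>; smooth means infinitely differentiable.\<close>

definition smooth_curve :: "(real \<Rightarrow> real^'r) \<Rightarrow> bool" where
  "smooth_curve \<gamma> \<longleftrightarrow> (\<exists>F :: nat \<Rightarrow> real \<Rightarrow> real^'r. F 0 = \<gamma> \<and>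
    (\<forall>k. \<forall>u\<in>{0..1}. (F k has_vector_derivative F (Suc k) u) (at u within {0..1})))"

definition velocity :: "(real \<Rightarrow> real^'r) \<Rightarrow> real \<Rightarrow> real^'r" where
  "velocity \<gamma> u = vector_derivative \<gamma> (at u within {0..1})"

definition weakly_admissible_curve :: "('l \<Rightarrow> 'r wall) \<Rightarrow> (real \<Rightarrow> real^'r) \<Rightarrow> bool" where
  "weakly_admissible_curve D \<gamma> \<longleftrightarrow> smooth_curve \<gamma> \<and>
    (\<forall>u\<in>{0..1}. \<forall>\<iota>. \<gamma> u \<in> support (D \<iota>) \<longrightarrow> pairing (normal (D \<iota>)) (velocity \<gamma> u) \<noteq> 0) \<and>
    (\<forall>u\<in>{0..1}. \<gamma> u \<notin> Sing D)"

definition admissible_curve :: "('l \<Rightarrow> 'r wall) \<Rightarrow> (real \<Rightarrow> real^'r) \<Rightarrow> bool" where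
  "admissible_curve D \<gamma> \<longleftrightarrow> weakly_admissible_curve D \<gamma> \<and> \<gamma> 0 \<notin> Supp D \<and> \<gamma> 1 \<notin> Supp D"

text \<open>Walls met at the end points of a weakly admissible curve are ignored.\<close>

definition crossings :: "('l \<Rightarrow> 'r wall) \<Rightarrow> (real \<Rightarrow> real^'r) \<Rightarrow> (real \<times> 'l) set" where
  "crossings D \<gamma> = {(u, \<iota>). 0 < u \<and> u < 1 \<and> \<gamma> u \<in> support (D \<iota>)}"

definition crossing_sign :: "('l \<Rightarrow> 'r wall) \<Rightarrow> (real \<Rightarrow> real^'r) \<Rightarrow> real \<Rightarrow> 'l \<Rightarrow> rat" where
  "crossing_sign D \<gamma> u \<iota> = (if pairing (normal (D \<iota>)) (velocity \<gamma> u) < 0 then 1 else -1)"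

text \<open>The vector t n of a wall with normal vector n and element \<open>\<Psi>[t n]\<^sup>c\<close>.\<close>

definition tnormal :: "('l \<Rightarrow> 'r wall) \<Rightarrow> ('l \<Rightarrow> nat) \<Rightarrow> 'l \<Rightarrow> int^'r" where
  "tnormal D t \<iota> = int (t \<iota>) *s normal (D \<iota>)"


section \<open>Seeds\<close>

locale seed = fixed_data form Nc \<delta>
  for form :: "int^'r \<Rightarrow> int^'r \<Rightarrow> rat" and Nc :: "(int^'r) set" and \<delta> :: "'r \<Rightarrow> nat" +
  fixes e :: "'r \<Rightarrow> int^'r"
  assumes seed_basis: "lattice_basis e UNIV"
    and seed_basis_Nc: "lattice_basis (\<lambda>i. int (\<delta> i) *s e i) Nc"
begin

definition coords :: "int^'r \<Rightarrow> int^'r" where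
  "coords n = (THE a. lin_comb e a = n)"

definition deg :: "int^'r \<Rightarrow> int" where
  "deg n = (\<Sum>i\<in>UNIV. coords n $ i)"

definition Npos :: "(int^'r) set" where
  "Npos = {n. (\<forall>i. coords n $ i \<ge> 0) \<and> (\<Sum>i\<in>UNIV. coords n $ i) > 0}"

definition Npr :: "(int^'r) set" where
  "Npr = {n \<in> Npos. primitive n}"

definition Qmon :: "(int^'r) set" where
  "Qmon = Npos \<union> {0}"

text \<open>The condition says \<open>q n \<in> Nc\<close>, read inside \<open>N \<otimes> \<rat>\<close>.\<close>

definition delta :: "int^'r \<Rightarrow> rat" where
  "delta n = (LEAST q. q > 0 \<and> (\<exists>m\<in>Nc. \<forall>i. of_int (m $ i) = q * of_int (n $ i)))"

definition Cplus :: "(real^'r) set" where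
  "Cplus = {z. \<forall>i. pairing (e i) z \<ge> 0}"


section \<open>The structure group\<close>

text \<open>
  Each degree contains finitely many elements of \<open>Npos\<close>, so the completion of
  \<open>\<Oplus>\<^sub>n \<rat> X\<^sub>n\<close> consists of all formal sums \<open>\<Sum>\<^sub>n x n X\<^sub>n\<close>, i.e. of
  all functions x supported in \<open>Npos\<close>. The element \<open>exp x\<close> of G is represented by x itself;
  the unit of G is therefore the zero function.
\<close>

definition ghat :: "(int^'r \<Rightarrow> rat) set" where
  "ghat = {x. \<forall>n. n \<notin> Npos \<longrightarrow> x n = 0}"

definition lie :: "(int^'r \<Rightarrow> rat) \<Rightarrow> (int^'r \<Rightarrow> rat) \<Rightarrow> int^'r \<Rightarrow> rat" where
  "lie x y n = (\<Sum>(a, b) \<in> {(a, b). a \<in> Npos \<and> b \<in> Npos \<and> a + b = n}. x a * y b * form a b)"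

fun nested_lie :: "(int^'r \<Rightarrow> rat) list \<Rightarrow> int^'r \<Rightarrow> rat" where
  "nested_lie [] = (\<lambda>_. 0)"
| "nested_lie [x] = x"
| "nested_lie (x # y # zs) = lie x (nested_lie (y # zs))"

text \<open>
  The Baker--Campbell--Hausdorff product in Dynkin's explicit form
  \[\log(e^x e^y) = \sum_{k \ge 1} \frac{(-1)^{k-1}}{k} \sum_{p_i+q_i>0}
    \frac{[x^{p_1} y^{q_1} \cdots x^{p_k} y^{q_k}]}{\sum_i (p_i+q_i) \, \prod_i p_i! \, q_i!}\]
  with right-nested brackets. A bracket of m entries has no component of degree below m,
  so in the coefficient of \<open>X\<^sub>n\<close> the words of length exceeding \<open>deg n\<close> are omitted.
\<close>

definition gmult :: "(int^'r \<Rightarrow> rat) \<Rightarrow> (int^'r \<Rightarrow> rat) \<Rightarrow> int^'r \<Rightarrow> rat" where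
  "gmult x y n =
    (\<Sum>ps \<in> {ps :: (nat \<times> nat) list. ps \<noteq> [] \<and> (\<forall>(p, q) \<in> set ps. p + q > 0) \<and>
                (\<Sum>(p, q) \<leftarrow> ps. p + q) \<le> nat (deg n)}.
       (-1) ^ (length ps - 1) / of_nat (length ps)
       / (of_nat (\<Sum>(p, q) \<leftarrow> ps. p + q) * (\<Prod>(p, q) \<leftarrow> ps. fact p * fact q))
       * nested_lie (concat (map (\<lambda>(p, q). replicate p x @ replicate q y) ps)) n)"

definition gone :: "int^'r \<Rightarrow> rat" where
  "gone = (\<lambda>_. 0)"

definition gpow :: "(int^'r \<Rightarrow> rat) \<Rightarrow> rat \<Rightarrow> int^'r \<Rightarrow> rat" where
  "gpow x c = (\<lambda>n. c * x n)"

definition Gpar :: "int^'r \<Rightarrow> (int^'r \<Rightarrow> rat) set" where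
  "Gpar n = {x. \<forall>m. x m \<noteq> 0 \<longrightarrow> (\<exists>j::nat. j \<ge> 1 \<and> m = int j *s n)}"

text \<open>For n in \<open>Npos\<close> the sum has at most one term.\<close>

definition Psi :: "int^'r \<Rightarrow> int^'r \<Rightarrow> rat" where
  "Psi n m = (\<Sum>j | j \<ge> 1 \<and> m = int j *s n. (-1) ^ (j + 1) / of_nat j ^ 2)"

text \<open>The product \<open>g\<^sub>k \<cdots> g\<^sub>2 g\<^sub>1\<close> of the list \<open>[g\<^sub>1, \<dots>, g\<^sub>k]\<close>.\<close>

definition gprod_rl :: "(int^'r \<Rightarrow> rat) list \<Rightarrow> int^'r \<Rightarrow> rat" where
  "gprod_rl gs = foldl (\<lambda>acc g. gmult g acc) gone gs"

text \<open>
  \<open>Ggt l\<close> is \<open>G\<^sup>>\<^sup>l\<close>: the elements of degree exceeding l already form a normal subgroup.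
  \<open>proj_eq l g h\<close> says that g and h have the same image in the quotient by it.
\<close>

definition Ggt :: "nat \<Rightarrow> (int^'r \<Rightarrow> rat) set" where
  "Ggt l = {x \<in> ghat. \<forall>n. x n \<noteq> 0 \<longrightarrow> deg n > int l}"

definition proj_eq :: "nat \<Rightarrow> (int^'r \<Rightarrow> rat) \<Rightarrow> (int^'r \<Rightarrow> rat) \<Rightarrow> bool" where
  "proj_eq l g h \<longleftrightarrow> gmult (gpow g (-1)) h \<in> Ggt l"


section \<open>Formal power series and the y-representation\<close>

text \<open>
  A formal power series \<open>\<Sum>\<^sub>n f n y\<^sup>n\<close> is the function f, supported in \<open>Qmon\<close>.
  The sums over powers below are cut off at \<open>deg n\<close>, beyond which all terms vanish.
\<close>

definition mono_y :: "int^'r \<Rightarrow> int^'r \<Rightarrow> rat" where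
  "mono_y m = (\<lambda>n. if n = m then 1 else 0)"

definition series_mult :: "(int^'r \<Rightarrow> rat) \<Rightarrow> (int^'r \<Rightarrow> rat) \<Rightarrow> int^'r \<Rightarrow> rat" where
  "series_mult f g n = (\<Sum>(a, b) \<in> {(a, b). a \<in> Qmon \<and> b \<in> Qmon \<and> a + b = n}. f a * g b)"

definition spow :: "(int^'r \<Rightarrow> rat) \<Rightarrow> nat \<Rightarrow> int^'r \<Rightarrow> rat" where
  "spow f j = (series_mult f ^^ j) (mono_y 0)"

definition deriv_act :: "(int^'r \<Rightarrow> rat) \<Rightarrow> (int^'r \<Rightarrow> rat) \<Rightarrow> int^'r \<Rightarrow> rat" where
  "deriv_act x f n =
    (\<Sum>(a, b) \<in> {(a, b). a \<in> Npos \<and> b \<in> Qmon \<and> a + b = n}. x a * f b * form a b)"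

definition gact :: "(int^'r \<Rightarrow> rat) \<Rightarrow> (int^'r \<Rightarrow> rat) \<Rightarrow> int^'r \<Rightarrow> rat" where
  "gact x f n = (\<Sum>j\<le>nat (deg n). (deriv_act x ^^ j) f n / fact j)"

text \<open>The series \<open>\<Sum>\<^sub>j\<^sub>\<ge>\<^sub>1 c j h\<^sup>j\<close>, for h without constant term.\<close>

definition subst_series :: "(nat \<Rightarrow> rat) \<Rightarrow> (int^'r \<Rightarrow> rat) \<Rightarrow> int^'r \<Rightarrow> rat" where
  "subst_series c h n = (\<Sum>j = 1..nat (deg n). c j * spow h j n)"

definition dilog_series :: "(int^'r \<Rightarrow> rat) \<Rightarrow> int^'r \<Rightarrow> rat" where
  "dilog_series = subst_series (\<lambda>j. (-1) ^ (j + 1) / of_nat j ^ 2)"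

definition log1p_series :: "(int^'r \<Rightarrow> rat) \<Rightarrow> int^'r \<Rightarrow> rat" where
  "log1p_series = subst_series (\<lambda>j. (-1) ^ (j + 1) / of_nat j)"

text \<open>The series h in \<open>Y = y\<^sup>m (1 + h)\<close>.\<close>

definition unit_tail :: "int^'r \<Rightarrow> (int^'r \<Rightarrow> rat) \<Rightarrow> int^'r \<Rightarrow> rat" where
  "unit_tail m Y = (\<lambda>n. if n \<in> Npos then Y (m + n) else 0)"

text \<open>
  A formal series \<open>f + \<Sum>\<^sub>i (log y\<^sub>i) g\<^sub>i\<close> with log factor is represented by the family
  \<open>None \<mapsto> f, Some i \<mapsto> g\<^sub>i\<close>.

  \<open>Ltilde m Y\<close> is the modified Rogers dilogarithm
  \[\tilde L(x) = \sum_{j \ge 1} \frac{(-1)^{j+1}}{j^2} x^j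
      - \frac12 \log x \sum_{j \ge 1} \frac{(-1)^{j+1}}{j} x^j\]
  at \<open>x = Y = y\<^sup>m (1 + h)\<close>, where
  \<open>log Y = \<Sum>\<^sub>i m\<^sub>i log y\<^sub>i + log (1 + h)\<close> for \<open>m = \<Sum>\<^sub>i m\<^sub>i e\<^sub>i\<close>.
\<close>

definition Ltilde :: "int^'r \<Rightarrow> (int^'r \<Rightarrow> rat) \<Rightarrow> 'r option \<Rightarrow> int^'r \<Rightarrow> rat" where
  "Ltilde m Y k n = (case k of
      None \<Rightarrow> dilog_series Y n
              - 1/2 * series_mult (log1p_series (unit_tail m Y)) (log1p_series Y) n
    | Some i \<Rightarrow> - 1/2 * of_int (coords m $ i) * log1p_series Y n)"

definition has_formal_sum ::
    "('j \<Rightarrow> 'r option \<Rightarrow> int^'r \<Rightarrow> rat) \<Rightarrow> 'j set \<Rightarrow> ('r option \<Rightarrow> int^'r \<Rightarrow> rat) \<Rightarrow> bool" where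
  "has_formal_sum F J S \<longleftrightarrow>
    (\<forall>d. finite {a \<in> J. \<exists>k n. deg n \<le> d \<and> F a k n \<noteq> 0}) \<and>
    (\<forall>k n. (\<Sum>a \<in> {a \<in> J. F a k n \<noteq> 0}. F a k n) = S k n)"


section \<open>Scattering diagrams\<close>

text \<open>\<open>pstar n\<close> is \<open>{\<cdot>, n}\<close> as a point of \<open>M\<^sub>\<real>\<close>.\<close>

definition pstar :: "int^'r \<Rightarrow> real^'r" where
  "pstar n = (\<chi> i. of_rat (form (axis i 1) n))"

definition is_wall :: "'r wall \<Rightarrow> bool" where
  "is_wall w \<longleftrightarrow> normal w \<in> Npr \<and> rational_polyhedral_cone (support w) \<and>
    support w \<subseteq> perp (normal w) \<and> aff_dim (support w) = int CARD('r) - 1 \<and>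
    elt w \<in> Gpar (normal w)"

definition incoming :: "'r wall \<Rightarrow> bool" where
  "incoming w \<longleftrightarrow> pstar (normal w) \<in> support w"

text \<open>A scattering diagram is a family of walls, so that walls may be repeated.\<close>

definition scattering_diagram :: "('l \<Rightarrow> 'r wall) \<Rightarrow> bool" where
  "scattering_diagram D \<longleftrightarrow> (\<forall>\<iota>. is_wall (D \<iota>)) \<and>
    (\<forall>l. finite {\<iota>. \<not> proj_eq l (elt (D \<iota>)) gone})"

text \<open>
  \<open>has_path_product D \<gamma> g\<close>: the path-ordered product along \<gamma> is g. Walls crossed
  simultaneously outside \<open>Sing D\<close> have the same normal vector, so their elements commute and
  the finite product does not depend on the chosen enumeration.
\<close>

definition has_path_product ::
    "('l \<Rightarrow> 'r wall) \<Rightarrow> (real \<Rightarrow> real^'r) \<Rightarrow> (int^'r \<Rightarrow> rat) \<Rightarrow> bool" where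
  "has_path_product D \<gamma> g \<longleftrightarrow> g \<in> ghat \<and>
    (\<forall>l. \<exists>cs. distinct cs \<and> sorted (map fst cs) \<and>
       set cs = {(u, \<iota>) \<in> crossings D \<gamma>. \<not> proj_eq l (elt (D \<iota>)) gone} \<and>
       proj_eq l g
         (gprod_rl (map (\<lambda>(u, \<iota>). gpow (elt (D \<iota>)) (crossing_sign D \<gamma> u \<iota>)) cs)))"

definition consistent :: "('l \<Rightarrow> 'r wall) \<Rightarrow> bool" where
  "consistent D \<longleftrightarrow>
    (\<forall>\<gamma>. admissible_curve D \<gamma> \<and> \<gamma> 0 = \<gamma> 1 \<longrightarrow> has_path_product D \<gamma> gone)"

text \<open>Each of the r prescribed incoming walls occurs exactly once.\<close>

definition cluster_scattering_diagram :: "('l \<Rightarrow> 'r wall) \<Rightarrow> bool" where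
  "cluster_scattering_diagram D \<longleftrightarrow> scattering_diagram D \<and> consistent D \<and>
    bij_betw D {\<iota>. incoming (D \<iota>)}
      (range (\<lambda>i. \<lparr>normal = e i, support = perp (e i),
                    elt = gpow (Psi (e i)) (of_nat (\<delta> i))\<rparr>))"

definition positive_realization ::
    "('l \<Rightarrow> 'r wall) \<Rightarrow> ('l \<Rightarrow> nat) \<Rightarrow> ('l \<Rightarrow> nat) \<Rightarrow> bool" where
  "positive_realization D t s \<longleftrightarrow> (\<forall>\<iota>. t \<iota> > 0 \<and> s \<iota> > 0 \<and>
    elt (D \<iota>) = gpow (Psi (tnormal D t \<iota>))
                  (of_nat (s \<iota>) * delta (tnormal D t \<iota>)))"

text \<open>
  \<open>is_y_variable D z m Y\<close>: the series Y is \<open>y\<^sub>z[m]\<close>, computed along some weakly admissible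
  curve from z to the interior of the positive chamber; the series does not depend on this curve.
\<close>

definition is_y_variable ::
    "('l \<Rightarrow> 'r wall) \<Rightarrow> real^'r \<Rightarrow> int^'r \<Rightarrow> (int^'r \<Rightarrow> rat) \<Rightarrow> bool" where
  "is_y_variable D z m Y \<longleftrightarrow>
    (\<exists>\<gamma> g. weakly_admissible_curve D \<gamma> \<and> \<gamma> 0 = z \<and> \<gamma> 1 \<in> interior Cplus \<and>
       has_path_product D \<gamma> g \<and> Y = gact g (mono_y m))"

end

end

theory Submission
  imports Defs "HOL-Computational_Algebra.Formal_Power_Series"
begin

text \<open>
  The y-representation is extended by a symbol v and by the symbols \<open>log y\<^sub>i\<close>: put
  \<open>X\<^sub>n v = y\<^sup>n (1 - 1/2 log y\<^sup>n)\<close>. This is compatible with the brackets, and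
  \<open>exp (c \<Psi>[m]) v = v + c L(y\<^sup>m)\<close>, where L is the modified Rogers dilogarithm, while every
  element of \<open>G\<^sub>n\<^sup>\<parallel>\<close> fixes \<open>L(y\<^sup>k\<^sup>n)\<close>; here \<open>log y\<^sup>m\<close> transforms like the logarithm of a
  series, so g sends \<open>L(y\<^sup>m)\<close> to \<open>L(g y\<^sup>m)\<close>. Applied to v, the product of wall elements along
  the loop therefore changes by \<open>\<epsilon> c L(y\<^sub>z[m])\<close> at every crossing, and since the total product
  is the identity these contributions add up to 0.

  The y-variables are computed along auxiliary curves. To compare these with the loop, the operator
  of the path from a point to the positive chamber is viewed as a function of that point; by
  consistency it is well defined, locally constant off the walls, and it jumps by the wall elements.
\<close>

text \<open>The product of the structure group is given only by Dynkin's series, so it has to be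
  proved for this very series that a representation of the Lie algebra integrates to one of the
  group. Convergence is avoided by letting the operators act modulo degree > l, where they are
  nilpotent; the identity is claimed coefficient by coefficient, so all l together suffice. The
  factor 1/2 in the action on v is forced by the bracket relation: in
  \<open>X_a X_b v - X_b X_a v\<close> each order contributes {a,b} y^(a+b), and loses one half of
  it again when the logarithm is differentiated; what remains is {a,b} y^(a+b) (1 - 1/2 log
  y^(a+b)). A crossing point z of the loop lies on a wall, where the operator of the path to the
  chamber has two values. They differ by an element of the parallel subgroup of the normal n, which
  fixes L(y^(kn)). Hence L(y_z[kn]) can be read off on either side, and the auxiliary curve and the
  loop may leave z on different sides.\<close>

locale rat_algebra =
  fixes q :: "rat \<Rightarrow> 'a::ring_1"
  assumes q_add: "q (c + d) = q c + q d"
    and q_mult: "q (c * d) = q c * q d"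
    and q_1: "q 1 = 1"
    and q_commute: "q c * x = x * q c"
begin

lemma q_0: "q 0 = 0"
  using q_add[of 0 0] by simp

lemma q_minus: "q (- c) = - q c"
  using q_add[of c "- c"] by (simp add: q_0 eq_neg_iff_add_eq_0 add.commute)

lemma q_diff: "q (c - d) = q c - q d"
  using q_add[of c "- d"] by (simp add: q_minus)

lemma q_of_nat: "q (of_nat n) = of_nat n"
  by (induction n) (simp_all add: q_0 q_1 q_add)

lemma q_sum: "q (sum f A) = (\<Sum>x\<in>A. q (f x))"
  by (induction A rule: infinite_finite_induct) (simp_all add: q_0 q_add)

lemma q_assoc: "q c * (q d * x) = q (c * d) * x"
  by (simp add: q_mult mult.assoc)

lemma q_left_commute: "x * (q c * y) = q c * (x * y)"
  by (metis mult.assoc q_commute)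

lemma q_cancel:
  assumes "c \<noteq> 0" "q c * x = 0"
  shows "x = 0"
proof -
  have "q (inverse c) * (q c * x) = 0" using assms by simp
  then show ?thesis using assms(1) by (simp add: q_assoc q_1)
qed

text \<open>Subtracting \<open>2 ^ Suc d\<close> times the value at n from the value at
  \<open>2 * n\<close> removes the top coefficient and multiplies the i-th one by
  \<open>2 ^ i - 2 ^ Suc d\<close>, which is nonzero for i at most d. This allows induction on d
  without Vandermonde determinants.\<close>

lemma poly_values_eq_0D:
  assumes "\<And>n::nat. (\<Sum>i\<le>d. q (of_nat n ^ i) * c i) = 0" and "i \<le> d"
  shows "c i = 0"
  using assms
proof (induction d arbitrary: c i)
  case 0
  show ?case using 0(1)[of 0] 0(2) by (simp add: q_1)
next
  case (Suc d)
  have low: "c i = 0" if i: "i \<le> d" for i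
  proof -
    have "(\<Sum>i\<le>d. q (of_nat n ^ i) * (q (2 ^ i - 2 ^ Suc d) * c i)) = 0" for n :: nat
    proof -
      have "(\<Sum>i\<le>d. q (of_nat n ^ i) * (q (2 ^ i - 2 ^ Suc d) * c i))
          = (\<Sum>i\<le>Suc d. q (of_nat n ^ i) * (q (2 ^ i - 2 ^ Suc d) * c i))"
        by (simp add: q_0)
      also have "\<dots> = (\<Sum>i\<le>Suc d. q (of_nat (2 * n) ^ i) * c i)
          - q (2 ^ Suc d) * (\<Sum>i\<le>Suc d. q (of_nat n ^ i) * c i)"
        unfolding sum_distrib_left sum_subtractf[symmetric]
        by (intro sum.cong refl)
          (simp only: q_assoc left_diff_distrib[symmetric] q_diff[symmetric],
           simp add: power_mult_distrib algebra_simps)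
      finally show ?thesis using Suc.prems(1)[of n] Suc.prems(1)[of "2 * n"] by simp
    qed
    then have "q (2 ^ i - 2 ^ Suc d) * c i = 0" by (rule Suc.IH) (rule i)
    moreover have "(2::rat) ^ i - 2 ^ Suc d \<noteq> 0" using i power_strict_increasing[of i "Suc d" "2::rat"] by simp
    ultimately show ?thesis using q_cancel by blast
  qed
  have "c (Suc d) = 0" using Suc.prems(1)[of 1] low by (simp add: q_1)
  then show ?case using low Suc.prems(2) by (cases "i = Suc d") auto
qed

text \<open>This is how identities that are polynomial in an exponent n are exploited: all terms are
  collected as fixed ring elements with polynomial weights, and only the coefficient of n is
  kept.\<close>

lemma linear_coeff_eq_0:
  assumes fin: "finite A" and z: "\<And>n::nat. (\<Sum>x\<in>A. q (poly (P x) (of_nat n)) * r x) = 0"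
  shows "(\<Sum>x\<in>A. q (coeff (P x) 1) * r x) = 0"
proof -
  \<comment> \<open>A common bound for the degrees; the \<open>Suc\<close> keeps index 1 in range
    even if all polynomials are constant.\<close>
  define d where "d = Suc (\<Sum>x\<in>A. degree (P x))"
  have deg: "degree (P x) \<le> d" if "x \<in> A" for x
    using member_le_sum[OF that, of "\<lambda>x. degree (P x)"] fin by (simp add: d_def)
  have pe: "poly (P x) a = (\<Sum>i\<le>d. coeff (P x) i * a ^ i)" if "x \<in> A" for x a
    unfolding poly_altdef using deg[OF that]
    by (intro sum.mono_neutral_left) (auto simp: coeff_eq_0)
  have "(\<Sum>i\<le>d. q (of_nat n ^ i) * (\<Sum>x\<in>A. q (coeff (P x) i) * r x)) = 0" for n :: nat
  proof -
    have "(\<Sum>i\<le>d. q (of_nat n ^ i) * (\<Sum>x\<in>A. q (coeff (P x) i) * r x))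
        = (\<Sum>i\<le>d. \<Sum>x\<in>A. q (coeff (P x) i * of_nat n ^ i) * r x)"
      by (simp add: sum_distrib_left q_assoc mult.commute)
    also have "\<dots> = (\<Sum>x\<in>A. \<Sum>i\<le>d. q (coeff (P x) i * of_nat n ^ i) * r x)"
      by (rule sum.swap)
    also have "\<dots> = (\<Sum>x\<in>A. q (poly (P x) (of_nat n)) * r x)"
      by (intro sum.cong refl) (simp add: pe q_sum sum_distrib_right)
    finally show ?thesis using z by simp
  qed
  then show ?thesis by (rule poly_values_eq_0D) (simp add: d_def)
qed

end

section \<open>Dynkin's form of the Baker--Campbell--Hausdorff formula\<close>

text \<open>
  Identities between powers \<open>u\<^sup>n\<close> that are polynomial in n turn into identities for \<open>log u\<close>
  by comparing the coefficients of n.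
\<close>

fun binomial_poly :: "nat \<Rightarrow> rat poly" where
  "binomial_poly 0 = 1"
| "binomial_poly (Suc k) = smult (1 / of_nat (Suc k)) ([:- of_nat k, 1:] * binomial_poly k)"

lemma poly_binomial_poly: "poly (binomial_poly k) (of_nat n) = of_nat (n choose k)"
proof -
  have "poly (binomial_poly k) x = x gchoose k" for x
  proof (induction k)
    case (Suc k)
    have "of_nat (Suc k) * (x gchoose Suc k) = (x - of_nat k) * (x gchoose k)"
      using gbinomial_mult_1[of x k] by (simp add: algebra_simps)
    then show ?case using Suc by (simp add: field_simps)
  qed simp
  then show ?thesis by (simp add: binomial_gbinomial)
qed

lemma coeff_binomial_poly_0: "coeff (binomial_poly k) 0 = (if k = 0 then 1 else 0)"
proof (induction k)
  case (Suc k)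
  then show ?case by (cases k) (simp_all add: mult.commute)
qed simp

text \<open>These are the coefficients of log(1 + x), in accordance with the fact that log u is the
  coefficient of n in the expansion of u^n in powers of u - 1.\<close>

lemma coeff_binomial_poly_1: "coeff (binomial_poly (Suc k)) 1 = (- 1) ^ k / of_nat (Suc k)"
proof (induction k)
  case (Suc k)
  have gen: "coeff (smult c ([:- a, 1:] * p)) 1 = c * (coeff p 0 - a * coeff p 1)" for c a and p :: "rat poly"
    by (simp add: coeff_pCons_Suc)
  have "coeff (binomial_poly (Suc (Suc k))) 1
      = (coeff (binomial_poly (Suc k)) 0 - of_nat (Suc k) * coeff (binomial_poly (Suc k)) 1) / of_nat (Suc (Suc k))"
    by (subst binomial_poly.simps(2)) (simp only: gen times_divide_eq_left mult_1)
  then show ?case unfolding Suc by (simp add: coeff_binomial_poly_0 del: binomial_poly.simps)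
qed simp

unbundle fps_syntax and no vec_syntax

section \<open>Formal exponentials and iterated commutators\<close>

context rat_algebra
begin

text \<open>The series exp(tX) in a central formal variable t, which counts letters and replaces
  convergence.\<close>

definition expt :: "'a \<Rightarrow> 'a fps" where
  "expt X = Abs_fps (\<lambda>n. q (1 / fact n) * X ^ n)"

definition ad :: "'a \<Rightarrow> 'a \<Rightarrow> 'a" where
  "ad X w = X * w - w * X"

fun nested_ad :: "'a list \<Rightarrow> 'a" where
  "nested_ad [] = 0"
| "nested_ad [x] = x"
| "nested_ad (x # y # zs) = ad x (nested_ad (y # zs))"

text \<open>The Euler operator t d/dt. It multiplies the part of word length n by n, which is
  exactly the division by the word length in Dynkin's formula undone.\<close>

definition theta :: "'a fps \<Rightarrow> 'a fps" where
  "theta f = Abs_fps (\<lambda>n. of_nat n * f $ n)"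

lemma theta_nth [simp]: "theta f $ n = of_nat n * f $ n"
  by (simp add: theta_def)

lemma theta_mult: "theta (f * g) = theta f * g + f * theta g"
proof (rule fps_ext)
  fix n
  have "theta (f * g) $ n = (\<Sum>i=0..n. of_nat n * (f $ i * g $ (n - i)))"
    by (simp add: fps_mult_nth sum_distrib_left)
  also have "\<dots> = (\<Sum>i=0..n. of_nat i * f $ i * g $ (n - i) + f $ i * (of_nat (n - i) * g $ (n - i)))"
  proof (intro sum.cong refl)
    fix i assume "i \<in> {0..n}"
    then have "of_nat n = (of_nat i + of_nat (n - i) :: 'a)" by (simp flip: of_nat_add)
    then show "of_nat n * (f $ i * g $ (n - i)) = of_nat i * f $ i * g $ (n - i) + f $ i * (of_nat (n - i) * g $ (n - i))"
      by (simp add: distrib_right mult.assoc) (metis mult.assoc mult_of_nat_commute)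
  qed
  finally show "theta (f * g) $ n = (theta f * g + f * theta g) $ n"
    by (simp add: fps_mult_nth sum.distrib)
qed

lemma theta_1: "theta 1 = 0"
  by (simp add: fps_eq_iff)

lemma expt_nth [simp]: "expt X $ n = q (1 / fact n) * X ^ n"
  by (simp add: expt_def)

lemma of_nat_q_fact: "of_nat (Suc n) * (q (1 / fact (Suc n)) * w) = q (1 / fact n) * w"
  by (simp add: q_assoc flip: q_of_nat)

lemma q_fact_of_nat: "q (1 / fact (Suc n)) * (of_nat (Suc n) * w) = q (1 / fact n) * w"
  using of_nat_q_fact[of n w] by (simp only: q_left_commute)

lemma fps_deriv_expt:
  "fps_deriv (expt X) = fps_const X * expt X" "fps_deriv (expt X) = expt X * fps_const X"
proof -
  have "of_nat (Suc n) * (q (1 / fact (Suc n)) * X ^ Suc n) = q (1 / fact n) * X ^ Suc n" for n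
    by (rule of_nat_q_fact)
  then show "fps_deriv (expt X) = fps_const X * expt X" "fps_deriv (expt X) = expt X * fps_const X"
    by (auto simp: fps_eq_iff q_left_commute mult.assoc power_commutes simp del: of_nat_Suc fact_Suc)
qed

text \<open>The left-hand side f satisfies f' = X f - f X with constant term w, so its coefficients
  obey the recursion of the iterated commutators: Ad(exp tX) = exp(t ad X).\<close>

lemma expt_conj_const: "expt X * fps_const w * expt (- X) = Abs_fps (\<lambda>n. q (1 / fact n) * (ad X ^^ n) w)"
proof -
  define f where "f = expt X * fps_const w * expt (- X)"
  have d: "fps_deriv f = fps_const X * f - f * fps_const X"
    unfolding f_def fps_deriv_mult fps_deriv_const fps_deriv_expt(1)[of X] fps_deriv_expt(2)[of "-X"]
    by (simp add: mult.assoc flip: fps_const_neg)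
  have s: "of_nat (Suc n) * f $ Suc n = ad X (f $ n)" for n
    using arg_cong[OF d, of "\<lambda>g. g $ n"] by (simp add: ad_def del: of_nat_Suc)
  have adq: "ad X (q c * y) = q c * ad X y" for c y
    by (simp add: ad_def q_left_commute right_diff_distrib mult.assoc)
  have "f $ n = q (1 / fact n) * (ad X ^^ n) w" for n
  proof (induction n)
    case 0 show ?case by (simp add: f_def q_1)
  next
    case (Suc n)
    have "of_nat (Suc n) * f $ Suc n = of_nat (Suc n) * (q (1 / fact (Suc n)) * (ad X ^^ Suc n) w)"
      unfolding s Suc adq of_nat_q_fact by simp
    then have "q (of_nat (Suc n)) * (f $ Suc n - q (1 / fact (Suc n)) * (ad X ^^ Suc n) w) = 0"
      by (simp only: q_of_nat right_diff_distrib) simp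
    then show ?case using q_cancel[of "of_nat (Suc n)"] by (metis eq_iff_diff_eq_0 of_nat_neq_0)
  qed
  then show ?thesis by (simp add: fps_eq_iff f_def)
qed

lemma expt_uminus: "expt X * expt (- X) = 1"
proof -
  have "(ad X ^^ n) 1 = (if n = 0 then 1 else 0)" for n
    by (induction n) (auto simp: ad_def)
  then show ?thesis using expt_conj_const[of X 1] by (simp add: fps_eq_iff q_1)
qed

lemma expt_conj_nth:
  "(expt X * w * expt (- X)) $ m = (\<Sum>i\<le>m. q (1 / fact i) * (ad X ^^ i) (w $ (m - i)))"
proof -
  have "(expt X * w * expt (- X)) $ m
      = (\<Sum>i=0..m. \<Sum>j=0..i. expt X $ j * w $ (i - j) * expt (- X) $ (m - i))"
    by (simp add: fps_mult_nth sum_distrib_right)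
  also have "\<dots> = (\<Sum>(k, j, i)\<in>{(k, j, i). k + j + i = m}. expt X $ j * w $ k * expt (- X) $ i)"
    unfolding sum.Sigma[OF finite_atLeastAtMost ballI[OF finite_atLeastAtMost]]
    by (rule sum.reindex_bij_witness[of _ "\<lambda>(k, j, i). (k + j, j)" "\<lambda>(i, j). (i - j, j, m - i)"]) auto
  also have "\<dots> = (\<Sum>i\<le>m. \<Sum>j=0..i. expt X $ j * w $ (m - i) * expt (- X) $ (i - j))"
    unfolding sum.Sigma[OF finite_atMost ballI[OF finite_atLeastAtMost]]
    by (rule sum.reindex_bij_witness[of _ "\<lambda>(i, j). (m - i, j, i - j)" "\<lambda>(k, j, i). (j + i, j)"]) auto
  also have "\<dots> = (\<Sum>i\<le>m. (expt X * fps_const (w $ (m - i)) * expt (- X)) $ i)"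
    by (simp add: fps_mult_nth[of "_ * fps_const _"])
  finally show ?thesis by (simp add: expt_conj_const)
qed

lemma ad_0: "ad X 0 = 0"
  and ad_add: "ad X (v + w) = ad X v + ad X w"
  and ad_q: "ad X (q c * w) = q c * ad X w"
  by (simp_all add: ad_def algebra_simps q_left_commute)

lemma ad_pow_0: "(ad X ^^ n) 0 = 0"
  and ad_pow_add: "(ad X ^^ n) (v + w) = (ad X ^^ n) v + (ad X ^^ n) w"
  and ad_pow_q: "(ad X ^^ n) (q c * w) = q c * (ad X ^^ n) w"
  by (induction n) (simp_all add: ad_0 ad_add ad_q)

lemma ad_pow_sum: "(ad X ^^ n) (sum f A) = (\<Sum>x\<in>A. (ad X ^^ n) (f x))"
  by (induction A rule: infinite_finite_induct) (simp_all add: ad_pow_0 ad_pow_add)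

lemma nested_ad_append:
  "ws \<noteq> [] \<Longrightarrow> nested_ad (replicate i X @ ws) = (ad X ^^ i) (nested_ad ws)"
proof (induction i)
  case (Suc i)
  then obtain y zs where "replicate i X @ ws = y # zs" by (cases "replicate i X @ ws") auto
  then show ?case using Suc by simp
qed simp

lemma nested_ad_replicate: "nested_ad (replicate i X) = (if i = 1 then X else 0)"
proof (cases i)
  case (Suc k)
  have "nested_ad (replicate k X @ [X]) = (ad X ^^ k) X" by (simp add: nested_ad_append)
  also have "\<dots> = (if k = 0 then X else 0)"
    by (cases k) (simp_all add: funpow_swap1 ad_def ad_pow_0 del: funpow.simps(2), simp add: ad_def ad_pow_0 funpow_Suc_right del: funpow.simps(2))
  finally show ?thesis using Suc by (simp add: replicate_append_same)
qed simp

text \<open>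
  Conjugation by \<open>u = e\<^sup>X e\<^sup>Y\<close> minus the identity: its k-fold iterate, applied to the logarithmic
  derivative of u, is the sum over k + 1 blocks in Dynkin's formula. Expanding
  \<open>\<theta>(u\<^sup>n) = \<Sum>\<^sub>i\<^sub><\<^sub>n u\<^sup>i (\<theta>(u) u\<^sup>-\<^sup>1) u\<^sup>n\<^sup>-\<^sup>i\<close> in binomial coefficients of n, the linear
  terms give \<open>\<theta>(log u)\<close>.
\<close>

definition conj1 :: "'a \<Rightarrow> 'a \<Rightarrow> 'a fps \<Rightarrow> 'a fps" where
  "conj1 X Y w = (expt X * expt Y) * w * (expt (- Y) * expt (- X)) - w"

lemma conj1_add: "conj1 X Y (v + w) = conj1 X Y v + conj1 X Y w"
  by (simp add: conj1_def algebra_simps)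

lemma conj1_of_nat: "conj1 X Y (of_nat n * w) = of_nat n * conj1 X Y w"
  by (induction n) (simp_all add: conj1_add distrib_right, simp add: conj1_def)

lemma conj1_sum: "conj1 X Y (sum f A) = (\<Sum>x\<in>A. conj1 X Y (f x))"
  by (induction A rule: infinite_finite_induct) (simp_all add: conj1_add, simp_all add: conj1_def)

lemma finite_pairs_le: "finite {(i, j). P i j \<and> i + j \<le> (m::nat)}"
  by (rule finite_subset[of _ "{..m} \<times> {..m}"]) auto

text \<open>Both conjugations are expanded in commutators. The term i = j = 0 is w itself and is
  removed by the subtraction in \<open>conj1\<close>; this is the origin of Dynkin's condition p + q
  > 0.\<close>

lemma conj1_nth: "conj1 X Y w $ m = (\<Sum>(i, j)\<in>{(i, j). 0 < i + j \<and> i + j \<le> m}.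
    q (1 / (fact i * fact j)) * (ad X ^^ i) ((ad Y ^^ j) (w $ (m - (i + j)))))"
proof -
  let ?f = "\<lambda>i j. q (1 / (fact i * fact j)) * (ad X ^^ i) ((ad Y ^^ j) (w $ (m - (i + j))))"
  have "((expt X * expt Y) * w * (expt (- Y) * expt (- X))) $ m
      = (expt X * (expt Y * w * expt (- Y)) * expt (- X)) $ m"
    by (simp add: mult.assoc)
  also have "\<dots> = (\<Sum>i\<le>m. \<Sum>j\<le>m - i. ?f i j)"
    unfolding expt_conj_nth
    by (simp add: ad_pow_sum ad_pow_q sum_distrib_left q_assoc diff_diff_left)
  also have "\<dots> = (\<Sum>(i, j)\<in>{(i, j). i + j \<le> m}. ?f i j)"
    unfolding sum.Sigma[OF finite_atMost ballI[OF finite_atMost]]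
    by (intro sum.cong) auto
  also have "\<dots> = (\<Sum>(i, j)\<in>insert (0, 0) {(i, j). 0 < i + j \<and> i + j \<le> m}. ?f i j)"
    by (intro sum.cong) auto
  also have "\<dots> = w $ m + (\<Sum>(i, j)\<in>{(i, j). 0 < i + j \<and> i + j \<le> m}. ?f i j)"
    using finite_pairs_le[of "\<lambda>i j. 0 < i + j" m] by (subst sum.insert) (auto simp: q_1)
  finally show ?thesis by (simp add: conj1_def)
qed

text \<open>The letters have an arbitrary type because the same words are formed from operators and
  from elements of the Lie algebra.\<close>

definition xy_word :: "'b \<Rightarrow> 'b \<Rightarrow> (nat \<times> nat) list \<Rightarrow> 'b list" where
  "xy_word X Y ps = concat (map (\<lambda>(i, j). replicate i X @ replicate j Y) ps)"

definition exponent_lists :: "nat \<Rightarrow> nat \<Rightarrow> (nat \<times> nat) list set" where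
  "exponent_lists k m = {ps. length ps = k \<and> (\<forall>(i, j)\<in>set ps. 0 < i + j) \<and> (\<Sum>(i, j)\<leftarrow>ps. i + j) = m}"

definition fact_prod :: "(nat \<times> nat) list \<Rightarrow> rat" where
  "fact_prod ps = (\<Prod>(i, j)\<leftarrow>ps. fact i * fact j)"

text \<open>The words with k blocks, graded by their length m, still without the factor (-1)^(k-1)/k
  and without the division by m.\<close>

definition dynkin_sum :: "'a \<Rightarrow> 'a \<Rightarrow> nat \<Rightarrow> 'a fps" where
  "dynkin_sum X Y k = Abs_fps (\<lambda>m. \<Sum>ps\<in>exponent_lists k m.
     q (1 / fact_prod ps) * nested_ad (xy_word X Y ps))"

lemma length_le_exponents: "\<forall>(i, j)\<in>set ps. 0 < i + j \<Longrightarrow> length ps \<le> (\<Sum>(i, j)\<leftarrow>ps. i + (j::nat))"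
  by (induction ps) auto

lemma exponent_lists_Suc: "exponent_lists (Suc k) m =
    (\<lambda>((i, j), ps). (i, j) # ps) ` (SIGMA (i, j):{(i, j). 0 < i + j \<and> i + j \<le> m}. exponent_lists k (m - (i + j)))"
  (is "?L = ?R")
proof
  show "?L \<subseteq> ?R"
  proof
    fix ps assume "ps \<in> ?L"
    then obtain i j rs where "ps = (i, j) # rs" "0 < i + j" "rs \<in> exponent_lists k (m - (i + j))" "i + j \<le> m"
      by (cases ps) (auto simp: exponent_lists_def)
    then show "ps \<in> ?R" by (auto simp: image_iff intro!: bexI[of _ "((i, j), rs)"])
  qed
qed (auto simp: exponent_lists_def)

lemma finite_exponent_lists: "finite (exponent_lists k m)"
proof (induction k arbitrary: m)
  case 0
  have "exponent_lists 0 m \<subseteq> {[]}" by (auto simp: exponent_lists_def)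
  then show ?case using finite_subset by blast
next
  case (Suc k)
  show ?case unfolding exponent_lists_Suc
    by (intro finite_imageI finite_SigmaI) (auto simp: finite_pairs_le Suc)
qed

lemma xy_word_nonempty:
  assumes "ps \<in> exponent_lists (Suc k) m" shows "xy_word X Y ps \<noteq> []"
  using assms by (cases ps) (auto simp: exponent_lists_def xy_word_def)

lemma sum_exponent_lists_Suc:
  "(\<Sum>ps\<in>exponent_lists (Suc k) m. F ps)
    = (\<Sum>(i, j)\<in>{(i, j). 0 < i + j \<and> i + j \<le> m}. \<Sum>ps\<in>exponent_lists k (m - (i + j)). F ((i, j) # ps))"
proof -
  let ?A = "{(i, j). 0 < i + j \<and> i + j \<le> m}" and ?B = "\<lambda>p. exponent_lists k (m - (fst p + snd p))"
  have "exponent_lists (Suc k) m = (\<lambda>(p, ps). p # ps) ` Sigma ?A ?B"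
    unfolding exponent_lists_Suc by (force simp: image_iff)
  moreover have "inj_on (\<lambda>(p, ps). p # ps) (Sigma ?A ?B)" by (auto simp: inj_on_def)
  ultimately have "(\<Sum>ps\<in>exponent_lists (Suc k) m. F ps) = (\<Sum>(p, ps)\<in>Sigma ?A ?B. F (p # ps))"
    by (simp add: sum.reindex case_prod_unfold)
  also have "\<dots> = (\<Sum>p\<in>?A. \<Sum>ps\<in>?B p. F (p # ps))"
    by (subst sum.Sigma) (auto simp: finite_pairs_le finite_exponent_lists)
  finally show ?thesis by (simp add: case_prod_unfold)
qed

text \<open>Putting a block X^i Y^j in front of a nonempty word applies (ad X)^i (ad Y)^j to its
  bracket; with the weights 1/(i! j!) this is the expansion of \<open>conj1\<close>. The word must
  be nonempty, hence the two \<open>Suc\<close>.\<close>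

lemma dynkin_sum_Suc: "dynkin_sum X Y (Suc (Suc k)) = conj1 X Y (dynkin_sum X Y (Suc k))"
proof (rule fps_ext)
  fix m
  have "dynkin_sum X Y (Suc (Suc k)) $ m = (\<Sum>(i, j)\<in>{(i, j). 0 < i + j \<and> i + j \<le> m}.
      \<Sum>ps\<in>exponent_lists (Suc k) (m - (i + j)).
        q (1 / fact_prod ((i, j) # ps)) * nested_ad (xy_word X Y ((i, j) # ps)))"
    by (simp add: dynkin_sum_def sum_exponent_lists_Suc[where k = "Suc k"])
  also have "\<dots> = (\<Sum>(i, j)\<in>{(i, j). 0 < i + j \<and> i + j \<le> m}.
      \<Sum>ps\<in>exponent_lists (Suc k) (m - (i + j)).
        q (1 / (fact i * fact j)) * (ad X ^^ i) ((ad Y ^^ j) (q (1 / fact_prod ps) * nested_ad (xy_word X Y ps))))"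
  proof (intro sum.cong refl, clarify, intro sum.cong refl)
    fix i j ps assume ps: "ps \<in> exponent_lists (Suc k) (m - (i + j))"
    have "nested_ad (xy_word X Y ((i, j) # ps)) = nested_ad (replicate i X @ (replicate j Y @ xy_word X Y ps))"
      by (simp add: xy_word_def)
    also have "\<dots> = (ad X ^^ i) ((ad Y ^^ j) (nested_ad (xy_word X Y ps)))"
      using xy_word_nonempty[OF ps, of X Y] by (simp add: nested_ad_append)
    finally show "q (1 / fact_prod ((i, j) # ps)) * nested_ad (xy_word X Y ((i, j) # ps)) =
        q (1 / (fact i * fact j)) * (ad X ^^ i) ((ad Y ^^ j) (q (1 / fact_prod ps) * nested_ad (xy_word X Y ps)))"
      by (simp add: ad_pow_q q_assoc fact_prod_def)
  qed
  finally show "dynkin_sum X Y (Suc (Suc k)) $ m = conj1 X Y (dynkin_sum X Y (Suc k)) $ m"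
    by (simp add: conj1_nth dynkin_sum_def ad_pow_sum sum_distrib_left)
qed

lemma dynkin_sum_nth_eq_0: "m < k \<Longrightarrow> dynkin_sum X Y k $ m = 0"
proof -
  assume "m < k"
  then have "exponent_lists k m = {}" using length_le_exponents by (force simp: exponent_lists_def)
  then show ?thesis by (simp add: dynkin_sum_def)
qed

text \<open>A single block X^i Y^j has a nonzero bracket only for (1,0) and for j = 1. The terms
  with j = 1 add up to the conjugate of Y by exp(tX), so one block gives the logarithmic derivative
  of exp(tX) exp(tY).\<close>

lemma dynkin_sum_1: "dynkin_sum X Y (Suc 0) = fps_X * (fps_const X + expt X * fps_const Y * expt (- X))"
proof (rule fps_ext)
  fix m
  have e0: "exponent_lists 0 k = (if k = 0 then {[]} else {})" for k by (auto simp: exponent_lists_def)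
  have "dynkin_sum X Y (Suc 0) $ m = (\<Sum>(i, j)\<in>{(i, j). 0 < i + j \<and> i + j \<le> m}. if i + j = m then
        q (1 / (fact i * fact j)) * nested_ad (replicate i X @ replicate j Y) else 0)"
    by (simp add: dynkin_sum_def sum_exponent_lists_Suc[where k = 0] e0 xy_word_def fact_prod_def)
       (intro sum.cong, auto)
  also have "\<dots> = (\<Sum>(i, j)\<in>{(i, j). 0 < i + j \<and> i + j = m}.
        q (1 / (fact i * fact j)) * nested_ad (replicate i X @ replicate j Y))"
    by (rule sum.mono_neutral_cong_right) (auto simp: finite_pairs_le split: if_splits)
  also have "\<dots> = (\<Sum>(i, j)\<in>(\<lambda>j. (m - j, j)) ` {j. 0 < m \<and> j \<le> m}.
        q (1 / (fact i * fact j)) * nested_ad (replicate i X @ replicate j Y))"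
    by (intro sum.cong) (auto simp: image_iff)
  also have "\<dots> = (\<Sum>j\<in>{j. 0 < m \<and> j \<le> m}.
        q (1 / (fact (m - j) * fact j)) * nested_ad (replicate (m - j) X @ replicate j Y))"
    by (subst sum.reindex) (auto simp: inj_on_def)
  also have "\<dots> = (\<Sum>j\<in>{j. 0 < m \<and> j \<le> 1}.
        q (1 / (fact (m - j) * fact j)) * nested_ad (replicate (m - j) X @ replicate j Y))"
  proof (rule sum.mono_neutral_right)
    show "\<forall>j\<in>{j. 0 < m \<and> j \<le> m} - {j. 0 < m \<and> j \<le> 1}.
        q (1 / (fact (m - j) * fact j)) * nested_ad (replicate (m - j) X @ replicate j Y) = 0"
    proof
      fix j assume "j \<in> {j. 0 < m \<and> j \<le> m} - {j. 0 < m \<and> j \<le> 1}"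
      then have "j \<ge> 2" by auto
      then have "replicate j Y \<noteq> []" "nested_ad (replicate j Y) = 0" by (auto simp: nested_ad_replicate)
      then show "q (1 / (fact (m - j) * fact j)) * nested_ad (replicate (m - j) X @ replicate j Y) = 0"
        by (simp add: nested_ad_append ad_pow_0)
    qed
  qed auto
  also have "\<dots> = (if m = 0 then 0 else q (1 / fact m) * nested_ad (replicate m X)
       + q (1 / fact (m - 1)) * nested_ad (replicate (m - 1) X @ [Y]))"
  proof (cases "m = 0")
    case False
    then have "{j. 0 < m \<and> j \<le> 1} = {0, 1::nat}" by auto
    then show ?thesis using False by simp
  qed simp
  also have "\<dots> = (fps_X * (fps_const X + expt X * fps_const Y * expt (- X))) $ m"
    by (cases m) (auto simp: nested_ad_replicate nested_ad_append expt_conj_const q_1 simp del: replicate.simps)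
  finally show "dynkin_sum X Y (Suc 0) $ m = (fps_X * (fps_const X + expt X * fps_const Y * expt (- X))) $ m" .
qed

text \<open>The product rule gives t X e^(tX) e^(tY) + t e^(tX) Y e^(tY), and in the second term
  e^(tX) Y is rewritten as the conjugate of Y times e^(tX).\<close>

lemma theta_expt_mult:
  "theta (expt X * expt Y) = dynkin_sum X Y (Suc 0) * (expt X * expt Y)"
proof -
  have e: "theta (expt X) = fps_X * (fps_const X * expt X)" for X
    by (rule fps_ext) (case_tac n, simp_all add: q_fact_of_nat q_left_commute del: of_nat_Suc fact_Suc)
  have i: "expt (- X) * (expt X * w) = w" for w
    using expt_uminus[of "- X"] by (metis minus_minus mult.assoc mult_1)
  show ?thesis
    unfolding theta_mult e dynkin_sum_1
    by (simp add: distrib_left distrib_right mult.assoc i)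
       (metis fps_mult_fps_X_commute mult.assoc)
qed

text \<open>Let s be the factor in front of u^n and b_j the (j+1)-block sum. Passing to u^(n+1)
  replaces s by b_0 + u s u^-1 = b_0 + s + conj1 s, and \<open>conj1\<close> shifts b_j to b_(j+1),
  so Pascal's rule yields the binomial coefficients. The bound N keeps the range of summation
  independent of n.\<close>

lemma theta_expt_mult_power:
  assumes "n \<le> N"
  shows "theta ((expt X * expt Y) ^ n)
    = (\<Sum>j<N. of_nat (n choose Suc j) * dynkin_sum X Y (Suc j)) * (expt X * expt Y) ^ n"
  using assms
proof (induction n)
  case 0
  show ?case by (simp add: theta_1)
next
  case (Suc n)
  let ?u = "expt X * expt Y" and ?u' = "expt (- Y) * expt (- X)" and ?b = "\<lambda>j. dynkin_sum X Y (Suc j)"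
  let ?s = "\<Sum>j<N. of_nat (n choose Suc j) * ?b j"
  have i: "expt (- X) * (expt X * w) = w" for X w
    using expt_uminus[of "- X"] by (metis minus_minus mult.assoc mult_1)
  have IH: "theta (?u ^ n) = ?s * ?u ^ n" using Suc by simp
  have "theta (?u ^ Suc n) = theta ?u * ?u ^ n + ?u * theta (?u ^ n)"
    by (simp only: power_Suc theta_mult[of ?u "?u ^ n"])
  also have "\<dots> = ?b 0 * ?u ^ Suc n + ?u * (?s * ?u ^ n)"
    unfolding IH theta_expt_mult by (simp only: power_Suc mult.assoc)
  also have "?u * (?s * ?u ^ n) = (?u * ?s * ?u') * ?u ^ Suc n"
    by (simp only: power_Suc mult.assoc i)
  also have "?u * ?s * ?u' = conj1 X Y ?s + ?s"
    by (simp add: conj1_def)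
  finally have "theta (?u ^ Suc n) = (?b 0 + conj1 X Y ?s + ?s) * ?u ^ Suc n"
    by (simp add: distrib_right)
  also have "conj1 X Y ?s = (\<Sum>j<N. of_nat (n choose Suc j) * ?b (Suc j))"
    by (simp add: conj1_sum conj1_of_nat dynkin_sum_Suc)
  also have "?b 0 + \<dots> = (\<Sum>j<Suc N. of_nat (n choose j) * ?b j)"
    by (subst sum.lessThan_Suc_shift) simp
  also have "\<dots> = (\<Sum>j<N. of_nat (n choose j) * ?b j)"
    using Suc.prems by (simp add: binomial_eq_0)
  also have "\<dots> + ?s = (\<Sum>j<N. of_nat (Suc n choose Suc j) * ?b j)"
    by (simp add: sum.distrib[symmetric] distrib_right)
  finally show ?case .
qed

lemma q_mult_mult: "(q a * x) * (q b * y) = q (a * b) * (x * y)"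
  by (metis mult.assoc q_assoc q_left_commute)

lemma length_xy_word: "length (xy_word X Y ps) = (\<Sum>(i, j)\<leftarrow>ps. i + j)"
  by (induction ps) (auto simp: xy_word_def)

lemma set_xy_word: "set (xy_word X Y ps) \<subseteq> {X, Y}"
  by (auto simp: xy_word_def)

lemma map_xy_word: "map f (xy_word X Y ps) = xy_word (f X) (f Y) ps"
  by (induction ps) (auto simp: xy_word_def)

lemma power_nth_eq_0:
  fixes v :: "'a fps"
  assumes "v $ 0 = 0" "d < k"
  shows "(v ^ k) $ d = 0"
  using assms(2)
proof (induction k arbitrary: d)
  case (Suc k)
  have "v $ i * (v ^ k) $ (d - i) = 0" if "i \<le> d" for i
    using Suc that assms(1) by (cases "i = 0") auto
  then show ?case by (simp add: fps_mult_nth)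
qed simp

text \<open>In the binomial theorem the powers v^k with k > d do not reach degree d. The range up to
  d is thus independent of n, as needed for comparing polynomials in n.\<close>

lemma one_plus_power_nth:
  fixes v :: "'a fps"
  assumes v: "v $ 0 = 0"
  shows "((1 + v) ^ n) $ d = (\<Sum>k\<le>d. q (of_nat (n choose k)) * (v ^ k) $ d)"
proof -
  have "(1 + v) ^ n = (\<Sum>k<Suc N. of_nat (n choose k) * v ^ k)" if "n \<le> N" for N
    using that
  proof (induction n)
    case 0
    show ?case by (subst sum.lessThan_Suc_shift) simp
  next
    case (Suc n)
    have IH: "(1 + v) ^ n = (\<Sum>k<Suc N. of_nat (n choose k) * v ^ k)" using Suc by simp
    have vc: "v * (of_nat c * v ^ k) = of_nat c * v ^ Suc k" for c k
      by (metis mult.assoc mult_of_nat_commute power_Suc)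
    have "(1 + v) ^ Suc n = (1 + v) ^ n + v * (1 + v) ^ n" by (simp add: distrib_right)
    also have "\<dots> = (\<Sum>k<Suc N. of_nat (n choose k) * v ^ k) + (\<Sum>k<Suc N. of_nat (n choose k) * v ^ Suc k)"
      unfolding IH sum_distrib_left vc ..
    also have "(\<Sum>k<Suc N. of_nat (n choose k) * v ^ Suc k) = (\<Sum>k<N. of_nat (n choose k) * v ^ Suc k)"
      using Suc.prems by (simp add: Suc_le_eq binomial_eq_0)
    also have "(\<Sum>k<Suc N. of_nat (n choose k) * v ^ k) = 1 + (\<Sum>k<N. of_nat (n choose Suc k) * v ^ Suc k)"
      by (subst sum.lessThan_Suc_shift) simp
    finally show ?case
      by (subst sum.lessThan_Suc_shift) (simp add: distrib_right sum.distrib algebra_simps)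
  qed
  from this[of "n + d"] have "((1 + v) ^ n) $ d = (\<Sum>k<Suc (n + d). q (of_nat (n choose k)) * (v ^ k) $ d)"
    by (simp add: fps_sum_nth q_of_nat fps_of_nat[symmetric])
  also have "\<dots> = (\<Sum>k\<le>d. q (of_nat (n choose k)) * (v ^ k) $ d)"
    by (rule sum.mono_neutral_right) (auto simp: power_nth_eq_0 v)
  finally show ?thesis .
qed

definition log1pt :: "'a fps \<Rightarrow> 'a fps" where
  "log1pt v = Abs_fps (\<lambda>d. \<Sum>k=1..d. q ((- 1) ^ (k - 1) / of_nat k) * (v ^ k) $ d)"

text \<open>The coefficients of n in two expansions of theta(u^n) are compared, for u = 1 + v. In
  powers of v one finds theta(log u). On the other side stand products binomial(n, j+1) binomial(n,
  k), which are divisible by n^2 unless k = 0; so only the block sums themselves survive.\<close>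

lemma theta_log1pt_nth:
  "of_nat d * log1pt (expt X * expt Y - 1) $ d
    = (\<Sum>k=1..d. q ((- 1) ^ (k - 1) / of_nat k) * dynkin_sum X Y k $ d)"
proof -
  define v where "v = expt X * expt Y - 1"
  have u: "expt X * expt Y = 1 + v" by (simp add: v_def)
  have v0: "v $ 0 = 0" by (simp add: v_def q_1)
  let ?b = "\<lambda>j. dynkin_sum X Y (Suc j)"
  \<comment> \<open>Both sides are collected in one sum over a disjoint union, with polynomial
    weights \<open>P\<close> and signed ring elements \<open>r\<close>, so that the comparison of
    linear coefficients applies once.\<close>
  define P where "P = case_sum binomial_poly (\<lambda>(j, k). binomial_poly (Suc j) * binomial_poly k)"
  define r where "r = case_sum (\<lambda>k. of_nat d * (v ^ k) $ d) (\<lambda>(j, k). - (?b j * v ^ k) $ d)"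
  have split: "(\<Sum>x\<in>{..d} <+> {..d} \<times> {..d}. q (F (P x)) * r x)
      = (\<Sum>k\<le>d. q (F (binomial_poly k)) * (of_nat d * (v ^ k) $ d))
        - (\<Sum>j\<le>d. \<Sum>k\<le>d. q (F (binomial_poly (Suc j) * binomial_poly k)) * (?b j * v ^ k) $ d)" for F
    by (simp add: sum.Plus P_def r_def sum.cartesian_product case_prod_unfold sum_negf)
  have "(\<Sum>x\<in>{..d} <+> {..d} \<times> {..d}. q (coeff (P x) 1) * r x) = 0"
  proof (rule linear_coeff_eq_0[where P = P and r = r])
    fix n :: nat
    define N where "N = n + Suc d"
    have b0: "?b j $ i = 0" if "i \<le> j" for i j
      using that by (simp add: dynkin_sum_nth_eq_0)
    have "of_nat d * ((1 + v) ^ n) $ d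
        = (\<Sum>i=0..d. (\<Sum>j<N. of_nat (n choose Suc j) * ?b j $ i) * ((1 + v) ^ n) $ (d - i))"
      using arg_cong[OF theta_expt_mult_power[of n N X Y, unfolded u], of "\<lambda>f. f $ d"]
      by (simp add: N_def fps_mult_nth[of _ "(1 + v) ^ n"] fps_sum_nth fps_of_nat[symmetric] del: sum.lessThan_Suc)
    also have "\<dots> = (\<Sum>i=0..d. (\<Sum>j\<le>d. of_nat (n choose Suc j) * ?b j $ i) * ((1 + v) ^ n) $ (d - i))"
    proof (rule sum.cong[OF refl])
      fix i assume "i \<in> {0..d}"
      then have "(\<Sum>j<N. of_nat (n choose Suc j) * ?b j $ i) = (\<Sum>j\<le>d. of_nat (n choose Suc j) * ?b j $ i)"
        by (intro sum.mono_neutral_right) (auto simp: N_def b0)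
      then show "(\<Sum>j<N. of_nat (n choose Suc j) * ?b j $ i) * ((1 + v) ^ n) $ (d - i)
          = (\<Sum>j\<le>d. of_nat (n choose Suc j) * ?b j $ i) * ((1 + v) ^ n) $ (d - i)" by simp
    qed
    also have "\<dots> = (\<Sum>i=0..d. (\<Sum>j\<le>d. q (of_nat (n choose Suc j)) * ?b j $ i)
          * (\<Sum>k\<le>d. q (of_nat (n choose k)) * (v ^ k) $ (d - i)))"
    proof (rule sum.cong[OF refl])
      fix i
      have "((1 + v) ^ n) $ (d - i) = (\<Sum>k\<le>d. q (of_nat (n choose k)) * (v ^ k) $ (d - i))"
        unfolding one_plus_power_nth[OF v0]
        by (rule sum.mono_neutral_left) (auto simp: power_nth_eq_0[OF v0])
      then show "(\<Sum>j\<le>d. of_nat (n choose Suc j) * ?b j $ i) * ((1 + v) ^ n) $ (d - i)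
          = (\<Sum>j\<le>d. q (of_nat (n choose Suc j)) * ?b j $ i) * (\<Sum>k\<le>d. q (of_nat (n choose k)) * (v ^ k) $ (d - i))"
        by (simp only: q_of_nat)
    qed
    also have "\<dots> = (\<Sum>i=0..d. \<Sum>j\<le>d. \<Sum>k\<le>d.
          q (of_nat (n choose Suc j) * of_nat (n choose k)) * (?b j $ i * (v ^ k) $ (d - i)))"
      by (simp only: sum_product q_mult_mult)
    also have "\<dots> = (\<Sum>j\<le>d. \<Sum>k\<le>d. q (of_nat (n choose Suc j) * of_nat (n choose k)) * (?b j * v ^ k) $ d)"
      by (subst sum.swap, rule sum.cong[OF refl], subst sum.swap)
         (simp add: fps_mult_nth sum_distrib_left)
    finally show "(\<Sum>x\<in>{..d} <+> {..d} \<times> {..d}. q (poly (P x) (of_nat n)) * r x) = 0"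
      unfolding split[of "\<lambda>p. poly p (of_nat n)"] one_plus_power_nth[OF v0]
      by (simp add: poly_binomial_poly sum_distrib_left q_left_commute del: binomial_poly.simps)
  qed simp
  then have "(\<Sum>k\<le>d. q (coeff (binomial_poly k) 1) * (of_nat d * (v ^ k) $ d))
      = (\<Sum>j\<le>d. \<Sum>k\<le>d. q (coeff (binomial_poly (Suc j) * binomial_poly k) 1) * (?b j * v ^ k) $ d)"
    unfolding split[of "\<lambda>p. coeff p 1"] by simp
  moreover have "(\<Sum>k\<le>d. q (coeff (binomial_poly k) 1) * (of_nat d * (v ^ k) $ d)) = of_nat d * log1pt v $ d"
  proof -
    have "(\<Sum>k\<le>d. q (coeff (binomial_poly k) 1) * (of_nat d * (v ^ k) $ d))
        = (\<Sum>k=1..d. q (coeff (binomial_poly k) 1) * (of_nat d * (v ^ k) $ d))"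
      by (rule sum.mono_neutral_right) (auto simp: q_0 not_le)
    also have "\<dots> = (\<Sum>k=1..d. of_nat d * (q ((- 1) ^ (k - 1) / of_nat k) * (v ^ k) $ d))"
    proof (intro sum.cong refl)
      fix k assume "k \<in> {1..d}"
      then obtain k' where "k = Suc k'" by (cases k) auto
      then show "q (coeff (binomial_poly k) 1) * (of_nat d * (v ^ k) $ d)
          = of_nat d * (q ((- 1) ^ (k - 1) / of_nat k) * (v ^ k) $ d)"
        using coeff_binomial_poly_1[of k'] by (simp add: q_left_commute del: binomial_poly.simps)
    qed
    finally show ?thesis by (simp add: log1pt_def sum_distrib_left)
  qed
  moreover have "(\<Sum>j\<le>d. \<Sum>k\<le>d. q (coeff (binomial_poly (Suc j) * binomial_poly k) 1) * (?b j * v ^ k) $ d)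
      = (\<Sum>k=1..d. q ((- 1) ^ (k - 1) / of_nat k) * dynkin_sum X Y k $ d)"
  proof -
    have c: "coeff (binomial_poly (Suc j) * binomial_poly k) 1
        = (if k = 0 then (- 1) ^ j / of_nat (Suc j) else 0)" for j k
      using coeff_binomial_poly_1[of j]
      by (simp add: coeff_mult coeff_binomial_poly_0 del: binomial_poly.simps)
    have "(\<Sum>j\<le>d. \<Sum>k\<le>d. q (coeff (binomial_poly (Suc j) * binomial_poly k) 1) * (?b j * v ^ k) $ d)
        = (\<Sum>j\<le>d. \<Sum>k\<le>d. if k = 0 then q ((- 1) ^ j / of_nat (Suc j)) * ?b j $ d else 0)"
      unfolding c by (intro sum.cong refl) (auto simp: q_0 simp del: of_nat_Suc)
    also have "\<dots> = (\<Sum>j\<le>d. q ((- 1) ^ j / of_nat (Suc j)) * ?b j $ d)"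
      by simp
    also have "\<dots> = (\<Sum>j<d. q ((- 1) ^ j / of_nat (Suc j)) * ?b j $ d)"
      by (rule sum.mono_neutral_right) (auto simp: dynkin_sum_nth_eq_0)
    also have "\<dots> = (\<Sum>k=1..d. q ((- 1) ^ (k - 1) / of_nat k) * dynkin_sum X Y k $ d)"
      by (rule sum.reindex_bij_witness[of _ "\<lambda>k. k - 1" Suc]) auto
    finally show ?thesis .
  qed
  ultimately show ?thesis by (simp add: v_def)
qed

definition power_subst :: "'a fps \<Rightarrow> rat fps \<Rightarrow> 'a fps" where
  "power_subst v c = Abs_fps (\<lambda>d. \<Sum>k\<le>d. q (c $ k) * (v ^ k) $ d)"

text \<open>Substitution of v is multiplicative on the commutative ring of rational series. This
  transports the identity exp(log(1 + x)) = 1 + x to noncommutative coefficients, where a single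
  element v still commutes with its own powers.\<close>

lemma power_subst_mult:
  assumes v: "v $ 0 = 0"
  shows "power_subst v (c * c') = power_subst v c * power_subst v c'"
proof (rule fps_ext)
  fix d
  have ext: "(\<Sum>k\<le>i. q (c $ k) * (v ^ k) $ i) = (\<Sum>k\<le>d. q (c $ k) * (v ^ k) $ i)" if "i \<le> d" for i c
    using that by (intro sum.mono_neutral_left) (auto simp: power_nth_eq_0[OF v])
  have "(power_subst v c * power_subst v c') $ d
      = (\<Sum>i=0..d. (\<Sum>j\<le>d. q (c $ j) * (v ^ j) $ i) * (\<Sum>k\<le>d. q (c' $ k) * (v ^ k) $ (d - i)))"
    by (simp add: fps_mult_nth power_subst_def ext)
  also have "\<dots> = (\<Sum>i=0..d. \<Sum>j\<le>d. \<Sum>k\<le>d. q (c $ j * c' $ k) * ((v ^ j) $ i * (v ^ k) $ (d - i)))"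
    by (simp only: sum_product q_mult_mult)
  also have "\<dots> = (\<Sum>j\<le>d. \<Sum>k\<le>d. q (c $ j * c' $ k) * (v ^ (j + k)) $ d)"
    by (subst sum.swap, rule sum.cong[OF refl], subst sum.swap)
       (simp add: fps_mult_nth sum_distrib_left power_add)
  also have "\<dots> = (\<Sum>(j, k)\<in>{..d} \<times> {..d}. q (c $ j * c' $ k) * (v ^ (j + k)) $ d)"
    by (simp add: sum.cartesian_product)
  also have "\<dots> = (\<Sum>(j, k)\<in>{(j, k). j + k \<le> d}. q (c $ j * c' $ k) * (v ^ (j + k)) $ d)"
    by (rule sum.mono_neutral_right) (auto, metis mult_zero_right not_le power_nth_eq_0[OF v])
  also have "\<dots> = (\<Sum>(m, j)\<in>(SIGMA m:{..d}. {0..m}). q (c $ j * c' $ (m - j)) * (v ^ m) $ d)"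
    by (rule sum.reindex_bij_witness[of _ "\<lambda>(m, j). (j, m - j)" "\<lambda>(j, k). (j + k, j)"]) auto
  also have "\<dots> = (\<Sum>m\<le>d. q ((c * c') $ m) * (v ^ m) $ d)"
    by (subst sum.Sigma[symmetric]) (auto simp: fps_mult_nth q_sum sum_distrib_right)
  finally show "power_subst v (c * c') $ d = (power_subst v c * power_subst v c') $ d"
    by (simp add: power_subst_def)
qed

lemma power_subst_power:
  assumes v: "v $ 0 = 0"
  shows "power_subst v (c ^ n) = power_subst v c ^ n"
proof (induction n)
  case 0
  have "power_subst v 1 $ d = (1 :: 'a fps) $ d" for d
  proof -
    have "(\<Sum>k\<le>d. q ((1 :: rat fps) $ k) * (v ^ k) $ d) = (\<Sum>k\<in>{0}. q ((1 :: rat fps) $ k) * (v ^ k) $ d)"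
      by (rule sum.mono_neutral_right) (auto simp: q_0)
    then show ?thesis by (simp add: power_subst_def q_1)
  qed
  then show ?case by (simp add: fps_eq_iff)
qed (simp add: power_subst_mult v)

lemma exp_log1pt_nth:
  assumes v: "v $ 0 = 0"
  shows "(\<Sum>k\<le>d. q (1 / fact k) * (log1pt v ^ k) $ d) = (1 + v) $ d"
proof -
  let ?L = "fps_ln 1 :: rat fps"
  have "log1pt v $ d = power_subst v ?L $ d" for d
  proof -
    have "(\<Sum>k=1..d. q ((- 1) ^ (k - 1) / of_nat k) * (v ^ k) $ d) = (\<Sum>k=1..d. q (?L $ k) * (v ^ k) $ d)"
      by (intro sum.cong refl) (simp add: fps_ln_nth)
    also have "\<dots> = (\<Sum>k\<le>d. q (?L $ k) * (v ^ k) $ d)"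
      by (rule sum.mono_neutral_left) (auto simp: fps_ln_nth q_0)
    finally show ?thesis by (simp add: log1pt_def power_subst_def)
  qed
  then have L: "log1pt v = power_subst v ?L" by (simp add: fps_eq_iff)
  have comp: "(fps_exp 1 oo ?L) = 1 + fps_X"
  proof -
    have "(fps_exp 1 - 1) oo ?L = (fps_X :: rat fps)"
      using fps_inv_fps_exp_compose(2)[of "1 :: rat"] fps_ln_fps_exp_inv[of "1 :: rat"] by simp
    moreover have "(fps_exp 1 - 1) oo ?L = (fps_exp 1 oo ?L) - 1"
      by (simp add: fps_compose_sub_distrib)
    ultimately show ?thesis by (simp add: algebra_simps)
  qed
  have "(\<Sum>k\<le>d. q (1 / fact k) * (log1pt v ^ k) $ d)
      = (\<Sum>k\<le>d. \<Sum>j\<le>d. q (1 / fact k * (?L ^ k) $ j) * (v ^ j) $ d)"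
    unfolding L power_subst_power[OF v, symmetric]
    by (simp add: power_subst_def sum_distrib_left q_assoc)
  also have "\<dots> = (\<Sum>j\<le>d. q (\<Sum>k\<le>d. 1 / fact k * (?L ^ k) $ j) * (v ^ j) $ d)"
    by (subst sum.swap) (simp add: q_sum sum_distrib_right)
  also have "\<dots> = (\<Sum>j\<le>d. q ((1 + fps_X :: rat fps) $ j) * (v ^ j) $ d)"
  proof (intro sum.cong refl arg_cong2[where f = "(*)"] arg_cong[where f = q])
    fix j assume "j \<in> {..d}"
    then have "(\<Sum>k\<le>d. 1 / fact k * (?L ^ k) $ j) = (\<Sum>k=0..j. 1 / fact k * (?L ^ k) $ j)"
      by (intro sum.mono_neutral_right) (auto intro!: startsby_zero_power_prefix[rule_format])
    also have "\<dots> = (fps_exp 1 oo ?L) $ j" by (simp add: fps_compose_nth)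
    finally show "(\<Sum>k\<le>d. 1 / fact k * (?L ^ k) $ j) = (1 + fps_X :: rat fps) $ j" by (simp add: comp)
  qed
  also have "\<dots> = (1 + v) $ d"
  proof (cases d)
    case 0
    then show ?thesis by (simp add: q_1 v)
  next
    case (Suc d')
    have "(\<Sum>j\<le>d. q ((1 + fps_X :: rat fps) $ j) * (v ^ j) $ d) = (\<Sum>j\<in>{1}. q ((1 + fps_X :: rat fps) $ j) * (v ^ j) $ d)"
      using Suc by (intro sum.mono_neutral_right) (auto simp: q_0 fps_X_def)
    then show ?thesis using Suc by (simp add: q_1)
  qed
  finally show ?thesis .
qed

text \<open>Dynkin's series graded by word length. The factor 1/m inverts \<open>theta\<close> in
  positive degree; in degree 0 the sum is empty.\<close>

definition dynkin_series :: "'a \<Rightarrow> 'a \<Rightarrow> 'a fps" where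
  "dynkin_series X Y = Abs_fps (\<lambda>m. q (1 / of_nat m) *
     (\<Sum>k=1..m. q ((- 1) ^ (k - 1) / of_nat k) * dynkin_sum X Y k $ m))"

text \<open>Dynkin's series and log(e^(tX) e^(tY)) have the same image under \<open>theta\<close>
  and no constant term, hence they coincide; exponentiating returns the product.\<close>

theorem exp_dynkin_series_nth:
  "(\<Sum>k\<le>d. q (1 / fact k) * (dynkin_series X Y ^ k) $ d) = (expt X * expt Y) $ d"
proof -
  have "log1pt (expt X * expt Y - 1) $ m = dynkin_series X Y $ m" for m
  proof (cases "m = 0")
    case False
    then have "log1pt (expt X * expt Y - 1) $ m = q (1 / of_nat m) * (of_nat m * log1pt (expt X * expt Y - 1) $ m)"
      by (simp add: q_assoc q_1 flip: q_of_nat)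
    also have "\<dots> = dynkin_series X Y $ m"
      unfolding theta_log1pt_nth by (simp add: dynkin_series_def)
    finally show ?thesis .
  qed (simp add: log1pt_def dynkin_series_def)
  then have "dynkin_series X Y = log1pt (expt X * expt Y - 1)" by (simp add: fps_eq_iff)
  then show ?thesis using exp_log1pt_nth[of "expt X * expt Y - 1" d] by (simp add: q_1)
qed

end

text \<open>\<open>R m\<close> models operators that raise the degree by at least m; raising it by
  more than l leaves nothing in a truncated representation. The formal variable can then be set to 1
  by finite sums.\<close>

locale filtered_nilpotent = rat_algebra q
  for q :: "rat \<Rightarrow> 'a::ring_1" +
  fixes R :: "nat \<Rightarrow> 'a set" and l :: nat
  assumes R_0: "0 \<in> R m"
    and R_add: "x \<in> R m \<Longrightarrow> y \<in> R m \<Longrightarrow> x + y \<in> R m"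
    and R_q: "x \<in> R m \<Longrightarrow> q c * x \<in> R m"
    and R_mult: "x \<in> R m \<Longrightarrow> y \<in> R k \<Longrightarrow> x * y \<in> R (m + k)"
    and R_eq_0: "l < m \<Longrightarrow> x \<in> R m \<Longrightarrow> x = 0"
begin

lemma R_minus: "x \<in> R m \<Longrightarrow> - x \<in> R m"
  using R_q[of x m "- 1"] by (simp add: q_minus q_1)

lemma R_sum: "(\<And>x. x \<in> A \<Longrightarrow> f x \<in> R m) \<Longrightarrow> sum f A \<in> R m"
  by (induction A rule: infinite_finite_induct) (auto simp: R_0 R_add)

lemma R_ad: "x \<in> R m \<Longrightarrow> y \<in> R k \<Longrightarrow> ad x y \<in> R (m + k)"
  unfolding ad_def diff_conv_add_uminus
  by (intro R_add R_minus) (auto intro: R_mult, metis R_mult add.commute)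

lemma R_nested_ad: "set ws \<subseteq> R 1 \<Longrightarrow> ws \<noteq> [] \<Longrightarrow> nested_ad ws \<in> R (length ws)"
  by (induction ws rule: nested_ad.induct) (auto dest: R_ad)

definition nexp :: "'a \<Rightarrow> 'a" where
  "nexp x = (\<Sum>k\<le>l. q (1 / fact k) * x ^ k)"

definition ev :: "'a fps \<Rightarrow> 'a" where
  "ev s = (\<Sum>m\<le>l. s $ m)"

text \<open>Evaluation at t = 1 forgets everything beyond degree l, so it is multiplicative only if
  the products of total degree beyond l vanish. The filtration supplies this below.\<close>

lemma ev_mult:
  assumes "\<And>i j. l < i + j \<Longrightarrow> s $ i * s' $ j = 0"
  shows "ev (s * s') = ev s * ev s'"
proof -
  have "ev s * ev s' = (\<Sum>(i, j)\<in>{..l} \<times> {..l}. s $ i * s' $ j)"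
    by (simp add: ev_def sum_product sum.cartesian_product)
  also have "\<dots> = (\<Sum>(i, j)\<in>{(i, j). i + j \<le> l}. s $ i * s' $ j)"
    by (rule sum.mono_neutral_right) (auto, metis assms not_le)
  also have "\<dots> = (\<Sum>(m, i)\<in>(SIGMA m:{..l}. {0..m}). s $ i * s' $ (m - i))"
    by (rule sum.reindex_bij_witness[of _ "\<lambda>(m, j). (j, m - j)" "\<lambda>(j, k). (j + k, j)"]) auto
  also have "\<dots> = ev (s * s')"
    by (subst sum.Sigma[symmetric]) (auto simp: ev_def fps_mult_nth)
  finally show ?thesis ..
qed

lemma R_dynkin_series:
  assumes "X \<in> R 1" "Y \<in> R 1"
  shows "dynkin_series X Y $ m \<in> R m"
proof -
  have "nested_ad (xy_word X Y ps) \<in> R m" if "ps \<in> exponent_lists k m" "1 \<le> k" for ps k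
  proof -
    obtain k' where "k = Suc k'" using \<open>1 \<le> k\<close> by (cases k) auto
    then have "xy_word X Y ps \<noteq> []" using that xy_word_nonempty[of ps k' m X Y] by blast
    then have "nested_ad (xy_word X Y ps) \<in> R (length (xy_word X Y ps))"
      using set_xy_word[of X Y ps] assms by (intro R_nested_ad) auto
    then show ?thesis using that by (simp add: length_xy_word exponent_lists_def)
  qed
  then show ?thesis
    by (auto simp: dynkin_series_def dynkin_sum_def intro!: R_q R_sum)
qed

lemma R_power: "x \<in> R 1 \<Longrightarrow> x ^ Suc k \<in> R (Suc k)"
proof (induction k)
  case (Suc k)
  then show ?case using R_mult[of x 1 "x ^ Suc k" "Suc k"] by simp
qed simp

lemma nexp_dynkin_series:
  assumes X: "X \<in> R 1" and Y: "Y \<in> R 1"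
  shows "nexp (\<Sum>m\<le>l. dynkin_series X Y $ m) = nexp X * nexp Y"
proof -
  let ?Z = "dynkin_series X Y"
  have Z0: "?Z $ 0 = 0" by (simp add: dynkin_series_def)
  \<comment> \<open>Only positive powers are treated: the unit is not assumed to lie in
    \<open>R 0\<close>, so exponent 0 is handled separately throughout.\<close>
  have ZR: "(?Z ^ Suc k) $ j \<in> R j" for k j
  proof (induction k arbitrary: j)
    case 0
    show ?case using R_dynkin_series[OF X Y] by simp
  next
    case (Suc k)
    have "(?Z * ?Z ^ Suc k) $ j \<in> R j" unfolding fps_mult_nth
    proof (rule R_sum)
      fix i assume "i \<in> {0..j}"
      then show "?Z $ i * (?Z ^ Suc k) $ (j - i) \<in> R j"
        using R_mult[OF R_dynkin_series[OF X Y, of i] Suc[of "j - i"]] by simp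
    qed
    then show ?case by simp
  qed
  have ev_pow: "ev (?Z ^ k) = ev ?Z ^ k" for k
  proof (induction k)
    case 0
    have "(\<Sum>m\<le>l. (1 :: 'a fps) $ m) = (\<Sum>m\<in>{0}. (1 :: 'a fps) $ m)"
      by (rule sum.mono_neutral_right) auto
    then show ?case by (simp add: ev_def)
  next
    case (Suc k)
    show ?case
    proof (cases k)
      case (Suc k')
      have "ev (?Z * ?Z ^ k) = ev ?Z * ev (?Z ^ k)"
      proof (rule ev_mult)
        fix i j assume "l < i + j"
        then show "?Z $ i * (?Z ^ k) $ j = 0"
          using R_eq_0 R_mult[OF R_dynkin_series[OF X Y, of i] ZR[of k' j]] Suc by metis
      qed
      then show ?thesis using Suc.IH by simp
    qed simp
  qed
  have "nexp (\<Sum>m\<le>l. ?Z $ m) = (\<Sum>k\<le>l. q (1 / fact k) * ev (?Z ^ k))"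
    by (simp add: nexp_def ev_pow) (simp add: ev_def)
  also have "\<dots> = (\<Sum>d\<le>l. \<Sum>k\<le>l. q (1 / fact k) * (?Z ^ k) $ d)"
    by (subst sum.swap) (simp add: ev_def sum_distrib_left)
  also have "\<dots> = (\<Sum>d\<le>l. \<Sum>k\<le>d. q (1 / fact k) * (?Z ^ k) $ d)"
    by (intro sum.cong refl sum.mono_neutral_right) (auto simp: power_nth_eq_0[OF Z0])
  also have "\<dots> = ev (expt X * expt Y)"
    by (simp add: exp_dynkin_series_nth ev_def)
  also have "\<dots> = ev (expt X) * ev (expt Y)"
  proof (rule ev_mult)
    fix i j assume ij: "l < i + j"
    have XR: "x ^ k \<in> R k" if "x \<in> R 1" "k > 0" for x k
      using R_power[OF that(1)] that(2) by (cases k) auto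
    have "X ^ i * Y ^ j = 0"
    proof (cases "i = 0 \<or> j = 0")
      case True
      then show ?thesis using ij XR[OF X, of i] XR[OF Y, of j] R_eq_0 by fastforce
    next
      case False
      then show ?thesis using ij R_mult[OF XR[OF X, of i] XR[OF Y, of j]] R_eq_0 by blast
    qed
    then show "expt X $ i * expt Y $ j = 0" by (simp add: q_mult_mult)
  qed
  also have "\<dots> = nexp X * nexp Y" by (simp add: ev_def nexp_def)
  finally show ?thesis .
qed

lemma nexp_0: "nexp 0 = 1"
proof -
  have "nexp 0 = (\<Sum>k\<in>{0}. q (1 / fact k) * 0 ^ k)"
    unfolding nexp_def by (rule sum.mono_neutral_right) (auto simp: power_0_left)
  then show ?thesis by (simp add: q_1)
qed

end

unbundle no fps_syntax and vec_syntax

text \<open>As a type of its own, the operators form an instance of \<open>ring_1\<close>, to which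
  the preceding theory applies. Vectors are arbitrary functions, since series have infinitely many
  coefficients. The single law for \<open>x + c y\<close> covers additivity and homogeneity.\<close>

typedef 'b lop = "{f :: ('b \<Rightarrow> rat) \<Rightarrow> 'b \<Rightarrow> rat.
    \<forall>x y c. f (\<lambda>i. x i + c * y i) = (\<lambda>i. f x i + c * f y i)}"
  morphisms app Lop
  by (rule exI[of _ "\<lambda>x. x"]) auto

setup_lifting type_definition_lop

instantiation lop :: (type) ring_1
begin

lift_definition zero_lop :: "'a lop" is "\<lambda>_ _. 0" by simp
lift_definition one_lop :: "'a lop" is "\<lambda>x. x" by simp
lift_definition plus_lop :: "'a lop \<Rightarrow> 'a lop \<Rightarrow> 'a lop" is "\<lambda>f g x i. f x i + g x i"
  by (simp add: algebra_simps)
lift_definition minus_lop :: "'a lop \<Rightarrow> 'a lop \<Rightarrow> 'a lop" is "\<lambda>f g x i. f x i - g x i"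
  by (simp add: algebra_simps)
lift_definition uminus_lop :: "'a lop \<Rightarrow> 'a lop" is "\<lambda>f x i. - f x i"
  by (simp add: algebra_simps)
lift_definition times_lop :: "'a lop \<Rightarrow> 'a lop \<Rightarrow> 'a lop" is "\<lambda>f g x. f (g x)"
  by simp

instance
proof
  fix a b c :: "'a lop"
  show "a * b * c = a * (b * c)" by transfer simp
  show "1 * a = a" by transfer simp
  show "a * 1 = a" by transfer simp
  show "a + b + c = a + (b + c)" by transfer (simp add: add.assoc)
  show "a + b = b + a" by transfer (simp add: add.commute)
  show "0 + a = a" by transfer simp
  show "- a + a = 0" by transfer simp
  show "a - b = a + - b" by transfer simp
  show "(a + b) * c = a * c + b * c" by transfer simp
  show "a * (b + c) = a * b + a * c"
  proof transfer
    fix a b c :: "('a \<Rightarrow> rat) \<Rightarrow> 'a \<Rightarrow> rat"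
    assume "\<forall>x y c. a (\<lambda>i. x i + c * y i) = (\<lambda>i. a x i + c * a y i)"
    from this[rule_format, of _ 1] show "(\<lambda>x. a (\<lambda>i. b x i + c x i)) = (\<lambda>x i. a (b x) i + a (c x) i)"
      by simp
  qed
  show "(0 :: 'a lop) \<noteq> 1"
    by transfer (auto simp: fun_eq_iff intro!: exI[of _ "\<lambda>_. 1"])
qed

end

lift_definition lop_scale :: "rat \<Rightarrow> 'a lop" is "\<lambda>c x i. c * x i"
  by (simp add: algebra_simps)

lemma app_zero [simp]: "app 0 x = (\<lambda>_. 0)" by transfer simp
lemma app_one [simp]: "app 1 x = x" by transfer simp
lemma app_add: "app (f + g) x i = app f x i + app g x i" by transfer simp
lemma app_diff: "app (f - g) x i = app f x i - app g x i" by transfer simp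
lemma app_mult [simp]: "app (f * g) x = app f (app g x)" by transfer simp
lemma app_scale [simp]: "app (lop_scale c) x = (\<lambda>i. c * x i)" by transfer simp
lemma app_linear: "app f (\<lambda>i. x i + c * y i) = (\<lambda>i. app f x i + c * app f y i)" by transfer simp

lemma app_sum: "app (sum f A) x i = (\<Sum>a\<in>A. app (f a) x i)"
  by (induction A rule: infinite_finite_induct) (auto simp: app_add)

lemma app_zero_arg: "app f (\<lambda>_. 0) = (\<lambda>_. 0)"
  using app_linear[of f "\<lambda>_. 0" "- 1" "\<lambda>_. 0"] by (simp add: fun_eq_iff)

lemma app_arg_add: "app f (\<lambda>i. x i + y i) i = app f x i + app f y i"
  using app_linear[of f x 1 y] by (simp add: fun_eq_iff)

lemma app_arg_scale: "app f (\<lambda>i. c * x i) i = c * app f x i"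
  using app_linear[of f "\<lambda>_. 0" c x] by (simp add: app_zero_arg fun_eq_iff)

lemma app_arg_sum: "app f (\<lambda>i. \<Sum>a\<in>A. g a i) i = (\<Sum>a\<in>A. app f (g a) i)"
  by (induction A rule: infinite_finite_induct) (auto simp: app_zero_arg app_arg_add)

lemma lop_eqI: "(\<And>x i. app f x i = app g x i) \<Longrightarrow> f = g"
  by transfer (simp add: fun_eq_iff)

global_interpretation lop: rat_algebra lop_scale
proof
  fix c d :: rat and x :: "'a lop"
  show "lop_scale (c + d) = (lop_scale c + lop_scale d :: 'a lop)" by transfer (simp add: distrib_right)
  show "lop_scale (c * d) = (lop_scale c * lop_scale d :: 'a lop)" by transfer (simp add: mult.assoc)
  show "lop_scale 1 = (1 :: 'a lop)" by transfer simp
  show "lop_scale c * x = x * lop_scale c" by (rule lop_eqI) (simp add: app_arg_scale)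
qed

section \<open>The extended y-representation\<close>

context seed
begin

lemma lin_comb_add: "lin_comb b (x + y) = lin_comb b x + lin_comb b y"
  by (simp add: lin_comb_def vector_sadd_rdistrib sum.distrib)

lemma lin_comb_scale: "lin_comb b (k *s x) = k *s lin_comb b x"
  by (simp add: lin_comb_def vec_eq_iff sum_distrib_left mult.assoc)

lemma lin_comb_coords [simp]: "lin_comb e (coords n) = n"
proof -
  have b: "bij (lin_comb e)" using seed_basis by (simp add: lattice_basis_def)
  then have "\<exists>!a. lin_comb e a = n" by (metis bij_pointE)
  then show ?thesis unfolding coords_def by (rule theI')
qed

lemma coords_eqI: "lin_comb e a = n \<Longrightarrow> coords n = a"
proof -
  assume "lin_comb e a = n"
  then have "lin_comb e (coords n) = lin_comb e a" by (simp only: lin_comb_coords)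
  moreover have "inj (lin_comb e)" using seed_basis by (simp add: lattice_basis_def bij_betw_def)
  ultimately show ?thesis by (simp add: inj_eq del: lin_comb_coords)
qed

lemma coords_add: "coords (m + n) = coords m + coords n"
  by (rule coords_eqI) (simp add: lin_comb_add)

lemma coords_scale: "coords (k *s n) = k *s coords n"
  by (rule coords_eqI) (simp add: lin_comb_scale)

lemma coords_0 [simp]: "coords 0 = 0"
  using coords_add[of 0 0] by simp

lemma coords_eq_0_iff: "coords n = 0 \<longleftrightarrow> n = 0"
proof
  assume "coords n = 0"
  then have "coords n = coords 0" by simp
  then have "lin_comb e (coords n) = lin_comb e (coords 0)" by (rule arg_cong)
  then show "n = 0" by (simp only: lin_comb_coords)
qed simp

lemma deg_add: "deg (m + n) = deg m + deg n"
  by (simp add: deg_def coords_add sum.distrib)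

lemma deg_scale: "deg (k *s n) = k * deg n"
  by (simp add: deg_def coords_scale sum_distrib_left)

lemma deg_0 [simp]: "deg 0 = 0"
  by (simp add: deg_def)

lemma Npos_deg: "n \<in> Npos \<Longrightarrow> deg n \<ge> 1"
  by (simp add: Npos_def deg_def)

lemma Qmon_iff: "n \<in> Qmon \<longleftrightarrow> (\<forall>i. coords n $ i \<ge> 0)"
proof
  assume a: "\<forall>i. coords n $ i \<ge> 0"
  show "n \<in> Qmon"
  proof (cases "n \<in> Npos")
    case False
    then have "(\<Sum>i\<in>UNIV. coords n $ i) = 0"
      using a sum_nonneg[of UNIV "\<lambda>i. coords n $ i"] by (auto simp: Npos_def)
    then have "coords n = 0" using a by (simp add: sum_nonneg_eq_0_iff vec_eq_iff)
    then show ?thesis by (simp add: Qmon_def coords_eq_0_iff)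
  qed (simp add: Qmon_def)
qed (auto simp: Qmon_def Npos_def)

lemma Npos_iff: "n \<in> Npos \<longleftrightarrow> n \<in> Qmon \<and> deg n > 0"
  by (simp add: Qmon_iff) (simp add: Npos_def deg_def)

lemma Qmon_deg: "n \<in> Qmon \<Longrightarrow> deg n \<ge> 0"
  by (simp add: Qmon_iff deg_def sum_nonneg)

lemma Npos_Qmon: "n \<in> Npos \<Longrightarrow> n \<in> Qmon"
  by (simp add: Npos_iff)

lemma Qmon_0 [simp]: "0 \<in> Qmon"
  by (simp add: Qmon_def)

lemma Qmon_add: "m \<in> Qmon \<Longrightarrow> n \<in> Qmon \<Longrightarrow> m + n \<in> Qmon"
  by (simp add: Qmon_iff coords_add)

lemma Npos_add_Qmon: "m \<in> Npos \<Longrightarrow> n \<in> Qmon \<Longrightarrow> m + n \<in> Npos"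
  using Qmon_deg[of n] by (auto simp: Npos_iff Qmon_add deg_add)

lemma Qmon_deg_0: "n \<in> Qmon \<Longrightarrow> deg n \<le> 0 \<Longrightarrow> n = 0"
  by (simp add: Qmon_def) (metis Npos_deg not_one_le_zero order_trans)

lemma form_add2: "form m (n + n') = form m n + form m n'"
  using form_add[of n n' m] form_skew[of m "n + n'"] form_skew[of m n] form_skew[of m n'] by simp

lemma form_0 [simp]: "form 0 m = 0" "form m 0 = 0"
  using form_add[of 0 0 m] form_add2[of m 0 0] by simp_all

lemma form_self [simp]: "form n n = 0"
  using form_skew[of n n] by simp

lemma form_scale: "form (k *s n) m = of_int k * form n m"
proof -
  have nat: "form (int j *s n) m = of_nat j * form n m" for j
    by (induction j) (simp_all add: vector_sadd_rdistrib form_add algebra_simps)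
  have neg: "form (- n) m = - form n m" for n
    using form_add[of n "- n" m] by simp
  show ?thesis
  proof (cases "k \<ge> 0")
    case True
    then show ?thesis using nat[of "nat k"] by simp
  next
    case False
    then show ?thesis using nat[of "nat (- k)"] neg[of "k *s n"]
      by (simp flip: vector_smult_lneg)
  qed
qed

lemma form_scale2: "form m (k *s n) = of_int k * form m n"
  using form_scale[of k n m] form_skew[of m "k *s n"] form_skew[of m n] by simp

lemma form_sum2: "form m (sum f A) = (\<Sum>x\<in>A. form m (f x))"
  by (induction A rule: infinite_finite_induct) (simp_all add: form_add2)

lemma form_coords: "(\<Sum>i\<in>UNIV. form m (e i) * of_int (coords n $ i)) = form m n"
proof -
  have "form m n = form m (\<Sum>i\<in>UNIV. coords n $ i *s e i)"
    using lin_comb_coords[of n] by (simp add: lin_comb_def)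
  then show ?thesis by (simp add: form_sum2 form_scale2 mult.commute)
qed

text \<open>Seed coordinates embed the summands of n into the finite box between 0 and the
  coordinates of n.\<close>

lemma finite_below: "finite {a \<in> Qmon. \<exists>c\<in>Qmon. a + c = n}"
proof -
  have "coords a \<in> vec_lambda ` (PiE UNIV (\<lambda>i. {0..coords n $ i}))" if "a \<in> Qmon" "c \<in> Qmon" "a + c = n" for a c
  proof -
    have "coords n = coords a + coords c" using that(3) by (simp flip: coords_add)
    then have "vec_nth (coords a) \<in> PiE UNIV (\<lambda>i. {0..coords n $ i})"
      using that by (auto simp: Qmon_iff)
    then have "vec_lambda (vec_nth (coords a)) \<in> vec_lambda ` (PiE UNIV (\<lambda>i. {0..coords n $ i}))" by (rule imageI)
    then show ?thesis by simp
  qed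
  then have "coords ` {a \<in> Qmon. \<exists>c\<in>Qmon. a + c = n} \<subseteq> vec_lambda ` (PiE UNIV (\<lambda>i. {0..coords n $ i}))" by auto
  then have "finite (coords ` {a \<in> Qmon. \<exists>c\<in>Qmon. a + c = n})"
    by (rule finite_subset) (intro finite_imageI finite_PiE, auto)
  moreover have "inj_on coords A" for A by (rule inj_on_inverseI[of _ "lin_comb e"]) simp
  ultimately show ?thesis using finite_imageD by blast
qed

lemma finite_splits: "finite {(a, c). a \<in> Qmon \<and> c \<in> Qmon \<and> a + c = n}"
proof (rule finite_subset)
  show "{(a, c). a \<in> Qmon \<and> c \<in> Qmon \<and> a + c = n} \<subseteq> (\<lambda>a. (a, n - a)) ` {a \<in> Qmon. \<exists>c\<in>Qmon. a + c = n}"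
    by (auto simp: image_iff)
qed (simp add: finite_below)

lemma finite_splits_Npos:
  "finite {(a, c). a \<in> Npos \<and> c \<in> Qmon \<and> a + c = n}"
  "finite {(a, c). a \<in> Npos \<and> c \<in> Npos \<and> a + c = n}"
  by (rule finite_subset[OF _ finite_splits[of n]], auto simp: Npos_iff)+

text \<open>Both ways of grouping a triple a + b + c = n are needed: this one for a product of two
  operators, the next one for the operator of a bracket.\<close>

lemma sum_splits_right:
  "(\<Sum>(a, d)\<in>{(a, d). a \<in> Npos \<and> d \<in> Qmon \<and> a + d = n}. \<Sum>(b, c)\<in>{(b, c). b \<in> Npos \<and> c \<in> Qmon \<and> b + c = d}. F a b c)
    = (\<Sum>(a, b, c)\<in>{(a, b, c). a \<in> Npos \<and> b \<in> Npos \<and> c \<in> Qmon \<and> a + b + c = n}. F a b c)"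
proof -
  let ?A = "{(a, d). a \<in> Npos \<and> d \<in> Qmon \<and> a + d = n}"
  let ?B = "\<lambda>p. {(b, c). b \<in> Npos \<and> c \<in> Qmon \<and> b + c = snd p}"
  have "(\<Sum>(a, d)\<in>?A. \<Sum>(b, c)\<in>{(b, c). b \<in> Npos \<and> c \<in> Qmon \<and> b + c = d}. F a b c)
      = (\<Sum>p\<in>?A. \<Sum>r\<in>?B p. F (fst p) (fst r) (snd r))"
    by (simp add: case_prod_unfold)
  also have "\<dots> = (\<Sum>(p, r)\<in>Sigma ?A ?B. F (fst p) (fst r) (snd r))"
    by (rule sum.Sigma) (auto simp: finite_splits_Npos)
  also have "\<dots> = (\<Sum>(a, b, c)\<in>{(a, b, c). a \<in> Npos \<and> b \<in> Npos \<and> c \<in> Qmon \<and> a + b + c = n}. F a b c)"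
    by (rule sum.reindex_bij_witness[of _ "\<lambda>(a, b, c). ((a, b + c), (b, c))" "\<lambda>((a, d), (b, c)). (a, b, c)"])
       (auto simp: Npos_iff Qmon_add deg_add add.assoc)
  finally show ?thesis .
qed

lemma sum_splits_left:
  "(\<Sum>(m, c)\<in>{(m, c). m \<in> Npos \<and> c \<in> Qmon \<and> m + c = n}. \<Sum>(a, b)\<in>{(a, b). a \<in> Npos \<and> b \<in> Npos \<and> a + b = m}. F a b c)
    = (\<Sum>(a, b, c)\<in>{(a, b, c). a \<in> Npos \<and> b \<in> Npos \<and> c \<in> Qmon \<and> a + b + c = n}. F a b c)"
proof -
  let ?A = "{(m, c). m \<in> Npos \<and> c \<in> Qmon \<and> m + c = n}"
  let ?B = "\<lambda>p. {(a, b). a \<in> Npos \<and> b \<in> Npos \<and> a + b = fst p}"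
  have "(\<Sum>(m, c)\<in>?A. \<Sum>(a, b)\<in>{(a, b). a \<in> Npos \<and> b \<in> Npos \<and> a + b = m}. F a b c)
      = (\<Sum>p\<in>?A. \<Sum>r\<in>?B p. F (fst r) (snd r) (snd p))"
    by (simp add: case_prod_unfold)
  also have "\<dots> = (\<Sum>(p, r)\<in>Sigma ?A ?B. F (fst r) (snd r) (snd p))"
    by (rule sum.Sigma) (auto simp: finite_splits_Npos)
  also have "\<dots> = (\<Sum>(a, b, c)\<in>{(a, b, c). a \<in> Npos \<and> b \<in> Npos \<and> c \<in> Qmon \<and> a + b + c = n}. F a b c)"
    by (rule sum.reindex_bij_witness[of _ "\<lambda>(a, b, c). ((a + b, c), (a, b))" "\<lambda>((m, c), (a, b)). (a, b, c)"])
       (auto simp: Npos_add_Qmon Npos_Qmon)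
  finally show ?thesis .
qed

text \<open>
  A vector \<open>\<Sum>\<^sub>c y\<^sup>c b\<^sub>c\<close> of the extended representation is a function of \<open>(c, \<kappa>)\<close>, where the
  symbols are \<open>None \<mapsto> v\<close>, \<open>Some None \<mapsto> 1\<close> and \<open>Some (Some i) \<mapsto> log y\<^sub>i\<close>;
  \<open>fib a c\<close> is the action of \<open>X\<^sub>a\<close> on \<open>y\<^sup>c\<close> times the span of the symbols, with
  \<open>X\<^sub>a (log y\<^sub>i) = {a, e\<^sub>i} y\<^sup>a\<close> and \<open>X\<^sub>a v = y\<^sup>a (1 - 1/2 log y\<^sup>a)\<close>.
\<close>

definition fib :: "int^'r \<Rightarrow> int^'r \<Rightarrow> ('r option option \<Rightarrow> rat) \<Rightarrow> 'r option option \<Rightarrow> rat" where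
  "fib a c f \<kappa> = form a c * f \<kappa> + (case \<kappa> of
      None \<Rightarrow> 0
    | Some None \<Rightarrow> f None + (\<Sum>i\<in>UNIV. form a (e i) * f (Some (Some i)))
    | Some (Some i) \<Rightarrow> - (1 / 2) * of_int (coords a $ i) * f None)"

lemma fib_linear: "fib a c (\<lambda>\<kappa>. f \<kappa> + k * g \<kappa>) \<kappa> = fib a c f \<kappa> + k * fib a c g \<kappa>"
  by (auto simp: fib_def algebra_simps sum.distrib sum_distrib_left split: option.split)

lemma fib_0: "fib a c (\<lambda>_. 0) \<kappa> = 0"
  using fib_linear[of a c "\<lambda>_. 0" "- 1" "\<lambda>_. 0"] by simp

lemma fib_scale: "fib a c (\<lambda>\<kappa>. k * g \<kappa>) \<kappa> = k * fib a c g \<kappa>"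
  using fib_linear[of a c "\<lambda>_. 0" k g] by (simp add: fib_0)

lemma fib_sum: "fib a c (\<lambda>\<kappa>. \<Sum>x\<in>A. g x \<kappa>) \<kappa> = (\<Sum>x\<in>A. fib a c (g x) \<kappa>)"
proof (induction A rule: infinite_finite_induct)
  case (insert x A)
  then show ?case using fib_linear[of a c "g x" 1 "\<lambda>\<kappa>. \<Sum>x\<in>A. g x \<kappa>"] by simp
qed (simp_all add: fib_0)

text \<open>The bracket relation on y^c times each symbol. Only the symbol 1 is delicate:
  differentiating the logarithms in X_b v gives sum_i {a, e_i} b_i = {a,b}, with weight -1/2, and
  the two orders together reduce twice {a,b} to {a,b}.\<close>

lemma fib_commutator:
  "fib a (b + c) (fib b c f) \<kappa> - fib b (a + c) (fib a c f) \<kappa> = form a b * fib (a + b) c f \<kappa>"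
proof -
  have s: "(\<Sum>i\<in>UNIV. form a (e i) * (form b c * f (Some (Some i)) - (of_int (coords b $ i) * f None) / 2))
      = form b c * (\<Sum>i\<in>UNIV. form a (e i) * f (Some (Some i))) - form a b * f None / 2" for a b
  proof -
    have "(\<Sum>i\<in>UNIV. form a (e i) * (form b c * f (Some (Some i)) - (of_int (coords b $ i) * f None) / 2))
      = (\<Sum>i\<in>UNIV. form b c * (form a (e i) * f (Some (Some i))) - (f None / 2) * (form a (e i) * of_int (coords b $ i)))"
      by (intro sum.cong refl) (simp add: algebra_simps)
    also have "\<dots> = form b c * (\<Sum>i\<in>UNIV. form a (e i) * f (Some (Some i))) - (f None / 2) * form a b"
      by (simp only: sum_subtractf sum_distrib_left[symmetric] form_coords)
    finally show ?thesis by simp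
  qed
  have ba: "form b a = - form a b" by (rule form_skew)
  have ab: "(\<Sum>i\<in>UNIV. form (a + b) (e i) * f (Some (Some i)))
      = (\<Sum>i\<in>UNIV. form a (e i) * f (Some (Some i))) + (\<Sum>i\<in>UNIV. form b (e i) * f (Some (Some i)))"
    by (simp add: form_add distrib_right sum.distrib)
  show ?thesis
  proof (cases \<kappa>)
    case None
    then show ?thesis by (simp add: fib_def form_add form_add2 ba algebra_simps)
  next
    case (Some k)
    show ?thesis
    proof (cases k)
      case None
      then show ?thesis
        by (simp add: fib_def Some s ab) (simp add: form_add form_add2 ba algebra_simps)
    next
      case (Some i)
      then show ?thesis
        by (simp add: fib_def \<open>\<kappa> = Some k\<close> form_add form_add2 ba coords_add add_divide_distrib diff_divide_distrib algebra_simps)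
    qed
  qed
qed

text \<open>
  Truncation in degree l makes the operators nilpotent, so that finite exponential sums suffice.
\<close>

definition rho :: "nat \<Rightarrow> (int^'r \<Rightarrow> rat) \<Rightarrow> ((int^'r) \<times> 'r option option) lop" where
  "rho l x = Lop (\<lambda>b (n, \<kappa>). if deg n \<le> int l
     then \<Sum>(a, c)\<in>{(a, c). a \<in> Npos \<and> c \<in> Qmon \<and> a + c = n}. x a * fib a c (\<lambda>\<kappa>. b (c, \<kappa>)) \<kappa> else 0)"

lemma app_rho: "app (rho l x) b (n, \<kappa>) = (if deg n \<le> int l
     then \<Sum>(a, c)\<in>{(a, c). a \<in> Npos \<and> c \<in> Qmon \<and> a + c = n}. x a * fib a c (\<lambda>\<kappa>. b (c, \<kappa>)) \<kappa> else 0)"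
  unfolding rho_def
  by (subst Lop_inverse)
     (auto simp: fun_eq_iff fib_linear algebra_simps sum.distrib sum_distrib_left case_prod_unfold)

lemma rho_add: "rho l (\<lambda>n. x n + y n) = rho l x + rho l y"
  by (rule lop_eqI) (auto simp: app_rho app_add algebra_simps sum.distrib case_prod_unfold)

lemma rho_scale: "rho l (\<lambda>n. k * x n) = lop_scale k * rho l x"
  by (rule lop_eqI) (auto simp: app_rho algebra_simps sum_distrib_left case_prod_unfold)

lemma rho_0: "rho l (\<lambda>n. 0) = 0"
  using rho_scale[of l 0 "\<lambda>_. 0"] by (simp add: lop.q_0)

lemma rho_sum: "rho l (\<lambda>n. \<Sum>p\<in>A. f p n) = (\<Sum>p\<in>A. rho l (f p))"
  by (induction A rule: infinite_finite_induct) (simp_all add: rho_0 rho_add)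

lemma rho_cong:
  assumes "\<And>n. n \<in> Npos \<Longrightarrow> deg n \<le> int l \<Longrightarrow> x n = y n"
  shows "rho l x = rho l y"
proof (rule lop_eqI)
  fix b :: "(int^'r) \<times> 'r option option \<Rightarrow> rat" and p :: "(int^'r) \<times> 'r option option"
  obtain n \<kappa> where p: "p = (n, \<kappa>)" by force
  have "x a = y a" if "a \<in> Npos" "c \<in> Qmon" "a + c = n" "deg n \<le> int l" for a c
    using that Qmon_deg[of c] by (intro assms) (auto simp: deg_add)
  then show "app (rho l x) b p = app (rho l y) b p"
    unfolding p app_rho by (auto intro!: sum.cong)
qed

lemma app_rho_rho: "app (rho l x * rho l y) b (n, \<kappa>) = (if deg n \<le> int l then
    \<Sum>(a, a', c)\<in>{(a, a', c). a \<in> Npos \<and> a' \<in> Npos \<and> c \<in> Qmon \<and> a + a' + c = n}.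
      x a * y a' * fib a (a' + c) (fib a' c (\<lambda>\<kappa>. b (c, \<kappa>))) \<kappa> else 0)"
proof (cases "deg n \<le> int l")
  case True
  have "app (rho l x * rho l y) b (n, \<kappa>)
      = (\<Sum>(a, d)\<in>{(a, d). a \<in> Npos \<and> d \<in> Qmon \<and> a + d = n}.
          \<Sum>(a', c)\<in>{(a', c). a' \<in> Npos \<and> c \<in> Qmon \<and> a' + c = d}.
            x a * y a' * fib a (a' + c) (fib a' c (\<lambda>\<kappa>. b (c, \<kappa>))) \<kappa>)"
    unfolding app_mult app_rho[of l x] if_P[OF True]
  proof (intro sum.cong refl, clarify)
    fix a d assume a: "a \<in> Npos" "d \<in> Qmon" and n: "n = a + d"
    have d: "deg d \<le> int l" using True Npos_deg[OF a(1)] n by (simp add: deg_add)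
    have "fib a d (\<lambda>\<kappa>. app (rho l y) b (d, \<kappa>)) \<kappa>
        = (\<Sum>(a', c)\<in>{(a', c). a' \<in> Npos \<and> c \<in> Qmon \<and> a' + c = d}. y a' * fib a d (fib a' c (\<lambda>\<kappa>. b (c, \<kappa>))) \<kappa>)"
      unfolding app_rho if_P[OF d] case_prod_unfold fib_sum fib_scale ..
    then show "x a * fib a d (\<lambda>\<kappa>. app (rho l y) b (d, \<kappa>)) \<kappa> =
        (\<Sum>(a', c)\<in>{(a', c). a' \<in> Npos \<and> c \<in> Qmon \<and> a' + c = d}.
            x a * y a' * fib a (a' + c) (fib a' c (\<lambda>\<kappa>. b (c, \<kappa>))) \<kappa>)"
      by (auto simp: sum_distrib_left mult.assoc intro!: sum.cong)
  qed
  then show ?thesis unfolding sum_splits_right using True by simp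
qed (simp add: app_rho)

text \<open>Both products of operators become sums over triples; after renaming the triples of the
  second one, the difference is the commutator relation of \<open>fib\<close> term by term.\<close>

lemma rho_lie: "rho l (lie x y) = rho l x * rho l y - rho l y * rho l x"
proof (rule lop_eqI)
  fix b :: "(int^'r) \<times> 'r option option \<Rightarrow> rat" and p :: "(int^'r) \<times> 'r option option"
  obtain n \<kappa> where p: "p = (n, \<kappa>)" by force
  let ?b = "\<lambda>c \<kappa>. b (c, \<kappa>)"
  let ?T = "{(a, a', c). a \<in> Npos \<and> a' \<in> Npos \<and> c \<in> Qmon \<and> a + a' + c = n}"
  show "app (rho l (lie x y)) b p = app (rho l x * rho l y - rho l y * rho l x) b p"
  proof (cases "deg n \<le> int l")
    case True
    have "app (rho l (lie x y)) b p = (\<Sum>(m, c)\<in>{(m, c). m \<in> Npos \<and> c \<in> Qmon \<and> m + c = n}.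
        \<Sum>(a, a')\<in>{(a, a'). a \<in> Npos \<and> a' \<in> Npos \<and> a + a' = m}.
          x a * y a' * (form a a' * fib (a + a') c (?b c) \<kappa>))"
      unfolding p app_rho if_P[OF True]
      by (auto simp: lie_def sum_distrib_right mult.assoc intro!: sum.cong)
    also have "\<dots> = (\<Sum>(a, a', c)\<in>?T. x a * y a' * (form a a' * fib (a + a') c (?b c) \<kappa>))"
      by (rule sum_splits_left)
    also have "\<dots> = (\<Sum>(a, a', c)\<in>?T. x a * y a' * fib a (a' + c) (fib a' c (?b c)) \<kappa>)
        - (\<Sum>(a, a', c)\<in>?T. y a' * x a * fib a' (a + c) (fib a c (?b c)) \<kappa>)"
      unfolding sum_subtractf[symmetric] fib_commutator[symmetric]
      by (auto intro!: sum.cong simp: algebra_simps)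
    also have "(\<Sum>(a, a', c)\<in>?T. y a' * x a * fib a' (a + c) (fib a c (?b c)) \<kappa>)
        = (\<Sum>(a, a', c)\<in>?T. y a * x a' * fib a (a' + c) (fib a' c (?b c)) \<kappa>)"
      by (rule sum.reindex_bij_witness[of _ "\<lambda>(a, b, c). (b, a, c)" "\<lambda>(a, b, c). (b, a, c)"])
         (auto simp: add.commute)
    finally show ?thesis using True by (simp only: app_diff p app_rho_rho if_True)
  qed (simp only: p app_diff app_rho_rho, simp add: app_rho)
qed

text \<open>Outputs live on \<open>Qmon\<close> up to degree l and start at least m degrees later
  than the input. Inputs are tested only on \<open>Qmon\<close>, because coefficients elsewhere are
  never read.\<close>

definition filt :: "nat \<Rightarrow> nat \<Rightarrow> ((int^'r) \<times> 'r option option) lop set" where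
  "filt l m = {P. (\<forall>b n \<kappa>. app P b (n, \<kappa>) \<noteq> 0 \<longrightarrow> n \<in> Qmon \<and> deg n \<le> int l) \<and>
     (\<forall>b d. (\<forall>n \<kappa>. n \<in> Qmon \<and> deg n < d \<longrightarrow> b (n, \<kappa>) = 0) \<longrightarrow>
        (\<forall>n \<kappa>. deg n < d + int m \<longrightarrow> app P b (n, \<kappa>) = 0))}"

lemma filtI:
  assumes "\<And>b n \<kappa>. app P b (n, \<kappa>) \<noteq> 0 \<Longrightarrow> n \<in> Qmon \<and> deg n \<le> int l"
    and "\<And>b d n \<kappa>. (\<And>n \<kappa>. n \<in> Qmon \<Longrightarrow> deg n < d \<Longrightarrow> b (n, \<kappa>) = 0) \<Longrightarrow> deg n < d + int m \<Longrightarrow> app P b (n, \<kappa>) = 0"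
  shows "P \<in> filt l m"
  unfolding filt_def using assms by blast

lemma filtD1: "P \<in> filt l m \<Longrightarrow> app P b (n, \<kappa>) \<noteq> 0 \<Longrightarrow> n \<in> Qmon \<and> deg n \<le> int l"
  unfolding filt_def by blast

lemma filtD2:
  "P \<in> filt l m \<Longrightarrow> (\<And>n \<kappa>. n \<in> Qmon \<Longrightarrow> deg n < d \<Longrightarrow> b (n, \<kappa>) = 0) \<Longrightarrow> deg n < d + int m \<Longrightarrow> app P b (n, \<kappa>) = 0"
  unfolding filt_def by blast

lemma filtered_nilpotent_filt: "filtered_nilpotent lop_scale (filt l) l"
proof
  fix m k :: nat and c :: rat and x y :: "((int^'r) \<times> 'r option option) lop"
  show "0 \<in> filt l m" by (rule filtI) auto
  show "x + y \<in> filt l m" if "x \<in> filt l m" "y \<in> filt l m"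
  proof (rule filtI)
    fix b :: "(int^'r) \<times> 'r option option \<Rightarrow> rat" and n \<kappa> assume "app (x + y) b (n, \<kappa>) \<noteq> 0"
    then have "app x b (n, \<kappa>) \<noteq> 0 \<or> app y b (n, \<kappa>) \<noteq> 0" by (auto simp: app_add)
    then show "n \<in> Qmon \<and> deg n \<le> int l" using filtD1 that by blast
  next
    fix b :: "(int^'r) \<times> 'r option option \<Rightarrow> rat" and d n \<kappa>
    assume "\<And>n \<kappa>. n \<in> Qmon \<Longrightarrow> deg n < d \<Longrightarrow> b (n, \<kappa>) = 0" "deg n < d + int m"
    then show "app (x + y) b (n, \<kappa>) = 0" using filtD2[OF that(1), of d b n] filtD2[OF that(2), of d b n] by (simp add: app_add)
  qed
  show "lop_scale c * x \<in> filt l m" if "x \<in> filt l m"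
  proof (rule filtI)
    fix b :: "(int^'r) \<times> 'r option option \<Rightarrow> rat" and n \<kappa> assume "app (lop_scale c * x) b (n, \<kappa>) \<noteq> 0"
    then show "n \<in> Qmon \<and> deg n \<le> int l" using filtD1[OF that, of b n \<kappa>] by auto
  next
    fix b :: "(int^'r) \<times> 'r option option \<Rightarrow> rat" and d n \<kappa>
    assume "\<And>n \<kappa>. n \<in> Qmon \<Longrightarrow> deg n < d \<Longrightarrow> b (n, \<kappa>) = 0" "deg n < d + int m"
    then show "app (lop_scale c * x) b (n, \<kappa>) = 0" using filtD2[OF that, of d b n] by simp
  qed
  show "x * y \<in> filt l (m + k)" if "x \<in> filt l m" "y \<in> filt l k"
  proof (rule filtI)
    fix b :: "(int^'r) \<times> 'r option option \<Rightarrow> rat" and n \<kappa> assume "app (x * y) b (n, \<kappa>) \<noteq> 0"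
    then show "n \<in> Qmon \<and> deg n \<le> int l" using filtD1[OF that(1)] by auto
  next
    fix b :: "(int^'r) \<times> 'r option option \<Rightarrow> rat" and d n \<kappa>
    assume "\<And>n \<kappa>. n \<in> Qmon \<Longrightarrow> deg n < d \<Longrightarrow> b (n, \<kappa>) = 0" "deg n < d + int (m + k)"
    then show "app (x * y) b (n, \<kappa>) = 0"
      using filtD2[OF that(2), of d b] filtD2[OF that(1), of "d + int k" "app y b" n] by simp
  qed
  show "x = 0" if "l < m" "x \<in> filt l m"
  proof (rule lop_eqI)
    fix b :: "(int^'r) \<times> 'r option option \<Rightarrow> rat" and p :: "(int^'r) \<times> 'r option option"
    obtain n \<kappa> where p: "p = (n, \<kappa>)" by force
    show "app x b p = app 0 b p"
    proof (rule ccontr)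
      assume "app x b p \<noteq> app 0 b p"
      then have nz: "app x b (n, \<kappa>) \<noteq> 0" by (simp add: p)
      then have "deg n \<le> int l" using filtD1[OF that(2)] by blast
      moreover have "n \<in> Qmon \<Longrightarrow> deg n < 0 \<Longrightarrow> b (n, \<kappa>) = 0" for n \<kappa> using Qmon_deg[of n] by simp
      ultimately show False using filtD2[OF that(2), of 0 b n \<kappa>] nz that(1) by simp
    qed
  qed
qed

lemma rho_filt: "rho l x \<in> filt l 1"
proof (rule filtI)
  fix b n \<kappa> assume nz: "app (rho l x) b (n, \<kappa>) \<noteq> 0"
  then have l: "deg n \<le> int l" by (auto simp: app_rho split: if_splits)
  obtain p where "p \<in> {(a, c). a \<in> Npos \<and> c \<in> Qmon \<and> a + c = n}"
    using nz unfolding app_rho if_P[OF l] by (rule sum.not_neutral_contains_not_neutral)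
  then show "n \<in> Qmon \<and> deg n \<le> int l"
    using l by (auto simp: Npos_Qmon Npos_add_Qmon)
next
  fix b :: "(int^'r) \<times> 'r option option \<Rightarrow> rat" and d n \<kappa>
  assume b: "\<And>n \<kappa>. n \<in> Qmon \<Longrightarrow> deg n < d \<Longrightarrow> b (n, \<kappa>) = (0::rat)" "deg n < d + int 1"
  have "x a * fib a c (\<lambda>\<kappa>. b (c, \<kappa>)) \<kappa> = 0" if "a \<in> Npos" "c \<in> Qmon" "a + c = n" for a c
  proof -
    have "deg c < d" using that b(2) Npos_deg[of a] by (auto simp: deg_add)
    then have "(\<lambda>\<kappa>. b (c, \<kappa>)) = (\<lambda>_. 0)" using b(1) that by auto
    then show ?thesis by (simp add: fib_0)
  qed
  then show "app (rho l x) b (n, \<kappa>) = 0" by (auto simp: app_rho intro!: sum.neutral)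
qed

definition gexp :: "nat \<Rightarrow> (int^'r \<Rightarrow> rat) \<Rightarrow> ((int^'r) \<times> 'r option option) lop" where
  "gexp l x = (\<Sum>k\<le>l. lop_scale (1 / fact k) * rho l x ^ k)"

section \<open>The group product as composition of operators\<close>

lemma nested_lie_deg:
  "set ws \<subseteq> ghat \<Longrightarrow> ws \<noteq> [] \<Longrightarrow> nested_lie ws n \<noteq> 0 \<Longrightarrow> n \<in> Npos \<and> deg n \<ge> int (length ws)"
proof (induction ws arbitrary: n rule: nested_lie.induct)
  case (2 x)
  then have "n \<in> Npos" by (auto simp: ghat_def)
  then show ?case using Npos_deg by simp
next
  case (3 x y zs)
  have "lie x (nested_lie (y # zs)) n \<noteq> 0" using 3 by simp
  then obtain a c where ac: "a \<in> Npos" "c \<in> Npos" "a + c = n" "nested_lie (y # zs) c \<noteq> 0"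
    unfolding lie_def by (auto elim!: sum.not_neutral_contains_not_neutral)
  then have "deg c \<ge> int (length (y # zs))" using 3 by auto
  then show ?case using ac Npos_deg[of a] Npos_add_Qmon[of a c] by (auto simp: deg_add Npos_Qmon)
qed simp

lemma rho_nested_lie: "rho l (nested_lie ws) = lop.nested_ad (map (rho l) ws)"
  by (induction ws rule: nested_lie.induct) (simp_all add: rho_0 rho_lie lop.ad_def)

definition word_lists :: "nat \<Rightarrow> (nat \<times> nat) list set" where
  "word_lists l = {ps. ps \<noteq> [] \<and> (\<forall>(p, q)\<in>set ps. p + q > 0) \<and> (\<Sum>(p, q)\<leftarrow>ps. p + q) \<le> l}"

lemma word_lists_eq: "word_lists l = (\<Union>m\<in>{..l}. \<Union>k\<in>{1..m}. lop.exponent_lists k m)"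
proof
  show "word_lists l \<subseteq> (\<Union>m\<in>{..l}. \<Union>k\<in>{1..m}. lop.exponent_lists k m)"
  proof
    fix ps assume ps: "ps \<in> word_lists l"
    then have "length ps \<le> (\<Sum>(p, q)\<leftarrow>ps. p + q)" "length ps \<ge> 1"
      by (auto simp: word_lists_def Suc_le_eq intro!: lop.length_le_exponents)
    then show "ps \<in> (\<Union>m\<in>{..l}. \<Union>k\<in>{1..m}. lop.exponent_lists k m)"
      using ps by (auto simp: word_lists_def lop.exponent_lists_def)
  qed
qed (auto simp: word_lists_def lop.exponent_lists_def)

lemma finite_word_lists: "finite (word_lists l)"
  unfolding word_lists_eq by (intro finite_UN_I finite_atMost finite_atLeastAtMost lop.finite_exponent_lists)

lemma sum_word_lists: "sum F (word_lists l) = (\<Sum>m\<le>l. \<Sum>k=1..m. sum F (lop.exponent_lists k m))"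
proof -
  have "sum F (word_lists l) = (\<Sum>m\<le>l. sum F (\<Union>k\<in>{1..m}. lop.exponent_lists k m))"
    unfolding word_lists_eq
    by (rule sum.UNION_disjoint) (simp_all add: lop.finite_exponent_lists, auto simp: lop.exponent_lists_def)
  also have "\<dots> = (\<Sum>m\<le>l. \<Sum>k=1..m. sum F (lop.exponent_lists k m))"
    by (rule sum.cong[OF refl], rule sum.UNION_disjoint) (simp_all add: lop.finite_exponent_lists, auto simp: lop.exponent_lists_def)
  finally show ?thesis .
qed

definition dynkin_coeff :: "(nat \<times> nat) list \<Rightarrow> rat" where
  "dynkin_coeff ps = (-1) ^ (length ps - 1) / of_nat (length ps)
       / (of_nat (\<Sum>(p, q) \<leftarrow> ps. p + q) * (\<Prod>(p, q) \<leftarrow> ps. fact p * fact q))"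

lemma gmult_eq: "gmult x y n = (\<Sum>ps\<in>word_lists (nat (deg n)). dynkin_coeff ps * nested_lie (lop.xy_word x y ps) n)"
  unfolding gmult_def word_lists_def dynkin_coeff_def lop.xy_word_def ..

lemma nested_lie_word_eq_0:
  assumes xy: "x \<in> ghat" "y \<in> ghat" and ps: "ps \<in> word_lists l" "ps \<notin> word_lists (nat (deg n))"
  shows "nested_lie (lop.xy_word x y ps) n = 0"
proof (rule ccontr)
  assume "nested_lie (lop.xy_word x y ps) n \<noteq> 0"
  moreover have "set (lop.xy_word x y ps) \<subseteq> ghat" using xy lop.set_xy_word[of x y ps] by auto
  moreover have "length (lop.xy_word x y ps) = (\<Sum>(p, q)\<leftarrow>ps. p + q)"
    by (rule lop.length_xy_word)
  moreover have "lop.xy_word x y ps \<noteq> []"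
    using ps(1) by (cases ps) (auto simp: word_lists_def lop.xy_word_def)
  ultimately have "int (\<Sum>(p, q)\<leftarrow>ps. p + q) \<le> deg n" using nested_lie_deg by metis
  then have "(\<Sum>(p, q)\<leftarrow>ps. p + q) \<le> nat (deg n)" by linarith
  then show False using ps by (auto simp: word_lists_def)
qed

text \<open>The cut-off in \<open>gmult\<close> varies with n. As long brackets vanish at n anyway,
  one cut-off l serves all n up to degree l, and \<open>rho\<close> can be applied to a single
  finite sum.\<close>

lemma gmult_eq_le:
  assumes xy: "x \<in> ghat" "y \<in> ghat" and "deg n \<le> int l"
  shows "gmult x y n = (\<Sum>ps\<in>word_lists l. dynkin_coeff ps * nested_lie (lop.xy_word x y ps) n)"
  unfolding gmult_eq
proof (rule sum.mono_neutral_left)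
  show "word_lists (nat (deg n)) \<subseteq> word_lists l"
    using assms(3) by (auto simp: word_lists_def)
  show "\<forall>ps\<in>word_lists l - word_lists (nat (deg n)). dynkin_coeff ps * nested_lie (lop.xy_word x y ps) n = 0"
    using nested_lie_word_eq_0[OF xy] by auto
qed (rule finite_word_lists)

lemma ghat_gmult:
  assumes xy: "x \<in> ghat" "y \<in> ghat" shows "gmult x y \<in> ghat"
proof -
  have "nested_lie (lop.xy_word x y ps) n = 0" if "n \<notin> Npos" "ps \<in> word_lists l" for ps n l
  proof (rule ccontr)
    assume "nested_lie (lop.xy_word x y ps) n \<noteq> 0"
    moreover have "set (lop.xy_word x y ps) \<subseteq> ghat" using xy lop.set_xy_word[of x y ps] by auto
    moreover have "lop.xy_word x y ps \<noteq> []"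
      using that by (cases ps) (auto simp: word_lists_def lop.xy_word_def)
    ultimately show False using that nested_lie_deg by blast
  qed
  then show ?thesis unfolding ghat_def gmult_eq by (auto intro!: sum.neutral)
qed

lemma rho_gmult:
  assumes xy: "x \<in> ghat" "y \<in> ghat"
  shows "rho l (gmult x y) = (\<Sum>m\<le>l. fps_nth (lop.dynkin_series (rho l x) (rho l y)) m)"
proof -
  have "rho l (gmult x y) = rho l (\<lambda>n. \<Sum>ps\<in>word_lists l. dynkin_coeff ps * nested_lie (lop.xy_word x y ps) n)"
    by (rule rho_cong) (simp add: gmult_eq_le xy)
  also have "\<dots> = (\<Sum>ps\<in>word_lists l. lop_scale (dynkin_coeff ps) * lop.nested_ad (lop.xy_word (rho l x) (rho l y) ps))"
    by (simp add: rho_sum rho_scale rho_nested_lie lop.map_xy_word)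
  also have "\<dots> = (\<Sum>m\<le>l. fps_nth (lop.dynkin_series (rho l x) (rho l y)) m)"
    unfolding sum_word_lists lop.dynkin_series_def lop.dynkin_sum_def fps_nth_Abs_fps sum_distrib_left lop.q_assoc
    by (intro sum.cong refl)
       (auto simp: lop.exponent_lists_def dynkin_coeff_def lop.fact_prod_def mult.assoc[symmetric] mult.commute
          simp flip: lop.q_mult intro!: arg_cong2[where f = "(*)"])
  finally show ?thesis .
qed

text \<open>The representation integrates to the group modulo degree > l: \<open>rho\<close> maps
  the product to the evaluated Dynkin series of the two operators, whose exponential is the product
  of exponentials.\<close>

lemma gexp_gmult:
  assumes xy: "x \<in> ghat" "y \<in> ghat"
  shows "gexp l (gmult x y) = gexp l x * gexp l y"
proof -
  interpret filtered_nilpotent lop_scale "filt l" l by (rule filtered_nilpotent_filt)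
  show ?thesis
    using nexp_dynkin_series[OF rho_filt rho_filt, of x y] unfolding nexp_def gexp_def rho_gmult[OF xy] .
qed

lemma lie_0: "lie (\<lambda>_. 0) x = (\<lambda>_. 0)" "lie x (\<lambda>_. 0) = (\<lambda>_. 0)"
  by (simp_all add: lie_def fun_eq_iff)

lemma nested_lie_commuting:
  assumes "\<And>u v. u \<in> S \<Longrightarrow> v \<in> S \<Longrightarrow> lie u v = (\<lambda>_. 0)"
  shows "set ws \<subseteq> S \<Longrightarrow> length ws \<ge> 2 \<Longrightarrow> nested_lie ws = (\<lambda>_. 0)"
proof (induction ws rule: nested_lie.induct)
  case (3 x y zs)
  show ?case
  proof (cases zs)
    case Nil
    then show ?thesis using 3 assms by simp
  next
    case (Cons z zs')
    then have "nested_lie (y # zs) = (\<lambda>_. 0)" using 3 by simp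
    then show ?thesis by (simp add: lie_0)
  qed
qed simp_all

text \<open>Every bracket of at least two letters vanishes, which leaves the one-letter words
  \<open>[(1, 0)]\<close> and \<open>[(0, 1)]\<close>, both with coefficient 1.\<close>

lemma gmult_commuting:
  assumes xy: "x \<in> ghat" "y \<in> ghat"
    and comm: "\<And>u v. u \<in> {x, y} \<Longrightarrow> v \<in> {x, y} \<Longrightarrow> lie u v = (\<lambda>_. 0)"
  shows "gmult x y = (\<lambda>n. x n + y n)"
proof
  fix n
  show "gmult x y n = x n + y n"
  proof (cases "deg n \<ge> 1")
    case False
    then have "n \<notin> Npos" using Npos_deg by auto
    then show ?thesis using xy ghat_gmult[OF xy] by (simp add: ghat_def)
  next
    case True
    have "gmult x y n = (\<Sum>ps\<in>{[(1, 0)], [(0, 1)]}. dynkin_coeff ps * nested_lie (lop.xy_word x y ps) n)"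
      unfolding gmult_eq
    proof (rule sum.mono_neutral_right)
      show "{[(1, 0)], [(0, 1)]} \<subseteq> word_lists (nat (deg n))"
        using True by (auto simp: word_lists_def)
      show "\<forall>ps\<in>word_lists (nat (deg n)) - {[(1, 0)], [(0, 1)]}.
          dynkin_coeff ps * nested_lie (lop.xy_word x y ps) n = 0"
      proof
        fix ps assume ps: "ps \<in> word_lists (nat (deg n)) - {[(1, 0)], [(0, 1)]}"
        then obtain i j rs where 1: "ps = (i, j) # rs" "i + j > 0" "\<forall>(p, q)\<in>set rs. 0 < p + q"
          by (cases ps) (auto simp: word_lists_def)
        have "2 \<le> (\<Sum>(p, q)\<leftarrow>ps. p + q)"
        proof (cases rs)
          case Nil
          then show ?thesis using 1 ps by (cases i; cases j; auto)
        next
          case (Cons r rs')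
          then show ?thesis using 1 by (cases r) auto
        qed
        then have "length (lop.xy_word x y ps) \<ge> 2" by (simp only: lop.length_xy_word)
        then have "nested_lie (lop.xy_word x y ps) = (\<lambda>_. 0)"
          by (intro nested_lie_commuting[of "{x, y}"] comm lop.set_xy_word)
        then show "dynkin_coeff ps * nested_lie (lop.xy_word x y ps) n = 0" by simp
      qed
    qed (rule finite_word_lists)
    then show ?thesis by (simp add: dynkin_coeff_def lop.xy_word_def)
  qed
qed

text \<open>The summands change sign when a and b are exchanged, by skew-symmetry of the
  form.\<close>

lemma lie_scaled_self: "lie (\<lambda>n. c * x n) (\<lambda>n. d * x n) = (\<lambda>_. 0)"
proof
  fix n
  let ?S = "{(a, b). a \<in> Npos \<and> b \<in> Npos \<and> a + b = n}"
  let ?F = "\<lambda>(a, b). c * x a * (d * x b) * form a b"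
  have "sum ?F ?S = (\<Sum>(a, b)\<in>?S. c * x b * (d * x a) * form b a)"
    by (rule sum.reindex_bij_witness[of _ "\<lambda>(a, b). (b, a)" "\<lambda>(a, b). (b, a)"]) (auto simp: add.commute)
  also have "\<dots> = (\<Sum>p\<in>?S. - ?F p)"
  proof (intro sum.cong refl)
    fix p assume "p \<in> ?S"
    show "(case p of (a, b) \<Rightarrow> c * x b * (d * x a) * form b a) = - ?F p"
      using form_skew[of "snd p" "fst p"] by (simp add: case_prod_unfold)
  qed
  finally have "sum ?F ?S = 0" by (simp add: sum_negf)
  then show "lie (\<lambda>n. c * x n) (\<lambda>n. d * x n) n = 0" by (simp add: lie_def)
qed

lemma ghat_gpow: "x \<in> ghat \<Longrightarrow> gpow x c \<in> ghat"
  by (simp add: ghat_def gpow_def)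

lemma ghat_gone: "gone \<in> ghat"
  by (simp add: ghat_def gone_def)

lemma gexp_gone [simp]: "gexp l gone = 1"
proof -
  interpret filtered_nilpotent lop_scale "filt l" l by (rule filtered_nilpotent_filt)
  show ?thesis using nexp_0 by (simp add: gexp_def nexp_def gone_def rho_0)
qed

lemma gmult_gpow_minus:
  assumes "x \<in> ghat"
  shows "gmult (gpow x (- 1)) x = gone" "gmult x (gpow x (- 1)) = gone"
proof -
  have c: "lie u v = (\<lambda>_. 0)" if "u \<in> {gpow x (- 1), x}" "v \<in> {gpow x (- 1), x}" for u v
  proof -
    have "\<exists>k. w = (\<lambda>n. k * x n)" if "w \<in> {gpow x (- 1), x}" for w
      using that unfolding gpow_def by (auto intro: exI[of _ 1] exI[of _ "- 1"])
    with that show ?thesis using lie_scaled_self by metis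
  qed
  have "gmult (gpow x (- 1)) x = (\<lambda>n. gpow x (- 1) n + x n)"
    by (rule gmult_commuting) (use assms ghat_gpow c in auto)
  then show "gmult (gpow x (- 1)) x = gone" by (simp add: gpow_def gone_def)
  have "gmult x (gpow x (- 1)) = (\<lambda>n. x n + gpow x (- 1) n)"
    by (rule gmult_commuting) (use assms ghat_gpow c in auto)
  then show "gmult x (gpow x (- 1)) = gone" by (simp add: gpow_def gone_def)
qed

lemma gexp_gpow_minus:
  assumes "x \<in> ghat"
  shows "gexp l (gpow x (- 1)) * gexp l x = 1" "gexp l x * gexp l (gpow x (- 1)) = 1"
  using gmult_gpow_minus[OF assms] assms by (simp_all add: ghat_gpow flip: gexp_gmult)

lemma gexp_Ggt: "x \<in> Ggt l \<Longrightarrow> gexp l x = 1"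
proof -
  assume "x \<in> Ggt l"
  then have "rho l x = rho l gone" by (intro rho_cong) (auto simp: Ggt_def gone_def)
  then show ?thesis using gexp_gone by (simp add: gexp_def)
qed

text \<open>Path-ordered products are available only modulo elements of degree > l; the operators
  truncated at l do not see the difference.\<close>

lemma gexp_proj_eq:
  assumes "g \<in> ghat" "h \<in> ghat" "proj_eq l g h"
  shows "gexp l g = gexp l h"
proof -
  have "gexp l (gpow g (- 1)) * gexp l h = 1"
    using assms gexp_Ggt by (simp add: proj_eq_def ghat_gpow flip: gexp_gmult)
  then have "gexp l g * (gexp l (gpow g (- 1)) * gexp l h) = gexp l g" by simp
  then show ?thesis by (simp add: mult.assoc[symmetric] gexp_gpow_minus assms)
qed

lemma proj_eq_gone_iff: "x \<in> ghat \<Longrightarrow> proj_eq l x gone \<longleftrightarrow> x \<in> Ggt l"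
proof -
  assume x: "x \<in> ghat"
  have "gmult (gpow x (- 1)) gone = (\<lambda>n. gpow x (- 1) n + gone n)"
  proof (rule gmult_commuting)
    fix u v assume "u \<in> {gpow x (- 1), gone}" "v \<in> {gpow x (- 1), gone}"
    then show "lie u v = (\<lambda>_. 0)"
      using lie_scaled_self[of "- 1" x "- 1"] lie_0 by (auto simp: gone_def gpow_def)
  qed (use x ghat_gpow ghat_gone in auto)
  then have "gmult (gpow x (- 1)) gone = (\<lambda>n. - x n)" by (simp add: gpow_def gone_def)
  then show ?thesis using x by (simp add: proj_eq_def Ggt_def ghat_def)
qed

lemma gprod_rl_snoc: "gprod_rl (gs @ [g]) = gmult g (gprod_rl gs)"
  by (simp add: gprod_rl_def)

lemma ghat_gprod_rl: "set gs \<subseteq> ghat \<Longrightarrow> gprod_rl gs \<in> ghat"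
  by (induction gs rule: rev_induct) (simp_all add: gprod_rl_snoc ghat_gmult, simp add: gprod_rl_def ghat_gone)

lemma gexp_gprod_rl: "set gs \<subseteq> ghat \<Longrightarrow> gexp l (gprod_rl gs) = prod_list (rev (map (gexp l) gs))"
  by (induction gs rule: rev_induct)
     (simp_all add: gprod_rl_snoc gexp_gmult ghat_gprod_rl, simp add: gprod_rl_def)

lemma Gpar_ghat: "n \<in> Npos \<Longrightarrow> x \<in> Gpar n \<Longrightarrow> x \<in> ghat"
proof -
  assume n: "n \<in> Npos" and x: "x \<in> Gpar n"
  have "int j *s n \<in> Npos" if "j \<ge> 1" for j :: nat
    using n that by (auto simp: Npos_iff Qmon_iff coords_scale deg_scale)
  then show ?thesis using x unfolding Gpar_def ghat_def by fastforce
qed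

lemma Gpar_form: "x \<in> Gpar n \<Longrightarrow> y \<in> Gpar n \<Longrightarrow> x a * y b * form a b = 0"
  by (cases "x a = 0 \<or> y b = 0") (auto simp: Gpar_def form_scale form_scale2, metis form_scale form_scale2 form_self mult_zero_right)

lemma Gpar_add: "x \<in> Gpar n \<Longrightarrow> y \<in> Gpar n \<Longrightarrow> (\<lambda>m. x m + y m) \<in> Gpar n"
  unfolding Gpar_def by (auto, metis add.right_neutral)

lemma Gpar_0: "(\<lambda>_. 0) \<in> Gpar n"
  by (simp add: Gpar_def)

lemma Gpar_sum: "(\<And>p. p \<in> A \<Longrightarrow> f p \<in> Gpar n) \<Longrightarrow> (\<lambda>m. \<Sum>p\<in>A. f p m) \<in> Gpar n"
  by (induction A rule: infinite_finite_induct) (simp_all add: Gpar_0 Gpar_add)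

lemma Gpar_gpow: "x \<in> Gpar n \<Longrightarrow> gpow x c \<in> Gpar n"
  by (auto simp: Gpar_def gpow_def)

text \<open>On multiples of one vector n the form vanishes, so the parallel subgroup is abelian and
  its law is addition of logarithms.\<close>

lemma gexp_add:
  assumes n: "n \<in> Npos" and x: "x \<in> Gpar n" and y: "y \<in> Gpar n"
  shows "gexp l (\<lambda>m. x m + y m) = gexp l x * gexp l y"
proof -
  have "gmult x y = (\<lambda>m. x m + y m)"
  proof (rule gmult_commuting)
    fix u v assume "u \<in> {x, y}" "v \<in> {x, y}"
    then have "u \<in> Gpar n" "v \<in> Gpar n" using x y by auto
    then show "lie u v = (\<lambda>_. 0)" by (auto simp: lie_def fun_eq_iff Gpar_form intro!: sum.neutral)
  qed (use n x y Gpar_ghat in auto)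
  then show ?thesis using gexp_gmult[of x y l] n x y Gpar_ghat by simp
qed

section \<open>The action without truncation, and its multiplicativity\<close>

definition ract :: "(int^'r \<Rightarrow> rat) \<Rightarrow> ((int^'r) \<times> 'r option option \<Rightarrow> rat) \<Rightarrow> (int^'r) \<times> 'r option option \<Rightarrow> rat" where
  "ract x b = (\<lambda>(n, \<kappa>). \<Sum>(a, c)\<in>{(a, c). a \<in> Npos \<and> c \<in> Qmon \<and> a + c = n}. x a * fib a c (\<lambda>\<kappa>. b (c, \<kappa>)) \<kappa>)"

text \<open>The counterpart of \<open>gact\<close> on extended vectors, with the same cut-off: each
  application of \<open>ract\<close> raises the degree. In degrees up to l it agrees with
  \<open>gexp l\<close>, which links the truncated operators to the y-variables.\<close>

definition gactv :: "(int^'r \<Rightarrow> rat) \<Rightarrow> ((int^'r) \<times> 'r option option \<Rightarrow> rat) \<Rightarrow> (int^'r) \<times> 'r option option \<Rightarrow> rat" where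
  "gactv x b = (\<lambda>(n, \<kappa>). \<Sum>j\<le>nat (deg n). (ract x ^^ j) b (n, \<kappa>) / fact j)"

lemma ract_cong:
  assumes "\<And>c \<kappa>. c \<in> Qmon \<Longrightarrow> deg c < deg n \<Longrightarrow> b (c, \<kappa>) = b' (c, \<kappa>)"
  shows "ract x b (n, \<kappa>) = ract x b' (n, \<kappa>)"
proof -
  have "(\<lambda>\<kappa>. b (c, \<kappa>)) = (\<lambda>\<kappa>. b' (c, \<kappa>))" if "a \<in> Npos" "c \<in> Qmon" "a + c = n" for a c
    using that Npos_deg[of a] by (intro ext assms) (auto simp: deg_add)
  then show ?thesis unfolding ract_def by (auto intro!: sum.cong)
qed

lemma ract_nz: "ract x b (n, \<kappa>) \<noteq> 0 \<Longrightarrow> \<exists>a\<in>Npos. \<exists>c\<in>Qmon. a + c = n \<and> x a \<noteq> 0 \<and> (\<exists>\<kappa>. b (c, \<kappa>) \<noteq> 0)"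
proof -
  assume "ract x b (n, \<kappa>) \<noteq> 0"
  then obtain a c where ac: "a \<in> Npos" "c \<in> Qmon" "a + c = n" "x a * fib a c (\<lambda>\<kappa>. b (c, \<kappa>)) \<kappa> \<noteq> 0"
    unfolding ract_def by (auto elim!: sum.not_neutral_contains_not_neutral)
  moreover have "\<exists>\<kappa>. b (c, \<kappa>) \<noteq> 0"
  proof (rule ccontr)
    assume "\<not> ?thesis"
    then show False using ac by (simp add: fib_0)
  qed
  ultimately show ?thesis by auto
qed

lemma ract_pow_nz: "(ract x ^^ Suc j) b (n, \<kappa>) \<noteq> 0 \<Longrightarrow> n \<in> Qmon \<and> deg n \<ge> int (Suc j)"
proof (induction j arbitrary: n \<kappa>)
  case 0
  then show ?case using ract_nz[of x b n \<kappa>] Npos_deg Npos_add_Qmon Npos_Qmon by fastforce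
next
  case (Suc j)
  have "ract x ((ract x ^^ Suc j) b) (n, \<kappa>) \<noteq> 0" using Suc.prems by simp
  from ract_nz[OF this] obtain a c \<kappa>' where "a \<in> Npos" "c \<in> Qmon" "a + c = n" "(ract x ^^ Suc j) b (c, \<kappa>') \<noteq> 0"
    by blast
  then show ?case using Suc.IH[of c \<kappa>'] Npos_deg[of a] Qmon_add Npos_Qmon by (auto simp: deg_add)
qed

lemma app_rho_pow:
  "deg n \<le> int l \<Longrightarrow> app (rho l x ^ j) b (n, \<kappa>) = (ract x ^^ j) b (n, \<kappa>)"
proof (induction j arbitrary: n \<kappa>)
  case (Suc j)
  have "app (rho l x ^ Suc j) b (n, \<kappa>) = ract x (app (rho l x ^ j) b) (n, \<kappa>)"
    using Suc.prems by (simp add: app_rho ract_def)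
  also have "\<dots> = ract x ((ract x ^^ j) b) (n, \<kappa>)"
    using Suc by (intro ract_cong) auto
  finally show ?case by simp
qed simp

lemma app_gexp:
  assumes "deg n \<le> int l"
  shows "app (gexp l x) b (n, \<kappa>) = gactv x b (n, \<kappa>)"
proof -
  have "app (gexp l x) b (n, \<kappa>) = (\<Sum>j\<le>l. (ract x ^^ j) b (n, \<kappa>) / fact j)"
    by (simp add: gexp_def app_sum app_rho_pow[OF assms])
  also have "\<dots> = (\<Sum>j\<le>nat (deg n). (ract x ^^ j) b (n, \<kappa>) / fact j)"
  proof (rule sum.mono_neutral_right)
    show "\<forall>j\<in>{..l} - {..nat (deg n)}. (ract x ^^ j) b (n, \<kappa>) / fact j = 0"
    proof
      fix j assume j: "j \<in> {..l} - {..nat (deg n)}"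
      then obtain j' where "j = Suc j'" by (cases j) auto
      then show "(ract x ^^ j) b (n, \<kappa>) / fact j = 0"
        using ract_pow_nz[of j' x b n \<kappa>] j by fastforce
    qed
  qed (use assms in auto)
  finally show ?thesis by (simp add: gactv_def)
qed

definition emb :: "(int^'r \<Rightarrow> rat) \<Rightarrow> (int^'r) \<times> 'r option option \<Rightarrow> rat" where
  "emb f = (\<lambda>(n, \<kappa>). if \<kappa> = Some None then f n else 0)"

definition smul :: "(int^'r \<Rightarrow> rat) \<Rightarrow> ((int^'r) \<times> 'r option option \<Rightarrow> rat) \<Rightarrow> (int^'r) \<times> 'r option option \<Rightarrow> rat" where
  "smul f b = (\<lambda>(n, \<kappa>). \<Sum>(a, c)\<in>{(a, c). a \<in> Qmon \<and> c \<in> Qmon \<and> a + c = n}. f a * b (c, \<kappa>))"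

lemma ract_emb: "ract x (emb f) = emb (deriv_act x f)"
proof
  fix p :: "(int^'r) \<times> 'r option option"
  obtain n \<kappa> where p: "p = (n, \<kappa>)" by force
  have "fib a c (\<lambda>\<kappa>. emb f (c, \<kappa>)) \<kappa> = (if \<kappa> = Some None then f c * form a c else 0)" for a c
    by (auto simp: fib_def emb_def split: option.split)
  then show "ract x (emb f) p = emb (deriv_act x f) p"
    by (auto simp: p ract_def deriv_act_def emb_def mult.assoc)
qed

lemma ract_pow_emb: "(ract x ^^ j) (emb f) = emb ((deriv_act x ^^ j) f)"
  by (induction j) (simp_all add: ract_emb)

lemma gactv_emb: "gactv x (emb f) = emb (gact x f)"
  unfolding gactv_def gact_def ract_pow_emb by (auto simp: emb_def fun_eq_iff)

lemma smul_emb: "smul f (emb g) = emb (series_mult f g)"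
  by (auto simp: smul_def series_mult_def emb_def fun_eq_iff)

lemma ract_linear: "ract x (\<lambda>p. b p + k * b' p) = (\<lambda>p. ract x b p + k * ract x b' p)"
  by (auto simp: ract_def fib_linear algebra_simps sum.distrib sum_distrib_left case_prod_unfold fun_eq_iff)

lemma ract_0: "ract x (\<lambda>p. 0) = (\<lambda>p. 0)"
  using ract_linear[of x "\<lambda>p. 0" "- 1" "\<lambda>p. 0"] by (simp add: fun_eq_iff)

lemma ract_scale: "ract x (\<lambda>p. k * b' p) = (\<lambda>p. k * ract x b' p)"
  using ract_linear[of x "\<lambda>p. 0" k b'] by (simp add: ract_0 fun_eq_iff)

lemma ract_add: "ract x (\<lambda>p. b p + b' p) = (\<lambda>p. ract x b p + ract x b' p)"
  using ract_linear[of x b 1 b'] by simp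

lemma ract_sum: "ract x (\<lambda>p. \<Sum>i\<in>A. g i p) = (\<lambda>p. \<Sum>i\<in>A. ract x (g i) p)"
  by (induction A rule: infinite_finite_induct) (simp_all add: ract_0 ract_add)

lemma ract_pow_linear: "(ract x ^^ j) (\<lambda>p. b p + k * b' p) = (\<lambda>p. (ract x ^^ j) b p + k * (ract x ^^ j) b' p)"
  by (induction j) (simp_all add: ract_linear)

lemma gactv_linear: "gactv x (\<lambda>p. b p + k * b' p) = (\<lambda>p. gactv x b p + k * gactv x b' p)"
  by (auto simp: gactv_def ract_pow_linear fun_eq_iff add_divide_distrib sum.distrib sum_distrib_left)

lemma smul_add: "smul f (\<lambda>p. b p + b' p) = (\<lambda>p. smul f b p + smul f b' p)"
  by (auto simp: smul_def fun_eq_iff algebra_simps sum.distrib case_prod_unfold)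

lemma fib_shift: "fib a (d + c) f \<kappa> = form a d * f \<kappa> + fib a c f \<kappa>"
  by (simp add: fib_def form_add2 algebra_simps)

text \<open>Additivity of the form in its second argument makes X_a a derivation: on y^d times a
  vector the factor {a, d} splits off, and the remainder is the action on the vector.\<close>

lemma ract_smul: "ract x (smul f b) = (\<lambda>p. smul (deriv_act x f) b p + smul f (ract x b) p)"
proof
  fix p :: "(int^'r) \<times> 'r option option"
  obtain n \<kappa> where p: "p = (n, \<kappa>)" by force
  let ?S = "\<lambda>n. {(a, c). a \<in> Npos \<and> c \<in> Qmon \<and> a + c = n}"
  let ?Q = "\<lambda>n. {(a, c). a \<in> Qmon \<and> c \<in> Qmon \<and> a + c = n}"
  let ?T = "{(a, d, c). a \<in> Npos \<and> d \<in> Qmon \<and> c \<in> Qmon \<and> a + d + c = n}"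
  have "ract x (smul f b) p = (\<Sum>r\<in>?S n. \<Sum>s\<in>?Q (snd r). x (fst r) * f (fst s) * fib (fst r) (snd r) (\<lambda>\<kappa>. b (snd s, \<kappa>)) \<kappa>)"
    unfolding p ract_def smul_def case_prod_unfold prod.sel fib_sum fib_scale sum_distrib_left
    by (simp add: mult.assoc)
  also have "\<dots> = (\<Sum>(r, s)\<in>Sigma (?S n) (\<lambda>r. ?Q (snd r)). x (fst r) * f (fst s) * fib (fst r) (snd r) (\<lambda>\<kappa>. b (snd s, \<kappa>)) \<kappa>)"
    by (rule sum.Sigma) (use finite_splits_Npos finite_splits in auto)
  also have "\<dots> = (\<Sum>(a, d, c)\<in>?T. x a * f d * fib a (d + c) (\<lambda>\<kappa>. b (c, \<kappa>)) \<kappa>)"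
    by (rule sum.reindex_bij_witness[of _ "\<lambda>(a, d, c). ((a, d + c), (d, c))" "\<lambda>((a, s), (d, c)). (a, d, c)"])
       (auto simp: Qmon_add add.assoc)
  also have "\<dots> = (\<Sum>(a, d, c)\<in>?T. x a * f d * form a d * b (c, \<kappa>)) + (\<Sum>(a, d, c)\<in>?T. f d * (x a * fib a c (\<lambda>\<kappa>. b (c, \<kappa>)) \<kappa>))"
    unfolding sum.distrib[symmetric] by (intro sum.cong refl) (auto simp: fib_shift algebra_simps)
  also have "(\<Sum>(a, d, c)\<in>?T. x a * f d * form a d * b (c, \<kappa>))
      = (\<Sum>(r, s)\<in>Sigma (?Q n) (\<lambda>r. ?S (fst r)). x (fst s) * f (snd s) * form (fst s) (snd s) * b (snd r, \<kappa>))"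
    by (rule sum.reindex_bij_witness[of _ "\<lambda>((m, c), (a, d)). (a, d, c)" "\<lambda>(a, d, c). ((a + d, c), (a, d))"])
       (auto simp: Npos_add_Qmon Npos_Qmon)
  also have "\<dots> = (\<Sum>r\<in>?Q n. \<Sum>s\<in>?S (fst r). x (fst s) * f (snd s) * form (fst s) (snd s) * b (snd r, \<kappa>))"
    by (rule sum.Sigma[symmetric]) (use finite_splits_Npos finite_splits in auto)
  also have "\<dots> = smul (deriv_act x f) b p"
    unfolding p deriv_act_def smul_def case_prod_unfold prod.sel sum_distrib_right ..
  also have "(\<Sum>(a, d, c)\<in>?T. f d * (x a * fib a c (\<lambda>\<kappa>. b (c, \<kappa>)) \<kappa>))
      = (\<Sum>(r, s)\<in>Sigma (?Q n) (\<lambda>r. ?S (snd r)). f (fst r) * (x (fst s) * fib (fst s) (snd s) (\<lambda>\<kappa>. b (snd s, \<kappa>)) \<kappa>))"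
    by (rule sum.reindex_bij_witness[of _ "\<lambda>((d, m), (a, c)). (a, d, c)" "\<lambda>(a, d, c). ((d, a + c), (a, c))"])
       (auto simp: Npos_add_Qmon Npos_Qmon add_ac)
  also have "\<dots> = (\<Sum>r\<in>?Q n. \<Sum>s\<in>?S (snd r). f (fst r) * (x (fst s) * fib (fst s) (snd s) (\<lambda>\<kappa>. b (snd s, \<kappa>)) \<kappa>))"
    by (rule sum.Sigma[symmetric]) (use finite_splits_Npos finite_splits in auto)
  also have "\<dots> = smul f (ract x b) p"
    unfolding p ract_def smul_def case_prod_unfold prod.sel sum_distrib_left ..
  finally show "ract x (smul f b) p = smul (deriv_act x f) b p + smul f (ract x b) p" .
qed

lemma ract_pow_smul:
  "(ract x ^^ j) (smul f b) = (\<lambda>p. \<Sum>i\<le>j. of_nat (j choose i) * smul ((deriv_act x ^^ i) f) ((ract x ^^ (j - i)) b) p)"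
proof (induction j)
  case (Suc j)
  let ?M = "\<lambda>i k. smul ((deriv_act x ^^ i) f) ((ract x ^^ k) b)"
  have "(ract x ^^ Suc j) (smul f b) = (\<lambda>p. \<Sum>i\<le>j. of_nat (j choose i) * (?M (Suc i) (j - i) p + ?M i (Suc (j - i)) p))"
    by (simp add: Suc ract_sum ract_scale ract_smul)
  also have "\<dots> = (\<lambda>p. \<Sum>i\<le>Suc j. of_nat (Suc j choose i) * ?M i (Suc j - i) p)"
  proof
    fix p
    have "(\<Sum>i\<le>j. of_nat (j choose i) * (?M (Suc i) (j - i) p + ?M i (Suc (j - i)) p))
        = (\<Sum>i\<le>j. of_nat (j choose i) * ?M (Suc i) (j - i) p) + (\<Sum>i\<le>j. of_nat (j choose i) * ?M i (Suc j - i) p)"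
      by (simp add: distrib_left sum.distrib Suc_diff_le)
    also have "(\<Sum>i\<le>j. of_nat (j choose i) * ?M i (Suc j - i) p) = (\<Sum>i\<le>Suc j. of_nat (j choose i) * ?M i (Suc j - i) p)"
      by simp
    also have "\<dots> = ?M 0 (Suc j) p + (\<Sum>i\<le>j. of_nat (j choose Suc i) * ?M (Suc i) (j - i) p)"
      by (subst sum.atMost_Suc_shift) simp
    finally show "(\<Sum>i\<le>j. of_nat (j choose i) * (?M (Suc i) (j - i) p + ?M i (Suc (j - i)) p))
        = (\<Sum>i\<le>Suc j. of_nat (Suc j choose i) * ?M i (Suc j - i) p)"
      by (subst sum.atMost_Suc_shift) (simp add: distrib_right sum.distrib)
  qed
  finally show ?case .
qed simp

lemma deriv_pow_nz: "(deriv_act x ^^ j) f n \<noteq> 0 \<Longrightarrow> n \<in> Qmon \<Longrightarrow> deg n \<ge> int j"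
proof (cases j)
  case (Suc k)
  assume "(deriv_act x ^^ j) f n \<noteq> 0"
  then have "(ract x ^^ Suc k) (emb f) (n, Some None) \<noteq> 0"
    unfolding ract_pow_emb using Suc by (simp add: emb_def)
  then show ?thesis using ract_pow_nz Suc by blast
qed (simp add: Qmon_deg)

text \<open>The exponential of a derivation is multiplicative. Leibniz's rule turns the exponential
  sum into a Cauchy product for each splitting of n.\<close>

lemma gactv_smul: "gactv x (smul f b) = smul (gact x f) (gactv x b)"
proof
  fix p :: "(int^'r) \<times> 'r option option"
  obtain n \<kappa> where p: "p = (n, \<kappa>)" by force
  let ?Q = "{(a, c). a \<in> Qmon \<and> c \<in> Qmon \<and> a + c = n}"
  let ?D = "\<lambda>i a. (deriv_act x ^^ i) f a / fact i" and ?R = "\<lambda>k c. (ract x ^^ k) b (c, \<kappa>) / fact k"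
  let ?N = "nat (deg n)"
  have "gactv x (smul f b) p = (\<Sum>j\<le>?N. \<Sum>i\<le>j. \<Sum>(a, c)\<in>?Q. ?D i a * ?R (j - i) c)"
  proof -
    have "(ract x ^^ j) (smul f b) (n, \<kappa>) / fact j = (\<Sum>i\<le>j. \<Sum>(a, c)\<in>?Q. ?D i a * ?R (j - i) c)" for j
    proof -
      have "of_nat (j choose i) * (A * B) / fact j = A / fact i * (B / fact (j - i))" if "i \<le> j" for i and A B :: rat
        using binomial_fact[OF that, where 'a = rat] by (simp add: field_simps)
      then show ?thesis
        unfolding ract_pow_smul by (auto simp: smul_def sum_divide_distrib sum_distrib_left case_prod_unfold intro!: sum.cong)
    qed
    then show ?thesis by (simp add: p gactv_def)
  qed
  also have "\<dots> = (\<Sum>j\<le>?N. \<Sum>(a, c)\<in>?Q. \<Sum>i\<le>j. ?D i a * ?R (j - i) c)"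
    by (intro sum.cong refl) (subst sum.swap, simp add: case_prod_unfold)
  also have "\<dots> = (\<Sum>(a, c)\<in>?Q. \<Sum>j\<le>?N. \<Sum>i\<le>j. ?D i a * ?R (j - i) c)"
    by (subst sum.swap) (simp add: case_prod_unfold)
  also have "\<dots> = (\<Sum>(a, c)\<in>?Q. (\<Sum>i\<le>nat (deg a). ?D i a) * (\<Sum>k\<le>nat (deg c). ?R k c))"
  proof (intro sum.cong refl, clarify)
    fix a c assume ac: "a \<in> Qmon" "c \<in> Qmon" and n: "n = a + c"
    have N: "nat (deg (a + c)) = nat (deg a) + nat (deg c)"
      using Qmon_deg[OF ac(1)] Qmon_deg[OF ac(2)] by (simp add: deg_add)
    have D0: "?D i a = 0" if "nat (deg a) < i" for i
      using deriv_pow_nz[OF _ ac(1), of i x f] that by fastforce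
    have R0: "?R k c = 0" if k: "nat (deg c) < k" for k
    proof -
      obtain k' where "k = Suc k'" using k by (cases k) auto
      then show ?thesis using ract_pow_nz[of k' x b c \<kappa>] k by fastforce
    qed
    have "(\<Sum>j\<le>nat (deg (a + c)). \<Sum>i\<le>j. ?D i a * ?R (j - i) c) = (\<Sum>(j, i)\<in>Sigma {..nat (deg (a + c))} (\<lambda>j. {..j}). ?D i a * ?R (j - i) c)"
      by (rule sum.Sigma) auto
    also have "\<dots> = (\<Sum>(i, k)\<in>{(i, k). i + k \<le> nat (deg (a + c))}. ?D i a * ?R k c)"
      by (rule sum.reindex_bij_witness[of _ "\<lambda>(i, k). (i + k, i)" "\<lambda>(j, i). (i, j - i)"]) auto
    \<comment> \<open>The triangle of exponents contains this rectangle, as degrees add; outside the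
      rectangle one factor has more derivations than its degree allows and vanishes.\<close>
    also have "\<dots> = (\<Sum>(i, k)\<in>{..nat (deg a)} \<times> {..nat (deg c)}. ?D i a * ?R k c)"
    proof (rule sum.mono_neutral_right)
      show "finite {(i, k). i + k \<le> nat (deg (a + c))}"
        by (rule finite_subset[of _ "{..nat (deg (a + c))} \<times> {..nat (deg (a + c))}"]) auto
      show "\<forall>p\<in>{(i, k). i + k \<le> nat (deg (a + c))} - {..nat (deg a)} \<times> {..nat (deg c)}. (case p of (i, k) \<Rightarrow> ?D i a * ?R k c) = 0"
      proof
        fix p assume p: "p \<in> {(i, k). i + k \<le> nat (deg (a + c))} - {..nat (deg a)} \<times> {..nat (deg c)}"
        obtain i k where ik: "p = (i, k)" by force
        have "nat (deg a) < i \<or> nat (deg c) < k" using p ik by auto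
        then have "?D i a * ?R k c = 0" using D0 R0 by (metis mult_zero_left mult_zero_right)
        then show "(case p of (i, k) \<Rightarrow> ?D i a * ?R k c) = 0" by (simp add: ik)
      qed
    qed (auto simp: N)
    also have "\<dots> = (\<Sum>i\<le>nat (deg a). ?D i a) * (\<Sum>k\<le>nat (deg c). ?R k c)"
      by (simp only: sum_product sum.cartesian_product)
    finally show "(\<Sum>j\<le>nat (deg (a + c)). \<Sum>i\<le>j. ?D i a * ?R (j - i) c)
        = (\<Sum>i\<le>nat (deg a). ?D i a) * (\<Sum>k\<le>nat (deg c). ?R k c)" .
  qed
  also have "\<dots> = smul (gact x f) (gactv x b) p"
    by (simp add: p smul_def gact_def gactv_def)
  finally show "gactv x (smul f b) p = smul (gact x f) (gactv x b) p" .
qed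

text \<open>Series are embedded as multiples of the symbol 1, where the module statement specialises
  to this one.\<close>

lemma gact_series_mult: "gact x (series_mult f g) = series_mult (gact x f) (gact x g)"
proof
  fix n
  have "emb (gact x (series_mult f g)) = emb (series_mult (gact x f) (gact x g))"
    by (simp only: gactv_emb[symmetric] smul_emb[symmetric] gactv_smul)
  from fun_cong[OF this, of "(n, Some None)"]
  show "gact x (series_mult f g) n = series_mult (gact x f) (gact x g) n" by (simp add: emb_def)
qed

section \<open>Powers of series and substitution under the action\<close>

lemma Qmon_scale: "m \<in> Qmon \<Longrightarrow> int k *s m \<in> Qmon"
  by (simp add: Qmon_iff coords_scale)

lemma ract_pow_cong:
  assumes "n \<in> Qmon" "\<And>c \<kappa>. c \<in> Qmon \<Longrightarrow> deg c \<le> deg n \<Longrightarrow> b (c, \<kappa>) = b' (c, \<kappa>)"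
  shows "(ract x ^^ j) b (n, \<kappa>) = (ract x ^^ j) b' (n, \<kappa>)"
  using assms
proof (induction j arbitrary: n \<kappa>)
  case (Suc j)
  have "ract x ((ract x ^^ j) b) (n, \<kappa>) = ract x ((ract x ^^ j) b') (n, \<kappa>)"
    by (rule ract_cong) (use Suc in force)
  then show ?case by simp
qed simp

lemma gactv_cong:
  assumes "n \<in> Qmon" "\<And>c \<kappa>. c \<in> Qmon \<Longrightarrow> deg c \<le> deg n \<Longrightarrow> b (c, \<kappa>) = b' (c, \<kappa>)"
  shows "gactv x b (n, \<kappa>) = gactv x b' (n, \<kappa>)"
proof -
  have "(ract x ^^ j) b (n, \<kappa>) = (ract x ^^ j) b' (n, \<kappa>)" for j
    by (rule ract_pow_cong) (use assms in auto)
  then show ?thesis by (simp add: gactv_def)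
qed

lemma sum_splits_zero:
  assumes "\<And>a c. a \<in> Npos \<Longrightarrow> c \<in> Qmon \<Longrightarrow> c \<noteq> 0 \<Longrightarrow> F a c = 0"
  shows "(\<Sum>(a, c)\<in>{(a, c). a \<in> Npos \<and> c \<in> Qmon \<and> a + c = n}. F a c) = (if n \<in> Npos then F n 0 else 0)"
proof -
  have "(\<Sum>(a, c)\<in>{(a, c). a \<in> Npos \<and> c \<in> Qmon \<and> a + c = n}. F a c) = (\<Sum>(a, c)\<in>(if n \<in> Npos then {(n, 0)} else {}). F a c)"
    by (rule sum.mono_neutral_right[OF finite_splits_Npos(1)]) (auto split: if_splits intro!: assms)
  then show ?thesis by simp
qed

lemma sum_splits_zero_Qmon:
  assumes "n \<in> Qmon" "\<And>a c. a \<in> Qmon \<Longrightarrow> c \<in> Qmon \<Longrightarrow> c \<noteq> 0 \<Longrightarrow> F a c = 0"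
  shows "(\<Sum>(a, c)\<in>{(a, c). a \<in> Qmon \<and> c \<in> Qmon \<and> a + c = n}. F a c) = F n 0"
proof -
  have "(\<Sum>(a, c)\<in>{(a, c). a \<in> Qmon \<and> c \<in> Qmon \<and> a + c = n}. F a c) = (\<Sum>(a, c)\<in>{(n, 0)}. F a c)"
    by (rule sum.mono_neutral_right[OF finite_splits]) (auto intro!: assms)
  then show ?thesis by simp
qed

lemma gact_emb: "gact x f n = gactv x (emb f) (n, Some None)"
  unfolding gactv_emb by (simp add: emb_def)

lemma gact_cong:
  assumes "n \<in> Qmon" "\<And>c. c \<in> Qmon \<Longrightarrow> deg c \<le> deg n \<Longrightarrow> f c = g c"
  shows "gact x f n = gact x g n"
  unfolding gact_emb by (rule gactv_cong) (use assms in \<open>auto simp: emb_def\<close>)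

lemma gact_linear: "gact x (\<lambda>n. f n + k * g n) n = gact x f n + k * gact x g n"
proof -
  have "emb (\<lambda>n. f n + k * g n) = (\<lambda>p. emb f p + k * emb g p)"
    by (auto simp: emb_def fun_eq_iff)
  then show ?thesis by (simp add: gact_emb gactv_linear)
qed

lemma gact_0: "gact x (\<lambda>n. 0) n = 0"
  using gact_linear[of x "\<lambda>_. 0" "- 1" "\<lambda>_. 0" n] by simp

lemma gact_sum: "finite A \<Longrightarrow> gact x (\<lambda>n. \<Sum>i\<in>A. c i * f i n) n = (\<Sum>i\<in>A. c i * gact x (f i) n)"
proof (induction A rule: finite_induct)
  case (insert i A)
  then show ?case using gact_linear[of x "\<lambda>n. \<Sum>i\<in>A. c i * f i n" "c i" "f i" n] by (simp add: add.commute)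
qed (simp add: gact_0)

lemma series_mult_nz: "series_mult f g n \<noteq> 0 \<Longrightarrow> \<exists>a\<in>Qmon. \<exists>b\<in>Qmon. a + b = n \<and> f a \<noteq> 0 \<and> g b \<noteq> 0"
proof -
  assume "series_mult f g n \<noteq> 0"
  then obtain a b where "a \<in> Qmon" "b \<in> Qmon" "a + b = n" "f a * g b \<noteq> 0"
    unfolding series_mult_def by (auto elim!: sum.not_neutral_contains_not_neutral)
  then show ?thesis by (metis mult_zero_left mult_zero_right)
qed

lemma series_mult_one:
  assumes "n \<in> Qmon" shows "series_mult (mono_y 0) f n = f n"
proof -
  have "series_mult (mono_y 0) f n = (\<Sum>(a, b)\<in>{(0, n)}. mono_y 0 a * f b)"
    unfolding series_mult_def using assms
    by (intro sum.mono_neutral_right finite_splits) (auto simp: mono_y_def split: if_splits)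
  then show ?thesis by (simp add: mono_y_def)
qed

lemma series_mult_add: "series_mult (\<lambda>n. f n + g n) h n = series_mult f h n + series_mult g h n"
  by (simp add: series_mult_def algebra_simps sum.distrib case_prod_unfold)

lemma series_mult_scale2: "series_mult f (\<lambda>n. k * g n) n = k * series_mult f g n"
  by (simp add: series_mult_def sum_distrib_left case_prod_unfold algebra_simps)

lemma series_mult_sum2: "series_mult f (\<lambda>n. \<Sum>i\<in>A. g i n) n = (\<Sum>i\<in>A. series_mult f (g i) n)"
  unfolding series_mult_def by (subst sum.swap) (simp add: sum_distrib_left case_prod_unfold)

lemma series_mult_cong:
  assumes "\<And>a. a \<in> Qmon \<Longrightarrow> f a = f' a" "\<And>a. a \<in> Qmon \<Longrightarrow> g a = g' a"
  shows "series_mult f g n = series_mult f' g' n"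
  unfolding series_mult_def using assms by (intro sum.cong) auto

lemma series_mult_commute: "series_mult f g n = series_mult g f n"
  unfolding series_mult_def
  by (rule sum.reindex_bij_witness[of _ "\<lambda>(a, b). (b, a)" "\<lambda>(a, b). (b, a)"]) (auto simp: add.commute)

lemma spow_0: "spow h 0 = mono_y 0"
  by (simp add: spow_def)

lemma spow_Suc: "spow h (Suc j) = series_mult h (spow h j)"
  by (simp add: spow_def)

lemma spow_nz: "h 0 = 0 \<Longrightarrow> spow h j n \<noteq> 0 \<Longrightarrow> n \<in> Qmon \<and> deg n \<ge> int j"
proof (induction j arbitrary: n)
  case 0
  then show ?case by (auto simp: spow_0 mono_y_def split: if_splits)
next
  case (Suc j)
  then obtain a b where ab: "a \<in> Qmon" "b \<in> Qmon" "a + b = n" "h a \<noteq> 0" "spow h j b \<noteq> 0"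
    using series_mult_nz[of h "spow h j" n] by (auto simp: spow_Suc)
  then have "a \<in> Npos" using Suc.prems(1) by (auto simp: Qmon_def)
  then show ?case using Suc.IH[of b] ab Suc.prems(1) Npos_deg[of a] by (auto simp: Qmon_add deg_add)
qed

lemma spow_one_plus:
  assumes "k \<le> N" "n \<in> Qmon"
  shows "spow (\<lambda>n. mono_y 0 n + h n) k n = (\<Sum>j<Suc N. of_nat (k choose j) * spow h j n)"
  using assms
proof (induction k arbitrary: n)
  case 0
  show ?case by (subst sum.lessThan_Suc_shift) (simp add: spow_0)
next
  case (Suc k)
  let ?s = "spow (\<lambda>n. mono_y 0 n + h n) k"
  have "spow (\<lambda>n. mono_y 0 n + h n) (Suc k) n = ?s n + series_mult h ?s n"
    using Suc.prems by (simp add: spow_Suc series_mult_add series_mult_one)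
  also have "series_mult h ?s n = series_mult h (\<lambda>n. \<Sum>j<Suc N. of_nat (k choose j) * spow h j n) n"
    by (rule series_mult_cong) (use Suc in auto)
  also have "\<dots> = (\<Sum>j<Suc N. of_nat (k choose j) * spow h (Suc j) n)"
    by (simp only: series_mult_sum2 series_mult_scale2 spow_Suc)
  also have "\<dots> = (\<Sum>j<N. of_nat (k choose j) * spow h (Suc j) n)"
    using Suc.prems by (simp add: binomial_eq_0)
  also have "?s n = spow h 0 n + (\<Sum>j<N. of_nat (k choose Suc j) * spow h (Suc j) n)"
    using Suc by (simp only: Suc_leD) (subst sum.lessThan_Suc_shift, simp)
  finally show ?case
    by (subst sum.lessThan_Suc_shift) (simp add: distrib_right sum.distrib)
qed

lemma series_mult_mono:
  assumes "m \<in> Qmon" "k \<in> Qmon"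
  shows "series_mult (mono_y m) (mono_y k) = mono_y (m + k)"
proof
  fix n
  have "series_mult (mono_y m) (mono_y k) n
      = (\<Sum>(a, b)\<in>{(a, b). a \<in> Qmon \<and> b \<in> Qmon \<and> a + b = n}. if (a, b) = (m, k) then 1 else 0)"
    unfolding series_mult_def by (intro sum.cong) (auto simp: mono_y_def)
  also have "\<dots> = mono_y (m + k) n"
    using assms finite_splits[of n] by (auto simp: mono_y_def case_prod_unfold prod_eq_iff[symmetric] simp del: prod.inject)
  finally show "series_mult (mono_y m) (mono_y k) n = mono_y (m + k) n" .
qed

lemma spow_mono: "m \<in> Qmon \<Longrightarrow> spow (mono_y m) j = mono_y (int j *s m)"
  by (induction j) (simp_all add: spow_0 spow_Suc series_mult_mono Qmon_scale vector_sadd_rdistrib)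

lemma gact_mono_0: "gact x (mono_y 0) = mono_y 0"
proof -
  have "deriv_act x (mono_y 0) n = 0" for n
    unfolding deriv_act_def by (intro sum.neutral) (auto simp: mono_y_def)
  then have 1: "deriv_act x (mono_y 0) = (\<lambda>_. 0)" by auto
  have "(deriv_act x ^^ j) (\<lambda>_. 0) = (\<lambda>_. 0)" for j
    by (induction j) (auto simp: deriv_act_def fun_eq_iff)
  then have "(deriv_act x ^^ Suc j) (mono_y 0) = (\<lambda>_. 0)" for j
    by (simp only: funpow_Suc_right comp_def 1)
  then have "(deriv_act x ^^ j) (mono_y 0) n / fact j = (if j = 0 then mono_y 0 n else 0)" for j n
    by (cases j) auto
  then show ?thesis by (simp add: gact_def fun_eq_iff)
qed

lemma gact_spow: "gact x (spow h j) = spow (gact x h) j"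
  by (induction j) (simp_all add: spow_0 spow_Suc gact_mono_0 gact_series_mult)

text \<open>Below a fixed degree a substitution is a finite sum of powers because h has no constant
  term, and an algebra automorphism commutes with powers.\<close>

lemma gact_subst_series:
  assumes n: "n \<in> Qmon" and h: "h 0 = 0"
  shows "gact x (subst_series c h) n = subst_series c (gact x h) n"
proof -
  let ?N = "nat (deg n)"
  have "gact x (subst_series c h) n = gact x (\<lambda>n. \<Sum>j\<in>{1..?N}. c j * spow h j n) n"
  proof (rule gact_cong[OF n])
    fix a assume a: "a \<in> Qmon" "deg a \<le> deg n"
    have "spow h j a = 0" if "nat (deg a) < j" for j
      using spow_nz[of h j a] h that by fastforce
    then show "subst_series c h a = (\<Sum>j\<in>{1..?N}. c j * spow h j a)"
      unfolding subst_series_def using a by (intro sum.mono_neutral_left) auto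
  qed
  then show ?thesis by (simp add: gact_sum gact_spow subst_series_def)
qed

text \<open>The series X(log y^m) = sum_n x_n {n, m} y^n.\<close>

definition dlog :: "(int^'r \<Rightarrow> rat) \<Rightarrow> int^'r \<Rightarrow> int^'r \<Rightarrow> rat" where
  "dlog x m = (\<lambda>n. if n \<in> Npos then x n * form n m else 0)"

text \<open>
  \<open>X\<^sup>j y\<^sup>k\<^sup>m = y\<^sup>k\<^sup>m \<Sum>\<^sub>c (twist x m j c)(k) y\<^sup>c\<close> is polynomial in k; since
  \<open>exp X\<close> maps \<open>y\<^sup>k\<^sup>m\<close> to \<open>y\<^sup>k\<^sup>m (1 + h)\<^sup>k\<close>, the coefficient of k gives \<open>log (1 + h)\<close>.
\<close>

primrec twist :: "(int^'r \<Rightarrow> rat) \<Rightarrow> int^'r \<Rightarrow> nat \<Rightarrow> int^'r \<Rightarrow> rat poly" where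
  "twist x m 0 = (\<lambda>c. if c = 0 then 1 else 0)"
| "twist x m (Suc j) = (\<lambda>c. \<Sum>(a, b)\<in>{(a, b). a \<in> Npos \<and> b \<in> Qmon \<and> a + b = c}.
     [:x a * form a b, x a * form a m:] * twist x m j b)"

lemma deriv_pow_mono_nz: "m \<in> Qmon \<Longrightarrow> (deriv_act x ^^ j) (mono_y m) n \<noteq> 0 \<Longrightarrow> n - m \<in> Qmon \<and> (j > 0 \<longrightarrow> n - m \<in> Npos)"
proof (induction j arbitrary: n)
  case 0
  then show ?case by (auto simp: mono_y_def split: if_splits)
next
  case (Suc j)
  then have "deriv_act x ((deriv_act x ^^ j) (mono_y m)) n \<noteq> 0" by simp
  then obtain a b where ab: "a \<in> Npos" "b \<in> Qmon" "a + b = n" "(deriv_act x ^^ j) (mono_y m) b \<noteq> 0"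
    unfolding deriv_act_def by (auto elim!: sum.not_neutral_contains_not_neutral)
  have eq: "n - m = a + (b - m)" using ab(3) by auto
  have "b - m \<in> Qmon" using Suc.IH[of b] Suc.prems ab by blast
  then have "n - m \<in> Npos" unfolding eq by (rule Npos_add_Qmon[OF ab(1)])
  then show ?case by (simp add: Npos_Qmon)
qed

lemma twist_nz: "twist x m j c \<noteq> 0 \<Longrightarrow> c \<in> Qmon \<and> deg c \<ge> int j"
proof (induction j arbitrary: c)
  case 0
  then show ?case by (auto split: if_splits)
next
  case (Suc j)
  obtain p where p: "p \<in> {(a, b). a \<in> Npos \<and> b \<in> Qmon \<and> a + b = c}"
    "(case p of (a, b) \<Rightarrow> [:x a * form a b, x a * form a m:] * twist x m j b) \<noteq> 0"
    using Suc.prems unfolding twist.simps(2) by (rule sum.not_neutral_contains_not_neutral)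
  obtain a b where "p = (a, b)" by force
  with p have ab: "a \<in> Npos" "b \<in> Qmon" "a + b = c" "twist x m j b \<noteq> 0" by auto
  then show ?case using Suc.IH[of b] Npos_deg[of a] by (auto simp: deg_add Qmon_add Npos_Qmon)
qed

text \<open>X_a multiplies y^(km+b) by y^a with the factor {a, b} + k {a, m}, the linear polynomial
  in the recursion of \<open>twist\<close>. Splittings not divisible by y^(km) contribute
  nothing.\<close>

lemma deriv_pow_mono:
  assumes m: "m \<in> Qmon"
  shows "(deriv_act x ^^ j) (mono_y (int k *s m)) (int k *s m + c) = poly (twist x m j c) (of_nat k)"
proof (induction j arbitrary: c)
  case 0
  show ?case by (simp add: mono_y_def)
next
  case (Suc j)
  let ?M = "int k *s m"
  define f where "f = (deriv_act x ^^ j) (mono_y ?M)"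
  have fM: "f (?M + c) = poly (twist x m j c) (of_nat k)" for c
    unfolding f_def by (rule Suc)
  have M: "?M \<in> Qmon" by (rule Qmon_scale[OF m])
  have "deriv_act x f (?M + c)
      = (\<Sum>(a, b)\<in>(\<lambda>(a, b). (a, ?M + b)) ` {(a, b). a \<in> Npos \<and> b \<in> Qmon \<and> a + b = c}. x a * f b * form a b)"
    unfolding deriv_act_def
  proof (rule sum.mono_neutral_right)
    show "(\<lambda>(a, b). (a, ?M + b)) ` {(a, b). a \<in> Npos \<and> b \<in> Qmon \<and> a + b = c}
        \<subseteq> {(a, b). a \<in> Npos \<and> b \<in> Qmon \<and> a + b = ?M + c}"
      using M by (auto simp: Qmon_add)
    show "\<forall>p\<in>{(a, b). a \<in> Npos \<and> b \<in> Qmon \<and> a + b = ?M + c}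
          - (\<lambda>(a, b). (a, ?M + b)) ` {(a, b). a \<in> Npos \<and> b \<in> Qmon \<and> a + b = c}.
        (case p of (a, b) \<Rightarrow> x a * f b * form a b) = 0"
    proof
      fix p assume p: "p \<in> {(a, b). a \<in> Npos \<and> b \<in> Qmon \<and> a + b = ?M + c}
          - (\<lambda>(a, b). (a, ?M + b)) ` {(a, b). a \<in> Npos \<and> b \<in> Qmon \<and> a + b = c}"
      obtain a b where ab: "p = (a, b)" by force
      have s: "a + b = ?M + c" "a \<in> Npos" using p ab by auto
      have "f b = 0"
      proof (rule ccontr)
        assume "f b \<noteq> 0"
        then have "b - ?M \<in> Qmon" unfolding f_def using deriv_pow_mono_nz[OF M] by blast
        moreover have "a + (b - ?M) = c" using s(1) by (simp add: algebra_simps)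
        ultimately have "(a, b - ?M) \<in> {(a, b). a \<in> Npos \<and> b \<in> Qmon \<and> a + b = c}" using s by simp
        then have "(\<lambda>(a, b). (a, ?M + b)) (a, b - ?M) \<in> (\<lambda>(a, b). (a, ?M + b)) ` {(a, b). a \<in> Npos \<and> b \<in> Qmon \<and> a + b = c}"
          by (rule imageI)
        then show False using p ab by simp
      qed
      then show "(case p of (a, b) \<Rightarrow> x a * f b * form a b) = 0" by (simp add: ab)
    qed
  qed (rule finite_splits_Npos(1))
  also have "\<dots> = (\<Sum>(a, b)\<in>{(a, b). a \<in> Npos \<and> b \<in> Qmon \<and> a + b = c}. x a * f (?M + b) * form a (?M + b))"
    by (subst sum.reindex) (auto simp: inj_on_def case_prod_unfold)
  also have "\<dots> = poly (twist x m (Suc j) c) (of_nat k)"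
    unfolding fM by (auto simp: poly_sum form_add2 form_scale2 algebra_simps intro!: sum.cong)
  finally show ?case by (simp add: f_def)
qed

lemma coeff_twist_0: "coeff (twist x m j c) 0 = (if j = 0 \<and> c = 0 then 1 else 0)"
proof (induction j arbitrary: c)
  case (Suc j)
  have "coeff (twist x m (Suc j) c) 0
      = (\<Sum>(a, b)\<in>{(a, b). a \<in> Npos \<and> b \<in> Qmon \<and> a + b = c}. x a * form a b * (if j = 0 \<and> b = 0 then 1 else 0))"
    by (simp add: coeff_sum coeff_mult_0 Suc case_prod_unfold)
  also have "\<dots> = 0" by (rule sum.neutral) auto
  finally show ?case by simp
qed simp

text \<open>A term of \<open>twist\<close> is a product of factors {a, b} + k {a, m}. The innermost
  one has b = 0, hence no constant part; so the coefficient of k takes {a, m} there and {a, b} in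
  all later factors.\<close>

lemma coeff_twist_1: "coeff (twist x m (Suc j) c) 1 = (deriv_act x ^^ j) (dlog x m) c"
proof (induction j arbitrary: c)
  case 0
  let ?S = "{(a, b). a \<in> Npos \<and> b \<in> Qmon \<and> a + b = c}"
  have "coeff (twist x m (Suc 0) c) 1 = (\<Sum>(a, b)\<in>?S. if b = 0 then x a * form a m else 0)"
    by (simp add: coeff_sum case_prod_unfold) (intro sum.cong, auto)
  also have "\<dots> = dlog x m c" by (subst sum_splits_zero) (auto simp: dlog_def)
  finally show ?case by simp
next
  case (Suc j)
  have "coeff (twist x m (Suc (Suc j)) c) 1
      = (\<Sum>(a, b)\<in>{(a, b). a \<in> Npos \<and> b \<in> Qmon \<and> a + b = c}. x a * form a b * coeff (twist x m (Suc j) b) 1)"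
    by (subst twist.simps(2))
       (simp add: coeff_sum coeff_pCons_Suc coeff_twist_0 case_prod_unfold del: twist.simps)
  also have "\<dots> = (deriv_act x ^^ Suc j) (dlog x m) c"
    unfolding Suc by (auto simp: deriv_act_def intro!: sum.cong)
  finally show ?case .
qed

lemma gact_mono:
  assumes m: "m \<in> Qmon" and c: "c \<in> Qmon"
  shows "gact x (mono_y (int k *s m)) (int k *s m + c) = (\<Sum>j\<le>nat (deg c). poly (twist x m j c) (of_nat k) / fact j)"
proof -
  have "gact x (mono_y (int k *s m)) (int k *s m + c)
      = (\<Sum>j\<le>nat (deg (int k *s m + c)). poly (twist x m j c) (of_nat k) / fact j)"
    by (simp add: gact_def deriv_pow_mono[OF m])
  also have "\<dots> = (\<Sum>j\<le>nat (deg c). poly (twist x m j c) (of_nat k) / fact j)"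
  proof (rule sum.mono_neutral_right)
    show "{..nat (deg c)} \<subseteq> {..nat (deg (int k *s m + c))}"
      using Qmon_deg[OF Qmon_scale[OF m, of k]] by (auto simp: deg_add)
    show "\<forall>j\<in>{..nat (deg (int k *s m + c))} - {..nat (deg c)}. poly (twist x m j c) (of_nat k) / fact j = 0"
    proof
      fix j assume "j \<in> {..nat (deg (int k *s m + c))} - {..nat (deg c)}"
      then have "twist x m j c = 0" using twist_nz[of x m j c] by fastforce
      then show "poly (twist x m j c) (of_nat k) / fact j = 0" by simp
    qed
  qed simp
  finally show ?thesis .
qed

lemma gact_mono_nz: "m \<in> Qmon \<Longrightarrow> gact x (mono_y m) n \<noteq> 0 \<Longrightarrow> n - m \<in> Qmon"
  unfolding gact_def
  by (elim sum.not_neutral_contains_not_neutral) (use deriv_pow_mono_nz in force)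

lemma gact_mono_self:
  assumes "m \<in> Qmon" shows "gact x (mono_y m) m = 1"
  using gact_mono[OF assms Qmon_0, of x 1] by simp

text \<open>The action is multiplicative and y^(km) is the k-th power of y^m. After division by
  y^(km) the k-th power of 1 + h remains.\<close>

lemma gact_mono_scale:
  assumes m: "m \<in> Qmon" and c: "c \<in> Qmon"
  shows "gact x (mono_y (int k *s m)) (int k *s m + c)
    = spow (\<lambda>n. mono_y 0 n + unit_tail m (gact x (mono_y m)) n) k c"
  using c
proof (induction k arbitrary: c)
  case 0
  show ?case by (simp add: gact_mono_0 spow_0)
next
  case (Suc k)
  let ?M = "int k *s m" and ?Y = "gact x (mono_y m)" and ?Z = "gact x (mono_y (int k *s m))"
  let ?u = "\<lambda>n. mono_y 0 n + unit_tail m ?Y n"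
  let ?Q = "\<lambda>n. {(a, b). a \<in> Qmon \<and> b \<in> Qmon \<and> a + b = n}"
  have M: "?M \<in> Qmon" by (rule Qmon_scale[OF m])
  have u: "?Y (m + a) = ?u a" if "a \<in> Qmon" for a
  proof (cases "a = 0")
    case True
    then show ?thesis using gact_mono_self[OF m, of x] Npos_deg[of 0] by (auto simp: mono_y_def unit_tail_def)
  next
    case False
    then have "a \<in> Npos" using that by (simp add: Qmon_def)
    then show ?thesis using False by (simp add: mono_y_def unit_tail_def)
  qed
  have S: "int (Suc k) *s m = m + ?M" by (simp add: vector_sadd_rdistrib)
  have "gact x (mono_y (int (Suc k) *s m)) (int (Suc k) *s m + c) = series_mult ?Y ?Z (m + ?M + c)"
    unfolding S series_mult_mono[OF m M, symmetric] gact_series_mult ..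
  also have "\<dots> = (\<Sum>(a, b)\<in>(\<lambda>(a, b). (m + a, ?M + b)) ` ?Q c. ?Y a * ?Z b)"
    unfolding series_mult_def
  proof (rule sum.mono_neutral_right)
    show "(\<lambda>(a, b). (m + a, ?M + b)) ` ?Q c \<subseteq> ?Q (m + ?M + c)"
      using M m by (auto simp: Qmon_add)
    show "\<forall>p\<in>?Q (m + ?M + c) - (\<lambda>(a, b). (m + a, ?M + b)) ` ?Q c. (case p of (a, b) \<Rightarrow> ?Y a * ?Z b) = 0"
    proof
      fix p assume p: "p \<in> ?Q (m + ?M + c) - (\<lambda>(a, b). (m + a, ?M + b)) ` ?Q c"
      obtain a b where ab: "p = (a, b)" by force
      have "?Y a * ?Z b = 0"
      proof (rule ccontr)
        assume "?Y a * ?Z b \<noteq> 0"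
        then have "a - m \<in> Qmon" "b - ?M \<in> Qmon" using gact_mono_nz[OF m] gact_mono_nz[OF M] by auto
        moreover have "(a - m) + (b - ?M) = c" using p ab by (auto simp: algebra_simps)
        ultimately have "(a - m, b - ?M) \<in> ?Q c" by simp
        then have "(\<lambda>(a, b). (m + a, ?M + b)) (a - m, b - ?M) \<in> (\<lambda>(a, b). (m + a, ?M + b)) ` ?Q c"
          by (rule imageI)
        then show False using p ab by simp
      qed
      then show "(case p of (a, b) \<Rightarrow> ?Y a * ?Z b) = 0" by (simp add: ab)
    qed
  qed (rule finite_splits)
  also have "\<dots> = (\<Sum>(a, b)\<in>?Q c. ?Y (m + a) * ?Z (?M + b))"
    by (subst sum.reindex) (auto simp: inj_on_def case_prod_unfold)
  also have "\<dots> = series_mult ?u (spow ?u k) c"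
    unfolding series_mult_def by (intro sum.cong) (auto simp: u Suc.IH)
  finally show ?case by (simp add: spow_Suc)
qed

text \<open>The part with j at least 1 of exp(X) applied to log y^m: the first derivation gives
  \<open>dlog\<close>, the other j - 1 act on a series.\<close>

definition log_tail :: "(int^'r \<Rightarrow> rat) \<Rightarrow> int^'r \<Rightarrow> int^'r \<Rightarrow> rat" where
  "log_tail x m n = (\<Sum>j = 1..nat (deg n). (deriv_act x ^^ (j - 1)) (dlog x m) n / fact j)"

text \<open>This justifies the symbols \<open>log y_i\<close>. The coefficient of y^(km+c) in exp(X)
  y^(km) is computed once through \<open>twist\<close> and once by the binomial theorem for (1 +
  h)^k; equating the coefficients of k gives \<open>log_tail\<close> on one side and log(1 + h) on
  the other.\<close>

lemma log1p_unit_tail: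
  assumes m: "m \<in> Qmon" and c: "c \<in> Qmon"
  shows "log1p_series (unit_tail m (gact x (mono_y m))) c = log_tail x m c"
proof -
  interpret ratq: rat_algebra "\<lambda>c :: rat. c" by standard auto
  let ?h = "unit_tail m (gact x (mono_y m))" and ?d = "nat (deg c)"
  have h0: "?h 0 = 0" using Npos_deg[of 0] by (auto simp: unit_tail_def)
  have z: "spow ?h j c = 0" if "?d < j" for j using spow_nz[of ?h j c] h0 that by fastforce
  define P where "P = case_sum binomial_poly (\<lambda>j. twist x m j c)"
  define r where "r = case_sum (\<lambda>j. spow ?h j c) (\<lambda>j. - 1 / fact j)"
  have split: "(\<Sum>p\<in>{..?d} <+> {..?d}. F (P p) * r p)
      = (\<Sum>j\<le>?d. F (binomial_poly j) * spow ?h j c) - (\<Sum>j\<le>?d. F (twist x m j c) / fact j)" for F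
    by (simp add: sum.Plus P_def r_def sum_negf)
  have "(\<Sum>p\<in>{..?d} <+> {..?d}. coeff (P p) 1 * r p) = 0"
  proof (rule ratq.linear_coeff_eq_0[where P = P and r = r])
    fix k :: nat
    have "(\<Sum>j\<le>?d. poly (twist x m j c) (of_nat k) / fact j) = (\<Sum>j<Suc (k + ?d). of_nat (k choose j) * spow ?h j c)"
      unfolding gact_mono[OF m c, symmetric] gact_mono_scale[OF m c]
      by (rule spow_one_plus) (use c in auto)
    also have "\<dots> = (\<Sum>j\<le>?d. of_nat (k choose j) * spow ?h j c)"
      by (rule sum.mono_neutral_right) (auto simp: z)
    finally show "(\<Sum>p\<in>{..?d} <+> {..?d}. poly (P p) (of_nat k) * r p) = 0"
      unfolding split[of "\<lambda>p. poly p (of_nat k)"] by (simp add: poly_binomial_poly)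
  qed simp
  then have "(\<Sum>j\<le>?d. coeff (binomial_poly j) 1 * spow ?h j c) = (\<Sum>j\<le>?d. coeff (twist x m j c) 1 / fact j)"
    unfolding split[of "\<lambda>p. coeff p 1"] by simp
  moreover have "(\<Sum>j\<le>?d. coeff (binomial_poly j) 1 * spow ?h j c) = log1p_series ?h c"
  proof -
    have "coeff (binomial_poly j) 1 = (- 1) ^ (j + 1) / of_nat j" if "1 \<le> j" for j
      using that coeff_binomial_poly_1[of "j - 1"] by (cases j) simp_all
    then have "(\<Sum>j\<in>{1..?d}. coeff (binomial_poly j) 1 * spow ?h j c) = log1p_series ?h c"
      by (simp add: log1p_series_def subst_series_def)
    moreover have "(\<Sum>j\<le>?d. coeff (binomial_poly j) 1 * spow ?h j c) = (\<Sum>j\<in>{1..?d}. coeff (binomial_poly j) 1 * spow ?h j c)"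
      by (rule sum.mono_neutral_right) (auto simp: not_le)
    ultimately show ?thesis by simp
  qed
  moreover have "(\<Sum>j\<le>?d. coeff (twist x m j c) 1 / fact j) = log_tail x m c"
  proof -
    have "coeff (twist x m j c) 1 = (deriv_act x ^^ (j - 1)) (dlog x m) c" if "1 \<le> j" for j
      using that coeff_twist_1[of x m "j - 1" c] by (cases j) simp_all
    then have "(\<Sum>j\<in>{1..?d}. coeff (twist x m j c) 1 / fact j) = log_tail x m c"
      by (simp add: log_tail_def)
    moreover have "(\<Sum>j\<le>?d. coeff (twist x m j c) 1 / fact j) = (\<Sum>j\<in>{1..?d}. coeff (twist x m j c) 1 / fact j)"
      by (rule sum.mono_neutral_right) (auto simp: not_le)
    ultimately show ?thesis by simp
  qed
  ultimately show ?thesis by simp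
qed

section \<open>The vectors log y^m, L(y^m) and v\<close>

definition logv :: "int^'r \<Rightarrow> (int^'r) \<times> 'r option option \<Rightarrow> rat" where
  "logv m = (\<lambda>(n, \<kappa>). case \<kappa> of Some (Some i) \<Rightarrow> if n = 0 then of_int (coords m $ i) else 0 | _ \<Rightarrow> 0)"

definition Ltv :: "int^'r \<Rightarrow> (int^'r) \<times> 'r option option \<Rightarrow> rat" where
  "Ltv m = (\<lambda>p. emb (dilog_series (mono_y m)) p + (- 1 / 2) * smul (log1p_series (mono_y m)) (logv m) p)"

lemma ract_logv: "ract x (logv m) = emb (dlog x m)"
proof
  fix p :: "(int^'r) \<times> 'r option option"
  obtain n \<kappa> where p: "p = (n, \<kappa>)" by force
  let ?S = "{(a, c). a \<in> Npos \<and> c \<in> Qmon \<and> a + c = n}"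
  have f: "fib a c (\<lambda>\<kappa>. logv m (c, \<kappa>)) \<kappa> = (if c = 0 \<and> \<kappa> = Some None then form a m else 0)" for a c
    using form_coords[of a m] by (auto simp: fib_def logv_def split: option.split)
  have "ract x (logv m) (n, \<kappa>) = (\<Sum>(a, c)\<in>?S. x a * (if c = 0 \<and> \<kappa> = Some None then form a m else 0))"
    by (simp add: ract_def f)
  also have "\<dots> = emb (dlog x m) p" by (subst sum_splits_zero) (auto simp: p emb_def dlog_def)
  finally show "ract x (logv m) p = emb (dlog x m) p" by (simp add: p)
qed

lemma gactv_logv: "gactv x (logv m) = (\<lambda>p. logv m p + emb (log_tail x m) p)"
proof
  fix p :: "(int^'r) \<times> 'r option option"
  obtain n \<kappa> where p: "p = (n, \<kappa>)" by force
  let ?d = "nat (deg n)"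
  have s: "(ract x ^^ Suc j) (logv m) = emb ((deriv_act x ^^ j) (dlog x m))" for j
    by (simp only: funpow_Suc_right comp_def ract_logv ract_pow_emb)
  have "gactv x (logv m) p = (\<Sum>j\<in>insert 0 {1..?d}. (ract x ^^ j) (logv m) (n, \<kappa>) / fact j)"
    unfolding p gactv_def prod.case by (intro sum.cong) auto
  also have "\<dots> = logv m (n, \<kappa>) + (\<Sum>j\<in>{1..?d}. (ract x ^^ j) (logv m) (n, \<kappa>) / fact j)"
    by simp
  also have "(\<Sum>j\<in>{1..?d}. (ract x ^^ j) (logv m) (n, \<kappa>) / fact j)
      = (\<Sum>j\<in>{1..?d}. emb ((deriv_act x ^^ (j - 1)) (dlog x m)) (n, \<kappa>) / fact j)"
  proof (intro sum.cong refl)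
    fix j assume "j \<in> {1..?d}"
    then show "(ract x ^^ j) (logv m) (n, \<kappa>) / fact j = emb ((deriv_act x ^^ (j - 1)) (dlog x m)) (n, \<kappa>) / fact j"
      using s[of "j - 1"] by (cases j) simp_all
  qed
  also have "\<dots> = emb (log_tail x m) (n, \<kappa>)" by (simp add: emb_def log_tail_def)
  finally show "gactv x (logv m) p = logv m p + emb (log_tail x m) p" by (simp add: p)
qed

lemma smul_logv:
  assumes "n \<in> Qmon"
  shows "smul f (logv m) (n, \<kappa>) = (case \<kappa> of Some (Some i) \<Rightarrow> of_int (coords m $ i) * f n | _ \<Rightarrow> 0)"
  unfolding smul_def prod.case using assms
  by (subst sum_splits_zero_Qmon) (auto simp: logv_def split: option.split)

lemma smul_cong:
  assumes "\<And>a. a \<in> Qmon \<Longrightarrow> f a = f' a"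
  shows "smul f b = smul f' b"
  unfolding smul_def using assms by (auto simp: fun_eq_iff intro!: sum.cong)

text \<open>The automorphism carries y^m to Y and log y^m to log y^m + log(1 + h), so each
  constituent of L(y^m) becomes that of L(Y). The index \<open>Some k\<close> omits only the symbol
  v, which \<open>Ltilde\<close> does not record.\<close>

lemma gactv_Ltv:
  assumes m: "m \<in> Npos" and n: "n \<in> Qmon"
  shows "gactv x (Ltv m) (n, Some k) = Ltilde m (gact x (mono_y m)) k n"
proof -
  let ?Y = "gact x (mono_y m)"
  have m0: "mono_y m 0 = 0" using m Npos_deg[of m] by (auto simp: mono_y_def)
  have lg: "smul (gact x (log1p_series (mono_y m))) b = smul (log1p_series ?Y) b" for b
    by (rule smul_cong) (simp add: log1p_series_def gact_subst_series m0)
  have "gactv x (Ltv m) = (\<lambda>p. emb (gact x (dilog_series (mono_y m))) p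
      + (- 1 / 2) * (smul (log1p_series ?Y) (logv m) p + emb (series_mult (log1p_series ?Y) (log_tail x m)) p))"
    unfolding Ltv_def gactv_linear gactv_emb gactv_smul gactv_logv smul_add lg unfolding smul_emb ..
  moreover have "gact x (dilog_series (mono_y m)) n = dilog_series ?Y n"
    unfolding dilog_series_def by (rule gact_subst_series) (use n m0 in auto)
  moreover have "series_mult (log1p_series ?Y) (log_tail x m) n
      = series_mult (log1p_series (unit_tail m ?Y)) (log1p_series ?Y) n"
    by (subst series_mult_commute, rule series_mult_cong) (simp_all add: log1p_unit_tail Npos_Qmon[OF m])
  ultimately show ?thesis
    using n by (auto simp: Ltilde_def emb_def smul_logv split: option.split)
qed

lemma Ltilde_eq_0: "n \<notin> Qmon \<Longrightarrow> Ltilde m Y k n = 0"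
proof -
  assume n: "n \<notin> Qmon"
  have s: "series_mult f g n = 0" for f g
    using series_mult_nz[of f g n] n Qmon_add by blast
  have "subst_series c Y n = 0" for c
    unfolding subst_series_def
  proof (intro sum.neutral ballI)
    fix j assume "j \<in> {1..nat (deg n)}"
    then show "c j * spow Y j n = 0" by (cases j) (simp_all add: spow_Suc s)
  qed
  then show ?thesis by (simp add: Ltilde_def dilog_series_def log1p_series_def s split: option.split)
qed

lemma scale_inj: "m \<in> Npos \<Longrightarrow> int j *s m = int k *s m \<longleftrightarrow> j = k"
  using Npos_deg[of m] by (metis deg_scale mult_cancel_right not_one_le_zero of_nat_eq_iff)

lemma subst_series_mono:
  assumes m: "m \<in> Npos" and j: "j \<ge> 1"
  shows "subst_series c (mono_y m) (int j *s m) = c j"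
proof -
  have d: "int j \<le> int j * deg m" using Npos_deg[OF m] j by simp
  then have d': "j \<le> nat (int j * deg m)" by linarith
  have "subst_series c (mono_y m) (int j *s m) = (\<Sum>i\<in>{j}. c i * spow (mono_y m) i (int j *s m))"
    unfolding subst_series_def spow_mono[OF Npos_Qmon[OF m]] unfolding mono_y_def
    by (rule sum.mono_neutral_right) (use j d' in \<open>auto simp: scale_inj m deg_scale\<close>)
  then show ?thesis by (simp add: spow_mono[OF Npos_Qmon[OF m]]) (simp add: mono_y_def)
qed

lemma subst_series_mono_0:
  assumes m: "m \<in> Npos" and n: "\<And>j. j \<ge> 1 \<Longrightarrow> n \<noteq> int j *s m"
  shows "subst_series c (mono_y m) n = 0"
  unfolding subst_series_def spow_mono[OF Npos_Qmon[OF m]] unfolding mono_y_def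
  by (rule sum.neutral) (use n in auto)

lemma Psi_scale: "m \<in> Npos \<Longrightarrow> j \<ge> 1 \<Longrightarrow> Psi m (int j *s m) = (- 1) ^ (j + 1) / of_nat j ^ 2"
proof -
  assume "m \<in> Npos" "j \<ge> 1"
  then have "{i. i \<ge> 1 \<and> int j *s m = int i *s m} = {j}" by (auto simp: scale_inj)
  then show ?thesis unfolding Psi_def by simp
qed

lemma Psi_0: "(\<And>j. j \<ge> 1 \<Longrightarrow> n \<noteq> int j *s m) \<Longrightarrow> Psi m n = 0"
  unfolding Psi_def by (rule sum.neutral) auto

lemma dilog_mono: "m \<in> Npos \<Longrightarrow> dilog_series (mono_y m) n = Psi m n"
  by (cases "\<exists>j\<ge>1. n = int j *s m")
     (auto simp: dilog_series_def subst_series_mono Psi_scale subst_series_mono_0 Psi_0)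

lemma log1p_mono: "m \<in> Npos \<Longrightarrow> of_int (coords m $ i) * log1p_series (mono_y m) n = of_int (coords n $ i) * Psi m n"
  by (cases "\<exists>j\<ge>1. n = int j *s m")
     (auto simp: log1p_series_def subst_series_mono Psi_scale subst_series_mono_0 Psi_0 coords_scale power2_eq_square)

text \<open>At n = jm the logarithmic coefficient -1/2 m_i (-1)^(j+1)/j equals -1/2 n_i
  (-1)^(j+1)/j^2. Hence L(y^m) = sum_n Psi_n y^n (1 - 1/2 log y^n), which is the logarithm of Psi[m]
  applied to v.\<close>

lemma Ltv_eq:
  assumes m: "m \<in> Npos" and n: "n \<in> Qmon"
  shows "Ltv m (n, \<kappa>) = (case \<kappa> of None \<Rightarrow> 0 | Some None \<Rightarrow> Psi m n
    | Some (Some i) \<Rightarrow> - 1 / 2 * of_int (coords n $ i) * Psi m n)"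
  using log1p_mono[OF m, of _ n]
  by (auto simp: Ltv_def smul_logv n emb_def dilog_mono m split: option.split)

lemma Psi_nz: "Psi m n \<noteq> 0 \<Longrightarrow> \<exists>j\<ge>1. n = int j *s m"
  using Psi_0 by blast

lemma Psi_Gpar: "k \<ge> 1 \<Longrightarrow> Psi (int k *s n) \<in> Gpar n"
proof -
  assume k: "k \<ge> 1"
  have "\<exists>i::nat. i \<ge> 1 \<and> m = int i *s n" if nz: "Psi (int k *s n) m \<noteq> 0" for m
  proof -
    obtain j where "j \<ge> 1" "m = int j *s (int k *s n)" using Psi_nz[OF nz] by blast
    then show ?thesis using k by (intro exI[of _ "j * k"]) (auto simp: vector_smult_assoc)
  qed
  then show ?thesis by (auto simp: Gpar_def)
qed

text \<open>Every term of X_a applied to y^c (1 - 1/2 log y^c) carries the factor {a, c}, which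
  vanishes if a and c are multiples of the same vector.\<close>

lemma ract_Ltv:
  assumes x: "x \<in> Gpar n" and k: "k \<ge> 1" and m: "int k *s n \<in> Npos"
  shows "ract x (Ltv (int k *s n)) = (\<lambda>_. 0)"
proof
  fix p :: "(int^'r) \<times> 'r option option"
  obtain n' \<kappa> where p: "p = (n', \<kappa>)" by force
  have "x a * fib a c (\<lambda>\<kappa>. Ltv (int k *s n) (c, \<kappa>)) \<kappa> = 0" if "c \<in> Qmon" for a c
  proof -
    have z: "x a * Psi (int k *s n) c * form a c = 0"
      using x Psi_Gpar[OF k] by (rule Gpar_form)
    have s: "(\<Sum>i\<in>UNIV. form a (e i) * (of_int (coords c $ i) * Psi (int k *s n) c) / 2) = form a c * Psi (int k *s n) c / 2"
      unfolding form_coords[of a c, symmetric] by (simp add: sum_distrib_right sum_divide_distrib mult.assoc)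
    show ?thesis
      using z by (auto simp: fib_def Ltv_eq[OF m that] s sum_negf split: option.split)
  qed
  then show "ract x (Ltv (int k *s n)) p = 0"
    by (auto simp: p ract_def intro!: sum.neutral)
qed

lemma gactv_Ltv_Gpar:
  assumes x: "x \<in> Gpar n" and k: "k \<ge> 1" and m: "int k *s n \<in> Npos"
  shows "gactv x (Ltv (int k *s n)) = Ltv (int k *s n)"
proof
  fix p :: "(int^'r) \<times> 'r option option"
  obtain n' \<kappa> where p: "p = (n', \<kappa>)" by force
  have z: "(ract x ^^ j) (\<lambda>_. 0) = (\<lambda>_. 0)" for j by (induction j) (simp_all add: ract_0)
  have "(ract x ^^ Suc j) (Ltv (int k *s n)) = (\<lambda>_. 0)" for j
    by (simp only: funpow_Suc_right comp_def ract_Ltv[OF assms] z)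
  then have "(ract x ^^ j) (Ltv (int k *s n)) p / fact j = (if j = 0 then Ltv (int k *s n) p else 0)" for j
    by (cases j) simp_all
  then show "gactv x (Ltv (int k *s n)) p = Ltv (int k *s n) p" by (simp add: gactv_def p)
qed

definition v0 :: "(int^'r) \<times> 'r option option \<Rightarrow> rat" where
  "v0 = (\<lambda>(n, \<kappa>). if n = 0 \<and> \<kappa> = None then 1 else 0)"

lemma ract_v0:
  assumes "n \<in> Npos"
  shows "ract x v0 (n, \<kappa>) = (case \<kappa> of None \<Rightarrow> 0 | Some None \<Rightarrow> x n | Some (Some i) \<Rightarrow> - 1 / 2 * of_int (coords n $ i) * x n)"
  unfolding ract_def prod.case using assms
  by (subst sum_splits_zero) (auto simp: v0_def fib_0, auto simp: fib_def split: option.split)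

text \<open>One application to v gives the combination of the L(y^(kn)), and a second one kills it;
  the exponential series stops after its linear term. Sums over K serve walls crossed
  simultaneously.\<close>

lemma gactv_v0:
  assumes fin: "finite K" and n: "n \<in> Npos" and k: "\<And>\<iota>. \<iota> \<in> K \<Longrightarrow> k \<iota> \<ge> (1::nat)" and n': "n' \<in> Qmon"
  shows "gactv (\<lambda>m. \<Sum>\<iota>\<in>K. c \<iota> * Psi (int (k \<iota>) *s n) m) v0 (n', \<kappa>)
    = v0 (n', \<kappa>) + (\<Sum>\<iota>\<in>K. c \<iota> * Ltv (int (k \<iota>) *s n) (n', \<kappa>))"
proof -
  let ?x = "\<lambda>m. \<Sum>\<iota>\<in>K. c \<iota> * Psi (int (k \<iota>) *s n) m"
  let ?L = "\<lambda>p. \<Sum>\<iota>\<in>K. c \<iota> * Ltv (int (k \<iota>) *s n) p"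
  have m: "int (k \<iota>) *s n \<in> Npos" if "\<iota> \<in> K" for \<iota>
    using n k[OF that] by (simp add: Npos_iff Qmon_scale deg_scale)
  have x: "?x \<in> Gpar n"
  proof (rule Gpar_sum)
    fix \<iota> assume "\<iota> \<in> K"
    then show "(\<lambda>m. c \<iota> * Psi (int (k \<iota>) *s n) m) \<in> Gpar n"
      using Gpar_gpow[OF Psi_Gpar[OF k], of \<iota> "n" "c \<iota>"] by (simp add: gpow_def)
  qed
  have L0: "?L (0, \<kappa>) = 0" for \<kappa>
  proof (rule sum.neutral, rule ballI)
    fix \<iota> assume i: "\<iota> \<in> K"
    have "Psi (int (k \<iota>) *s n) 0 = 0"
    proof (rule Psi_0)
      fix j :: nat assume "j \<ge> 1"
      then show "0 \<noteq> int j *s (int (k \<iota>) *s n)" using Npos_deg[OF m[OF i]] deg_scale[of "int j" "int (k \<iota>) *s n"] k[OF i] by auto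
    qed
    then show "c \<iota> * Ltv (int (k \<iota>) *s n) (0, \<kappa>) = 0"
      by (auto simp: Ltv_eq[OF m[OF i] Qmon_0] split: option.split)
  qed
  have r1: "ract ?x v0 (a, \<kappa>) = ?L (a, \<kappa>)" if "a \<in> Qmon" for a \<kappa>
  proof (cases "a \<in> Npos")
    case True
    have "?L (a, \<kappa>) = (\<Sum>\<iota>\<in>K. c \<iota> * (case \<kappa> of None \<Rightarrow> 0 | Some None \<Rightarrow> Psi (int (k \<iota>) *s n) a
        | Some (Some i) \<Rightarrow> - 1 / 2 * of_int (coords a $ i) * Psi (int (k \<iota>) *s n) a))"
      by (intro sum.cong refl) (simp add: Ltv_eq[OF m that])
    then show ?thesis
      unfolding ract_v0[OF True]
      by (auto simp: sum_distrib_left sum_negf algebra_simps sum_divide_distrib split: option.split)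
  next
    case False
    then have a: "a = 0" using that by (simp add: Qmon_def)
    have "ract ?x v0 (0, \<kappa>) = 0"
    proof (rule ccontr)
      assume "ract ?x v0 (0, \<kappa>) \<noteq> 0"
      from ract_nz[OF this] show False using Npos_add_Qmon Npos_deg[of 0] by force
    qed
    then show ?thesis using L0 a by simp
  qed
  have r2: "(ract ?x ^^ Suc (Suc j)) v0 = (\<lambda>_. 0)" for j
  proof -
    have "ract ?x (ract ?x v0) = ract ?x ?L"
    proof
      fix p :: "(int^'r) \<times> 'r option option"
      obtain a \<kappa>' where "p = (a, \<kappa>')" by force
      then show "ract ?x (ract ?x v0) p = ract ?x ?L p" using ract_cong[of a "ract ?x v0" ?L ?x \<kappa>'] r1 by blast
    qed
    also have "ract ?x ?L = (\<lambda>p. \<Sum>\<iota>\<in>K. c \<iota> * ract ?x (Ltv (int (k \<iota>) *s n)) p)"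
      by (simp only: ract_sum ract_scale)
    also have "\<dots> = (\<lambda>_. 0)" using ract_Ltv[OF x k m] by (auto intro!: sum.neutral)
    finally have "ract ?x (ract ?x v0) = (\<lambda>_. 0)" .
    moreover have "(ract ?x ^^ j) (\<lambda>_. 0) = (\<lambda>_. 0)" for j by (induction j) (simp_all add: ract_0)
    ultimately show ?thesis by (simp only: funpow_Suc_right comp_def)
  qed
  have t: "(ract ?x ^^ j) v0 (n', \<kappa>) / fact j
      = (if j = 0 then v0 (n', \<kappa>) else 0) + (if j = 1 then ?L (n', \<kappa>) else 0)" for j
  proof (cases j)
    case (Suc i)
    then show ?thesis using r1[OF n'] r2[of "i - 1"] by (cases i) simp_all
  qed simp
  have "gactv ?x v0 (n', \<kappa>) = v0 (n', \<kappa>) + (if 1 \<le> nat (deg n') then ?L (n', \<kappa>) else 0)"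
    unfolding gactv_def prod.case t by (simp add: sum.distrib)
  moreover have "?L (n', \<kappa>) = 0" if "\<not> 1 \<le> nat (deg n')"
  proof -
    have "deg n' \<le> 0" using that by linarith
    then show ?thesis using Qmon_deg_0[OF n'] L0 by simp
  qed
  ultimately show ?thesis by auto
qed

text \<open>L(y^m) cut down to \<open>Qmon\<close> and degree at most l. Outside this range the
  truncated exponentials act as the identity, so the cut makes the fixed-point and jump formulas
  hold for whole vectors.\<close>

definition Lvec :: "nat \<Rightarrow> int^'r \<Rightarrow> (int^'r) \<times> 'r option option \<Rightarrow> rat" where
  "Lvec l m = (\<lambda>(n, \<kappa>). if n \<in> Qmon \<and> deg n \<le> int l then Ltv m (n, \<kappa>) else 0)"

lemma app_gexp_outside:
  assumes "n \<notin> Qmon \<or> int l < deg n"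
  shows "app (gexp l x) b (n, \<kappa>) = b (n, \<kappa>)"
proof -
  have z: "app (rho l x) b' (n, \<kappa>) = 0" for b'
    using filtD1[OF rho_filt, of l x b' n \<kappa>] assms by fastforce
  have "app (rho l x ^ j) b (n, \<kappa>) / fact j = (if j = 0 then b (n, \<kappa>) else 0)" for j
    by (cases j) (simp_all add: z)
  then show ?thesis by (simp add: gexp_def app_sum)
qed

lemma app_gexp_Lvec_Gpar:
  assumes x: "x \<in> Gpar n" and k: "k \<ge> 1" and m: "int k *s n \<in> Npos"
  shows "app (gexp l x) (Lvec l (int k *s n)) = Lvec l (int k *s n)"
proof
  fix p :: "(int^'r) \<times> 'r option option"
  obtain n' \<kappa> where p: "p = (n', \<kappa>)" by force
  show "app (gexp l x) (Lvec l (int k *s n)) p = Lvec l (int k *s n) p"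
  proof (cases "n' \<notin> Qmon \<or> int l < deg n'")
    case False
    then have "app (gexp l x) (Lvec l (int k *s n)) p = gactv x (Ltv (int k *s n)) (n', \<kappa>)"
      unfolding p by (subst app_gexp) (auto simp: Lvec_def intro!: gactv_cong)
    then show ?thesis using False by (simp add: gactv_Ltv_Gpar[OF assms] p Lvec_def)
  qed (use app_gexp_outside p in blast)
qed

lemma app_gexp_v0:
  assumes fin: "finite K" and n: "n \<in> Npos" and k: "\<And>\<iota>. \<iota> \<in> K \<Longrightarrow> k \<iota> \<ge> (1::nat)"
  shows "app (gexp l (\<lambda>m. \<Sum>\<iota>\<in>K. c \<iota> * Psi (int (k \<iota>) *s n) m)) v0
    = (\<lambda>p. v0 p + (\<Sum>\<iota>\<in>K. c \<iota> * Lvec l (int (k \<iota>) *s n) p))"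
proof
  fix p :: "(int^'r) \<times> 'r option option"
  obtain n' \<kappa> where p: "p = (n', \<kappa>)" by force
  let ?x = "\<lambda>m. \<Sum>\<iota>\<in>K. c \<iota> * Psi (int (k \<iota>) *s n) m"
  show "app (gexp l ?x) v0 p = v0 p + (\<Sum>\<iota>\<in>K. c \<iota> * Lvec l (int (k \<iota>) *s n) p)"
  proof (cases "n' \<notin> Qmon \<or> int l < deg n'")
    case True
    then show ?thesis using app_gexp_outside[OF True, of ?x v0 \<kappa>] by (auto simp: p Lvec_def)
  next
    case False
    then show ?thesis using gactv_v0[OF fin n k, where n' = n' and \<kappa> = \<kappa> and c = c]
      by (simp add: p app_gexp Lvec_def)
  qed
qed

lemma app_gexp_Lvec:
  assumes m: "m \<in> Npos" and n: "deg n \<le> int l"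
  shows "app (gexp l g) (Lvec l m) (n, Some k) = Ltilde m (gact g (mono_y m)) k n"
proof (cases "n \<in> Qmon")
  case True
  then have "app (gexp l g) (Lvec l m) (n, Some k) = gactv g (Ltv m) (n, Some k)"
    using n by (subst app_gexp) (auto simp: Lvec_def intro!: gactv_cong)
  then show ?thesis using gactv_Ltv[OF m True] by simp
next
  case False
  then show ?thesis by (simp add: app_gexp_outside Ltilde_eq_0 Lvec_def)
qed

text \<open>L(y^m) has no terms below degree deg m. This is the source of local finiteness of the
  final sum.\<close>

lemma Lvec_eq_0:
  assumes m: "m \<in> Npos" and l: "int l < deg m"
  shows "Lvec l m = (\<lambda>_. 0)"
proof
  fix p :: "(int^'r) \<times> 'r option option"
  obtain n \<kappa> where p: "p = (n, \<kappa>)" by force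
  have "Psi m n = 0" if "deg n \<le> int l"
  proof (rule ccontr)
    assume "Psi m n \<noteq> 0"
    then obtain j where j: "j \<ge> 1" "n = int j *s m" using Psi_nz by blast
    have "1 * deg m \<le> int j * deg m" using Npos_deg[OF m] j(1) by (intro mult_right_mono) auto
    moreover have "deg n = int j * deg m" by (simp add: j(2) deg_scale)
    ultimately show False using that l by linarith
  qed
  then show "Lvec l m p = 0" by (auto simp: p Lvec_def Ltv_eq[OF m] split: option.split)
qed

end

section \<open>Smooth polygons\<close>

text \<open>
  Polygons have to be parametrised so that all derivatives vanish at the corners, because path
  products are only controlled for smooth loops.
\<close>

definition flat_exp :: "real poly \<Rightarrow> real \<Rightarrow> real" where
  "flat_exp p x = (if x > 0 then poly p (1 / x) * exp (- (1 / x)) else 0)"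

lemma poly_times_exp_minus_tendsto_0: "((\<lambda>s. poly p s * exp (- s)) \<longlongrightarrow> (0::real)) at_top"
proof -
  have "((\<lambda>s. \<Sum>i\<le>degree p. coeff p i * (s ^ i / exp s)) \<longlongrightarrow> (\<Sum>i\<le>degree p. coeff p i * 0)) at_top"
    by (intro tendsto_intros tendsto_power_div_exp_0)
  moreover have "(\<lambda>s. poly p s * exp (- s)) = (\<lambda>s. \<Sum>i\<le>degree p. coeff p i * (s ^ i / exp s))"
    by (auto simp: poly_altdef sum_divide_distrib exp_minus divide_inverse[symmetric])
  ultimately show ?thesis by simp
qed

text \<open>With s = 1/x one has d/dx = -s^2 d/ds, so p(s) e^(-s) is sent to s^2 (p - p')(s) e^(-s):
  differentiation stays within the family and acts on the polynomial.\<close>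

lemma flat_exp_DERIV:
  "(flat_exp p has_real_derivative flat_exp ([:0, 0, 1:] * (p - pderiv p)) x) (at x)"
proof -
  consider "x > 0" | "x < 0" | "x = 0" by linarith
  then show ?thesis
  proof cases
    case 1
    have "((\<lambda>x. poly p (1 / x) * exp (- (1 / x))) has_real_derivative
        flat_exp ([:0, 0, 1:] * (p - pderiv p)) x) (at x)"
      using 1 by (auto intro!: derivative_eq_intros simp: flat_exp_def field_simps power2_eq_square)
    then show ?thesis
      by (rule has_field_derivative_transform_within_open[of _ _ _ "{0<..}"])
         (use 1 in \<open>auto simp: flat_exp_def\<close>)
  next
    case 2
    have "((\<lambda>x. 0) has_real_derivative flat_exp ([:0, 0, 1:] * (p - pderiv p)) x) (at x)"
      using 2 by (simp add: flat_exp_def)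
    then show ?thesis
      by (rule has_field_derivative_transform_within_open[of _ _ _ "{..<0}"])
         (use 2 in \<open>auto simp: flat_exp_def\<close>)
  next
    case 3
    \<comment> \<open>The difference quotient at 0 carries an additional factor 1/h = s, whence the
      polynomial s p(s).\<close>
    have "((\<lambda>h. poly (pCons 0 p) (inverse h) * exp (- inverse h)) \<longlongrightarrow> (0::real)) (at_right 0)"
      using filterlim_compose[OF poly_times_exp_minus_tendsto_0 filterlim_inverse_at_top_right] .
    then have "((\<lambda>h. (flat_exp p (0 + h) - flat_exp p 0) / h) \<longlongrightarrow> 0) (at_right 0)"
      by (rule Lim_transform_eventually)
         (auto simp: flat_exp_def eventually_at_filter field_simps)
    moreover have "((\<lambda>h. (flat_exp p (0 + h) - flat_exp p 0) / h) \<longlongrightarrow> 0) (at_left 0)"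
      by (rule Lim_transform_eventually[of "\<lambda>_. 0"]) (auto simp: flat_exp_def eventually_at_filter)
    ultimately have "((\<lambda>h. (flat_exp p (0 + h) - flat_exp p 0) / h) \<longlongrightarrow> 0) (at 0)"
      by (simp add: filterlim_at_split)
    then show ?thesis unfolding 3 DERIV_def by (simp add: flat_exp_def)
  qed
qed

text \<open>Closure under differentiation provides derivatives of every order by iteration. Sums are
  needed because of the product rule.\<close>

inductive_set bump_class :: "(real \<Rightarrow> real) set" where
  prod: "(\<lambda>x. flat_exp p x * flat_exp q (1 - x)) \<in> bump_class"
| add: "f \<in> bump_class \<Longrightarrow> g \<in> bump_class \<Longrightarrow> (\<lambda>x. f x + g x) \<in> bump_class"

lemma bump_class_DERIV:
  "f \<in> bump_class \<Longrightarrow> \<exists>g\<in>bump_class. \<forall>x. (f has_real_derivative g x) (at x)"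
proof (induction rule: bump_class.induct)
  case (prod p q)
  let ?d = "\<lambda>p. [:0, 0, 1:] * (p - pderiv p)"
  have minus: "flat_exp (- q) x = - flat_exp q x" for q x by (simp add: flat_exp_def)
  have "((\<lambda>x. flat_exp p x * flat_exp q (1 - x)) has_real_derivative
      flat_exp (?d p) x * flat_exp q (1 - x) + flat_exp p x * flat_exp (- ?d q) (1 - x)) (at x)" for x
  proof -
    have "((\<lambda>x. flat_exp q (1 - x)) has_real_derivative flat_exp (?d q) (1 - x) * (- 1)) (at x)"
      by (rule DERIV_chain2[OF flat_exp_DERIV]) (auto intro!: derivative_eq_intros)
    from DERIV_mult[OF flat_exp_DERIV[of p x] this] show ?thesis
      by (simp only: minus) (simp add: mult.commute add.commute)
  qed
  moreover have "(\<lambda>x. flat_exp (?d p) x * flat_exp q (1 - x) + flat_exp p x * flat_exp (- ?d q) (1 - x)) \<in> bump_class"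
    by (intro bump_class.intros)
  ultimately show ?case by (intro bexI) auto
next
  case (add f g)
  then obtain f' g' where "f' \<in> bump_class" "g' \<in> bump_class"
    "\<And>x. (f has_real_derivative f' x) (at x)" "\<And>x. (g has_real_derivative g' x) (at x)" by blast
  then show ?case by (intro bexI[of _ "\<lambda>x. f' x + g' x"]) (auto intro: DERIV_add bump_class.add)
qed

text \<open>The normalised integral of the bump supported in [0,1]. The interval
  \<open>{-3<..<4}\<close> is an open neighbourhood of the values 3u - j with u in [0,1] and j = 0,
  1, 2, at which the triangle evaluates it.\<close>

lemma smooth_step_exists:
  "\<exists>S :: nat \<Rightarrow> real \<Rightarrow> real. (\<forall>k. \<forall>x\<in>{-3<..<4}. (S k has_real_derivative S (Suc k) x) (at x)) \<and>
     (\<forall>x\<in>{-3<..0}. S 0 x = 0 \<and> S 1 x = 0) \<and> (\<forall>x\<in>{1..<4}. S 0 x = 1 \<and> S 1 x = 0) \<and>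
     (\<forall>x\<in>{0<..<1}. S 1 x > 0) \<and> strict_mono_on {0..1} (S 0)"
proof -
  define \<phi> where "\<phi> = (\<lambda>x. flat_exp 1 x * flat_exp 1 (1 - x))"
  have \<phi>0: "\<phi> x = 0" if "x \<le> 0 \<or> x \<ge> 1" for x using that by (auto simp: \<phi>_def flat_exp_def)
  have \<phi>pos: "\<phi> x > 0" if "0 < x" "x < 1" for x using that by (auto simp: \<phi>_def flat_exp_def)
  have "\<exists>nx. \<forall>f\<in>bump_class. nx f \<in> bump_class \<and> (\<forall>x. (f has_real_derivative nx f x) (at x))"
    using bump_class_DERIV by metis
  then obtain nx where nx: "\<And>f. f \<in> bump_class \<Longrightarrow> nx f \<in> bump_class"
    "\<And>f x. f \<in> bump_class \<Longrightarrow> (f has_real_derivative nx f x) (at x)" by blast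
  define P where "P k = (nx ^^ k) \<phi>" for k
  have PB: "P k \<in> bump_class" for k
    by (induction k) (auto simp: P_def \<phi>_def intro: nx bump_class.prod)
  have PD: "(P k has_real_derivative P (Suc k) x) (at x)" for k x
    using nx(2)[OF PB[of k]] by (simp add: P_def)
  have "continuous_on {-3..4} \<phi>"
    using PD[of 0] by (intro DERIV_continuous_on[of _ _ "P 1"]) (simp add: P_def has_field_derivative_at_within)
  then obtain G where G: "\<And>x. x \<in> {-3..4} \<Longrightarrow> (G has_vector_derivative \<phi> x) (at x within {-3..4})"
    using antiderivative_continuous by blast
  have GD: "(G has_real_derivative \<phi> x) (at x)" if "x \<in> {-3<..<4}" for x
    using G[of x] that at_within_interior[of x "{-3..4}"]
    by (simp add: has_real_derivative_iff_has_vector_derivative)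
  have Gcont: "continuous_on {x..y} G" if "-3 < x" "y < 4" for x y
    by (rule DERIV_continuous_on[of _ _ \<phi>], rule has_field_derivative_at_within, rule GD) (use that in auto)
  have mono: "G x < G y" if "0 \<le> x" "x < y" "y \<le> 1" for x y
  proof (rule DERIV_pos_imp_increasing_open[OF that(2)])
    fix u assume "x < u" "u < y"
    then show "\<exists>d. (G has_real_derivative d) (at u) \<and> 0 < d"
      using GD[of u] \<phi>pos[of u] that by auto
  next
    show "continuous_on {x..y} G"
      using that by (intro Gcont) auto
  qed
  have const: "G x = G y" if "x \<in> {-3<..<4}" "y \<in> {-3<..<4}" "x < y" "y \<le> 0 \<or> x \<ge> 1" for x y
  proof (rule DERIV_isconst_end[OF that(3), symmetric])
    show "continuous_on {x..y} G"
      using that by (intro Gcont) auto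
    fix u assume "x < u" "u < y"
    then show "(G has_real_derivative 0) (at u)" using GD[of u] \<phi>0[of u] that by auto
  qed
  define C where "C = G 1 - G 0"
  have C: "C > 0" using mono[of 0 1] by (simp add: C_def)
  define S where "S k x = (case k of 0 \<Rightarrow> (G x - G 0) / C | Suc k \<Rightarrow> P k x / C)" for k x
  have "(S k has_real_derivative S (Suc k) x) (at x)" if "x \<in> {-3<..<4}" for k x
  proof (cases k)
    case 0
    have "((\<lambda>x. (G x - G 0) / C) has_real_derivative \<phi> x / C) (at x)"
      using GD[OF that] C by (auto intro!: derivative_eq_intros)
    then show ?thesis by (simp add: 0 S_def[abs_def] P_def)
  next
    case (Suc k')
    show ?thesis unfolding Suc S_def[abs_def] nat.case by (rule DERIV_cdivide[OF PD])
  qed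
  moreover have "S 0 x = 0 \<and> S 1 x = 0" if "x \<in> {-3<..0}" for x
    using that const[of x 0] \<phi>0[of x] by (cases "x = 0") (auto simp: S_def P_def)
  moreover have "S 0 x = 1 \<and> S 1 x = 0" if "x \<in> {1..<4}" for x
    using that const[of 1 x] \<phi>0[of x] C by (cases "x = 1") (auto simp: S_def P_def C_def)
  moreover have "S 1 x > 0" if "x \<in> {0<..<1}" for x
    using that \<phi>pos[of x] C by (auto simp: S_def P_def)
  moreover have "strict_mono_on {0..1} (S 0)"
    using mono C by (auto simp: S_def strict_mono_on_def divide_strict_right_mono)
  ultimately show ?thesis by (intro exI[of _ S]) blast
qed

definition step :: "nat \<Rightarrow> real \<Rightarrow> real" where
  "step = (SOME S. (\<forall>k. \<forall>x\<in>{-3<..<4}. (S k has_real_derivative S (Suc k) x) (at x)) \<and>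
     (\<forall>x\<in>{-3<..0}. S 0 x = 0 \<and> S 1 x = 0) \<and> (\<forall>x\<in>{1..<4}. S 0 x = 1 \<and> S 1 x = 0) \<and>
     (\<forall>x\<in>{0<..<1}. S 1 x > 0) \<and> strict_mono_on {0..1} (S 0))"

lemma
  shows step_DERIV: "x \<in> {-3<..<4} \<Longrightarrow> (step k has_real_derivative step (Suc k) x) (at x)"
    and step_low: "x \<in> {-3<..0} \<Longrightarrow> step 0 x = 0" "x \<in> {-3<..0} \<Longrightarrow> step 1 x = 0"
    and step_high: "x \<in> {1..<4} \<Longrightarrow> step 0 x = 1" "x \<in> {1..<4} \<Longrightarrow> step 1 x = 0"
    and step_pos: "x \<in> {0<..<1} \<Longrightarrow> step 1 x > 0"
    and step_mono: "strict_mono_on {0..1} (step 0)"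
  using someI_ex[OF smooth_step_exists] unfolding step_def[symmetric] by blast+

lemma step_strict: "0 < x \<Longrightarrow> x < 1 \<Longrightarrow> 0 < step 0 x \<and> step 0 x < 1"
  using strict_mono_onD[OF step_mono, of 0 x] strict_mono_onD[OF step_mono, of x 1] step_low(1)[of 0] step_high(1)[of 1] by simp

lemma step_onto: "0 < y \<Longrightarrow> y < 1 \<Longrightarrow> \<exists>x. 0 < x \<and> x < 1 \<and> step 0 x = y"
proof -
  assume y: "0 < y" "y < 1"
  have c: "isCont (step 0) x" if "0 \<le> x" "x \<le> 1" for x
    using step_DERIV[of x 0] that by (intro DERIV_isCont) auto
  have "\<exists>x. 0 \<le> x \<and> x \<le> 1 \<and> step 0 x = y"
    by (rule IVT) (use y c step_low(1)[of 0] step_high(1)[of 1] in auto)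
  then obtain x where x: "0 \<le> x" "x \<le> 1" "step 0 x = y" by blast
  then have "x \<noteq> 0" "x \<noteq> 1" using y step_low(1)[of 0] step_high(1)[of 1] by auto
  then show ?thesis using x by (intro exI[of _ x]) auto
qed

lemma velocityI:
  assumes "u \<in> {0..1}" "(\<gamma> has_vector_derivative v) (at u within {0..1})"
  shows "velocity \<gamma> u = v"
  unfolding velocity_def using assms by (intro vector_derivative_within_closed_interval) auto

lemma linepath_alt: "linepath p q u = p + u *\<^sub>R (q - p)"
  by (simp add: linepath_def algebra_simps)

lemma smooth_linepath: "smooth_curve (linepath p q)"
  and velocity_linepath: "u \<in> {0..1} \<Longrightarrow> velocity (linepath p q) u = q - p"
proof -
  have d: "(linepath p q has_vector_derivative (q - p)) (at u within {0..1})" for u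
    unfolding linepath_def by (auto intro!: derivative_eq_intros simp: algebra_simps)
  define F where "F k = (case k of 0 \<Rightarrow> linepath p q | Suc 0 \<Rightarrow> (\<lambda>_. q - p) | _ \<Rightarrow> (\<lambda>_. 0))" for k
  have "(F k has_vector_derivative F (Suc k) u) (at u within {0..1})" for k u
    using d by (auto simp: F_def split: nat.split)
  moreover have "F 0 = linepath p q" by (simp add: F_def)
  ultimately show "smooth_curve (linepath p q)" unfolding smooth_curve_def by blast
  show "velocity (linepath p q) u = q - p" if "u \<in> {0..1}"
    by (rule velocityI[OF that d])
qed

text \<open>The closed polygon p, q, r, p with one third of the time for each edge. Each summand
  moves only during its own third, so smoothness needs no matching at the corners.\<close>

definition triangle :: "real^'r \<Rightarrow> real^'r \<Rightarrow> real^'r \<Rightarrow> real \<Rightarrow> real^'r" where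
  "triangle p q r u = p + step 0 (3 * u) *\<^sub>R (q - p) + step 0 (3 * u - 1) *\<^sub>R (r - q) + step 0 (3 * u - 2) *\<^sub>R (p - r)"

lemma step_affine_derivative:
  fixes w :: "real^'r"
  assumes "u \<in> {0..1}" "j \<in> {0..2}"
  shows "((\<lambda>u. (3 ^ k * step k (3 * u - j)) *\<^sub>R w) has_vector_derivative (3 ^ Suc k * step (Suc k) (3 * u - j)) *\<^sub>R w) (at u within {0..1})"
proof -
  have "(step k has_real_derivative step (Suc k) (3 * u - j)) (at (3 * u - j))"
    using assms by (intro step_DERIV) auto
  moreover have "((\<lambda>u. 3 * u - j) has_real_derivative 3) (at u within {0..1})"
    by (auto intro!: derivative_eq_intros)
  ultimately have "((\<lambda>u. step k (3 * u - j)) has_real_derivative step (Suc k) (3 * u - j) * 3) (at u within {0..1})"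
    by (rule DERIV_chain2)
  from DERIV_cmult[OF this, of "3 ^ k"]
  have "((\<lambda>u. 3 ^ k * step k (3 * u - j)) has_real_derivative 3 ^ Suc k * step (Suc k) (3 * u - j)) (at u within {0..1})"
    by (simp add: mult_ac)
  from has_vector_derivative_scaleR[OF this has_vector_derivative_const[of w]] show ?thesis by simp
qed

lemma triangle_derivative:
  fixes p q r :: "real^'r"
  assumes "u \<in> {0..1}"
  shows "((\<lambda>u. (3 ^ k * step k (3 * u)) *\<^sub>R (q - p) + (3 ^ k * step k (3 * u - 1)) *\<^sub>R (r - q) + (3 ^ k * step k (3 * u - 2)) *\<^sub>R (p - r))
    has_vector_derivative (3 ^ Suc k * step (Suc k) (3 * u)) *\<^sub>R (q - p) + (3 ^ Suc k * step (Suc k) (3 * u - 1)) *\<^sub>R (r - q)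
      + (3 ^ Suc k * step (Suc k) (3 * u - 2)) *\<^sub>R (p - r)) (at u within {0..1})"
  using step_affine_derivative[OF assms, of 0 k "q - p"] step_affine_derivative[OF assms, of 1 k "r - q"]
    step_affine_derivative[OF assms, of 2 k "p - r"]
  by (auto intro!: has_vector_derivative_add)

lemma smooth_triangle: "smooth_curve (triangle p q r)"
  and velocity_triangle: "u \<in> {0..1} \<Longrightarrow> velocity (triangle p q r) u = (3 * step 1 (3 * u)) *\<^sub>R (q - p)
      + (3 * step 1 (3 * u - 1)) *\<^sub>R (r - q) + (3 * step 1 (3 * u - 2)) *\<^sub>R (p - r)"
proof -
  define T where "T k u = (3 ^ k * step k (3 * u)) *\<^sub>R (q - p) + (3 ^ k * step k (3 * u - 1)) *\<^sub>R (r - q)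
      + (3 ^ k * step k (3 * u - 2)) *\<^sub>R (p - r)" for k u
  define F where "F k u = (if k = 0 then p else 0) + T k u" for k u
  have "(F k has_vector_derivative F (Suc k) u) (at u within {0..1})" if "u \<in> {0..1}" for k u
    using has_vector_derivative_add[OF has_vector_derivative_const[of "if k = 0 then p else 0"] triangle_derivative[OF that, of k q p r]]
    by (simp add: F_def[abs_def] T_def[abs_def])
  moreover have F0: "F 0 = triangle p q r"
    by (simp add: F_def T_def triangle_def fun_eq_iff)
  ultimately show "smooth_curve (triangle p q r)" unfolding smooth_curve_def by blast
  assume u: "u \<in> {0..1}"
  have "(triangle p q r has_vector_derivative F 1 u) (at u within {0..1})"
    using \<open>\<And>u k. u \<in> {0..1} \<Longrightarrow> (F k has_vector_derivative F (Suc k) u) (at u within {0..1})\<close>[OF u, of 0] F0 by simp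
  then show "velocity (triangle p q r) u = (3 * step 1 (3 * u)) *\<^sub>R (q - p)
      + (3 * step 1 (3 * u - 1)) *\<^sub>R (r - q) + (3 * step 1 (3 * u - 2)) *\<^sub>R (p - r)"
    using velocityI[OF u] by (simp add: F_def T_def)
qed

text \<open>Vertices in cyclic order: indices 0 and 3 both give p, so that edge i always runs from
  vertex i to vertex \<open>Suc i\<close>.\<close>

definition vertex :: "'a \<Rightarrow> 'a \<Rightarrow> 'a \<Rightarrow> nat \<Rightarrow> 'a" where
  "vertex p q r i = (if i = 1 then q else if i = 2 then r else p)"

lemma triangle_edge:
  assumes i: "i < 3" and u: "real i \<le> 3 * u" "3 * u \<le> real i + 1"
  shows "triangle p q r u = linepath (vertex p q r i) (vertex p q r (Suc i)) (step 0 (3 * u - real i))"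
    and "velocity (triangle p q r) u = (3 * step 1 (3 * u - real i)) *\<^sub>R (vertex p q r (Suc i) - vertex p q r i)"
proof -
  have u01: "u \<in> {0..1}" using u i by auto
  consider "i = 0" | "i = 1" | "i = 2" using i by linarith
  note cs = this
  show "triangle p q r u = linepath (vertex p q r i) (vertex p q r (Suc i)) (step 0 (3 * u - real i))"
    using cs
  proof cases
    case 1
    then show ?thesis using u u01 by (simp add: triangle_def linepath_alt vertex_def step_low)
  next
    case 2
    then show ?thesis using u u01 by (simp add: triangle_def linepath_alt vertex_def step_low step_high)
  next
    case 3
    then show ?thesis using u u01 by (simp add: triangle_def linepath_alt vertex_def step_low step_high)
  qed
  show "velocity (triangle p q r) u = (3 * step 1 (3 * u - real i)) *\<^sub>R (vertex p q r (Suc i) - vertex p q r i)"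
    using cs
  proof cases
    case 1
    then show ?thesis using u u01 velocity_triangle[OF u01, of p q r] step_low(2)[of "3 * u - 1"] step_low(2)[of "3 * u - 2"] by (simp add: vertex_def)
  next
    case 2
    then show ?thesis using u u01 velocity_triangle[OF u01, of p q r] step_high(2)[of "3 * u"] step_low(2)[of "3 * u - 2"] by (simp add: vertex_def)
  next
    case 3
    then show ?thesis using u u01 velocity_triangle[OF u01, of p q r] step_high(2)[of "3 * u"] step_high(2)[of "3 * u - 1"] by (simp add: vertex_def)
  qed
qed

lemma triangle_loop: "triangle p q r 0 = p" "triangle p q r 1 = p"
  using triangle_edge(1)[of 0 0 p q r] triangle_edge(1)[of 2 1 p q r] step_low(1)[of 0] step_high(1)[of 1]
  by (simp_all add: vertex_def linepath_def)

lemma edge_index: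
  fixes u :: real
  assumes "u \<in> {0..1}"
  obtains i where "i < 3" "real i \<le> 3 * u" "3 * u \<le> real i + 1"
proof -
  consider "3 * u \<le> 1" | "1 \<le> 3 * u" "3 * u \<le> 2" | "2 \<le> 3 * u" by linarith
  then show ?thesis
  proof cases
    case 1
    then show ?thesis using assms that[of 0] by simp
  next
    case 2
    then show ?thesis using assms that[of 1] by simp
  next
    case 3
    then show ?thesis using assms that[of 2] by simp
  qed
qed

section \<open>Wall crossings of smooth triangles\<close>

lemma pairing_scaleR: "pairing n (c *\<^sub>R z) = c * pairing n z"
  by (simp add: pairing_def sum_distrib_left algebra_simps)

lemma pairing_add: "pairing n (y + z) = pairing n y + pairing n z"
  by (simp add: pairing_def sum.distrib algebra_simps)

lemma pairing_diff: "pairing n (y - z) = pairing n y - pairing n z"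
  by (simp add: pairing_def sum_subtractf algebra_simps)

lemma pairing_linepath: "pairing n (linepath p q u) = (1 - u) * pairing n p + u * pairing n q"
  by (simp add: linepath_def pairing_add pairing_scaleR)

lemma Supp_iff: "z \<in> Supp D \<longleftrightarrow> (\<exists>\<iota>. z \<in> support (D \<iota>))"
  by (auto simp: Supp_def)

lemma vertex_props:
  assumes "admissible_curve D (linepath p q)" "admissible_curve D (linepath q r)" "admissible_curve D (linepath r p)" "i < 3"
  shows "admissible_curve D (linepath (vertex p q r i) (vertex p q r (Suc i)))"
  using assms by (cases i rule: nat.exhaust) (auto simp: vertex_def less_Suc_eq numeral_eq_Suc)

lemma admissible_linepathD:
  assumes "admissible_curve D (linepath p q)" "u \<in> {0..1}"
  shows "linepath p q u \<notin> Sing D" "p \<notin> Supp D" "q \<notin> Supp D"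
    "linepath p q u \<in> support (D \<iota>) \<Longrightarrow> pairing (normal (D \<iota>)) (q - p) \<noteq> 0"
    "linepath p q u \<in> support (D \<iota>) \<Longrightarrow> 0 < u \<and> u < 1"
proof -
  have a: "linepath p q u \<notin> Sing D" "linepath p q 0 \<notin> Supp D" "linepath p q 1 \<notin> Supp D"
    "linepath p q u \<in> support (D \<iota>) \<Longrightarrow> pairing (normal (D \<iota>)) (velocity (linepath p q) u) \<noteq> 0"
    using assms unfolding admissible_curve_def weakly_admissible_curve_def by blast+
  then show "linepath p q u \<notin> Sing D" "p \<notin> Supp D" "q \<notin> Supp D"
    "linepath p q u \<in> support (D \<iota>) \<Longrightarrow> pairing (normal (D \<iota>)) (q - p) \<noteq> 0"
    using velocity_linepath[OF assms(2), of p q] by (simp_all add: linepath_0' linepath_1')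
  show "0 < u \<and> u < 1" if "linepath p q u \<in> support (D \<iota>)"
  proof -
    have "u \<noteq> 0" "u \<noteq> 1" using that a(2,3) by (auto simp: Supp_iff)
    then show ?thesis using assms(2) by auto
  qed
qed

text \<open>The corners are end points of admissible edges and thus lie off the support, so walls
  are met only strictly inside a third.\<close>

lemma triangle_crossing:
  assumes adm: "admissible_curve D (linepath p q)" "admissible_curve D (linepath q r)" "admissible_curve D (linepath r p)"
    and i: "i < 3" and u: "real i \<le> 3 * u" "3 * u \<le> real i + 1" and s: "triangle p q r u \<in> support (D \<iota>)"
  shows "real i < 3 * u" "3 * u < real i + 1"
proof -
  let ?w = "step 0 (3 * u - real i)"
  have "3 * u - real i = 0 \<or> 3 * u - real i = 1 \<or> (0 < 3 * u - real i \<and> 3 * u - real i < 1)" using u by linarith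
  then have "?w \<in> {0..1}" using step_strict[of "3 * u - real i"] step_low(1)[of 0] step_high(1)[of 1] by auto
  from admissible_linepathD(5)[OF vertex_props[OF adm i] this] s
  have w: "0 < ?w \<and> ?w < 1" by (simp add: triangle_edge(1)[OF i u])
  have "3 * u - real i \<noteq> 0" using w step_low(1)[of 0] by auto
  moreover have "3 * u - real i \<noteq> 1" using w step_high(1)[of 1] by auto
  ultimately show "real i < 3 * u" "3 * u < real i + 1" using u by auto
qed

lemma step_unit: "x \<in> {0..1} \<Longrightarrow> step 0 x \<in> {0..1}"
  using step_strict[of x] step_low(1)[of 0] step_high(1)[of 1] by (cases "x = 0 \<or> x = 1") auto

text \<open>The velocity vanishes at the corners, but no wall is met there; elsewhere it is a
  positive multiple of the edge direction, and transversality is inherited from the edges.\<close>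

lemma admissible_triangle:
  assumes adm: "admissible_curve D (linepath p q)" "admissible_curve D (linepath q r)" "admissible_curve D (linepath r p)"
  shows "admissible_curve D (triangle p q r)"
proof -
  have "triangle p q r u \<notin> Sing D" and
    "triangle p q r u \<in> support (D \<iota>) \<longrightarrow> pairing (normal (D \<iota>)) (velocity (triangle p q r) u) \<noteq> 0"
    if u01: "u \<in> {0..1}" for u \<iota>
  proof -
    obtain i where i: "i < 3" and u: "real i \<le> 3 * u" "3 * u \<le> real i + 1" using edge_index[OF u01] .
    let ?x = "3 * u - real i"
    have w: "step 0 ?x \<in> {0..1}" using u by (intro step_unit) auto
    note L = admissible_linepathD[OF vertex_props[OF adm i] w]
    show "triangle p q r u \<notin> Sing D" using L(1) by (simp add: triangle_edge(1)[OF i u])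
    show "triangle p q r u \<in> support (D \<iota>) \<longrightarrow> pairing (normal (D \<iota>)) (velocity (triangle p q r) u) \<noteq> 0"
    proof
      assume s: "triangle p q r u \<in> support (D \<iota>)"
      have "step 1 ?x > 0" using triangle_crossing[OF adm i u s] by (intro step_pos) auto
      moreover have "pairing (normal (D \<iota>)) (vertex p q r (Suc i) - vertex p q r i) \<noteq> 0"
        using L(4) s by (simp add: triangle_edge(1)[OF i u])
      ultimately show "pairing (normal (D \<iota>)) (velocity (triangle p q r) u) \<noteq> 0"
        by (simp add: triangle_edge(2)[OF i u] pairing_scaleR)
    qed
  qed
  moreover have "p \<notin> Supp D" using admissible_linepathD(2)[OF adm(1), of 0] by simp
  ultimately show ?thesis
    by (auto simp: admissible_curve_def weakly_admissible_curve_def smooth_triangle triangle_loop)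
qed

text \<open>\<open>step\<close> maps the open unit interval onto itself with positive derivative,
  hence preserves crossings together with their signs.\<close>

lemma triangle_edge_crossing:
  assumes adm: "admissible_curve D (linepath p q)" "admissible_curve D (linepath q r)" "admissible_curve D (linepath r p)"
    and i: "i < 3"
  shows "(\<lambda>(u, \<iota>). (step 0 (3 * u - real i), \<iota>)) ` {(u, \<iota>) \<in> crossings D (triangle p q r). real i < 3 * u \<and> 3 * u < real i + 1}
      = crossings D (linepath (vertex p q r i) (vertex p q r (Suc i)))" (is "?f ` ?A = ?B")
    and "real i < 3 * u \<Longrightarrow> 3 * u < real i + 1 \<Longrightarrow>
      crossing_sign D (triangle p q r) u \<iota> = crossing_sign D (linepath (vertex p q r i) (vertex p q r (Suc i))) (step 0 (3 * u - real i)) \<iota>"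
proof -
  show "?f ` ?A = ?B"
  proof
    show "?f ` ?A \<subseteq> ?B"
    proof clarify
      fix u \<iota> assume u: "real i < 3 * u" "3 * u < real i + 1" and c: "(u, \<iota>) \<in> crossings D (triangle p q r)"
      then show "(step 0 (3 * u - real i), \<iota>) \<in> ?B"
        using step_strict[of "3 * u - real i"] triangle_edge(1)[OF i, of u p q r] by (auto simp: crossings_def)
    qed
    show "?B \<subseteq> ?f ` ?A"
    proof
      fix x assume "x \<in> ?B"
      then obtain w \<iota> where x: "x = (w, \<iota>)" "0 < w" "w < 1" "linepath (vertex p q r i) (vertex p q r (Suc i)) w \<in> support (D \<iota>)"
        by (auto simp: crossings_def)
      then obtain y where y: "0 < y" "y < 1" "step 0 y = w" using step_onto by blast
      define u where "u = (y + real i) / 3"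
      have u: "3 * u - real i = y" by (simp add: u_def field_simps)
      have "triangle p q r u \<in> support (D \<iota>)"
        using triangle_edge(1)[OF i, of u p q r] x y u by simp
      moreover have "0 < u \<and> u < 1" using y i by (auto simp: u_def)
      ultimately have A: "(u, \<iota>) \<in> ?A" using y u by (auto simp: crossings_def)
      have "x = ?f (u, \<iota>)" using u y x by simp
      then show "x \<in> ?f ` ?A" using A by (rule image_eqI)
    qed
  qed
  assume u: "real i < 3 * u" "3 * u < real i + 1"
  have "step 1 (3 * u - real i) > 0" using u by (intro step_pos) auto
  moreover have "step 0 (3 * u - real i) \<in> {0..1}" using u by (intro step_unit) auto
  ultimately show "crossing_sign D (triangle p q r) u \<iota> = crossing_sign D (linepath (vertex p q r i) (vertex p q r (Suc i))) (step 0 (3 * u - real i)) \<iota>"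
    using u by (simp add: crossing_sign_def triangle_edge(2)[OF i] velocity_linepath pairing_scaleR mult_less_0_iff)
qed

section \<open>Null sets, and products over sorted lists\<close>

lemma negligible_lower:
  fixes S :: "(real^'r) set"
  assumes "aff_dim S < int CARD('r)" shows "negligible (affine hull S)"
proof -
  obtain a b where "a \<noteq> 0" "affine hull S \<subseteq> {x. a \<bullet> x = b}"
    using aff_lowdim_subset_hyperplane[of "affine hull S"] assms by auto
  then show ?thesis using negligible_hyperplane negligible_subset by blast
qed

text \<open>A point x seen from p through C lies on the line from p through a point of C, so in the
  affine hull of C and p, which still has dimension at most r - 1. The parameter is nonzero as p is
  not in C.\<close>

lemma negligible_visible:
  fixes C :: "(real^'r) set"
  assumes "aff_dim C = int CARD('r) - 2" "p \<notin> C"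
  shows "negligible {x. \<exists>u\<in>{0..1}. linepath p x u \<in> C}"
proof (rule negligible_subset)
  show "negligible (affine hull (insert p C))"
    by (rule negligible_lower) (use assms in \<open>simp add: aff_dim_insert\<close>)
  show "{x. \<exists>u\<in>{0..1}. linepath p x u \<in> C} \<subseteq> affine hull (insert p C)"
  proof clarify
    fix x and u :: real assume u: "u \<in> {0..1}" "linepath p x u \<in> C"
    then have u0: "u \<noteq> 0" using assms(2) by (auto simp: linepath_def)
    let ?c = "linepath p x u"
    have "x = (1 - 1 / u) *\<^sub>R p + (1 / u) *\<^sub>R ?c"
      using u0 by (simp add: linepath_def algebra_simps)
    moreover have "(1 - 1 / u) *\<^sub>R p + (1 / u) *\<^sub>R ?c \<in> affine hull (insert p C)"
      using u by (intro mem_affine[OF affine_affine_hull]) (auto intro: hull_inc)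
    ultimately show "x \<in> affine hull (insert p C)" by simp
  qed
qed

lemma pairing_inner: "pairing n z = (\<chi> i. of_int (n $ i)) \<bullet> z"
  by (simp add: pairing_def inner_vec_def)

lemma normal_vec_nonzero: "n \<noteq> 0 \<Longrightarrow> (\<chi> i. of_int (n $ i)) \<noteq> (0 :: real^'r)"
  by (auto simp: vec_eq_iff)

lemma negligible_pairing: "n \<noteq> 0 \<Longrightarrow> negligible {z. pairing n z = c}"
  unfolding pairing_inner by (rule negligible_hyperplane) (simp add: normal_vec_nonzero)

text \<open>Reversed as in \<open>gprod_rl\<close>: the earliest crossing is the rightmost
  factor.\<close>

definition lprod :: "('a \<Rightarrow> 'm::monoid_mult) \<Rightarrow> 'a list \<Rightarrow> 'm" where
  "lprod f cs = prod_list (rev (map f cs))"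

lemma lprod_simps [simp]:
  "lprod f [] = 1" "lprod f (x # cs) = lprod f cs * f x" "lprod f (cs @ ds) = lprod f ds * lprod f cs"
  by (simp_all add: lprod_def)

lemma lprod_map: "lprod f (map g cs) = lprod (\<lambda>x. f (g x)) cs"
  by (simp add: lprod_def comp_def)

lemma lprod_cong: "(\<And>x. x \<in> set cs \<Longrightarrow> f x = g x) \<Longrightarrow> lprod f cs = lprod g cs"
  unfolding lprod_def by (metis map_cong)

lemma lprod_commute:
  "(\<And>y. y \<in> set cs \<Longrightarrow> f y * c = c * f y) \<Longrightarrow> lprod f cs * c = c * lprod f cs"
  by (induction cs) (simp_all, metis mult.assoc)

text \<open>Two sorted enumerations differ only by the order among equal times. In the second list
  the head of the first one is preceded only by entries of the same time, with which it
  commutes.\<close>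

lemma lprod_unique:
  assumes "distinct cs" "distinct ds" "sorted (map fst cs)" "sorted (map fst ds)" "set cs = set ds"
    and "\<And>x y. x \<in> set cs \<Longrightarrow> y \<in> set cs \<Longrightarrow> fst x = fst y \<Longrightarrow> f x * f y = f y * f x"
  shows "lprod f cs = lprod f ds"
  using assms
proof (induction cs arbitrary: ds)
  case (Cons x cs)
  then have "x \<in> set ds" by auto
  then obtain as bs where ds: "ds = as @ x # bs" by (meson split_list)
  have as: "f y * f x = f x * f y" if y: "y \<in> set as" for y
  proof -
    have "y \<in> set (x # cs)" using Cons.prems(5) y ds by auto
    moreover have "fst x \<le> fst y" using Cons.prems(3) calculation by auto
    moreover have "fst y \<le> fst x" using Cons.prems(4) y ds by (auto simp: sorted_append)
    ultimately have "fst y = fst x" by simp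
    with \<open>y \<in> set (x # cs)\<close> show ?thesis by (intro Cons.prems(6)) simp_all
  qed
  have "lprod f cs = lprod f (as @ bs)"
  proof (rule Cons.IH)
    show "set cs = set (as @ bs)" using Cons.prems(1,2,5) ds by auto
    show "sorted (map fst (as @ bs))" using Cons.prems(4) ds by (auto simp: sorted_append)
    show "f x' * f y = f y * f x'" if "x' \<in> set cs" "y \<in> set cs" "fst x' = fst y" for x' y
      by (rule Cons.prems(6)) (use that in simp_all)
  qed (use Cons.prems(1-4) ds in auto)
  then show ?case using lprod_commute[of as f "f x"] as by (simp add: ds mult.assoc)
qed simp

lemma sorted_split:
  "sorted (map fst cs) \<Longrightarrow> cs = filter (\<lambda>x. fst x < t) cs @ filter (\<lambda>x. \<not> fst x < t) cs"
proof (induction cs)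
  case (Cons x cs)
  show ?case
  proof (cases "fst x < t")
    case False
    then have "\<forall>y\<in>set cs. \<not> fst y < t" using Cons.prems by auto
    then have "filter (\<lambda>x. fst x < t) cs = []" "filter (\<lambda>x. \<not> fst x < t) cs = cs"
      by (auto simp: filter_empty_conv filter_id_conv)
    then show ?thesis using False by simp
  qed (use Cons in auto)
qed simp

section \<open>Transport operators\<close>

text \<open>\<open>nontrivial\<close> makes the index type a union of the finite sets
  \<open>walls l\<close>, hence countable; points in general position exist only for countably many
  walls. In a positive realization every wall element is nontrivial.\<close>

locale diagram = seed form Nc \<delta> e
  for form :: "int^'r \<Rightarrow> int^'r \<Rightarrow> rat" and Nc :: "(int^'r) set" and \<delta> :: "'r \<Rightarrow> nat" and e :: "'r \<Rightarrow> int^'r" +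
  fixes D :: "'l \<Rightarrow> 'r wall"
  assumes scattering: "scattering_diagram D"
    and consistent: "consistent D"
    and nontrivial: "\<exists>l. \<not> proj_eq l (elt (D \<iota>)) gone"
begin

definition walls :: "nat \<Rightarrow> 'l set" where
  "walls l = {\<iota>. \<not> proj_eq l (elt (D \<iota>)) gone}"

lemma finite_walls: "finite (walls l)"
  using scattering by (simp add: scattering_diagram_def walls_def)

lemma countable_index: "countable (UNIV :: 'l set)"
proof -
  have "UNIV = (\<Union>l. walls l)" using nontrivial by (auto simp: walls_def)
  moreover have "countable (\<Union>l. walls l)" using finite_walls by (auto intro: countable_finite)
  ultimately show ?thesis by simp
qed

lemma wall: "is_wall (D \<iota>)"
  using scattering by (simp add: scattering_diagram_def)

lemma normal_Npos: "normal (D \<iota>) \<in> Npos" and normal_primitive: "primitive (normal (D \<iota>))"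
  and normal_nonzero: "normal (D \<iota>) \<noteq> 0"
  using wall[of \<iota>] by (auto simp: is_wall_def Npr_def primitive_def)

lemma elt_Gpar: "elt (D \<iota>) \<in> Gpar (normal (D \<iota>))"
  using wall[of \<iota>] by (simp add: is_wall_def)

lemma elt_ghat: "elt (D \<iota>) \<in> ghat"
  using Gpar_ghat[OF normal_Npos elt_Gpar] .

lemma support_polyhedron: "polyhedron (support (D \<iota>))"
  using wall[of \<iota>] polyhedron_convex_cone_hull by (auto simp: is_wall_def rational_polyhedral_cone_def)

lemma support_closed: "closed (support (D \<iota>))"
  by (simp add: support_polyhedron polyhedron_imp_closed)

lemma support_perp: "z \<in> support (D \<iota>) \<Longrightarrow> pairing (normal (D \<iota>)) z = 0"
  and support_aff_dim: "aff_dim (support (D \<iota>)) = int CARD('r) - 1"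
  using wall[of \<iota>] by (auto simp: is_wall_def perp_def)

lemma perp_inner: "perp n = {z. (\<chi> i. of_int (n $ i)) \<bullet> z = 0}"
  by (simp add: perp_def pairing_inner)

lemma affine_perp: "affine (perp n)"
  by (simp add: perp_inner affine_hyperplane)

lemma aff_dim_perp: "n \<noteq> 0 \<Longrightarrow> aff_dim (perp (n :: int^'r)) = int CARD('r) - 1"
  unfolding perp_inner by (subst aff_dim_hyperplane) (simp_all add: normal_vec_nonzero of_nat_diff)

lemma Sing_subset_Supp: "z \<in> Sing D \<Longrightarrow> z \<in> Supp D"
  using support_closed by (auto simp: Sing_def Supp_def rel_frontier_def)

lemma affine_hull_support: "affine hull (support (D \<iota>)) = perp (normal (D \<iota>))"
proof (rule affine_dim_equal)
  show "affine hull (support (D \<iota>)) \<noteq> {}"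
    using support_aff_dim[of \<iota>] by (auto simp: aff_dim_empty)
  show "affine hull support (D \<iota>) \<subseteq> perp (normal (D \<iota>))"
  proof (rule hull_minimal)
    show "support (D \<iota>) \<subseteq> perp (normal (D \<iota>))" using support_perp by (auto simp: perp_def)
  qed (rule affine_perp)
qed (simp_all add: affine_perp support_aff_dim aff_dim_perp normal_nonzero)

lemma support_local:
  assumes "z \<in> support (D \<iota>)" "z \<notin> Sing D"
  obtains T where "open T" "z \<in> T" "T \<inter> perp (normal (D \<iota>)) \<subseteq> support (D \<iota>)"
proof -
  have "z \<notin> rel_frontier (support (D \<iota>))" using assms(2) by (auto simp: Sing_def)
  then have "z \<in> rel_interior (support (D \<iota>))"
    using assms(1) support_closed by (auto simp: rel_frontier_def)
  then show thesis using that by (auto simp: mem_rel_interior affine_hull_support)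
qed

text \<open>After division of p and q by their gcd, primitivity forces both to be 1 or -1, and the
  positive degrees in \<open>Npos\<close> make the signs agree.\<close>

lemma primitive_unique:
  assumes "primitive n" "primitive n'" "p *s n' = q *s n" "p \<noteq> 0" "n \<in> Npos" "n' \<in> Npos"
  shows "n = n'"
proof -
  have n: "n \<noteq> 0" "n' \<noteq> 0" using assms(1,2) by (auto simp: primitive_def)
  have q: "q \<noteq> 0"
  proof
    assume q0: "q = 0"
    obtain i where i: "n' $ i \<noteq> 0" using n(2) by (auto simp: vec_eq_iff)
    have "p * n' $ i = q * n $ i" using arg_cong[OF assms(3), of "\<lambda>v. v $ i"] by simp
    then show False using q0 i assms(4) by simp
  qed
  define g where "g = gcd p q"
  have g0: "g \<noteq> 0" using assms(4) by (simp add: g_def)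
  then have "\<exists>p' q'. p = p' * g \<and> q = q' * g \<and> coprime p' q'"
    unfolding g_def by (rule gcd_coprime_exists)
  then obtain p' q' where pq': "p = p' * g" "q = q' * g" "coprime p' q'" by blast
  then have pq: "p = g * p'" "q = g * q'" "coprime p' q'" by (simp_all only: mult.commute)
  have pn: "p' * n' $ i = q' * n $ i" for i
  proof -
    have "g * (p' * n' $ i) = g * (q' * n $ i)"
      using arg_cong[OF assms(3), of "\<lambda>v. v $ i"] unfolding pq(1,2) by (simp only: vector_smult_component mult.assoc)
    then show ?thesis using g0 by simp
  qed
  have unit: "\<bar>a\<bar> = 1" if "\<And>i. a * m $ i = c * k $ i" "coprime a c" "primitive k" for a c :: int and m k :: "int^'r"
  proof -
    have "a dvd k $ i" for i
      using that(1)[of i] that(2) by (metis coprime_dvd_mult_right_iff dvd_triv_left)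
    then have "k = a *s (\<chi> i. k $ i div a)" by (simp add: vec_eq_iff)
    then show ?thesis using that(3) by (auto simp: primitive_def)
  qed
  have "\<bar>p'\<bar> = 1" by (rule unit[OF pn pq(3) assms(1)])
  moreover have "\<bar>q'\<bar> = 1"
    by (rule unit[of q' n p' n']) (use pn pq(3) assms(2) in \<open>auto simp: coprime_commute\<close>)
  moreover have "p' *s n' = q' *s n" using pn by (simp add: vec_eq_iff)
  then have "p' * deg n' = q' * deg n" using deg_scale by metis
  ultimately have d: "p' = 1 \<or> p' = - 1" "q' = 1 \<or> q' = - 1" "p' * deg n' = q' * deg n" by linarith+
  then have "p' = q'" using Npos_deg[OF assms(5)] Npos_deg[OF assms(6)] by (elim disjE) simp_all
  then have "n' $ i = n $ i" for i using pn[of i] d(1) by auto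
  then show ?thesis by (simp add: vec_eq_iff)
qed

lemma perp_subset_imp_eq:
  assumes "perp n \<subseteq> perp n'" "primitive n" "primitive n'" "n \<in> Npos" "n' \<in> Npos"
  shows "n = n'"
proof -
  have "n \<noteq> 0" using assms(2) by (simp add: primitive_def)
  then obtain i where i: "n $ i \<noteq> 0" by (auto simp: vec_eq_iff)
  have "n $ i *s n' = n' $ i *s n"
  proof -
    have "n $ i * n' $ j = n' $ i * n $ j" for j
    proof (cases "i = j")
      case False
      \<comment> \<open>The vector with entries n_j and -n_i in positions i and j is orthogonal to
        n; its pairing with n' is a 2 by 2 minor of n and n'.\<close>
      define z :: "real^'r" where "z = (\<chi> k. if k = i then of_int (n $ j) else if k = j then - of_int (n $ i) else 0)"
      have pz: "pairing m z = of_int (m $ i) * of_int (n $ j) - of_int (m $ j) * of_int (n $ i)" for m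
      proof -
        have "pairing m z = (\<Sum>k\<in>UNIV. (if k = i then of_int (m $ i) * of_int (n $ j) else 0) + (if k = j then - (of_int (m $ j) * of_int (n $ i)) else 0))"
          unfolding pairing_def z_def using False by (intro sum.cong) auto
        also have "\<dots> = of_int (m $ i) * of_int (n $ j) - of_int (m $ j) * of_int (n $ i)"
          by (simp add: sum.distrib)
        finally show ?thesis .
      qed
      have "z \<in> perp n" by (simp add: perp_def pz)
      then have "pairing n' z = 0" using assms(1) by (auto simp: perp_def)
      then have "(of_int (n' $ i * n $ j) :: real) = of_int (n' $ j * n $ i)" by (simp add: pz)
      then have "n' $ i * n $ j = n' $ j * n $ i" by (simp only: of_int_eq_iff)
      then show ?thesis by (simp add: mult.commute)
    qed (simp add: mult.commute)
    then show ?thesis by (simp add: vec_eq_iff)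
  qed
  then show ?thesis using primitive_unique assms i by blast
qed

text \<open>Near z both walls fill their hyperplanes. If these were distinct, the walls would share
  an open piece of an (r-2)-dimensional space around z, which would put z into
  \<open>Sing D\<close>.\<close>

lemma same_normal:
  assumes z: "z \<notin> Sing D" "z \<in> support (D \<iota>)" "z \<in> support (D \<iota>')"
  shows "normal (D \<iota>) = normal (D \<iota>')"
proof (rule ccontr)
  let ?n = "normal (D \<iota>)" and ?n' = "normal (D \<iota>')" and ?S = "support (D \<iota>)" and ?S' = "support (D \<iota>')"
  assume ne: "?n \<noteq> ?n'"
  have "\<not> perp ?n \<subseteq> perp ?n'"
    using perp_subset_imp_eq ne normal_primitive normal_Npos by blast
  moreover have "0 \<in> perp ?n \<inter> perp ?n'" by (simp add: perp_def pairing_def)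
  ultimately have dim: "aff_dim (perp ?n \<inter> perp ?n') = int CARD('r) - 2"
    using aff_dim_affine_Int_hyperplane[OF affine_perp[of ?n], of "\<chi> i. of_int (?n' $ i)" 0] aff_dim_perp[OF normal_nonzero]
    by (auto simp: perp_inner[of ?n'])
  obtain T where T: "open T" "z \<in> T" "T \<inter> perp ?n \<subseteq> ?S" using support_local z by blast
  obtain T' where T': "open T'" "z \<in> T'" "T' \<inter> perp ?n' \<subseteq> ?S'" using support_local z by blast
  have sub: "?S \<inter> ?S' \<subseteq> perp ?n \<inter> perp ?n'" using support_perp by (auto simp: perp_def)
  have "aff_dim (perp ?n \<inter> perp ?n' \<inter> (T \<inter> T')) = aff_dim (perp ?n \<inter> perp ?n')"
  proof (rule aff_dim_convex_Int_open)
    show "convex (perp ?n \<inter> perp ?n')" by (intro convex_Int affine_imp_convex affine_perp)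
    show "open (T \<inter> T')" using T T' by auto
    show "perp ?n \<inter> perp ?n' \<inter> (T \<inter> T') \<noteq> {}" using sub z T T' by auto
  qed
  moreover have "aff_dim (perp ?n \<inter> perp ?n' \<inter> (T \<inter> T')) \<le> aff_dim (?S \<inter> ?S')"
    by (rule aff_dim_subset) (use T T' in auto)
  moreover have "aff_dim (?S \<inter> ?S') \<le> aff_dim (perp ?n \<inter> perp ?n')" by (rule aff_dim_subset[OF sub])
  ultimately have "aff_dim (?S \<inter> ?S') = int CARD('r) - 2" using dim by simp
  then have "z \<in> Sing D" using z unfolding Sing_def by blast
  then show False using z by simp
qed

section \<open>Path products along segments\<close>

definition cross_op :: "nat \<Rightarrow> (real \<Rightarrow> real^'r) \<Rightarrow> real \<times> 'l \<Rightarrow> ((int^'r) \<times> 'r option option) lop" where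
  "cross_op l \<beta> = (\<lambda>(u, \<iota>). gexp l (gpow (elt (D \<iota>)) (crossing_sign D \<beta> u \<iota>)))"

definition lcross :: "nat \<Rightarrow> (real \<Rightarrow> real^'r) \<Rightarrow> (real \<times> 'l) set" where
  "lcross l \<beta> = {(u, \<iota>) \<in> crossings D \<beta>. \<iota> \<in> walls l}"

definition is_enum :: "nat \<Rightarrow> (real \<Rightarrow> real^'r) \<Rightarrow> (real \<times> 'l) list \<Rightarrow> bool" where
  "is_enum l \<beta> cs \<longleftrightarrow> distinct cs \<and> sorted (map fst cs) \<and> set cs = lcross l \<beta>"

lemma path_product_enum:
  assumes "has_path_product D \<beta> g"
  obtains cs where "is_enum l \<beta> cs" "gexp l g = lprod (cross_op l \<beta>) cs"
proof -
  obtain cs where g: "g \<in> ghat" and cs: "distinct cs" "sorted (map fst cs)"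
    "set cs = {(u, \<iota>) \<in> crossings D \<beta>. \<not> proj_eq l (elt (D \<iota>)) gone}"
    "proj_eq l g (gprod_rl (map (\<lambda>(u, \<iota>). gpow (elt (D \<iota>)) (crossing_sign D \<beta> u \<iota>)) cs))"
    using assms unfolding has_path_product_def by blast
  let ?gs = "map (\<lambda>(u, \<iota>). gpow (elt (D \<iota>)) (crossing_sign D \<beta> u \<iota>)) cs"
  have sub: "set ?gs \<subseteq> ghat" using ghat_gpow elt_ghat by auto
  have "gexp l g = gexp l (gprod_rl ?gs)"
    by (rule gexp_proj_eq[OF g ghat_gprod_rl[OF sub] cs(4)])
  also have "\<dots> = lprod (cross_op l \<beta>) cs"
    unfolding gexp_gprod_rl[OF sub] lprod_def cross_op_def by (simp add: comp_def case_prod_unfold)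
  finally show thesis using that cs by (simp add: is_enum_def lcross_def walls_def)
qed

lemma gexp_commute_Gpar:
  assumes "n \<in> Npos" "x \<in> Gpar n" "y \<in> Gpar n"
  shows "gexp l x * gexp l y = gexp l y * gexp l x"
  using gexp_add[OF assms, of l] gexp_add[OF assms(1,3,2), of l] by (simp add: add.commute)

text \<open>Off \<open>Sing D\<close> simultaneous crossings have a common normal, so their
  operators commute.\<close>

lemma enum_unique:
  assumes "weakly_admissible_curve D \<beta>" "is_enum l \<beta> cs" "is_enum l \<beta> ds"
  shows "lprod (cross_op l \<beta>) cs = lprod (cross_op l \<beta>) ds"
proof (rule lprod_unique)
  fix x y assume xy: "x \<in> set cs" "y \<in> set cs" "fst x = fst y"
  obtain u \<iota> \<iota>' where x: "x = (u, \<iota>)" "y = (u, \<iota>')" using xy(3) by (cases x; cases y) auto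
  have c: "0 < u" "u < 1" "\<beta> u \<in> support (D \<iota>)" "\<beta> u \<in> support (D \<iota>')"
    using xy assms(2) x by (auto simp: is_enum_def lcross_def crossings_def)
  then have "\<beta> u \<notin> Sing D" using assms(1) by (auto simp: weakly_admissible_curve_def)
  then have "normal (D \<iota>) = normal (D \<iota>')" using same_normal c by blast
  then show "cross_op l \<beta> x * cross_op l \<beta> y = cross_op l \<beta> y * cross_op l \<beta> x"
    using gexp_commute_Gpar[OF normal_Npos[of \<iota>] Gpar_gpow[OF elt_Gpar[of \<iota>]] Gpar_gpow] elt_Gpar[of \<iota>']
    by (simp add: cross_op_def x)
qed (use assms in \<open>auto simp: is_enum_def\<close>)

definition good :: "real^'r \<Rightarrow> real^'r \<Rightarrow> bool" where
  "good p q \<longleftrightarrow> admissible_curve D (linepath p q)"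

definition Seg :: "nat \<Rightarrow> real^'r \<Rightarrow> real^'r \<Rightarrow> ((int^'r) \<times> 'r option option) lop" where
  "Seg l p q = lprod (cross_op l (linepath p q)) (SOME cs. is_enum l (linepath p q) cs)"

lemma Seg_eq: "good p q \<Longrightarrow> is_enum l (linepath p q) cs \<Longrightarrow> Seg l p q = lprod (cross_op l (linepath p q)) cs"
proof -
  assume g: "good p q" and cs: "is_enum l (linepath p q) cs"
  have "is_enum l (linepath p q) (SOME cs. is_enum l (linepath p q) cs)" using cs by (rule someI)
  moreover have "weakly_admissible_curve D (linepath p q)" using g by (simp add: good_def admissible_curve_def)
  ultimately show ?thesis unfolding Seg_def using cs enum_unique by blast
qed

lemma goodI:
  assumes "p \<notin> Supp D" "q \<notin> Supp D" "\<And>u. u \<in> {0..1} \<Longrightarrow> linepath p q u \<notin> Sing D"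
    and "\<And>u \<iota>. u \<in> {0..1} \<Longrightarrow> linepath p q u \<in> support (D \<iota>) \<Longrightarrow> pairing (normal (D \<iota>)) (q - p) \<noteq> 0"
  shows "good p q"
  using assms by (auto simp: good_def admissible_curve_def weakly_admissible_curve_def smooth_linepath
      velocity_linepath linepath_0' linepath_1')

lemma goodD:
  assumes "good p q" "u \<in> {0..1}"
  shows "linepath p q u \<notin> Sing D" "p \<notin> Supp D" "q \<notin> Supp D"
    "linepath p q u \<in> support (D \<iota>) \<Longrightarrow> pairing (normal (D \<iota>)) (q - p) \<noteq> 0"
    "linepath p q u \<in> support (D \<iota>) \<Longrightarrow> 0 < u \<and> u < 1"
  using admissible_linepathD[OF assms(1)[unfolded good_def] assms(2)] by blast+

lemma good_ends: "good p q \<Longrightarrow> p \<notin> Supp D" "good p q \<Longrightarrow> q \<notin> Supp D"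
  using goodD(2,3)[of p q 0] by simp_all

lemma good_sym: "good p q \<Longrightarrow> good q p"
proof (rule goodI)
  assume g: "good p q"
  have r: "linepath q p u = linepath p q (1 - u)" for u by (simp add: linepath_def algebra_simps)
  show "p \<notin> Supp D" "q \<notin> Supp D" using good_ends[OF g] .
  fix u :: real assume u: "u \<in> {0..1}"
  then have u': "1 - u \<in> {0..1}" by auto
  show "linepath q p u \<notin> Sing D" using goodD(1)[OF g u'] by (simp add: r)
  show "pairing (normal (D \<iota>)) (p - q) \<noteq> 0" if "linepath q p u \<in> support (D \<iota>)" for \<iota>
    using goodD(4)[OF g u', of \<iota>] that by (simp add: r pairing_diff)
qed

lemma good_refl: "p \<notin> Supp D \<Longrightarrow> good p p"
proof (rule goodI)
  assume p: "p \<notin> Supp D"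
  have l: "linepath p p u = p" for u by (simp add: linepath_alt)
  show "p \<notin> Supp D" "p \<notin> Supp D" by fact+
  show "linepath p p u \<notin> Sing D" for u using p Sing_subset_Supp by (auto simp: l)
  show "pairing (normal (D \<iota>)) (p - p) \<noteq> 0" if "linepath p p u \<in> support (D \<iota>)" for u \<iota>
    using that p by (auto simp: l Supp_def)
qed

text \<open>Consistency is applied to the smooth triangle. Its list of crossings is distributed over
  the three thirds, and the increasing reparametrisation by \<open>step\<close> turns each portion
  into an enumeration for a straight edge.\<close>

lemma triangle_edges:
  assumes g: "good p q" "good q r" "good r p"
  obtains c where "\<And>i. i < 3 \<Longrightarrow> is_enum l (linepath (vertex p q r i) (vertex p q r (Suc i))) (c i)"
    "lprod (cross_op l (linepath r p)) (c 2) * lprod (cross_op l (linepath q r)) (c 1) * lprod (cross_op l (linepath p q)) (c (0::nat)) = 1"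
proof -
  let ?T = "triangle p q r"
  let ?L = "\<lambda>i. linepath (vertex p q r i) (vertex p q r (Suc i))"
  note adm = g[unfolded good_def]
  have "has_path_product D ?T gone"
    using consistent admissible_triangle[OF adm] triangle_loop[of p q r] unfolding consistent_def by metis
  then obtain cs where cs: "is_enum l ?T cs" "gexp l gone = lprod (cross_op l ?T) cs"
    by (rule path_product_enum)
  define pt where "pt i = filter (\<lambda>x. real i < 3 * fst x \<and> 3 * fst x < real i + 1) cs" for i
  define f where "f i = (\<lambda>(u, \<iota>::'l). (step 0 (3 * u - real i), \<iota>))" for i
  have mono: "step 0 x < step 0 y" if "0 < x" "x < y" "y < 1" for x y
    using strict_mono_onD[OF step_mono, of x y] that by auto
  have enum: "is_enum l (?L i) (map (f i) (pt i))" if i: "i < 3" for i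
    unfolding is_enum_def
  proof (intro conjI)
    have "inj_on (f i) (set (pt i))"
    proof (rule inj_onI)
      fix x y assume x: "x \<in> set (pt i)" and y: "y \<in> set (pt i)" and eq: "f i x = f i y"
      have "fst x = fst y"
      proof (rule ccontr)
        assume "fst x \<noteq> fst y"
        then have "3 * fst x - real i < 3 * fst y - real i \<or> 3 * fst y - real i < 3 * fst x - real i" by linarith
        then have "step 0 (3 * fst x - real i) \<noteq> step 0 (3 * fst y - real i)"
          using mono[of "3 * fst x - real i" "3 * fst y - real i"] mono[of "3 * fst y - real i" "3 * fst x - real i"] x y
          by (auto simp: pt_def)
        then show False using eq by (auto simp: f_def case_prod_unfold)
      qed
      then show "x = y" using eq by (auto simp: f_def case_prod_unfold prod_eq_iff)
    qed
    then show "distinct (map (f i) (pt i))" using cs(1) by (simp add: distinct_map pt_def is_enum_def)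
    have "sorted_wrt (\<lambda>x y. fst x \<le> fst y) (pt i)"
      using cs(1) unfolding pt_def is_enum_def sorted_map by (intro sorted_wrt_filter) auto
    then have "sorted_wrt (\<lambda>x y. fst (f i x) \<le> fst (f i y)) (pt i)"
    proof (rule sorted_wrt_mono_rel[rotated])
      fix x y assume "x \<in> set (pt i)" "y \<in> set (pt i)" "fst x \<le> fst y"
      then show "fst (f i x) \<le> fst (f i y)"
        using mono[of "3 * fst x - real i" "3 * fst y - real i"]
        by (cases "fst x = fst y") (auto simp: f_def case_prod_unfold pt_def)
    qed
    then show "sorted (map fst (map (f i) (pt i)))" by (simp add: sorted_map sorted_wrt_map)
    have "set (map (f i) (pt i)) = {(u, \<iota>) \<in> f i ` {(u, \<iota>) \<in> crossings D ?T. real i < 3 * u \<and> 3 * u < real i + 1}. \<iota> \<in> walls l}"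
      using cs(1) by (auto simp: pt_def is_enum_def lcross_def f_def image_iff)
    then show "set (map (f i) (pt i)) = lcross l (?L i)"
      unfolding lcross_def using triangle_edge_crossing(1)[OF adm i] by (simp add: f_def)
  qed
  have op: "lprod (cross_op l (?L i)) (map (f i) (pt i)) = lprod (cross_op l ?T) (pt i)" if i: "i < 3" for i
    unfolding lprod_map
  proof (rule lprod_cong)
    fix x assume "x \<in> set (pt i)"
    then show "cross_op l (?L i) (f i x) = cross_op l ?T x"
      using triangle_edge_crossing(2)[OF adm i, of "fst x" "snd x"]
      by (simp add: pt_def cross_op_def f_def case_prod_unfold)
  qed
  have strict: "\<exists>i<3. real i < 3 * fst x \<and> 3 * fst x < real i + 1" if x: "x \<in> set cs" for x
  proof -
    have x': "fst x \<in> {0..1}" "?T (fst x) \<in> support (D (snd x))"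
      using x cs(1) by (auto simp: is_enum_def lcross_def crossings_def)
    obtain i where "i < 3" "real i \<le> 3 * fst x" "3 * fst x \<le> real i + 1" using edge_index[OF x'(1)] .
    then show ?thesis using triangle_crossing[OF adm, of i "fst x" "snd x"] x'(2) by blast
  qed
  have three: "2 < (3::nat)" "1 < (3::nat)" "0 < (3::nat)" by simp_all
  have s: "sorted (map fst cs)" using cs(1) by (simp add: is_enum_def)
  \<comment> \<open>The sorted list is cut at the corner times 1/3 and 2/3. By \<open>strict\<close>
    no entry sits at a corner, so these portions are the lists \<open>pt i\<close>.\<close>
  let ?cs' = "filter (\<lambda>x. \<not> fst x < 1 / 3) cs"
  have "cs = filter (\<lambda>x. fst x < 1 / 3) cs @ ?cs'" by (rule sorted_split[OF s])
  also have "?cs' = filter (\<lambda>x. fst x < 2 / 3) ?cs' @ filter (\<lambda>x. \<not> fst x < 2 / 3) ?cs'"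
    by (rule sorted_split) (use s in \<open>simp add: sorted_map sorted_wrt_filter\<close>)
  also have "filter (\<lambda>x. fst x < 1 / 3) cs = pt 0"
    unfolding pt_def by (rule filter_cong[OF refl]) (use strict in fastforce)
  also have "filter (\<lambda>x. fst x < 2 / 3) ?cs' = pt 1"
    unfolding pt_def filter_filter by (rule filter_cong[OF refl]) (use strict in \<open>fastforce simp: less_Suc_eq numeral_eq_Suc\<close>)
  also have "filter (\<lambda>x. \<not> fst x < 2 / 3) ?cs' = pt 2"
    unfolding pt_def filter_filter by (rule filter_cong[OF refl]) (use strict in \<open>fastforce simp: less_Suc_eq numeral_eq_Suc\<close>)
  finally have "lprod (cross_op l ?T) (pt 0 @ (pt 1 @ pt 2)) = 1" using cs(2) by simp
  then have "lprod (cross_op l (?L 2)) (map (f 2) (pt 2)) * lprod (cross_op l (?L 1)) (map (f 1) (pt 1))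
      * lprod (cross_op l (?L 0)) (map (f 0) (pt 0)) = 1"
    unfolding op[OF three(1)] op[OF three(2)] op[OF three(3)] by (simp add: mult.assoc)
  then have "lprod (cross_op l (linepath r p)) (map (f 2) (pt 2)) * lprod (cross_op l (linepath q r)) (map (f 1) (pt 1))
      * lprod (cross_op l (linepath p q)) (map (f 0) (pt 0)) = 1"
    by (simp add: vertex_def)
  then show thesis using that[of "\<lambda>i. map (f i) (pt i)"] enum by blast
qed

text \<open>That a good segment crosses the walls of \<open>walls l\<close> only finitely often
  comes from the degenerate triangle p, q, q: consistency includes the existence of its finite
  products.\<close>

lemma enum_exists: "good p q \<Longrightarrow> \<exists>cs. is_enum l (linepath p q) cs"
proof -
  assume g: "good p q"
  have "good q q" using good_ends(2)[OF g] by (rule good_refl)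
  obtain c where "\<And>i. i < 3 \<Longrightarrow> is_enum l (linepath (vertex p q q i) (vertex p q q (Suc i))) (c i)"
    using triangle_edges[OF g \<open>good q q\<close> good_sym[OF g], where l = l] by blast
  from this[of 0] have "is_enum l (linepath p q) (c 0)" by (simp add: vertex_def)
  then show ?thesis ..
qed

lemma Seg_triangle:
  assumes g: "good p q" "good q r" "good r p"
  shows "Seg l r p * Seg l q r * Seg l p q = 1"
proof -
  obtain c where c: "\<And>i. i < 3 \<Longrightarrow> is_enum l (linepath (vertex p q r i) (vertex p q r (Suc i))) (c i)"
    "lprod (cross_op l (linepath r p)) (c 2) * lprod (cross_op l (linepath q r)) (c 1) * lprod (cross_op l (linepath p q)) (c (0::nat)) = 1"
    using triangle_edges[OF g] by blast
  have "Seg l p q = lprod (cross_op l (linepath p q)) (c 0)"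
    by (rule Seg_eq[OF g(1)]) (use c(1)[of 0] in \<open>simp add: vertex_def\<close>)
  moreover have "Seg l q r = lprod (cross_op l (linepath q r)) (c 1)"
    by (rule Seg_eq[OF g(2)]) (use c(1)[of 1] in \<open>simp add: vertex_def numeral_eq_Suc\<close>)
  moreover have "Seg l r p = lprod (cross_op l (linepath r p)) (c 2)"
    by (rule Seg_eq[OF g(3)]) (use c(1)[of 2] in \<open>simp add: vertex_def numeral_eq_Suc\<close>)
  ultimately show ?thesis using c(2) by simp
qed

section \<open>Dependence of segment products on the starting point\<close>

definition SuppW :: "nat \<Rightarrow> (real^'r) set" where
  "SuppW l = (\<Union>\<iota>\<in>walls l. support (D \<iota>))"

lemma closed_SuppW: "closed (SuppW l)"
  unfolding SuppW_def by (intro closed_UN finite_walls ballI support_closed)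

lemma Seg_trivial:
  assumes g: "good p q" and "\<And>u. u \<in> {0..1} \<Longrightarrow> linepath p q u \<notin> SuppW l"
  shows "Seg l p q = 1"
proof -
  have "is_enum l (linepath p q) []"
    using assms(2) by (auto simp: is_enum_def lcross_def crossings_def SuppW_def)
  then show ?thesis using Seg_eq[OF g] by simp
qed

text \<open>The degenerate triangles p, b, b and b, p, p show that the products along p b and b p
  are mutually inverse; the triangle p, q, b then gives the composition law.\<close>

lemma Seg_comp:
  assumes g: "good p q" "good q b" "good p b"
  shows "Seg l p b = Seg l q b * Seg l p q"
proof -
  have "b \<notin> Supp D" using good_ends(2)[OF g(2)] .
  then have "good b b" by (rule good_refl)
  have bb: "Seg l b b = 1"
    by (rule Seg_trivial[OF \<open>good b b\<close>])
       (use \<open>b \<notin> Supp D\<close> in \<open>auto simp: linepath_alt SuppW_def Supp_def\<close>)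
  have "Seg l b p * Seg l b b * Seg l p b = 1" by (rule Seg_triangle[OF g(3) \<open>good b b\<close> good_sym[OF g(3)]])
  then have 1: "Seg l b p * Seg l p b = 1" by (simp add: bb)
  have "Seg l p b * Seg l p p * Seg l b p = 1"
    by (rule Seg_triangle[OF good_sym[OF g(3)] good_refl g(3)]) (rule good_ends(1)[OF g(1)])
  moreover have "Seg l p p = 1"
    by (rule Seg_trivial[OF good_refl]) (use good_ends(1)[OF g(1)] in \<open>auto simp: linepath_alt SuppW_def Supp_def\<close>)
  ultimately have 2: "Seg l p b * Seg l b p = 1" by simp
  have 3: "Seg l b p * Seg l q b * Seg l p q = 1" by (rule Seg_triangle[OF g(1,2) good_sym[OF g(3)]])
  have "Seg l p b = Seg l p b * (Seg l b p * Seg l q b * Seg l p q)" using 3 by simp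
  also have "\<dots> = (Seg l p b * Seg l b p) * Seg l q b * Seg l p q" by (simp only: mult.assoc)
  finally show ?thesis by (simp add: 2)
qed

text \<open>The relative frontier of a polyhedron is the union of its finitely many facets, of
  dimension r - 2 here. With countably many walls all of \<open>Sing D\<close> is a countable union
  of such pieces.\<close>

lemma Sing_pieces:
  "\<exists>\<C>. countable \<C> \<and> Sing D = \<Union>\<C> \<and> (\<forall>C\<in>\<C>. aff_dim C = int CARD('r) - 2)"
proof -
  let ?F = "\<Union>\<iota>. {F. F facet_of support (D \<iota>)}"
  let ?I = "{support (D \<iota>) \<inter> support (D \<iota>') | \<iota> \<iota>'. aff_dim (support (D \<iota>) \<inter> support (D \<iota>')) = int CARD('r) - 2}"
  show ?thesis
  proof (intro exI[of _ "?F \<union> ?I"] conjI ballI)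
    have "countable ?F"
      using finite_polyhedron_facets[OF support_polyhedron]
      by (intro countable_UN[OF countable_index]) (rule countable_finite)
    moreover have "?I \<subseteq> (\<lambda>(\<iota>, \<iota>'). support (D \<iota>) \<inter> support (D \<iota>')) ` (UNIV \<times> UNIV)" by auto
    then have "countable ?I"
      by (rule countable_subset) (rule countable_image, rule countable_SIGMA, rule countable_index, rule countable_index)
    ultimately show "countable (?F \<union> ?I)" by simp
    show "Sing D = \<Union>(?F \<union> ?I)"
      unfolding Sing_def rel_frontier_of_polyhedron[OF support_polyhedron] by blast
    show "aff_dim C = int CARD('r) - 2" if "C \<in> ?F \<union> ?I" for C
      using that by (auto simp: facet_of_def support_aff_dim)
  qed
qed

lemma negligible_countable_UN:
  assumes "countable A" "\<And>x. x \<in> A \<Longrightarrow> negligible (f x :: (real^'r) set)"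
  shows "negligible (\<Union>x\<in>A. f x)"
proof (cases "A = {}")
  case False
  then have "range (from_nat_into A) = A" using assms(1) by (rule range_from_nat_into)
  moreover have "(\<Union>x\<in>range (from_nat_into A). f x) = (\<Union>n. f (from_nat_into A n))" by blast
  ultimately have "(\<Union>x\<in>A. f x) = (\<Union>n. f (from_nat_into A n))" by simp
  moreover have "negligible (\<Union>n. f (from_nat_into A n))"
    using assms(2) from_nat_into[OF False] by (intro negligible_Union_nat) auto
  ultimately show ?thesis by simp
qed simp

text \<open>An open set is not covered by countably many null sets. Excluded are the hyperplanes of
  the walls, their translates through the points of P (for transversality), and all points seen from
  P through a piece of \<open>Sing D\<close>.\<close>

lemma generic_point:
  assumes P: "finite P" "P \<inter> Supp D = {}" and U: "open U" "U \<noteq> {}"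
  shows "\<exists>r\<in>U. r \<notin> Supp D \<and> (\<forall>p\<in>P. good p r)"
proof -
  obtain \<C> where C: "countable \<C>" "Sing D = \<Union>\<C>" "\<And>C. C \<in> \<C> \<Longrightarrow> aff_dim C = int CARD('r) - 2"
    using Sing_pieces by blast
  let ?A = "\<Union>\<iota>. {z. pairing (normal (D \<iota>)) z = 0}"
  let ?B = "\<Union>p\<in>P. \<Union>\<iota>. {z. pairing (normal (D \<iota>)) z = pairing (normal (D \<iota>)) p}"
  let ?V = "\<Union>p\<in>P. \<Union>C\<in>\<C>. {x. \<exists>u\<in>{0..1}. linepath p x u \<in> C}"
  have "negligible ?A"
    by (intro negligible_countable_UN countable_index negligible_pairing normal_nonzero)
  moreover have "negligible ?B"
    by (intro negligible_countable_UN countable_index negligible_pairing normal_nonzero countable_finite P(1))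
  moreover have "negligible ?V"
  proof (intro negligible_countable_UN C(1) countable_finite P(1) negligible_visible C(3))
    fix p C assume "p \<in> P" "C \<in> \<C>"
    then show "p \<notin> C" using P(2) C(2) Sing_subset_Supp by blast
  qed
  ultimately have "negligible (?A \<union> ?B \<union> ?V)" by (intro negligible_Un)
  then have "\<not> U \<subseteq> ?A \<union> ?B \<union> ?V"
    using U open_not_negligible negligible_subset by blast
  then obtain r where r: "r \<in> U" "r \<notin> ?A" "r \<notin> ?B" "r \<notin> ?V" by blast
  have rS: "r \<notin> Supp D" using r(2) support_perp by (auto simp: Supp_def)
  show ?thesis
  proof (intro bexI[OF _ r(1)] conjI[OF rS] ballI)
    fix p assume p: "p \<in> P"
    show "good p r"
    proof (rule goodI)
      show "p \<notin> Supp D" using p P by auto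
      show "linepath p r u \<notin> Sing D" if "u \<in> {0..1}" for u
        using r(4) that p C(2) by blast
      show "pairing (normal (D \<iota>)) (r - p) \<noteq> 0" for \<iota>
        using r(3) p by (auto simp: pairing_diff)
    qed (fact rS)
  qed
qed

text \<open>The segment from p to q need not be good. A generic third point r of U has good segments
  to p, q and b; those to p and q stay in U and contribute nothing.\<close>

lemma Seg_const:
  assumes U: "open U" "convex U" "U \<inter> SuppW l = {}" and pq: "p \<in> U" "q \<in> U" and g: "good p b" "good q b"
  shows "Seg l p b = Seg l q b"
proof -
  have "{p, q, b} \<inter> Supp D = {}" using good_ends[OF g(1)] good_ends[OF g(2)] by simp
  moreover have "U \<noteq> {}" using pq by blast
  ultimately have "\<exists>r\<in>U. r \<notin> Supp D \<and> (\<forall>x\<in>{p, q, b}. good x r)"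
    using U(1) by (intro generic_point) simp_all
  then obtain r where r': "r \<in> U" "\<forall>x\<in>{p, q, b}. good x r" by blast
  then have r: "r \<in> U" "good p r" "good q r" "good b r" by simp_all
  have "Seg l x b = Seg l r b" if "x \<in> U" "good x b" "good x r" for x
  proof -
    have "linepath x r u \<notin> SuppW l" if "u \<in> {0..1}" for u
    proof -
      have "linepath x r u \<in> U"
        using U(2) \<open>x \<in> U\<close> r(1) that unfolding linepath_def convex_alt by auto
      then show ?thesis using U(3) by auto
    qed
    then show ?thesis using Seg_comp[OF that(3) good_sym[OF r(4)] that(2)] Seg_trivial[OF that(3)] by simp
  qed
  note this[OF pq(1) g(1) r(2)] this[OF pq(2) g(2) r(3)]
  then show ?thesis by simp
qed

lemma generic_good:
  assumes b: "b \<notin> Supp D" and V: "open V" "V \<noteq> {}"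
  shows "\<exists>r\<in>V. good r b"
proof -
  have "\<exists>r\<in>V. r \<notin> Supp D \<and> (\<forall>p\<in>{b}. good p r)" using b V by (intro generic_point) simp_all
  then obtain r where r: "r \<in> V" "good b r" by blast
  show ?thesis using r(1) good_sym[OF r(2)] by blast
qed

text \<open>
  The operator of a path from p to b: the segment is replaced by one from a nearby point in general
  position, as the segment itself may meet \<open>Sing D\<close>.
\<close>

definition Phi :: "nat \<Rightarrow> real^'r \<Rightarrow> real^'r \<Rightarrow> ((int^'r) \<times> 'r option option) lop" where
  "Phi l b p = Seg l (SOME r. good r b \<and> (\<exists>\<epsilon>>0. r \<in> ball p \<epsilon> \<and> ball p \<epsilon> \<inter> SuppW l = {})) b"

text \<open>The point chosen in \<open>Phi\<close> lies in some ball about p that misses the walls.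
  This ball meets U in an open set containing a good point, which compares the two choices.\<close>

lemma Phi_eq:
  assumes b: "b \<notin> Supp D" and U: "open U" "convex U" "U \<inter> SuppW l = {}" and p: "p \<in> U" and r: "r \<in> U" "good r b"
  shows "Phi l b p = Seg l r b"
proof -
  let ?P = "\<lambda>r. good r b \<and> (\<exists>\<epsilon>>0. r \<in> ball p \<epsilon> \<and> ball p \<epsilon> \<inter> SuppW l = {})"
  note gen = generic_good[OF b]
  obtain \<epsilon> where e: "\<epsilon> > 0" "ball p \<epsilon> \<subseteq> U" using U(1) p by (rule openE)
  then obtain s where "s \<in> ball p \<epsilon>" "good s b" using gen[of "ball p \<epsilon>"] by auto
  then have "?P s" using e U(3) by blast
  then have "?P (SOME r. ?P r)" by (rule someI)
  then obtain r0 \<epsilon>0 where r0: "r0 = (SOME r. ?P r)" "good r0 b" "\<epsilon>0 > 0" "r0 \<in> ball p \<epsilon>0" "ball p \<epsilon>0 \<inter> SuppW l = {}" by blast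
  have "p \<in> U \<inter> ball p \<epsilon>0" using p r0(3) by simp
  then have "U \<inter> ball p \<epsilon>0 \<noteq> {}" by blast
  then obtain r1 where r1: "r1 \<in> U \<inter> ball p \<epsilon>0" "good r1 b"
    using gen[OF open_Int[OF U(1) open_ball]] by blast
  have "Seg l r0 b = Seg l r1 b"
    by (rule Seg_const[of "ball p \<epsilon>0"]) (use r0 r1 in auto)
  also have "\<dots> = Seg l r b"
    by (rule Seg_const[OF U]) (use r r1 in auto)
  finally show ?thesis using r0(1) by (simp add: Phi_def)
qed

lemma Phi_const:
  assumes b: "b \<notin> Supp D" and U: "open U" "convex U" "U \<inter> SuppW l = {}" and pq: "p \<in> U" "q \<in> U"
  shows "Phi l b p = Phi l b q"
proof -
  have "U \<noteq> {}" using pq by auto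
  then obtain r where "r \<in> U" "good r b" using generic_good[OF b U(1)] by blast
  then show ?thesis using Phi_eq[OF b U] pq by simp
qed

section \<open>The jump across a wall\<close>

definition walls_at :: "nat \<Rightarrow> real^'r \<Rightarrow> 'l set" where
  "walls_at l z = {\<iota> \<in> walls l. z \<in> support (D \<iota>)}"

definition local_ball :: "nat \<Rightarrow> real^'r \<Rightarrow> real \<Rightarrow> bool" where
  "local_ball l z \<epsilon> \<longleftrightarrow> \<epsilon> > 0 \<and> (\<forall>\<iota>\<in>walls_at l z. ball z \<epsilon> \<inter> perp (normal (D \<iota>)) \<subseteq> support (D \<iota>)) \<and>
     (\<forall>\<iota>\<in>walls l - walls_at l z. ball z \<epsilon> \<inter> support (D \<iota>) = {})"

text \<open>Off \<open>Sing D\<close> a wall through z fills its hyperplane near z, and the other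
  walls are closed; since \<open>walls l\<close> is finite, a minimum of radii works for all of
  them.\<close>

lemma local_ball_exists:
  assumes "z \<notin> Sing D"
  obtains \<epsilon> where "local_ball l z \<epsilon>"
proof -
  have "\<exists>\<epsilon>>0. (z \<in> support (D \<iota>) \<longrightarrow> ball z \<epsilon> \<inter> perp (normal (D \<iota>)) \<subseteq> support (D \<iota>)) \<and>
      (z \<notin> support (D \<iota>) \<longrightarrow> ball z \<epsilon> \<inter> support (D \<iota>) = {})" for \<iota>
  proof (cases "z \<in> support (D \<iota>)")
    case True
    obtain T where "open T" "z \<in> T" "T \<inter> perp (normal (D \<iota>)) \<subseteq> support (D \<iota>)" by (rule support_local[OF True assms])
    from \<open>open T\<close> \<open>z \<in> T\<close> obtain \<epsilon> where "\<epsilon> > 0" "ball z \<epsilon> \<subseteq> T" by (rule openE)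
    with \<open>T \<inter> perp (normal (D \<iota>)) \<subseteq> support (D \<iota>)\<close> have "\<epsilon> > 0 \<and> ball z \<epsilon> \<inter> perp (normal (D \<iota>)) \<subseteq> support (D \<iota>)" by blast
    then show ?thesis using True by blast
  next
    case False
    then have "open (- support (D \<iota>))" "z \<in> - support (D \<iota>)" using support_closed[of \<iota>] by auto
    then obtain \<epsilon> where "\<epsilon> > 0" "ball z \<epsilon> \<subseteq> - support (D \<iota>)" by (rule openE)
    then have "\<epsilon> > 0 \<and> ball z \<epsilon> \<inter> support (D \<iota>) = {}" by blast
    then show ?thesis using False by blast
  qed
  then obtain E where E: "\<And>\<iota>. E \<iota> > 0" "\<And>\<iota>. z \<in> support (D \<iota>) \<Longrightarrow> ball z (E \<iota>) \<inter> perp (normal (D \<iota>)) \<subseteq> support (D \<iota>)"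
    "\<And>\<iota>. z \<notin> support (D \<iota>) \<Longrightarrow> ball z (E \<iota>) \<inter> support (D \<iota>) = {}" by metis
  define \<epsilon> where "\<epsilon> = Min (insert 1 (E ` walls l))"
  have fin: "finite (insert 1 (E ` walls l))" using finite_walls by simp
  have pos: "\<epsilon> > 0" unfolding \<epsilon>_def using fin E(1) by (subst Min_gr_iff) auto
  have le: "ball z \<epsilon> \<subseteq> ball z (E \<iota>)" if "\<iota> \<in> walls l" for \<iota>
    using Min_le[OF fin, of "E \<iota>"] that by (auto simp: \<epsilon>_def)
  show thesis
  proof (rule that)
    show "local_ball l z \<epsilon>"
      unfolding local_ball_def
    proof (intro conjI ballI pos)
      show "ball z \<epsilon> \<inter> perp (normal (D \<iota>)) \<subseteq> support (D \<iota>)" if "\<iota> \<in> walls_at l z" for \<iota>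
        using le[of \<iota>] E(2)[of \<iota>] that unfolding walls_at_def by blast
      show "ball z \<epsilon> \<inter> support (D \<iota>) = {}" if "\<iota> \<in> walls l - walls_at l z" for \<iota>
        using le[of \<iota>] E(3)[of \<iota>] that unfolding walls_at_def by blast
    qed
  qed
qed

text \<open>The logarithm of the product of all wall elements at z: off \<open>Sing D\<close> they
  share a normal vector, and logarithms add.\<close>

definition wsum :: "nat \<Rightarrow> real^'r \<Rightarrow> int^'r \<Rightarrow> rat" where
  "wsum l z = (\<lambda>m. \<Sum>\<iota>\<in>walls_at l z. elt (D \<iota>) m)"

lemma lprod_gexp:
  assumes "n \<in> Npos" "distinct cs" "\<And>x. x \<in> set cs \<Longrightarrow> f x \<in> Gpar n"
  shows "lprod (\<lambda>x. gexp l (f x)) cs = gexp l (\<lambda>m. \<Sum>x\<in>set cs. f x m)"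
  using assms
proof (induction cs)
  case Nil
  then show ?case using gexp_gone[of l] by (simp add: gone_def)
next
  case (Cons x cs)
  have "gexp l (\<lambda>m. (\<Sum>x\<in>set cs. f x m) + f x m) = gexp l (\<lambda>m. \<Sum>x\<in>set cs. f x m) * gexp l (f x)"
    by (rule gexp_add[OF Cons.prems(1)]) (use Cons.prems in \<open>auto intro: Gpar_sum\<close>)
  then show ?case using Cons by (simp add: add.commute)
qed

lemma open_side: "open {z. pairing n z > c}" "open {z. pairing n z < c}"
  and convex_side: "convex {z. pairing n z > c}" "convex {z. pairing n z < c}"
  unfolding pairing_inner
  by (auto simp: open_halfspace_gt open_halfspace_lt convex_halfspace_gt convex_halfspace_lt)

lemma side_disjoint:
  assumes lb: "local_ball l z \<epsilon>" and n: "\<And>\<iota>. \<iota> \<in> walls_at l z \<Longrightarrow> normal (D \<iota>) = n"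
  shows "ball z \<epsilon> \<inter> {y. pairing n y > 0} \<inter> SuppW l = {}" "ball z \<epsilon> \<inter> {y. pairing n y < 0} \<inter> SuppW l = {}"
proof -
  have "pairing n y = 0" if y: "y \<in> ball z \<epsilon>" "y \<in> SuppW l" for y
  proof -
    obtain \<iota> where i: "\<iota> \<in> walls l" "y \<in> support (D \<iota>)" using y(2) by (auto simp: SuppW_def)
    then have "\<iota> \<in> walls_at l z" using lb y(1) unfolding local_ball_def by blast
    then show ?thesis using n support_perp i by blast
  qed
  then show "ball z \<epsilon> \<inter> {y. pairing n y > 0} \<inter> SuppW l = {}" "ball z \<epsilon> \<inter> {y. pairing n y < 0} \<inter> SuppW l = {}"
    by force+
qed

text \<open>Nearby points p' and q' on the two sides are chosen so that the triangle p', q', b is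
  good. The segment p' q' stays in the ball and meets the hyperplane once, with decreasing pairing,
  which is intersection sign 1.\<close>

lemma Phi_jump:
  assumes b: "b \<notin> Supp D" and lb: "local_ball l z \<epsilon>"
    and n: "\<And>\<iota>. \<iota> \<in> walls_at l z \<Longrightarrow> normal (D \<iota>) = n" and nN: "n \<in> Npos"
    and p: "p \<in> ball z \<epsilon>" "pairing n p > 0" and q: "q \<in> ball z \<epsilon>" "pairing n q < 0"
  shows "Phi l b p = Phi l b q * gexp l (wsum l z)"
proof -
  let ?U = "ball z \<epsilon> \<inter> {y. pairing n y > 0}" and ?V = "ball z \<epsilon> \<inter> {y. pairing n y < 0}"
  have U: "open ?U" "convex ?U" "?U \<inter> SuppW l = {}" and V: "open ?V" "convex ?V" "?V \<inter> SuppW l = {}"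
    using side_disjoint[OF lb n] by (auto intro!: open_Int convex_Int open_side convex_side)
  have "p \<in> ?U" "q \<in> ?V" using p q by auto
  then have "?U \<noteq> {}" "?V \<noteq> {}" by blast+
  then obtain p' where p': "p' \<in> ?U" "good p' b" using generic_good[OF b U(1)] by blast
  have "{p', b} \<inter> Supp D = {}" using good_ends(1)[OF p'(2)] b by simp
  then have "\<exists>r\<in>?V. r \<notin> Supp D \<and> (\<forall>x\<in>{p', b}. good x r)"
    using V(1) \<open>?V \<noteq> {}\<close> by (intro generic_point) simp_all
  then obtain q' where q'': "q' \<in> ?V" "\<forall>x\<in>{p', b}. good x q'" by blast
  then have q': "q' \<in> ?V" "good p' q'" "good b q'" by simp_all
  have "Phi l b p = Seg l p' b" by (rule Phi_eq[OF b U]) (use p p' in auto)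
  also have "\<dots> = Seg l q' b * Seg l p' q'" by (rule Seg_comp[OF q'(2) good_sym[OF q'(3)] p'(2)])
  also have "Seg l q' b = Phi l b q" by (rule Phi_eq[OF b V, symmetric]) (use q q' good_sym in auto)
  also have "Seg l p' q' = gexp l (wsum l z)"
  proof -
    let ?L = "linepath p' q'"
    obtain cs where cs: "is_enum l ?L cs" using enum_exists[OF q'(2)] by blast
    define a c where "a = pairing n p'" and "c = pairing n q'"
    have ac: "a > 0" "c < 0" using p' q' by (auto simp: a_def c_def)
    \<comment> \<open>The zero of the pairing, which is affine along the segment from a > 0 to c <
      0.\<close>
    define u0 where "u0 = a / (a - c)"
    have u0: "0 < u0" "u0 < 1" using ac by (auto simp: u0_def field_simps)
    have zero: "pairing n (?L u) = 0 \<longleftrightarrow> u = u0" for u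
    proof -
      have "pairing n (?L u) = a - u * (a - c)" by (simp add: pairing_linepath a_def c_def algebra_simps)
      then show ?thesis using ac by (auto simp: u0_def field_simps)
    qed
    have inball: "?L u \<in> ball z \<epsilon>" if "u \<in> {0..1}" for u
      using convex_ball[of z \<epsilon>] p'(1) q'(1) that unfolding linepath_def convex_alt by auto
    have "lcross l ?L = {u0} \<times> walls_at l z"
    proof (intro set_eqI iffI)
      fix x assume "x \<in> lcross l ?L"
      then obtain u \<iota> where x: "x = (u, \<iota>)" "0 < u" "u < 1" "?L u \<in> support (D \<iota>)" "\<iota> \<in> walls l"
        by (auto simp: lcross_def crossings_def)
      then have at: "\<iota> \<in> walls_at l z" using lb inball[of u] unfolding local_ball_def by fastforce
      then have "pairing n (?L u) = 0" using n support_perp x(4) by blast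
      then show "x \<in> {u0} \<times> walls_at l z" using zero at x(1) by simp
    next
      fix x assume "x \<in> {u0} \<times> walls_at l z"
      then obtain \<iota> where x: "x = (u0, \<iota>)" "\<iota> \<in> walls_at l z" by auto
      have "?L u0 \<in> ball z \<epsilon> \<inter> perp (normal (D \<iota>))" using inball[of u0] u0 zero n[OF x(2)] by (auto simp: perp_def)
      then have "?L u0 \<in> support (D \<iota>)" using lb x(2) unfolding local_ball_def by blast
      then show "x \<in> lcross l ?L" using x u0 by (auto simp: lcross_def crossings_def walls_at_def)
    qed
    then have set: "set cs = {u0} \<times> walls_at l z" using cs by (simp add: is_enum_def)
    have "Seg l p' q' = lprod (cross_op l ?L) cs" by (rule Seg_eq[OF q'(2) cs])
    also have "\<dots> = lprod (\<lambda>x. gexp l (elt (D (snd x)))) cs"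
    proof (rule lprod_cong)
      fix x assume "x \<in> set cs"
      then obtain \<iota> where x: "x = (u0, \<iota>)" "\<iota> \<in> walls_at l z" using set by auto
      have "velocity ?L u0 = q' - p'" using u0 by (intro velocity_linepath) auto
      then have "crossing_sign D ?L u0 \<iota> = 1"
        using ac n[OF x(2)] by (simp add: crossing_sign_def pairing_diff a_def c_def)
      then show "cross_op l ?L x = gexp l (elt (D (snd x)))" by (simp add: cross_op_def x gpow_def)
    qed
    also have "\<dots> = gexp l (\<lambda>m. \<Sum>x\<in>set cs. elt (D (snd x)) m)"
    proof (rule lprod_gexp[OF nN])
      show "distinct cs" using cs by (simp add: is_enum_def)
      show "elt (D (snd x)) \<in> Gpar n" if "x \<in> set cs" for x
      proof -
        have "snd x \<in> walls_at l z" using that unfolding set by auto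
        then show ?thesis using n elt_Gpar[of "snd x"] by simp
      qed
    qed
    also have "(\<lambda>m. \<Sum>x\<in>set cs. elt (D (snd x)) m) = wsum l z"
    proof
      fix m
      have "set cs = Pair u0 ` walls_at l z" using set by auto
      then have "(\<Sum>x\<in>set cs. elt (D (snd x)) m) = (\<Sum>\<iota>\<in>walls_at l z. elt (D (snd (u0, \<iota>))) m)"
        by (simp only:) (subst sum.reindex, auto simp: inj_on_def)
      then show "(\<Sum>x\<in>set cs. elt (D (snd x)) m) = wsum l z m" by (simp add: wsum_def)
    qed
    finally show ?thesis .
  qed
  finally show ?thesis .
qed

end

section \<open>Crossings along a curve\<close>

lemma smooth_curve_derivative:
  assumes "smooth_curve \<beta>" "u \<in> {0..1}"
  shows "(\<beta> has_vector_derivative velocity \<beta> u) (at u within {0..1})"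
proof -
  obtain F where "F 0 = \<beta>" "\<And>k u. u \<in> {0..1} \<Longrightarrow> (F k has_vector_derivative F (Suc k) u) (at u within {0..1})"
    using assms(1) unfolding smooth_curve_def by blast
  then have d: "(\<beta> has_vector_derivative F 1 u) (at u within {0..1})" using assms(2) by fastforce
  show ?thesis using d unfolding velocityI[OF assms(2) d] .
qed

lemma smooth_curve_continuous: "smooth_curve \<beta> \<Longrightarrow> continuous_on {0..1} \<beta>"
  unfolding continuous_on_eq_continuous_within
  by (intro ballI has_vector_derivative_continuous[OF smooth_curve_derivative])

lemma pairing_derivative:
  assumes "smooth_curve \<beta>" "u \<in> {0..1}"
  shows "((\<lambda>u. pairing n (\<beta> u)) has_real_derivative pairing n (velocity \<beta> u)) (at u within {0..1})"
  unfolding has_real_derivative_iff_has_vector_derivative pairing_inner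
  by (rule bounded_linear.has_vector_derivative[OF bounded_linear_inner_right smooth_curve_derivative[OF assms]])

lemma finite_gap:
  fixes T :: "real set"
  assumes "finite T" "\<eta> > 0"
  obtains s where "t < s" "s < t + \<eta>" "\<And>t'. t' \<in> T \<Longrightarrow> t < t' \<Longrightarrow> s < t'"
proof -
  define m where "m = Min (insert (t + \<eta>) {t' \<in> T. t < t'})"
  have fin: "finite (insert (t + \<eta>) {t' \<in> T. t < t'})" using assms(1) by simp
  have m: "t < m" unfolding m_def using fin assms(2) by (subst Min_gr_iff) auto
  have le: "m \<le> t + \<eta>" "\<And>t'. t' \<in> T \<Longrightarrow> t < t' \<Longrightarrow> m \<le> t'"
    unfolding m_def using fin by (auto intro!: Min_le)
  show thesis
  proof (rule that[of "(t + m) / 2"])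
    show "(t + m) / 2 < t'" if "t' \<in> T" "t < t'" for t' using le(2)[OF that] m that by (simp add: field_simps)
  qed (use m le in \<open>auto simp: field_simps\<close>)
qed

text \<open>Induction on the number of times in T after s. Between consecutive times one may restart
  at any s' satisfying \<open>Q\<close>, which will say that the curve is off the walls at
  s'.\<close>

lemma finite_time_induct [consumes 2, case_names base step]:
  fixes T :: "real set"
  assumes fin: "finite T" and s: "Q s"
    and base: "\<And>s. Q s \<Longrightarrow> (\<And>t. t \<in> T \<Longrightarrow> \<not> s < t) \<Longrightarrow> P s"
    and step: "\<And>s t. Q s \<Longrightarrow> t \<in> T \<Longrightarrow> s < t \<Longrightarrow> (\<And>t'. t' \<in> T \<Longrightarrow> s < t' \<Longrightarrow> t \<le> t') \<Longrightarrow>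
      (\<And>s'. Q s' \<Longrightarrow> t < s' \<Longrightarrow> P s') \<Longrightarrow> P s"
  shows "P s"
  using s
proof (induction "card {t \<in> T. s < t}" arbitrary: s rule: less_induct)
  case less
  have finS: "finite {t \<in> T. s < t}" using fin by simp
  show ?case
  proof (cases "{t \<in> T. s < t} = {}")
    case True
    then show ?thesis using base[OF less.prems] by blast
  next
    case False
    let ?t = "Min {t \<in> T. s < t}"
    have t: "?t \<in> {t \<in> T. s < t}" using Min_in[OF finS False] .
    show ?thesis
    proof (rule step[OF less.prems])
      show "?t \<in> T" "s < ?t" using t by auto
      show "?t \<le> t'" if "t' \<in> T" "s < t'" for t' using Min_le[OF finS] that by auto
      show "P s'" if s': "Q s'" "?t < s'" for s'
      proof (rule less.hyps[OF _ s'(1)])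
        have "?t \<notin> {t \<in> T. s' < t}" using s'(2) by auto
        moreover have "{t \<in> T. s' < t} \<subseteq> {t \<in> T. s < t}" using t s'(2) by auto
        ultimately have "{t \<in> T. s' < t} \<subset> {t \<in> T. s < t}" using t by blast
        then show "card {t \<in> T. s' < t} < card {t \<in> T. s < t}" using finS by (rule psubset_card_mono[rotated])
      qed
    qed
  qed
qed

section \<open>The positive chamber, and positivity of \<open>delta\<close>\<close>

context seed
begin

lemma seed_vector_nonzero: "e i \<noteq> 0"
proof
  assume "e i = 0"
  have "lin_comb e (axis i 1) = e i"
  proof -
    have "lin_comb e (axis i 1) = (\<Sum>j\<in>UNIV. if j = i then e i else 0)"
      unfolding lin_comb_def by (intro sum.cong) (auto simp: axis_def vec_eq_iff)
    then show ?thesis by simp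
  qed
  then have "coords 0 = axis i 1" using coords_eqI \<open>e i = 0\<close> by metis
  then have "(axis i 1 :: int^'r) = 0" by (simp only: coords_0)
  then show False by simp
qed

text \<open>Otherwise a small move against the vector of e_i would leave the chamber.\<close>

lemma interior_Cplus_pos:
  assumes "z \<in> interior Cplus" shows "pairing (e i) z > 0"
proof (rule ccontr)
  assume neg: "\<not> ?thesis"
  let ?v = "(\<chi> j. of_int (e i $ j)) :: real^'r"
  obtain \<epsilon> where \<epsilon>: "\<epsilon> > 0" "ball z \<epsilon> \<subseteq> Cplus" using assms by (meson mem_interior)
  have v: "norm ?v > 0" using normal_vec_nonzero[OF seed_vector_nonzero[of i]] by simp
  define c where "c = \<epsilon> / (2 * norm ?v)"
  have c: "c > 0" using \<epsilon> v by (simp add: c_def)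
  have "dist z (z - c *\<^sub>R ?v) = \<epsilon> / 2" using v \<epsilon> by (simp add: dist_norm c_def)
  then have "z - c *\<^sub>R ?v \<in> Cplus" using \<epsilon> by (auto simp: subset_eq)
  then have "pairing (e i) (z - c *\<^sub>R ?v) \<ge> 0" by (simp add: Cplus_def)
  moreover have "pairing (e i) (z - c *\<^sub>R ?v) = pairing (e i) z - c * (?v \<bullet> ?v)"
    by (simp add: pairing_diff pairing_scaleR) (simp add: pairing_inner)
  moreover have "c * (?v \<bullet> ?v) > 0" using c v by simp
  ultimately show False using neg by linarith
qed

lemma pairing_coords: "pairing n z = (\<Sum>j\<in>UNIV. of_int (coords n $ j) * pairing (e j) z)"
proof -
  have n: "n $ i = (\<Sum>j\<in>UNIV. coords n $ j * e j $ i)" for i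
  proof -
    have "n $ i = lin_comb e (coords n) $ i" by (simp only: lin_comb_coords)
    then show ?thesis unfolding lin_comb_def by (simp only: sum_component vector_smult_component)
  qed
  have "pairing n z = (\<Sum>i\<in>UNIV. \<Sum>j\<in>UNIV. of_int (coords n $ j) * (of_int (e j $ i) * z $ i))"
    unfolding pairing_def by (subst n) (simp only: of_int_sum of_int_mult sum_distrib_right mult.assoc)
  also have "\<dots> = (\<Sum>j\<in>UNIV. of_int (coords n $ j) * pairing (e j) z)"
    by (subst sum.swap) (simp only: pairing_def sum_distrib_left)
  finally show ?thesis .
qed

lemma Npos_pairing_pos:
  assumes "n \<in> Npos" "z \<in> interior Cplus" shows "pairing n z > 0"
proof -
  have c: "coords n $ j \<ge> 0" for j using assms(1) by (simp add: Npos_def)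
  have "\<exists>j. coords n $ j \<noteq> 0"
  proof (rule ccontr)
    assume "\<nexists>j. coords n $ j \<noteq> 0"
    then show False using assms(1) by (simp add: Npos_def)
  qed
  then obtain j where j: "coords n $ j > 0" using c by (metis order_le_less)
  show ?thesis
  proof (subst pairing_coords, rule sum_pos2)
    show "0 < of_int (coords n $ j) * pairing (e j) z" using j interior_Cplus_pos[OF assms(2)] by simp
    show "0 \<le> of_int (coords n $ i) * pairing (e i) z" for i
      using c[of i] interior_Cplus_pos[OF assms(2), of i] by simp
  qed auto
qed

lemma convex_Cplus: "convex Cplus"
proof -
  have "Cplus = (\<Inter>i. {z. pairing (e i) z \<ge> 0})" by (auto simp: Cplus_def)
  then show ?thesis by (auto simp: pairing_inner intro!: convex_INT convex_halfspace_ge)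
qed

text \<open>\<open>LEAST\<close> over the rationals need not be attained. Here every admissible q is
  a multiple of 1/|n_i| for a nonzero coordinate n_i, so a least one exists as soon as one is
  admissible; the product of all \<delta>_j is.\<close>

lemma delta_pos:
  assumes "n \<noteq> 0" shows "delta n > 0"
proof -
  define P where "P = (\<lambda>q::rat. q > 0 \<and> (\<exists>m\<in>Nc. \<forall>i. of_int (m $ i) = q * of_int (n $ i)))"
  obtain i where i: "n $ i \<noteq> 0" using assms by (auto simp: vec_eq_iff)
  let ?N = "of_int \<bar>n $ i\<bar> :: rat"
  have N: "?N > 0" using i by simp
  define d where "d = (\<Prod>j\<in>UNIV. \<delta> j)"
  have d: "d > 0" unfolding d_def using \<delta>_pos by (simp add: prod_pos)
  have P0: "P (of_nat d)"
    unfolding P_def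
  proof
    let ?a = "(\<chi> j. coords n $ j * int (d div \<delta> j)) :: int^'r"
    have "\<delta> j dvd d" for j unfolding d_def by (rule dvd_prodI) auto
    then have eq: "int (d div \<delta> j) * int (\<delta> j) = int d" for j by (simp flip: of_nat_mult)
    have "?a $ j *s (int (\<delta> j) *s e j) = int d *s (coords n $ j *s e j)" for j
      by (simp only: vector_smult_assoc vec_lambda_beta mult.assoc eq) (simp only: mult.commute)
    then have "lin_comb (\<lambda>i. int (\<delta> i) *s e i) ?a = int d *s lin_comb e (coords n)"
      unfolding lin_comb_def by (simp only:) (simp add: vec_eq_iff sum_distrib_left mult.assoc)
    moreover have "lin_comb (\<lambda>i. int (\<delta> i) *s e i) ?a \<in> Nc"
      using seed_basis_Nc bij_betwE unfolding lattice_basis_def by (metis UNIV_I)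
    ultimately have "int d *s n \<in> Nc" by (simp only: lin_comb_coords)
    then show "\<exists>m\<in>Nc. \<forall>i. of_int (m $ i) = (of_nat d :: rat) * of_int (n $ i)"
      by (intro bexI[of _ "int d *s n"]) auto
  qed (use d in simp)
  have int: "\<exists>k::nat. q = of_nat k / ?N" if q: "P q" for q
  proof -
    obtain m where m: "of_int (m $ i) = q * of_int (n $ i)" using q unfolding P_def by blast
    have "\<bar>q\<bar> = q" using q unfolding P_def by (intro abs_of_pos) blast
    then have "q * ?N = \<bar>q * of_int (n $ i)\<bar>" by (simp only: abs_mult of_int_abs)
    also have "\<dots> = of_nat (nat \<bar>m $ i\<bar>)" unfolding m[symmetric] by simp
    finally have "q = of_nat (nat \<bar>m $ i\<bar>) / ?N" using i by (simp only: eq_divide_eq) simp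
    then show ?thesis by blast
  qed
  define k where "k = (LEAST k::nat. P (of_nat k / ?N))"
  obtain k0 :: nat where k0: "of_nat d = of_nat k0 / ?N" using int[OF P0] by blast
  have "P (of_nat k0 / ?N)" using P0 unfolding k0 .
  then have "\<exists>k::nat. P (of_nat k / ?N)" by blast
  then have Pk: "P (of_nat k / ?N)" unfolding k_def by (rule LeastI_ex[where P = "\<lambda>k. P (of_nat k / ?N)"])
  have "delta n = of_nat k / ?N"
    unfolding delta_def P_def[symmetric]
  proof (rule Least_equality[where P = P])
    show "P (of_nat k / ?N)" by (rule Pk)
    fix q assume q: "P q"
    then obtain j :: nat where j: "q = of_nat j / ?N" using int by blast
    have "k \<le> j" unfolding k_def using q[unfolded j] by (rule Least_le[where P = "\<lambda>k. P (of_nat k / ?N)"])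
    then show "of_nat k / ?N \<le> q" using N j by (simp add: divide_right_mono)
  qed
  then show ?thesis using Pk by (simp add: P_def)
qed

end

section \<open>Transport operators along smooth curves\<close>

context diagram
begin

lemma interior_Cplus_Supp: "z \<in> interior Cplus \<Longrightarrow> z \<notin> Supp D"
proof
  assume z: "z \<in> interior Cplus" "z \<in> Supp D"
  then obtain \<iota> where "z \<in> support (D \<iota>)" by (auto simp: Supp_def)
  then show False using Npos_pairing_pos[OF normal_Npos z(1), of \<iota>] support_perp[of z \<iota>] by simp
qed

lemma SuppW_Supp: "z \<in> SuppW l \<Longrightarrow> z \<in> Supp D"
  by (auto simp: SuppW_def Supp_def)

text \<open>Normals in \<open>Npos\<close> pair positively with the interior of the chamber, so this
  convex open set meets no wall.\<close>

lemma Phi_interior: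
  assumes b: "b \<in> interior Cplus" and w: "w \<in> interior Cplus"
  shows "Phi l b w = 1"
proof -
  let ?U = "interior Cplus"
  have bS: "b \<notin> Supp D" by (rule interior_Cplus_Supp[OF b])
  have U: "open ?U" "convex ?U" "?U \<inter> SuppW l = {}"
    using interior_Cplus_Supp SuppW_Supp by (auto simp: convex_interior convex_Cplus)
  have "?U \<noteq> {}" using b by blast
  then obtain r where r: "r \<in> ?U" "good r b" using generic_good[OF bS U(1)] by blast
  have "Phi l b w = Seg l r b" by (rule Phi_eq[OF bS U w r])
  also have "\<dots> = 1"
  proof (rule Seg_trivial[OF r(2)])
    fix u :: real assume "u \<in> {0..1}"
    then have "linepath r b u \<in> ?U" using U(2) r(1) b unfolding linepath_def convex_alt by auto
    then show "linepath r b u \<notin> SuppW l" using U(3) by blast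
  qed
  finally show ?thesis .
qed

lemma curve_const:
  assumes b: "b \<notin> Supp D" and \<beta>: "smooth_curve \<beta>" and st: "0 \<le> s" "s \<le> t" "t \<le> 1"
    and no: "\<And>u. s \<le> u \<Longrightarrow> u \<le> t \<Longrightarrow> \<beta> u \<notin> SuppW l"
  shows "Phi l b (\<beta> s) = Phi l b (\<beta> t)"
proof -
  have cont: "continuous_on {s..t} \<beta>"
    using smooth_curve_continuous[OF \<beta>] by (rule continuous_on_subset) (use st in auto)
  have "(\<lambda>u. Phi l b (\<beta> u)) constant_on {s..t}"
  proof (rule locally_constant_imp_constant)
    fix a assume a: "a \<in> {s..t}"
    then have "open (- SuppW l)" "\<beta> a \<in> - SuppW l" using closed_SuppW no by auto
    then obtain \<epsilon> where e: "\<epsilon> > 0" "ball (\<beta> a) \<epsilon> \<subseteq> - SuppW l" by (rule openE)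
    let ?T = "{s..t} \<inter> \<beta> -` ball (\<beta> a) \<epsilon>"
    have "openin (top_of_set {s..t}) ?T" using cont by (simp add: continuous_openin_preimage_gen)
    moreover have "a \<in> ?T" using a e by simp
    moreover have "\<forall>x\<in>?T. Phi l b (\<beta> x) = Phi l b (\<beta> a)"
    proof
      fix x assume "x \<in> ?T"
      then show "Phi l b (\<beta> x) = Phi l b (\<beta> a)"
        by (intro Phi_const[OF b open_ball convex_ball, of "\<beta> a" \<epsilon>]) (use e in auto)
    qed
    ultimately show "\<exists>T. openin (top_of_set {s..t}) T \<and> a \<in> T \<and> (\<forall>x\<in>T. Phi l b (\<beta> x) = Phi l b (\<beta> a))" by blast
  qed simp
  then obtain v where "\<And>u. u \<in> {s..t} \<Longrightarrow> Phi l b (\<beta> u) = v" unfolding constant_on_def by blast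
  then show ?thesis using st by simp
qed

text \<open>Multiplying the pairing by its derivative v at t gives a function with derivative v^2 >
  0 there, so both crossing directions are handled at once.\<close>

lemma curve_side:
  assumes \<beta>: "smooth_curve \<beta>" and t: "t \<in> {0..1}" and \<epsilon>: "\<epsilon> > 0"
    and n0: "pairing n (\<beta> t) = 0" and v: "pairing n (velocity \<beta> t) \<noteq> 0"
  obtains \<eta> where "\<eta> > 0"
    "\<And>u. u \<in> {0..1} \<Longrightarrow> t - \<eta> < u \<Longrightarrow> u < t \<Longrightarrow> \<beta> u \<in> ball (\<beta> t) \<epsilon> \<and> pairing n (velocity \<beta> t) * pairing n (\<beta> u) < 0"
    "\<And>u. u \<in> {0..1} \<Longrightarrow> t < u \<Longrightarrow> u < t + \<eta> \<Longrightarrow> \<beta> u \<in> ball (\<beta> t) \<epsilon> \<and> pairing n (velocity \<beta> t) * pairing n (\<beta> u) > 0"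
proof -
  let ?v = "pairing n (velocity \<beta> t)"
  let ?f = "\<lambda>u. ?v * pairing n (\<beta> u)"
  have f: "(?f has_real_derivative ?v * ?v) (at t within {0..1})"
    by (rule DERIV_cmult[OF pairing_derivative[OF \<beta> t]])
  have vv: "0 < ?v * ?v" using v by (auto simp: zero_less_mult_iff)
  obtain d1 where d1: "d1 > 0" "\<And>h. h > 0 \<Longrightarrow> t + h \<in> {0..1} \<Longrightarrow> h < d1 \<Longrightarrow> ?f t < ?f (t + h)"
    using has_real_derivative_pos_inc_right[OF f vv] by blast
  obtain d2 where d2: "d2 > 0" "\<And>h. h > 0 \<Longrightarrow> t - h \<in> {0..1} \<Longrightarrow> h < d2 \<Longrightarrow> ?f (t - h) < ?f t"
    using has_real_derivative_pos_inc_left[OF f vv] by blast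
  obtain d3 where d3: "d3 > 0" "\<And>u. u \<in> {0..1} \<Longrightarrow> dist u t < d3 \<Longrightarrow> dist (\<beta> u) (\<beta> t) < \<epsilon>"
    using smooth_curve_continuous[OF \<beta>] t \<epsilon> unfolding continuous_on_iff by metis
  show thesis
  proof (rule that[of "min d1 (min d2 d3)"])
    fix u assume u: "u \<in> {0..1}" "t - min d1 (min d2 d3) < u" "u < t"
    then show "\<beta> u \<in> ball (\<beta> t) \<epsilon> \<and> ?v * pairing n (\<beta> u) < 0"
      using d2(2)[of "t - u"] d3(2)[of u] n0 by (auto simp: dist_real_def dist_commute)
  next
    fix u assume u: "u \<in> {0..1}" "t < u" "u < t + min d1 (min d2 d3)"
    then show "\<beta> u \<in> ball (\<beta> t) \<epsilon> \<and> ?v * pairing n (\<beta> u) > 0"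
      using d1(2)[of "u - t"] d3(2)[of u] n0 by (auto simp: dist_real_def dist_commute)
  qed (use d1 d2 d3 in auto)
qed

lemma wsum_Gpar:
  assumes "\<And>\<iota>. \<iota> \<in> walls_at l z \<Longrightarrow> normal (D \<iota>) = n"
  shows "wsum l z \<in> Gpar n"
  unfolding wsum_def by (rule Gpar_sum) (use assms elt_Gpar in metis)

text \<open>The values of \<open>Phi\<close> on the two sides differ by the exponential of an
  element of the parallel subgroup of n, which fixes L(y^(kn)). Thus the side on which a curve
  leaves z does not matter.\<close>

lemma Phi_Lvec_sides:
  assumes b: "b \<notin> Supp D" and lb: "local_ball l z \<epsilon>"
    and n: "\<And>\<iota>. \<iota> \<in> walls_at l z \<Longrightarrow> normal (D \<iota>) = n" and nN: "n \<in> Npos" and k: "k \<ge> (1::nat)"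
    and p: "p \<in> ball z \<epsilon>" "pairing n p \<noteq> 0" and q: "q \<in> ball z \<epsilon>" "pairing n q \<noteq> 0"
  shows "app (Phi l b p) (Lvec l (int k *s n)) = app (Phi l b q) (Lvec l (int k *s n))"
proof -
  have kN: "int k *s n \<in> Npos" using nN k by (simp add: Npos_iff Qmon_scale deg_scale)
  have fixed: "app (gexp l (wsum l z)) (Lvec l (int k *s n)) = Lvec l (int k *s n)"
    by (rule app_gexp_Lvec_Gpar[OF wsum_Gpar[OF n] k kN])
  have jump: "app (Phi l b p) (Lvec l (int k *s n)) = app (Phi l b q) (Lvec l (int k *s n))"
    if "p \<in> ball z \<epsilon>" "pairing n p > 0" "q \<in> ball z \<epsilon>" "pairing n q < 0" for p q
    using Phi_jump[OF b lb n nN that] by (simp add: fixed)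
  have same: "Phi l b p = Phi l b q" if "p \<in> ball z \<epsilon>" "pairing n p > 0" "q \<in> ball z \<epsilon>" "pairing n q > 0" for p q
    by (rule Phi_const[OF b _ _ side_disjoint(1)[OF lb n]]) (use that in \<open>auto intro!: open_Int convex_Int open_side convex_side\<close>)
  have same': "Phi l b p = Phi l b q" if "p \<in> ball z \<epsilon>" "pairing n p < 0" "q \<in> ball z \<epsilon>" "pairing n q < 0" for p q
    by (rule Phi_const[OF b _ _ side_disjoint(2)[OF lb n]]) (use that in \<open>auto intro!: open_Int convex_Int open_side convex_side\<close>)
  consider "pairing n p > 0" "pairing n q > 0" | "pairing n p > 0" "pairing n q < 0"
    | "pairing n p < 0" "pairing n q > 0" | "pairing n p < 0" "pairing n q < 0"
    using p(2) q(2) by linarith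
  then show ?thesis
  proof cases
    case 1
    then show ?thesis using same[OF p(1) _ q(1)] by simp
  next
    case 2
    then show ?thesis using jump[OF p(1) _ q(1)] by simp
  next
    case 3
    then show ?thesis using jump[OF q(1) _ p(1)] by simp
  next
    case 4
    then show ?thesis using same'[OF p(1) _ q(1)] by simp
  qed
qed

lemma weakly_admissibleD:
  assumes "weakly_admissible_curve D \<beta>"
  shows "smooth_curve \<beta>" "u \<in> {0..1} \<Longrightarrow> \<beta> u \<notin> Sing D"
    "u \<in> {0..1} \<Longrightarrow> \<beta> u \<in> support (D \<iota>) \<Longrightarrow> pairing (normal (D \<iota>)) (velocity \<beta> u) \<noteq> 0"
  using assms unfolding weakly_admissible_curve_def by blast+

lemma curve_jump:
  assumes b: "b \<notin> Supp D" and \<beta>: "weakly_admissible_curve D \<beta>" and t: "0 < t" "t < 1"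
    and i: "\<iota> \<in> walls_at l (\<beta> t)"
  obtains \<eta> where "\<eta> > 0"
    "\<And>u. 0 \<le> u \<Longrightarrow> t - \<eta> < u \<Longrightarrow> u < t \<Longrightarrow> \<beta> u \<notin> SuppW l"
    "\<And>u. u \<le> 1 \<Longrightarrow> t < u \<Longrightarrow> u < t + \<eta> \<Longrightarrow> \<beta> u \<notin> SuppW l"
    "\<And>u u'. 0 \<le> u \<Longrightarrow> t - \<eta> < u \<Longrightarrow> u < t \<Longrightarrow> u' \<le> 1 \<Longrightarrow> t < u' \<Longrightarrow> u' < t + \<eta> \<Longrightarrow>
      Phi l b (\<beta> u) = Phi l b (\<beta> u') * gexp l (gpow (wsum l (\<beta> t)) (crossing_sign D \<beta> t \<iota>))"
proof -
  let ?z = "\<beta> t" and ?n = "normal (D \<iota>)"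
  have t01: "t \<in> {0..1}" using t by simp
  have zS: "?z \<notin> Sing D" using weakly_admissibleD(2)[OF \<beta> t01] .
  have zi: "?z \<in> support (D \<iota>)" using i by (simp add: walls_at_def)
  have n: "normal (D \<iota>') = ?n" if "\<iota>' \<in> walls_at l ?z" for \<iota>'
    using same_normal[OF zS _ zi] that by (simp add: walls_at_def)
  obtain \<epsilon> where lb: "local_ball l ?z \<epsilon>" using local_ball_exists[OF zS] .
  then have "\<epsilon> > 0" by (simp add: local_ball_def)
  let ?v = "pairing ?n (velocity \<beta> t)"
  have v: "?v \<noteq> 0" using weakly_admissibleD(3)[OF \<beta> t01 zi] .
  obtain \<eta> where \<eta>: "\<eta> > 0"
    "\<And>u. u \<in> {0..1} \<Longrightarrow> t - \<eta> < u \<Longrightarrow> u < t \<Longrightarrow> \<beta> u \<in> ball ?z \<epsilon> \<and> ?v * pairing ?n (\<beta> u) < 0"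
    "\<And>u. u \<in> {0..1} \<Longrightarrow> t < u \<Longrightarrow> u < t + \<eta> \<Longrightarrow> \<beta> u \<in> ball ?z \<epsilon> \<and> ?v * pairing ?n (\<beta> u) > 0"
    using curve_side[OF weakly_admissibleD(1)[OF \<beta>] t01 \<open>\<epsilon> > 0\<close> support_perp[OF zi] v] by blast
  have off: "y \<notin> SuppW l" if "y \<in> ball ?z \<epsilon>" "pairing ?n y \<noteq> 0" for y
  proof
    assume y: "y \<in> SuppW l"
    have "pairing ?n y > 0 \<or> pairing ?n y < 0" using that(2) by linarith
    then show False using side_disjoint[OF lb n] that(1) y by auto
  qed
  show thesis
  proof (rule that[OF \<eta>(1)])
    show "\<beta> u \<notin> SuppW l" if "0 \<le> u" "t - \<eta> < u" "u < t" for u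
      using \<eta>(2)[of u] that t by (intro off) auto
    show "\<beta> u \<notin> SuppW l" if "u \<le> 1" "t < u" "u < t + \<eta>" for u
      using \<eta>(3)[of u] that t by (intro off) auto
    fix u u' assume u: "0 \<le> u" "t - \<eta> < u" "u < t" and u': "u' \<le> 1" "t < u'" "u' < t + \<eta>"
    have A: "\<beta> u \<in> ball ?z \<epsilon>" "?v * pairing ?n (\<beta> u) < 0" using \<eta>(2)[of u] u t by auto
    have B: "\<beta> u' \<in> ball ?z \<epsilon>" "?v * pairing ?n (\<beta> u') > 0" using \<eta>(3)[of u'] u' t by auto
    have w: "wsum l ?z \<in> ghat" using Gpar_ghat[OF normal_Npos wsum_Gpar[OF n]] by blast
    show "Phi l b (\<beta> u) = Phi l b (\<beta> u') * gexp l (gpow (wsum l ?z) (crossing_sign D \<beta> t \<iota>))"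
    proof (cases "?v < 0")
      case True
      then have "pairing ?n (\<beta> u) > 0" "pairing ?n (\<beta> u') < 0"
        using A B by (auto simp: mult_less_0_iff zero_less_mult_iff)
      then show ?thesis using Phi_jump[OF b lb n normal_Npos A(1) _ B(1)] True by (simp add: crossing_sign_def gpow_def)
    next
      \<comment> \<open>The pairing increases: the jump formula holds with the roles of u and u'
        exchanged and is solved for the value before the crossing, whence the exponent -1.\<close>
      case False
      then have "pairing ?n (\<beta> u) < 0" "pairing ?n (\<beta> u') > 0"
        using A B by (auto simp: mult_less_0_iff zero_less_mult_iff)
      then have "Phi l b (\<beta> u') = Phi l b (\<beta> u) * gexp l (wsum l ?z)"
        using Phi_jump[OF b lb n normal_Npos B(1) _ A(1)] by blast
      then have "Phi l b (\<beta> u') * gexp l (gpow (wsum l ?z) (- 1)) = Phi l b (\<beta> u)"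
        using gexp_gpow_minus(2)[OF w, of l] by (simp add: mult.assoc)
      then show ?thesis using False by (simp add: crossing_sign_def)
    qed
  qed
qed

section \<open>Products and telescoping sums over all crossings\<close>

definition wtimes :: "nat \<Rightarrow> (real \<Rightarrow> real^'r) \<Rightarrow> real set" where
  "wtimes l \<beta> = fst ` lcross l \<beta>"

lemma wtimes_iff: "t \<in> wtimes l \<beta> \<longleftrightarrow> 0 < t \<and> t < 1 \<and> \<beta> t \<in> SuppW l"
  by (force simp: wtimes_def lcross_def crossings_def SuppW_def)

lemma walls_at_nonempty: "z \<in> SuppW l \<longleftrightarrow> walls_at l z \<noteq> {}"
  by (auto simp: SuppW_def walls_at_def)

text \<open>The point s' is chosen after t but before the next crossing time. The bound
  \<open>\<eta>0\<close> is for arguments that know the operator only shortly after t.\<close>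

lemma curve_step:
  assumes b: "b \<notin> Supp D" and \<beta>: "weakly_admissible_curve D \<beta>" and fin: "finite (wtimes l \<beta>)"
    and s: "0 \<le> s" "\<beta> s \<notin> SuppW l" and t: "t \<in> wtimes l \<beta>" "s < t"
    and first: "\<And>t'. t' \<in> wtimes l \<beta> \<Longrightarrow> s < t' \<Longrightarrow> t \<le> t'" and \<iota>: "\<iota> \<in> walls_at l (\<beta> t)" and \<eta>0: "\<eta>0 > 0"
  obtains s' where "t < s'" "s' < t + \<eta>0" "s' \<le> 1" "\<beta> s' \<notin> SuppW l" "\<And>t'. t' \<in> wtimes l \<beta> \<Longrightarrow> t < t' \<Longrightarrow> s' < t'"
    "Phi l b (\<beta> s) = Phi l b (\<beta> s') * gexp l (gpow (wsum l (\<beta> t)) (crossing_sign D \<beta> t \<iota>))"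
proof -
  have t01: "0 < t" "t < 1" using t(1) by (auto simp: wtimes_iff)
  obtain \<eta> where \<eta>: "\<eta> > 0"
    "\<And>u. 0 \<le> u \<Longrightarrow> t - \<eta> < u \<Longrightarrow> u < t \<Longrightarrow> \<beta> u \<notin> SuppW l"
    "\<And>u. u \<le> 1 \<Longrightarrow> t < u \<Longrightarrow> u < t + \<eta> \<Longrightarrow> \<beta> u \<notin> SuppW l"
    "\<And>u u'. 0 \<le> u \<Longrightarrow> t - \<eta> < u \<Longrightarrow> u < t \<Longrightarrow> u' \<le> 1 \<Longrightarrow> t < u' \<Longrightarrow> u' < t + \<eta> \<Longrightarrow>
      Phi l b (\<beta> u) = Phi l b (\<beta> u') * gexp l (gpow (wsum l (\<beta> t)) (crossing_sign D \<beta> t \<iota>))"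
    using curve_jump[OF b \<beta> t01 \<iota>] by blast
  define \<eta>' where "\<eta>' = min \<eta> (min \<eta>0 (1 - t))"
  have "\<eta>' > 0" using \<eta>(1) \<eta>0 t01 by (simp add: \<eta>'_def)
  then obtain s' where s': "t < s'" "s' < t + \<eta>'" "\<And>t'. t' \<in> wtimes l \<beta> \<Longrightarrow> t < t' \<Longrightarrow> s' < t'"
    using finite_gap[OF fin] by metis
  define u where "u = max s (t - \<eta> / 2)"
  have u: "s \<le> u" "t - \<eta> < u" "u < t" using \<eta>(1) t(2) by (auto simp: u_def)
  have "Phi l b (\<beta> s) = Phi l b (\<beta> u)"
  proof (rule curve_const[OF b weakly_admissibleD(1)[OF \<beta>] s(1) u(1)])
    show "u \<le> 1" using u t01 by simp
    fix x assume x: "s \<le> x" "x \<le> u"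
    show "\<beta> x \<notin> SuppW l"
    proof
      assume x': "\<beta> x \<in> SuppW l"
      then have "x \<noteq> s" using s(2) by auto
      then have "x \<in> wtimes l \<beta>" "s < x" using x x' s(1) u t01 by (auto simp: wtimes_iff)
      then show False using first[of x] x u by simp
    qed
  qed
  also have "\<dots> = Phi l b (\<beta> s') * gexp l (gpow (wsum l (\<beta> t)) (crossing_sign D \<beta> t \<iota>))"
    by (rule \<eta>(4)) (use s u s' in \<open>auto simp: \<eta>'_def\<close>)
  finally have "Phi l b (\<beta> s) = Phi l b (\<beta> s') * gexp l (gpow (wsum l (\<beta> t)) (crossing_sign D \<beta> t \<iota>))" .
  moreover have "s' < t + \<eta>0" "s' \<le> 1" "s' < t + \<eta>" using s'(2) by (auto simp: \<eta>'_def)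
  moreover from this have "\<beta> s' \<notin> SuppW l" using \<eta>(3) s'(1) by blast
  ultimately show thesis using that s' by blast
qed

lemma curve_end:
  assumes b: "b \<notin> Supp D" and \<beta>: "weakly_admissible_curve D \<beta>" and e: "\<beta> 1 \<notin> SuppW l"
    and s: "0 \<le> s" "s \<le> 1" "\<beta> s \<notin> SuppW l" and no: "\<And>t. t \<in> wtimes l \<beta> \<Longrightarrow> \<not> s < t"
  shows "Phi l b (\<beta> s) = Phi l b (\<beta> 1)"
proof (rule curve_const[OF b weakly_admissibleD(1)[OF \<beta>] s(1,2)])
  fix u assume u: "s \<le> u" "u \<le> 1"
  show "\<beta> u \<notin> SuppW l"
  proof
    assume u': "\<beta> u \<in> SuppW l"
    then have "u \<noteq> s" "u \<noteq> 1" using s e by auto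
    then have "u \<in> wtimes l \<beta>" "s < u" using u u' s(1) by (auto simp: wtimes_iff)
    then show False using no by blast
  qed
qed simp

lemma curve_sign:
  assumes \<beta>: "weakly_admissible_curve D \<beta>" and t: "t \<in> {0..1}"
    and i: "\<iota> \<in> walls_at l (\<beta> t)" "\<iota>' \<in> walls_at l (\<beta> t)"
  shows "normal (D \<iota>') = normal (D \<iota>)" "crossing_sign D \<beta> t \<iota>' = crossing_sign D \<beta> t \<iota>"
proof -
  show "normal (D \<iota>') = normal (D \<iota>)"
    using same_normal[OF weakly_admissibleD(2)[OF \<beta> t]] i by (simp add: walls_at_def)
  then show "crossing_sign D \<beta> t \<iota>' = crossing_sign D \<beta> t \<iota>" by (simp add: crossing_sign_def)
qed

lemma walls_at_lcross: "t \<in> wtimes l \<beta> \<Longrightarrow> {t} \<times> walls_at l (\<beta> t) \<subseteq> lcross l \<beta>"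
  by (auto simp: wtimes_iff lcross_def crossings_def walls_at_def)

lemma lcross_split:
  assumes t: "t \<in> wtimes l \<beta>" "s < t" "t < s'"
    and first: "\<And>t'. t' \<in> wtimes l \<beta> \<Longrightarrow> s < t' \<Longrightarrow> t \<le> t'"
    and gap: "\<And>t'. t' \<in> wtimes l \<beta> \<Longrightarrow> t < t' \<Longrightarrow> s' < t'"
  shows "{x \<in> lcross l \<beta>. s < fst x \<and> fst x < s'} = {t} \<times> walls_at l (\<beta> t)"
    "{x \<in> lcross l \<beta>. s < fst x \<and> \<not> fst x < s'} = {x \<in> lcross l \<beta>. s' < fst x}"
proof -
  have dich: "fst x = t \<or> s' < fst x" if "x \<in> lcross l \<beta>" "s < fst x" for x
  proof -
    have w: "fst x \<in> wtimes l \<beta>" using that(1) unfolding wtimes_def by (rule imageI)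
    show ?thesis using first[OF w that(2)] gap[OF w] by linarith
  qed
  show "{x \<in> lcross l \<beta>. s < fst x \<and> fst x < s'} = {t} \<times> walls_at l (\<beta> t)"
  proof (intro equalityI subsetI)
    fix x assume "x \<in> {x \<in> lcross l \<beta>. s < fst x \<and> fst x < s'}"
    then have x: "x \<in> lcross l \<beta>" "s < fst x" "fst x < s'" by auto
    then have "fst x = t" using dich[OF x(1,2)] by linarith
    then show "x \<in> {t} \<times> walls_at l (\<beta> t)" using x(1) by (auto simp: lcross_def crossings_def walls_at_def)
  next
    fix x assume x: "x \<in> {t} \<times> walls_at l (\<beta> t)"
    then have "x \<in> lcross l \<beta>" using walls_at_lcross[OF t(1)] by blast
    moreover have "fst x = t" using x by auto
    ultimately show "x \<in> {x \<in> lcross l \<beta>. s < fst x \<and> fst x < s'}" using t by simp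
  qed
  show "{x \<in> lcross l \<beta>. s < fst x \<and> \<not> fst x < s'} = {x \<in> lcross l \<beta>. s' < fst x}"
    using dich t(2,3) by (intro Collect_cong) fastforce
qed

text \<open>\<open>Phi\<close> was built from segments; passing the crossing times one by one
  identifies it with the path-ordered product along any weakly admissible curve with finitely many
  relevant crossing times. Simultaneous crossings are merged into one exponential.\<close>

lemma curve_product:
  assumes b: "b \<notin> Supp D" and \<beta>: "weakly_admissible_curve D \<beta>" and fin: "finite (wtimes l \<beta>)"
    and e: "\<beta> 1 \<notin> SuppW l" and s: "0 \<le> s" "s \<le> 1" "\<beta> s \<notin> SuppW l"
    and cs: "distinct cs" "sorted (map fst cs)" "set cs = {x \<in> lcross l \<beta>. s < fst x}"
  shows "Phi l b (\<beta> s) = Phi l b (\<beta> 1) * lprod (cross_op l \<beta>) cs"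
proof -
  let ?Q = "\<lambda>s. 0 \<le> s \<and> s \<le> 1 \<and> \<beta> s \<notin> SuppW l"
  have "?Q s" using s by blast
  with fin have "\<forall>cs. distinct cs \<and> sorted (map fst cs) \<and> set cs = {x \<in> lcross l \<beta>. s < fst x} \<longrightarrow>
      Phi l b (\<beta> s) = Phi l b (\<beta> 1) * lprod (cross_op l \<beta>) cs"
  proof (induction s rule: finite_time_induct[where Q = ?Q])
    case (base s)
    have none: "{x \<in> lcross l \<beta>. s < fst x} = {}" using base(2) by (auto simp: wtimes_def)
    have "Phi l b (\<beta> s) = Phi l b (\<beta> 1)" by (rule curve_end[OF b \<beta> e]) (use base in auto)
    then show ?case unfolding none by auto
  next
    case (step s t)
    obtain \<iota> where \<iota>: "\<iota> \<in> walls_at l (\<beta> t)" using step(2) walls_at_nonempty by (auto simp: wtimes_iff)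
    have t01: "t \<in> {0..1}" using step(2) by (auto simp: wtimes_iff)
    obtain s' where s': "t < s'" "s' \<le> 1" "\<beta> s' \<notin> SuppW l" "\<And>t'. t' \<in> wtimes l \<beta> \<Longrightarrow> t < t' \<Longrightarrow> s' < t'"
      "Phi l b (\<beta> s) = Phi l b (\<beta> s') * gexp l (gpow (wsum l (\<beta> t)) (crossing_sign D \<beta> t \<iota>))"
      using curve_step[OF b \<beta> fin _ _ step(2,3,4) \<iota> zero_less_one] step(1) by metis
    have IH: "\<forall>cs. distinct cs \<and> sorted (map fst cs) \<and> set cs = {x \<in> lcross l \<beta>. s' < fst x} \<longrightarrow>
      Phi l b (\<beta> s') = Phi l b (\<beta> 1) * lprod (cross_op l \<beta>) cs"
      by (rule step(5)) (use s' t01 in auto)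
    show ?case
    proof (intro allI impI)
      fix cs assume cs: "distinct cs \<and> sorted (map fst cs) \<and> set cs = {x \<in> lcross l \<beta>. s < fst x}"
      let ?A = "filter (\<lambda>x. fst x < s') cs" and ?B = "filter (\<lambda>x. \<not> fst x < s') cs"
      let ?\<sigma> = "crossing_sign D \<beta> t \<iota>"
      have sp: "{x \<in> lcross l \<beta>. s < fst x \<and> fst x < s'} = {t} \<times> walls_at l (\<beta> t)"
        "{x \<in> lcross l \<beta>. s < fst x \<and> \<not> fst x < s'} = {x \<in> lcross l \<beta>. s' < fst x}"
        by (rule lcross_split[OF step(2,3) s'(1)]; use step(4) s'(4) in blast)+
      have AB: "cs = ?A @ ?B" by (rule sorted_split) (use cs in blast)
      have setcs: "set cs = {x \<in> lcross l \<beta>. s < fst x}" using cs by blast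
      have setA: "set ?A = {t} \<times> walls_at l (\<beta> t)" unfolding sp(1)[symmetric] by (auto simp: setcs)
      have setB: "set ?B = {x \<in> lcross l \<beta>. s' < fst x}" unfolding sp(2)[symmetric] by (auto simp: setcs)
      have "sorted (map fst ?B)" using cs by (simp add: sorted_map sorted_wrt_filter)
      then have B: "Phi l b (\<beta> s') = Phi l b (\<beta> 1) * lprod (cross_op l \<beta>) ?B"
        using IH setB cs by simp
      have "lprod (cross_op l \<beta>) ?A = lprod (\<lambda>x. gexp l (gpow (elt (D (snd x))) ?\<sigma>)) ?A"
      proof (rule lprod_cong)
        fix x assume "x \<in> set ?A"
        then obtain \<iota>' where x: "x = (t, \<iota>')" "\<iota>' \<in> walls_at l (\<beta> t)" unfolding setA by auto
        then show "cross_op l \<beta> x = gexp l (gpow (elt (D (snd x))) ?\<sigma>)"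
          using curve_sign(2)[OF \<beta> t01 \<iota> x(2)] by (simp add: cross_op_def)
      qed
      also have "\<dots> = gexp l (\<lambda>m. \<Sum>x\<in>set ?A. gpow (elt (D (snd x))) ?\<sigma> m)"
      proof (rule lprod_gexp[OF normal_Npos[of \<iota>]])
        show "distinct ?A" using cs by simp
        fix x assume "x \<in> set ?A"
        then have "snd x \<in> walls_at l (\<beta> t)" unfolding setA by auto
        then show "gpow (elt (D (snd x))) ?\<sigma> \<in> Gpar (normal (D \<iota>))"
          using Gpar_gpow[OF elt_Gpar[of "snd x"]] curve_sign(1)[OF \<beta> t01 \<iota>] by simp
      qed
      also have "(\<lambda>m. \<Sum>x\<in>set ?A. gpow (elt (D (snd x))) ?\<sigma> m) = gpow (wsum l (\<beta> t)) ?\<sigma>"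
      proof
        fix m
        have "{t} \<times> walls_at l (\<beta> t) = Pair t ` walls_at l (\<beta> t)" by auto
        then show "(\<Sum>x\<in>set ?A. gpow (elt (D (snd x))) ?\<sigma> m) = gpow (wsum l (\<beta> t)) ?\<sigma> m"
          unfolding setA by (simp add: sum.reindex inj_on_def gpow_def wsum_def sum_distrib_left)
      qed
      finally have A: "lprod (cross_op l \<beta>) ?A = gexp l (gpow (wsum l (\<beta> t)) ?\<sigma>)" .
      have "lprod (cross_op l \<beta>) cs = lprod (cross_op l \<beta>) ?B * lprod (cross_op l \<beta>) ?A"
        by (subst AB) (rule lprod_simps(3))
      then show "Phi l b (\<beta> s) = Phi l b (\<beta> 1) * lprod (cross_op l \<beta>) cs"
        using s'(5) B A by (simp add: mult.assoc)
    qed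
  qed
  then show ?thesis using cs by blast
qed

text \<open>If g is the operator of a crossing and P the transport operator just after it, the value
  before is P g; the change of P v is P (g v - v), which the assumption expresses through G.\<close>

lemma curve_telescope:
  assumes b: "b \<notin> Supp D" and \<beta>: "weakly_admissible_curve D \<beta>" and fin: "finite (lcross l \<beta>)"
    and e: "\<beta> 1 \<notin> SuppW l" and s: "\<beta> 0 \<notin> SuppW l"
    and G: "\<And>t \<iota>. t \<in> wtimes l \<beta> \<Longrightarrow> \<iota> \<in> walls_at l (\<beta> t) \<Longrightarrow> \<exists>\<eta>>0. \<forall>u. t < u \<and> u < t + \<eta> \<and> u \<le> 1 \<longrightarrow>
      app (Phi l b (\<beta> u)) (app (gexp l (gpow (wsum l (\<beta> t)) (crossing_sign D \<beta> t \<iota>))) v0) p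
        - app (Phi l b (\<beta> u)) v0 p = (\<Sum>\<iota>'\<in>walls_at l (\<beta> t). G (t, \<iota>'))"
  shows "app (Phi l b (\<beta> 0)) v0 p - app (Phi l b (\<beta> 1)) v0 p = sum G (lcross l \<beta>)"
proof -
  let ?Q = "\<lambda>s. 0 \<le> s \<and> s \<le> 1 \<and> \<beta> s \<notin> SuppW l"
  have finw: "finite (wtimes l \<beta>)" using fin by (simp add: wtimes_def)
  have "app (Phi l b (\<beta> s)) v0 p - app (Phi l b (\<beta> 1)) v0 p = sum G {x \<in> lcross l \<beta>. s < fst x}" if "?Q s" for s
    using finw that
  proof (induction s rule: finite_time_induct[where Q = ?Q])
    case (base s)
    have none: "{x \<in> lcross l \<beta>. s < fst x} = {}" using base(2) by (auto simp: wtimes_def)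
    have "Phi l b (\<beta> s) = Phi l b (\<beta> 1)" by (rule curve_end[OF b \<beta> e]) (use base in auto)
    then show ?case unfolding none by simp
  next
    case (step s t)
    obtain \<iota> where \<iota>: "\<iota> \<in> walls_at l (\<beta> t)" using step(2) walls_at_nonempty by (auto simp: wtimes_iff)
    obtain \<eta> where \<eta>: "\<eta> > 0" "\<And>u. t < u \<Longrightarrow> u < t + \<eta> \<Longrightarrow> u \<le> 1 \<Longrightarrow>
      app (Phi l b (\<beta> u)) (app (gexp l (gpow (wsum l (\<beta> t)) (crossing_sign D \<beta> t \<iota>))) v0) p
        - app (Phi l b (\<beta> u)) v0 p = (\<Sum>\<iota>'\<in>walls_at l (\<beta> t). G (t, \<iota>'))"
      using G[OF step(2) \<iota>] by blast
    obtain s' where s': "t < s'" "s' < t + \<eta>" "s' \<le> 1" "\<beta> s' \<notin> SuppW l" "\<And>t'. t' \<in> wtimes l \<beta> \<Longrightarrow> t < t' \<Longrightarrow> s' < t'"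
      "Phi l b (\<beta> s) = Phi l b (\<beta> s') * gexp l (gpow (wsum l (\<beta> t)) (crossing_sign D \<beta> t \<iota>))"
      using curve_step[OF b \<beta> finw _ _ step(2,3,4) \<iota> \<eta>(1)] step(1) by metis
    have IH: "app (Phi l b (\<beta> s')) v0 p - app (Phi l b (\<beta> 1)) v0 p = sum G {x \<in> lcross l \<beta>. s' < fst x}"
      by (rule step(5)) (use s' step(2) in \<open>auto simp: wtimes_iff\<close>)
    have sp: "{x \<in> lcross l \<beta>. s < fst x \<and> fst x < s'} = {t} \<times> walls_at l (\<beta> t)"
        "{x \<in> lcross l \<beta>. s < fst x \<and> \<not> fst x < s'} = {x \<in> lcross l \<beta>. s' < fst x}"
        by (rule lcross_split[OF step(2,3) s'(1)]; use step(4) s'(5) in blast)+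
    have split: "{x \<in> lcross l \<beta>. s < fst x} = {t} \<times> walls_at l (\<beta> t) \<union> {x \<in> lcross l \<beta>. s' < fst x}"
      unfolding sp[symmetric] by blast
    have disj: "({t} \<times> walls_at l (\<beta> t)) \<inter> {x \<in> lcross l \<beta>. s' < fst x} = {}" using s'(1) by auto
    have fw: "finite (walls_at l (\<beta> t))" using finite_walls by (simp add: walls_at_def)
    have "{t} \<times> walls_at l (\<beta> t) = Pair t ` walls_at l (\<beta> t)" by auto
    then have "sum G ({t} \<times> walls_at l (\<beta> t)) = (\<Sum>\<iota>'\<in>walls_at l (\<beta> t). G (t, \<iota>'))"
      by (simp add: sum.reindex inj_on_def)
    then have "sum G {x \<in> lcross l \<beta>. s < fst x} = (\<Sum>\<iota>'\<in>walls_at l (\<beta> t). G (t, \<iota>')) + sum G {x \<in> lcross l \<beta>. s' < fst x}"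
      unfolding split using fw fin disj by (subst sum.union_disjoint) auto
    also have "(\<Sum>\<iota>'\<in>walls_at l (\<beta> t). G (t, \<iota>')) = app (Phi l b (\<beta> s)) v0 p - app (Phi l b (\<beta> s')) v0 p"
      using \<eta>(2)[OF s'(1-3)] s'(6) by simp
    finally show ?case using IH by simp
  qed
  from this[of 0] have "app (Phi l b (\<beta> 0)) v0 p - app (Phi l b (\<beta> 1)) v0 p = sum G {x \<in> lcross l \<beta>. 0 < fst x}"
    using s by simp
  moreover have "{x \<in> lcross l \<beta>. 0 < fst x} = lcross l \<beta>" by (auto simp: lcross_def crossings_def)
  ultimately show ?thesis by simp
qed

text \<open>Shortly after its start the auxiliary curve has left z and not crossed anything, so its
  whole product is the transport operator there, \<open>Phi\<close> being 1 in the chamber. The loop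
  is compared at a nearby point, possibly on the other side of the wall.\<close>

lemma y_variable_Ltilde:
  assumes b: "b \<in> interior Cplus" and \<gamma>: "weakly_admissible_curve D \<gamma>" and \<tau>: "0 < \<tau>" "\<tau> < 1"
    and i: "\<iota> \<in> walls_at l (\<gamma> \<tau>)" and k: "k \<ge> (1::nat)"
    and Y: "is_y_variable D (\<gamma> \<tau>) (int k *s normal (D \<iota>)) Y" and n: "deg n \<le> int l"
  obtains \<eta> where "\<eta> > 0" "\<And>u. \<tau> < u \<Longrightarrow> u < \<tau> + \<eta> \<Longrightarrow> u \<le> 1 \<Longrightarrow>
    app (Phi l b (\<gamma> u)) (Lvec l (int k *s normal (D \<iota>))) (n, Some \<kappa>) = Ltilde (int k *s normal (D \<iota>)) Y \<kappa> n"
proof -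
  let ?z = "\<gamma> \<tau>" and ?n = "normal (D \<iota>)"
  let ?m = "int k *s ?n"
  have mN: "?m \<in> Npos" using normal_Npos[of \<iota>] k by (simp add: Npos_iff Qmon_scale deg_scale)
  obtain \<beta> g where \<beta>: "weakly_admissible_curve D \<beta>" "\<beta> 0 = ?z" "\<beta> 1 \<in> interior Cplus"
      "has_path_product D \<beta> g" and Yg: "Y = gact g (mono_y ?m)"
    using Y unfolding is_y_variable_def by blast
  have bS: "b \<notin> Supp D" by (rule interior_Cplus_Supp[OF b])
  have \<tau>01: "\<tau> \<in> {0..1}" using \<tau> by simp
  have zS: "?z \<notin> Sing D" using weakly_admissibleD(2)[OF \<gamma> \<tau>01] .
  have zi: "?z \<in> support (D \<iota>)" using i by (simp add: walls_at_def)
  have normal: "normal (D \<iota>') = ?n" if "\<iota>' \<in> walls_at l ?z" for \<iota>'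
    using same_normal[OF zS _ zi] that by (simp add: walls_at_def)
  obtain \<epsilon> where lb: "local_ball l ?z \<epsilon>" using local_ball_exists[OF zS] .
  then have \<epsilon>: "\<epsilon> > 0" by (simp add: local_ball_def)
  have e: "\<beta> 1 \<notin> SuppW l" using interior_Cplus_Supp[OF \<beta>(3)] SuppW_Supp by blast
  obtain cs where cs: "is_enum l \<beta> cs" "gexp l g = lprod (cross_op l \<beta>) cs"
    using path_product_enum[OF \<beta>(4)] .
  have set: "set cs = lcross l \<beta>" using cs(1) by (simp add: is_enum_def)
  then have fin: "finite (wtimes l \<beta>)" unfolding wtimes_def by (metis List.finite_set finite_imageI)
  have z0: "\<beta> 0 \<in> support (D \<iota>)" using zi \<beta>(2) by simp
  have v0: "pairing ?n (velocity \<beta> 0) \<noteq> 0" by (rule weakly_admissibleD(3)[OF \<beta>(1) _ z0]) simp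
  obtain \<eta>1 where \<eta>1: "\<eta>1 > 0"
    "\<And>u. u \<in> {0..1} \<Longrightarrow> 0 < u \<Longrightarrow> u < 0 + \<eta>1 \<Longrightarrow> \<beta> u \<in> ball (\<beta> 0) \<epsilon> \<and> pairing ?n (velocity \<beta> 0) * pairing ?n (\<beta> u) > 0"
    using curve_side[OF weakly_admissibleD(1)[OF \<beta>(1)] _ \<epsilon> support_perp[OF z0] v0] by (metis atLeastAtMost_iff order_refl zero_le_one)
  have "min \<eta>1 1 > 0" using \<eta>1(1) by simp
  then obtain s where s: "0 < s" "s < 0 + min \<eta>1 1" "\<And>t'. t' \<in> wtimes l \<beta> \<Longrightarrow> 0 < t' \<Longrightarrow> s < t'"
    using finite_gap[OF fin] by metis
  have sb: "\<beta> s \<in> ball ?z \<epsilon>" "pairing ?n (\<beta> s) \<noteq> 0" using \<eta>1(2)[of s] s(1,2) \<beta>(2) by auto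
  have sW: "\<beta> s \<notin> SuppW l"
  proof
    assume "\<beta> s \<in> SuppW l"
    then have "s \<in> wtimes l \<beta>" using s(1,2) by (simp add: wtimes_iff)
    then show False using s(1,3) by blast
  qed
  have "fst x \<in> wtimes l \<beta> \<and> 0 < fst x" if "x \<in> lcross l \<beta>" for x
    using that by (auto simp: wtimes_def lcross_def crossings_def)
  \<comment> \<open>Before time s nothing is crossed: the wall at the starting point z is ignored in
    the product, and s precedes all crossing times.\<close>
  then have all: "{x \<in> lcross l \<beta>. s < fst x} = lcross l \<beta>" using s(3) by blast
  have "Phi l b (\<beta> s) = Phi l b (\<beta> 1) * lprod (cross_op l \<beta>) cs"
    by (rule curve_product[OF bS \<beta>(1) fin e _ _ sW]) (use s cs(1) all in \<open>auto simp: is_enum_def\<close>)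
  then have Phi_s: "Phi l b (\<beta> s) = gexp l g" using Phi_interior[OF b \<beta>(3)] cs(2) by simp
  have v: "pairing ?n (velocity \<gamma> \<tau>) \<noteq> 0" using weakly_admissibleD(3)[OF \<gamma> \<tau>01 zi] .
  obtain \<eta> where \<eta>: "\<eta> > 0"
    "\<And>u. u \<in> {0..1} \<Longrightarrow> \<tau> < u \<Longrightarrow> u < \<tau> + \<eta> \<Longrightarrow> \<gamma> u \<in> ball ?z \<epsilon> \<and> pairing ?n (velocity \<gamma> \<tau>) * pairing ?n (\<gamma> u) > 0"
    using curve_side[OF weakly_admissibleD(1)[OF \<gamma>] \<tau>01 \<epsilon> support_perp[OF zi] v] by metis
  show thesis
  proof (rule that[OF \<eta>(1)])
    fix u assume u: "\<tau> < u" "u < \<tau> + \<eta>" "u \<le> 1"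
    then have "u \<in> {0..1}" using \<tau> by simp
    then have ub: "\<gamma> u \<in> ball ?z \<epsilon>" "pairing ?n (\<gamma> u) \<noteq> 0" using \<eta>(2)[of u] u by auto
    have "app (Phi l b (\<gamma> u)) (Lvec l ?m) = app (gexp l g) (Lvec l ?m)"
      using Phi_Lvec_sides[OF bS lb normal normal_Npos k ub sb] by (simp only: Phi_s)
    then show "app (Phi l b (\<gamma> u)) (Lvec l ?m) (n, Some \<kappa>) = Ltilde ?m Y \<kappa> n"
      using app_gexp_Lvec[OF mN n] Yg by simp
  qed
qed

lemma finite_lcross:
  assumes "admissible_curve D \<gamma>" "\<gamma> 0 = \<gamma> 1" shows "finite (lcross l \<gamma>)"
proof -
  have "has_path_product D \<gamma> gone" using consistent assms unfolding consistent_def by blast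
  then obtain cs where "is_enum l \<gamma> cs" by (rule path_product_enum)
  then show ?thesis unfolding is_enum_def by (metis List.finite_set)
qed

text \<open>At a crossing time v becomes v + sum of \<sigma> c L(y^(tn)) over the walls met there,
  and transport to the chamber turns each L(y^(tn)) into L of the y-variable. The changes telescope
  around the loop.\<close>

lemma loop_identity:
  assumes elt: "\<And>\<iota>. elt (D \<iota>) = gpow (Psi (tnormal D t \<iota>)) (c \<iota>)" and t: "\<And>\<iota>. t \<iota> \<ge> 1"
    and b: "b \<in> interior Cplus" and \<gamma>: "admissible_curve D \<gamma>" "\<gamma> 0 = \<gamma> 1"
    and Y: "\<And>u \<iota>. (u, \<iota>) \<in> lcross l \<gamma> \<Longrightarrow> is_y_variable D (\<gamma> u) (tnormal D t \<iota>) (Y (u, \<iota>))"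
    and n: "deg n \<le> int l"
  shows "(\<Sum>(u, \<iota>)\<in>lcross l \<gamma>. crossing_sign D \<gamma> u \<iota> * c \<iota> * Ltilde (tnormal D t \<iota>) (Y (u, \<iota>)) \<kappa> n) = 0"
proof -
  have bS: "b \<notin> Supp D" by (rule interior_Cplus_Supp[OF b])
  have wa: "weakly_admissible_curve D \<gamma>" and ends: "\<gamma> 0 \<notin> SuppW l" "\<gamma> 1 \<notin> SuppW l"
    using \<gamma>(1) SuppW_Supp unfolding admissible_curve_def by blast+
  have fin: "finite (lcross l \<gamma>)" by (rule finite_lcross[OF \<gamma>])
  define G where "G = (\<lambda>(u, \<iota>). crossing_sign D \<gamma> u \<iota> * c \<iota> * Ltilde (tnormal D t \<iota>) (Y (u, \<iota>)) \<kappa> n)"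
  have "app (Phi l b (\<gamma> 0)) v0 (n, Some \<kappa>) - app (Phi l b (\<gamma> 1)) v0 (n, Some \<kappa>) = sum G (lcross l \<gamma>)"
  proof (rule curve_telescope[OF bS wa fin ends(2,1)])
    fix \<tau> \<iota> assume \<tau>: "\<tau> \<in> wtimes l \<gamma>" and \<iota>: "\<iota> \<in> walls_at l (\<gamma> \<tau>)"
    have \<tau>01: "0 < \<tau>" "\<tau> < 1" using \<tau> by (auto simp: wtimes_iff)
    then have \<tau>01': "\<tau> \<in> {0..1}" by simp
    let ?W = "walls_at l (\<gamma> \<tau>)" and ?\<sigma> = "crossing_sign D \<gamma> \<tau> \<iota>" and ?n = "normal (D \<iota>)"
    have finW: "finite ?W" using finite_walls by (simp add: walls_at_def)
    note same = curve_sign[OF wa \<tau>01' \<iota>]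
    have tn: "tnormal D t \<iota>' = int (t \<iota>') *s ?n" if "\<iota>' \<in> ?W" for \<iota>'
      using same(1)[OF that] by (simp add: tnormal_def)
    have "gpow (wsum l (\<gamma> \<tau>)) ?\<sigma> = (\<lambda>m. \<Sum>\<iota>'\<in>?W. (?\<sigma> * c \<iota>') * Psi (int (t \<iota>') *s ?n) m)"
    proof
      fix m
      have "gpow (wsum l (\<gamma> \<tau>)) ?\<sigma> m = (\<Sum>\<iota>'\<in>?W. ?\<sigma> * (c \<iota>' * Psi (tnormal D t \<iota>') m))"
        by (simp only: gpow_def wsum_def sum_distrib_left elt)
      also have "\<dots> = (\<Sum>\<iota>'\<in>?W. (?\<sigma> * c \<iota>') * Psi (int (t \<iota>') *s ?n) m)"
        by (intro sum.cong refl) (simp only: tn mult.assoc)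
      finally show "gpow (wsum l (\<gamma> \<tau>)) ?\<sigma> m = (\<Sum>\<iota>'\<in>?W. (?\<sigma> * c \<iota>') * Psi (int (t \<iota>') *s ?n) m)" .
    qed
    then have jump: "app (gexp l (gpow (wsum l (\<gamma> \<tau>)) ?\<sigma>)) v0 =
        (\<lambda>p. v0 p + (\<Sum>\<iota>'\<in>?W. (?\<sigma> * c \<iota>') * Lvec l (int (t \<iota>') *s ?n) p))"
      by (simp only:) (rule app_gexp_v0[OF finW normal_Npos t])
    have "\<exists>\<eta>>0. \<forall>u. \<tau> < u \<and> u < \<tau> + \<eta> \<and> u \<le> 1 \<longrightarrow>
        app (Phi l b (\<gamma> u)) (Lvec l (int (t \<iota>') *s ?n)) (n, Some \<kappa>) = Ltilde (tnormal D t \<iota>') (Y (\<tau>, \<iota>')) \<kappa> n"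
      if \<iota>': "\<iota>' \<in> ?W" for \<iota>'
    proof -
      have "(\<tau>, \<iota>') \<in> lcross l \<gamma>" using walls_at_lcross[OF \<tau>] \<iota>' by auto
      then have yv: "is_y_variable D (\<gamma> \<tau>) (int (t \<iota>') *s normal (D \<iota>')) (Y (\<tau>, \<iota>'))"
        using Y unfolding tnormal_def by blast
      show ?thesis
      proof (rule y_variable_Ltilde[OF b wa \<tau>01 \<iota>' t[of \<iota>'] yv n, where \<kappa> = \<kappa>])
        fix \<eta> :: real assume "\<eta> > 0" "\<And>u. \<tau> < u \<Longrightarrow> u < \<tau> + \<eta> \<Longrightarrow> u \<le> 1 \<Longrightarrow>
          app (Phi l b (\<gamma> u)) (Lvec l (int (t \<iota>') *s normal (D \<iota>'))) (n, Some \<kappa>) = Ltilde (int (t \<iota>') *s normal (D \<iota>')) (Y (\<tau>, \<iota>')) \<kappa> n"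
        then show ?thesis unfolding tn[OF \<iota>'] same(1)[OF \<iota>'] by (intro exI[of _ \<eta>]) auto
      qed
    qed
    then obtain \<eta> where \<eta>: "\<And>\<iota>'. \<iota>' \<in> ?W \<Longrightarrow> \<eta> \<iota>' > 0"
      "\<And>\<iota>' u. \<iota>' \<in> ?W \<Longrightarrow> \<tau> < u \<Longrightarrow> u < \<tau> + \<eta> \<iota>' \<Longrightarrow> u \<le> 1 \<Longrightarrow>
        app (Phi l b (\<gamma> u)) (Lvec l (int (t \<iota>') *s ?n)) (n, Some \<kappa>) = Ltilde (tnormal D t \<iota>') (Y (\<tau>, \<iota>')) \<kappa> n"
      by metis
    \<comment> \<open>One interval after the crossing that serves all walls met at this
      time.\<close>
    define \<eta>0 where "\<eta>0 = Min (insert 1 (\<eta> ` ?W))"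
    have \<eta>0: "\<eta>0 > 0" "\<And>\<iota>'. \<iota>' \<in> ?W \<Longrightarrow> \<eta>0 \<le> \<eta> \<iota>'" unfolding \<eta>0_def using finW \<eta>(1) by auto
    show "\<exists>\<eta>>0. \<forall>u. \<tau> < u \<and> u < \<tau> + \<eta> \<and> u \<le> 1 \<longrightarrow>
      app (Phi l b (\<gamma> u)) (app (gexp l (gpow (wsum l (\<gamma> \<tau>)) ?\<sigma>)) v0) (n, Some \<kappa>)
        - app (Phi l b (\<gamma> u)) v0 (n, Some \<kappa>) = (\<Sum>\<iota>'\<in>?W. G (\<tau>, \<iota>'))"
    proof (intro exI[of _ \<eta>0] conjI allI impI \<eta>0(1))
      fix u assume u: "\<tau> < u \<and> u < \<tau> + \<eta>0 \<and> u \<le> 1"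
      have "app (Phi l b (\<gamma> u)) (Lvec l (int (t \<iota>') *s ?n)) (n, Some \<kappa>) = Ltilde (tnormal D t \<iota>') (Y (\<tau>, \<iota>')) \<kappa> n"
        if "\<iota>' \<in> ?W" for \<iota>'
        using u \<eta>0(2)[OF that] by (intro \<eta>(2)[OF that]) auto
      then have "(\<Sum>\<iota>'\<in>?W. (?\<sigma> * c \<iota>') * app (Phi l b (\<gamma> u)) (Lvec l (int (t \<iota>') *s ?n)) (n, Some \<kappa>)) = (\<Sum>\<iota>'\<in>?W. G (\<tau>, \<iota>'))"
        by (intro sum.cong refl) (simp add: G_def same(2))
      then show "app (Phi l b (\<gamma> u)) (app (gexp l (gpow (wsum l (\<gamma> \<tau>)) ?\<sigma>)) v0) (n, Some \<kappa>)
        - app (Phi l b (\<gamma> u)) v0 (n, Some \<kappa>) = (\<Sum>\<iota>'\<in>?W. G (\<tau>, \<iota>'))"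
        unfolding jump by (simp add: app_arg_add app_arg_sum app_arg_scale)
    qed
  qed
  \<comment> \<open>The loop closes, so the two ends of the telescope cancel.\<close>
  then show ?thesis using \<gamma>(2) by (simp add: G_def)
qed

end

text \<open>The coefficient of X_(tn) in the wall element is s \<delta>(tn), which is not 0. So a
  wall that is trivial modulo degree > l has deg(tn) > l.\<close>

lemma (in seed) positive_wall_degree:
  assumes D: "scattering_diagram D" and pos: "positive_realization D t s"
    and gone: "proj_eq l (elt (D \<iota>)) gone"
  shows "int l < deg (tnormal D t \<iota>)"
proof -
  let ?m = "tnormal D t \<iota>"
  let ?c = "of_nat (s \<iota>) * delta ?m"
  have w: "normal (D \<iota>) \<in> Npos" "elt (D \<iota>) \<in> Gpar (normal (D \<iota>))"
    using D by (auto simp: scattering_diagram_def is_wall_def Npr_def)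
  have ts: "t \<iota> > 0" "s \<iota> > 0" and elt: "elt (D \<iota>) = gpow (Psi ?m) ?c"
    using pos by (auto simp: positive_realization_def)
  have m: "?m \<in> Npos" using w(1) ts(1) by (simp add: tnormal_def Npos_iff Qmon_scale deg_scale)
  then have "?m \<noteq> 0" by (auto simp: Npos_iff)
  then have "?c \<noteq> 0" using ts(2) delta_pos[of ?m] by simp
  moreover have "Psi ?m ?m = 1" using Psi_scale[OF m, of 1] by simp
  ultimately have "elt (D \<iota>) ?m \<noteq> 0" unfolding elt by (simp add: gpow_def)
  moreover have "elt (D \<iota>) \<in> Ggt l" using gone proj_eq_gone_iff[OF Gpar_ghat[OF w]] by blast
  ultimately show ?thesis by (simp add: Ggt_def)
qed

theorem theorem3p6:
  fixes form :: "int^'r \<Rightarrow> int^'r \<Rightarrow> rat"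
    and Nc :: "(int^'r) set"
    and \<delta> :: "'r \<Rightarrow> nat"
    and e :: "'r \<Rightarrow> int^'r"
    and D :: "'l \<Rightarrow> 'r wall"
    and t s :: "'l \<Rightarrow> nat"
    and \<gamma> :: "real \<Rightarrow> real^'r"
    and J :: "'j::linorder set"
    and \<tau> :: "'j \<Rightarrow> real"
    and \<omega> :: "'j \<Rightarrow> 'l"
    and Y :: "'j \<Rightarrow> int^'r \<Rightarrow> rat"
  assumes seed: "seed form Nc \<delta> e"
    and cluster: "seed.cluster_scattering_diagram form \<delta> e D"
    and positive: "seed.positive_realization Nc D t s"
    and admissible: "admissible_curve D \<gamma>"
    and loop: "\<gamma> 0 = \<gamma> 1"
    and J_countable: "countable J"
    and J_crossings: "bij_betw (\<lambda>a. (\<tau> a, \<omega> a)) J (crossings D \<gamma>)"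
    and J_order: "\<And>a b. a \<in> J \<Longrightarrow> b \<in> J \<Longrightarrow> \<tau> a < \<tau> b \<Longrightarrow> a < b"
    and Y: "\<And>a. a \<in> J \<Longrightarrow> seed.is_y_variable form e D (\<gamma> (\<tau> a)) (tnormal D t (\<omega> a)) (Y a)"
  shows "seed.has_formal_sum e
           (\<lambda>a k m. crossing_sign D \<gamma> (\<tau> a) (\<omega> a) * of_nat (s (\<omega> a))
                      * seed.delta Nc (tnormal D t (\<omega> a)) * seed.Ltilde e (tnormal D t (\<omega> a)) (Y a) k m)
           J (\<lambda>k m. 0)"
proof -
  interpret seed form Nc \<delta> e by (rule seed)
  have D: "scattering_diagram D" "consistent D" using cluster by (auto simp: cluster_scattering_diagram_def)
  have "\<exists>l. \<not> proj_eq l (elt (D \<iota>)) gone" for \<iota>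
  proof (intro exI notI)
    assume gone: "proj_eq (nat (deg (tnormal D t \<iota>))) (elt (D \<iota>)) gone"
    show False using positive_wall_degree[OF D(1) positive gone] by linarith
  qed
  then interpret diagram form Nc \<delta> e D using D by unfold_locales
  define h where "h = (\<lambda>a. (\<tau> a, \<omega> a))"
  define c where "c = (\<lambda>\<iota>. of_nat (s \<iota>) * delta (tnormal D t \<iota>))"
  define F where "F = (\<lambda>a k n. crossing_sign D \<gamma> (\<tau> a) (\<omega> a) * of_nat (s (\<omega> a))
    * delta (tnormal D t (\<omega> a)) * Ltilde (tnormal D t (\<omega> a)) (Y a) k n)"
  have elt: "elt (D \<iota>) = gpow (Psi (tnormal D t \<iota>)) (c \<iota>)" and t: "t \<iota> \<ge> 1" for \<iota>
    using positive by (auto simp: positive_realization_def c_def Suc_le_eq)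
  have bij: "bij_betw h {a \<in> J. \<omega> a \<in> walls l} (lcross l \<gamma>)" for l
  proof -
    have h: "inj_on h J" "h ` J = crossings D \<gamma>" using J_crossings by (auto simp: bij_betw_def h_def)
    have "lcross l \<gamma> = {x \<in> h ` J. snd x \<in> walls l}" by (auto simp: lcross_def h(2))
    also have "\<dots> = h ` {a \<in> J. \<omega> a \<in> walls l}" by (auto simp: h_def)
    finally show ?thesis using inj_on_subset[OF h(1)] by (simp add: bij_betw_def)
  qed
  have fin: "finite {a \<in> J. \<omega> a \<in> walls l}" for l
    using bij_betw_finite[OF bij] finite_lcross[OF admissible loop] by blast
  \<comment> \<open>A wall outside \<open>walls l\<close> has deg(tn) > l, and L of its y-variable
    has no terms up to degree l.\<close>
  have vanish: "F a k n = 0" if a: "a \<in> J" "\<omega> a \<notin> walls l" and n: "deg n \<le> int l" for a l k n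
  proof -
    let ?m = "tnormal D t (\<omega> a)"
    obtain g where g: "Y a = gact g (mono_y ?m)" using Y[OF a(1)] unfolding is_y_variable_def by blast
    have m: "?m \<in> Npos" using normal_Npos t[of "\<omega> a"] by (simp add: tnormal_def Npos_iff Qmon_scale deg_scale)
    have "int l < deg ?m" using positive_wall_degree[OF D(1) positive] a(2) by (simp add: walls_def)
    then have "Ltilde ?m (Y a) k n = 0"
      using app_gexp_Lvec[OF m n, of g k] by (simp add: g Lvec_eq_0[OF m] app_zero_arg)
    then show ?thesis by (simp add: F_def)
  qed
  have "finite {a \<in> J. \<exists>k n. deg n \<le> d \<and> F a k n \<noteq> 0}" for d
  proof (rule finite_subset[OF _ fin[of "nat d"]])
    have "d \<le> int (nat d)" by simp
    then show "{a \<in> J. \<exists>k n. deg n \<le> d \<and> F a k n \<noteq> 0} \<subseteq> {a \<in> J. \<omega> a \<in> walls (nat d)}"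
      using vanish by (blast intro: order_trans)
  qed
  moreover have "(\<Sum>a\<in>{a \<in> J. F a k n \<noteq> 0}. F a k n) = 0" for k n
  proof -
    define l where "l = nat (deg n)"
    have n: "deg n \<le> int l" by (simp add: l_def)
    let ?A = "{a \<in> J. \<omega> a \<in> walls l}"
    have "{a \<in> J. F a k n \<noteq> 0} \<subseteq> ?A" using vanish n by blast
    then have "(\<Sum>a\<in>{a \<in> J. F a k n \<noteq> 0}. F a k n) = (\<Sum>a\<in>?A. F a k n)"
      by (intro sum.mono_neutral_left fin) auto
    also have "\<dots> = 0"
    proof (cases "?A = {}")
      case True
      then show ?thesis by (simp only: sum.empty)
    next
      case False
      then obtain a where "a \<in> J" by blast
      \<comment> \<open>The base point in the chamber is the end point of a curve that defines one
        of the y-variables.\<close>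
      then obtain \<beta> :: "real \<Rightarrow> real^'r" where b: "\<beta> 1 \<in> interior Cplus"
        using Y unfolding is_y_variable_def by blast
      \<comment> \<open>The y-variables reindexed by crossings instead of elements of J.\<close>
      define Z where "Z x = Y (the_inv_into J h x)" for x
      have Z: "Z (\<tau> a, \<omega> a) = Y a" if "a \<in> J" for a
        using the_inv_into_f_f[of h J a] J_crossings that by (simp add: Z_def h_def bij_betw_def)
      have y: "is_y_variable D (\<gamma> u) (tnormal D t \<iota>) (Z (u, \<iota>))" if "(u, \<iota>) \<in> lcross l \<gamma>" for u \<iota>
      proof -
        have "(u, \<iota>) \<in> h ` ?A" using that bij[of l] by (simp add: bij_betw_def)
        then obtain a where "a \<in> J" "u = \<tau> a" "\<iota> = \<omega> a" by (auto simp: h_def)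
        then show ?thesis using Y Z by simp
      qed
      have "(\<Sum>a\<in>?A. F a k n)
          = (\<Sum>a\<in>?A. (\<lambda>(u, \<iota>). crossing_sign D \<gamma> u \<iota> * c \<iota> * Ltilde (tnormal D t \<iota>) (Z (u, \<iota>)) k n) (h a))"
        by (intro sum.cong refl) (simp add: F_def h_def c_def Z mult.assoc)
      also have "\<dots> = (\<Sum>(u, \<iota>)\<in>lcross l \<gamma>. crossing_sign D \<gamma> u \<iota> * c \<iota> * Ltilde (tnormal D t \<iota>) (Z (u, \<iota>)) k n)"
        by (rule sum.reindex_bij_betw[OF bij])
      also have "\<dots> = 0" by (rule loop_identity[OF elt t b admissible loop y n])
      finally show ?thesis .
    qed
    finally show ?thesis .
  qed
  ultimately show ?thesis unfolding has_formal_sum_def F_def by blast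
qed

end
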